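(* Let $R$ and $R'$ be two diagonal rectangulations. Then $R$ and $R'$ are connected by a Barcelona flip if and only if $\mathrm{B}(R)$ and $\mathrm{B}(R')$ differ by a single transposition of consecutive elements.
   Context: A rectangulation is a partition of a square into axis-aligned rectangles (up to combinatorial equivalence), interior vertices of degree 3; it is diagonal if every rectangle meets the main (top-left to bottom-right) diagonal. Wall slides define R-equivalence; each class has a unique representative in which every rectangle meets the bottom-left to top-right diagonal (the anti-diagonal representative). $\mathrm{B}(R)$ is the Baxter permutation (avoiding $3\underline{14}2$ and $2\underline{41}3$) obtained by labeling rectangles of $R$ by the order in which the main diagonal meets them, then listing the labels in the order in which the bottom-left to top-right diagonal meets the rectangles of the anti-diagonal representative. A flip either replaces an edge unmatched at both endpoints by one of the other orientation (simple flip), or rotates an edge matched by a collinear edge at exactly one endpoint around that endpoint, when the result is again diagonal. Barcelona flips are flips of edges that intersect the main diagonal. A transposition swapping $\pi(j)$ and $\pi(k)$ is of consecutive elements if $|\pi(j)-\pi(k)|=1$. *)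

theory Defs
  imports "HOL-Analysis.Analysis"
begin

type_synonym point = "real \<times> real"

abbreviation unit_square :: "point set" where
  "unit_square \<equiv> cbox (0, 0) (1, 1)"

definition main_diagonal :: "point set" where
  "main_diagonal = closed_segment (0, 1) (1, 0)"

definition anti_diagonal :: "point set" where
  "anti_diagonal = closed_segment (0, 0) (1, 1)"


section \<open>Rectangulations\<close>

text \<open>A rectangulation drawn in the unit square is the finite set of its closed rectangles.
  The extreme points of a rectangle are its four corners.\<close>

definition vertices :: "point set set \<Rightarrow> point set" where
  "vertices R = {p. \<exists>K\<in>R. p extreme_point_of K}"

definition skeleton :: "point set set \<Rightarrow> point set" where
  "skeleton R = (\<Union>K\<in>R. frontier K)"

text \<open>Edges are minimal: a side of a rectangle may consist of several edges. Since the skeleton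
  is a finite union of axis-parallel segments, every edge is axis-parallel. The sides of the
  square also consist of edges.\<close>

definition edge :: "point set set \<Rightarrow> point \<Rightarrow> point \<Rightarrow> bool" where
  "edge R p q \<longleftrightarrow> p \<in> vertices R \<and> q \<in> vertices R \<and> p \<noteq> q \<and>
     closed_segment p q \<subseteq> skeleton R \<and> open_segment p q \<inter> vertices R = {}"

definition rectangulation :: "point set set \<Rightarrow> bool" where
  "rectangulation R \<longleftrightarrow> R division_of unit_square \<and> (\<forall>K\<in>R. interior K \<noteq> {}) \<and>
     (\<forall>v \<in> vertices R \<inter> interior unit_square. card {w. edge R v w} = 3)"

text \<open>Meeting a diagonal is meant with the interior of the rectangle; touching it in a corner
  would not determine a position in the order along the diagonal.\<close>

definition diagonal_rectangulation :: "point set set \<Rightarrow> bool" where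
  "diagonal_rectangulation R \<longleftrightarrow>
     rectangulation R \<and> (\<forall>K\<in>R. interior K \<inter> main_diagonal \<noteq> {})"

definition antidiagonal_rectangulation :: "point set set \<Rightarrow> bool" where
  "antidiagonal_rectangulation R \<longleftrightarrow>
     rectangulation R \<and> (\<forall>K\<in>R. interior K \<inter> anti_diagonal \<noteq> {})"


section \<open>Combinatorial equivalence and R-equivalence\<close>

text \<open>\<open>left_of K L\<close> and \<open>below K L\<close> say that \<open>K\<close> and \<open>L\<close> share a nondegenerate boundary segment,
  with \<open>K\<close> on its left and \<open>L\<close> on its right, respectively \<open>K\<close> under it and \<open>L\<close> above it.\<close>

definition left_of :: "point set \<Rightarrow> point set \<Rightarrow> bool" where
  "left_of K L \<longleftrightarrow> (\<exists>x y y'. y < y' \<and> {x} \<times> {y..y'} \<subseteq> K \<inter> L \<and>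
     K \<subseteq> {..x} \<times> UNIV \<and> L \<subseteq> {x..} \<times> UNIV)"

definition below :: "point set \<Rightarrow> point set \<Rightarrow> bool" where
  "below K L \<longleftrightarrow> (\<exists>y x x'. x < x' \<and> {x..x'} \<times> {y} \<subseteq> K \<inter> L \<and>
     K \<subseteq> UNIV \<times> {..y} \<and> L \<subseteq> UNIV \<times> {y..})"

text \<open>In a labeled rectangulation, the rectangles are listed in the order of their labels, so
  that they can be followed through wall slides.\<close>

definition labeled_rectangulation :: "point set list \<Rightarrow> bool" where
  "labeled_rectangulation xs \<longleftrightarrow> distinct xs \<and> rectangulation (set xs)"

definition h_contacts :: "point set list \<Rightarrow> (nat \<times> nat) set" where
  "h_contacts xs = {(i, j). i < length xs \<and> j < length xs \<and> left_of (xs ! i) (xs ! j)}"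

definition v_contacts :: "point set list \<Rightarrow> (nat \<times> nat) set" where
  "v_contacts xs = {(i, j). i < length xs \<and> j < length xs \<and> below (xs ! i) (xs ! j)}"

definition labeled_equiv :: "point set list \<Rightarrow> point set list \<Rightarrow> bool" where
  "labeled_equiv xs ys \<longleftrightarrow> labeled_rectangulation xs \<and> labeled_rectangulation ys \<and>
     length xs = length ys \<and> h_contacts xs = h_contacts ys \<and> v_contacts xs = v_contacts ys"

definition combinatorially_equivalent :: "point set set \<Rightarrow> point set set \<Rightarrow> bool" where
  "combinatorially_equivalent R S \<longleftrightarrow> (\<exists>xs ys. set xs = R \<and> set ys = S \<and> labeled_equiv xs ys)"

text \<open>A wall slide exchanges two consecutive vertices of a wall whose third edges lie on opposite
  sides of the wall. On a vertical wall, let \<open>b\<close> lie directly above \<open>a\<close> on the left and \<open>d\<close>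
  directly above \<open>c\<close> on the right. The contacts \<open>(a, c)\<close>, \<open>(b, c)\<close>, \<open>(b, d)\<close> say that the vertex
  at the corners of \<open>a\<close> and \<open>b\<close> is the one immediately below the vertex at the corners of \<open>c\<close>
  and \<open>d\<close>; after exchanging them, \<open>a\<close> touches \<open>d\<close> instead of \<open>b\<close> touching \<open>c\<close>, and no other
  contact changes. The second disjunct is the same for a horizontal wall. The slides in the
  opposite direction are the converse relation.\<close>

definition wall_slide :: "point set list \<Rightarrow> point set list \<Rightarrow> bool" where
  "wall_slide xs ys \<longleftrightarrow>
     labeled_rectangulation xs \<and> labeled_rectangulation ys \<and> length xs = length ys \<and>
     (\<exists>a b c d.
        ({(a, b), (c, d)} \<subseteq> v_contacts xs \<and> {(a, c), (b, c), (b, d)} \<subseteq> h_contacts xs \<and>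
         v_contacts ys = v_contacts xs \<and>
         h_contacts ys = insert (a, d) (h_contacts xs - {(b, c)})) \<or>
        ({(a, b), (c, d)} \<subseteq> h_contacts xs \<and> {(a, c), (b, c), (b, d)} \<subseteq> v_contacts xs \<and>
         h_contacts ys = h_contacts xs \<and>
         v_contacts ys = insert (a, d) (v_contacts xs - {(b, c)})))"

definition R_equivalent :: "point set list \<Rightarrow> point set list \<Rightarrow> bool" where
  "R_equivalent = equivclp (\<lambda>xs ys. labeled_equiv xs ys \<or> wall_slide xs ys)"


section \<open>The Baxter permutation of a diagonal rectangulation\<close>

text \<open>Both diagonals are traversed from left to right.\<close>

definition met_in_order :: "point set \<Rightarrow> point set list \<Rightarrow> bool" where
  "met_in_order D xs \<longleftrightarrow>
     sorted_wrt (\<lambda>K L. \<forall>p \<in> interior K \<inter> D. \<forall>q \<in> interior L \<inter> D. fst p < fst q) xs"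

text \<open>Permutations of \<open>{1..n}\<close> are given in one-line notation. In \<open>xs\<close>, the rectangle with label
  \<open>i\<close> is at index \<open>i - 1\<close>; \<open>ys\<close> is the anti-diagonal representative with the same labels.\<close>

definition is_baxter_permutation :: "point set set \<Rightarrow> nat list \<Rightarrow> bool" where
  "is_baxter_permutation R \<pi> \<longleftrightarrow> (\<exists>xs ys.
     set xs = R \<and> distinct xs \<and> met_in_order main_diagonal xs \<and>
     R_equivalent xs ys \<and> antidiagonal_rectangulation (set ys) \<and>
     distinct \<pi> \<and> set \<pi> = {1..length ys} \<and>
     met_in_order anti_diagonal (map (\<lambda>i. ys ! (i - 1)) \<pi>))"

definition baxter_permutation :: "point set set \<Rightarrow> nat list" where
  "baxter_permutation R = (THE \<pi>. is_baxter_permutation R \<pi>)"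

definition differ_by_consecutive_transposition :: "nat list \<Rightarrow> nat list \<Rightarrow> bool" where
  "differ_by_consecutive_transposition \<pi> \<sigma> \<longleftrightarrow>
     (\<exists>j k. j < length \<pi> \<and> k < length \<pi> \<and> \<bar>int (\<pi> ! j) - int (\<pi> ! k)\<bar> = 1 \<and>
        \<sigma> = \<pi>[j := \<pi> ! k, k := \<pi> ! j])"


section \<open>Flips\<close>

text \<open>The edge \<open>p q\<close> is matched at its endpoint \<open>p\<close>.\<close>

definition matched_at :: "point set set \<Rightarrow> point \<Rightarrow> point \<Rightarrow> bool" where
  "matched_at R p q \<longleftrightarrow> (\<exists>r. edge R p r \<and> p \<in> open_segment q r)"

text \<open>An edge on the boundary of the square cannot be replaced, because the skeleton of a
  rectangulation contains that boundary.\<close>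

definition edge_replacement ::
  "point set set \<Rightarrow> point \<Rightarrow> point \<Rightarrow> point set set \<Rightarrow> point \<Rightarrow> point \<Rightarrow> bool" where
  "edge_replacement R p q R' p' q' \<longleftrightarrow>
     rectangulation R \<and> rectangulation R' \<and> edge R p q \<and> edge R' p' q' \<and>
     (q - p) \<bullet> (q' - p') = 0 \<and>
     skeleton R' = (skeleton R - open_segment p q) \<union> closed_segment p' q'"

definition simple_flip :: "point set set \<Rightarrow> point \<Rightarrow> point \<Rightarrow> point set set \<Rightarrow> bool" where
  "simple_flip R p q R' \<longleftrightarrow> \<not> matched_at R p q \<and> \<not> matched_at R q p \<and>
     (\<exists>p' q'. edge_replacement R p q R' p' q' \<and> open_segment p q \<inter> open_segment p' q' \<noteq> {})"

text \<open>Rotation of the edge \<open>p q\<close> around \<open>p\<close>.\<close>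

definition rotation_flip :: "point set set \<Rightarrow> point \<Rightarrow> point \<Rightarrow> point set set \<Rightarrow> bool" where
  "rotation_flip R p q R' \<longleftrightarrow> matched_at R p q \<and> \<not> matched_at R q p \<and>
     (\<exists>q'. edge_replacement R p q R' p q')"

definition flip :: "point set set \<Rightarrow> point \<Rightarrow> point \<Rightarrow> point set set \<Rightarrow> bool" where
  "flip R p q R' \<longleftrightarrow> simple_flip R p q R' \<or> rotation_flip R p q R' \<or> rotation_flip R q p R'"

text \<open>Flips act on combinatorial classes. The flipped edge is taken in a drawing \<open>S\<close> that is
  diagonal, where intersecting the main diagonal makes sense. The drawing \<open>S'\<close> obtained by the
  geometric flip need not be diagonal itself (rotating an edge that crosses the diagonal
  may leave a rectangle away from it); its class has to contain the diagonal drawing \<open>R'\<close>.\<close>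

definition barcelona_flip :: "point set set \<Rightarrow> point set set \<Rightarrow> bool" where
  "barcelona_flip R R' \<longleftrightarrow> diagonal_rectangulation R \<and> diagonal_rectangulation R' \<and>
     (\<exists>S S' p q. combinatorially_equivalent R S \<and> diagonal_rectangulation S \<and>
        closed_segment p q \<inter> main_diagonal \<noteq> {} \<and> flip S p q S' \<and>
        combinatorially_equivalent S' R')"

end

theory Submission
  imports Defs
begin

text \<open>Number the rectangles of a diagonal rectangulation along the main diagonal. Where the diagonal
  passes from \<open>i\<close> to \<open>i + 1\<close> it crosses exactly one wall, and every wall crosses it once; up to the
  positions of the crossings, the rectangulation is a partition of an integer grid. Any two labels
  are related by exactly one of the transitive closures of \<open>right side of i = left side of j\<close> and
  \<open>lower side of i = upper side of j\<close>. Calling \<open>i\<close> smaller than \<open>j\<close> if it is to the left of or below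
  \<open>j\<close> gives a linear order on the labels, which determines the grid. The identities between walls
  are invariant under wall slides, and rectangles that are consecutive along the anti-diagonal
  touch; therefore the Baxter permutation lists the labels in increasing order.

  An edge that meets the diagonal lies on the wall between two labels \<open>i\<close> and \<open>i + 1\<close>.
  By the two symmetries of the square that preserve the diagonal it may be assumed that the edge is
  vertical, and that its lower endpoint is not the one about which it is rotated. The flip exchanges
  the labels \<open>i\<close> and \<open>i + 1\<close> and changes no other comparison. Conversely, let the orders of two
  grids differ by exchanging \<open>i\<close> and \<open>i + 1\<close>. If the sides of \<open>i\<close> and \<open>i + 1\<close> are level at
  both ends of the wall, a simple flip produces the second order; if they are level at one end
  only, a rotation does; if they are level at neither, there is no such second grid.\<close>

section \<open>Diagonal grids\<close>

text \<open>The identity \<open>rt i = lf j\<close> does not say that the tiles touch, only that one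
  wall bounds both. This is why it survives wall slides, while contacts do not. The price is that
  the generated order must be shown total and asymmetric combinatorially; both proofs go by
  induction on the distance of two labels, using the stack of tiles behind one wall. The order gives
  back the grid because \<open>lf j\<close> is the largest smaller label preceding \<open>j\<close>,
  or 0, and \<open>rt j + 1\<close> is the smallest larger label following it.

  The obstacle in the geometric part is that grids have to be drawn with walls out of the order of
  their indices: in the anti-diagonal representative, between two slides and after a rotation.
  \<open>double_telescope\<close> shows that every placement of the walls that gives all tiles
  positive width and height is a tiling. The outcome of a flip is compared with its diagonal
  redrawing only through contacts: consecutive labels touch, which forces the numbering, and
  contacts along a wall yield the wall identities.\<close>

text \<open>Rectangle \<open>i\<close> occupies the columns \<open>{lf i<..rt i}\<close> and the rows \<open>{tp i<..bt i}\<close>, where rows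
  are counted downwards so that the main diagonal consists of the cells \<open>(i, i)\<close>.\<close>

locale diagonal_grid =
  fixes n :: nat and lf rt tp bt :: "nat \<Rightarrow> nat"
  assumes n_pos: "0 < n"
    and diag: "i \<in> {1..n} \<Longrightarrow> lf i < i \<and> i \<le> rt i \<and> tp i < i \<and> i \<le> bt i"
    and bounds: "i \<in> {1..n} \<Longrightarrow> rt i \<le> n \<and> bt i \<le> n"
    and cover: "u \<in> {1..n} \<Longrightarrow> v \<in> {1..n} \<Longrightarrow>
      \<exists>i\<in>{1..n}. lf i < u \<and> u \<le> rt i \<and> tp i < v \<and> v \<le> bt i"
    and disj: "i \<in> {1..n} \<Longrightarrow> j \<in> {1..n} \<Longrightarrow>
      lf i < u \<Longrightarrow> u \<le> rt i \<Longrightarrow> tp i < v \<Longrightarrow> v \<le> bt i \<Longrightarrow>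
      lf j < u \<Longrightarrow> u \<le> rt j \<Longrightarrow> tp j < v \<Longrightarrow> v \<le> bt j \<Longrightarrow> i = j"
begin

text \<open>Equality of lines instead of contact: \<open>H\<close> relates any two tiles on the two
  sides of one vertical wall, even if they do not touch.\<close>

definition H :: "(nat \<times> nat) set" where
  "H = {(i, j). i \<in> {1..n} \<and> j \<in> {1..n} \<and> rt i = lf j}"

definition V :: "(nat \<times> nat) set" where
  "V = {(i, j). i \<in> {1..n} \<and> j \<in> {1..n} \<and> bt i = tp j}"

text \<open>Rows are counted downwards, so \<open>V\<close> leads from the upper tile to the lower
  one; the lower one is to be smaller, hence the reversed pair.\<close>

definition prec :: "nat \<Rightarrow> nat \<Rightarrow> bool" where
  "prec i j \<longleftrightarrow> (i, j) \<in> H\<^sup>+ \<or> (j, i) \<in> V\<^sup>+"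

text \<open>Exchanging columns and rows fixes the diagonal cells and therefore all labels. It
  transfers every fact about vertical walls to horizontal ones.\<close>

lemma reflect: "diagonal_grid n tp bt lf rt"
proof (unfold_locales, goal_cases)
  case (4 u v) then show ?case using cover[of v u] by blast
next
  case (5 i j u v) then show ?case using disj[of i j v u] by blast
qed (use n_pos diag bounds in auto)

text \<open>The half turn sends label \<open>i\<close> to \<open>n + 1 - i\<close> but line
  \<open>k\<close> to \<open>n - k\<close>, since lines are numbered from 0 and cells from
  1.\<close>

lemma rotate: "diagonal_grid n (\<lambda>i. n - rt (n + 1 - i)) (\<lambda>i. n - lf (n + 1 - i))
   (\<lambda>i. n - bt (n + 1 - i)) (\<lambda>i. n - tp (n + 1 - i))"
proof (unfold_locales, goal_cases)
  case (2 i)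
  define k where "k = n + 1 - i"
  then have k: "k \<in> {1..n}" "i = n + 1 - k" using 2 by auto
  from diag[OF k(1)] bounds[OF k(1)] k(1) show ?case unfolding k_def[symmetric] k(2) by auto
next
  case (4 u v)
  then obtain i where i: "i \<in> {1..n}" "lf i < n + 1 - u" "n + 1 - u \<le> rt i" "tp i < n + 1 - v"
    "n + 1 - v \<le> bt i"
    using cover[of "n + 1 - u" "n + 1 - v"] by fastforce
  have "n + 1 - (n + 1 - i) = i" using i(1) by auto
  then show ?case using i 4 by (intro bexI[of _ "n + 1 - i"]) auto
next
  case (5 i j u v)
  have i: "n + 1 - i \<in> {1..n}" "n + 1 - j \<in> {1..n}" using 5(1,2) by auto
  have le: "n - a < u \<Longrightarrow> n + 1 - u \<le> a" for a u by linarith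
  have less: "n - b < u \<Longrightarrow> u \<le> n - a \<Longrightarrow> a < n + 1 - u" for a b u by linarith
  have "n + 1 - i = n + 1 - j"
    by (rule disj[OF i, of "n + 1 - u" "n + 1 - v"]) (use 5(3-10) in \<open>blast intro: le less\<close>)+
  then show ?case using 5(1,2) by auto
qed (use n_pos in auto)

lemma same_tile: "i \<in> {1..n} \<Longrightarrow> j \<in> {1..n} \<Longrightarrow> lf i < j \<Longrightarrow> j \<le> rt i \<Longrightarrow> tp i < j \<Longrightarrow> j \<le> bt i \<Longrightarrow> i = j"
  using disj[of i j j j] diag[of j] by blast

text \<open>If both lines came earlier, tile \<open>i\<close> would contain the diagonal cell of
  \<open>i - 1\<close>.\<close>

lemma max_lf_tp:
  assumes "i \<in> {1..n}" shows "max (lf i) (tp i) = i - 1"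
proof (rule ccontr)
  assume "\<not> ?thesis"
  then have l: "lf i < i - 1" "tp i < i - 1" using diag[OF assms] by auto
  then have "i - 1 \<in> {1..n}" using assms by auto
  then have "i = i - 1" using same_tile[OF assms, of "i - 1"] diag[OF assms] l by linarith
  then show False using l by simp
qed

lemma min_rt_bt:
  assumes "i \<in> {1..n}" shows "min (rt i) (bt i) = i"
proof (rule ccontr)
  assume "\<not> ?thesis"
  then have "i < rt i" "i < bt i" using diag[OF assms] by auto
  then show False using same_tile[OF assms, of "i + 1"] diag[OF assms] bounds[OF assms] assms
    by auto
qed

section \<open>Walls crossed by the diagonal\<close>

definition vert :: "nat \<Rightarrow> bool" where
  "vert k \<longleftrightarrow> 0 < k \<and> k < n \<and> rt k = k \<and> lf (k + 1) = k \<and> k < bt k \<and> tp (k + 1) < k"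

definition horiz :: "nat \<Rightarrow> bool" where
  "horiz k \<longleftrightarrow> 0 < k \<and> k < n \<and> bt k = k \<and> tp (k + 1) = k \<and> k < rt k \<and> lf (k + 1) < k"

text \<open>A tile that covers one of the two cells beside the crossing, (k, k + 1) or (k + 1, k),
  also covers one of the diagonal cells \<open>k\<close> and \<open>k + 1\<close>, so it is one of
  these two tiles. The owner of the lower left cell decides the direction of the wall.\<close>

lemma vert_or_horiz:
  assumes "0 < k" "k < n" shows "vert k \<or> horiz k"
proof -
  have k: "k \<in> {1..n}" "k + 1 \<in> {1..n}" using assms by auto
  note d = diag[OF k(1)] diag[OF k(2)] max_lf_tp[OF k(2)] min_rt_bt[OF k(1)]
  obtain i where i: "i \<in> {1..n}" "lf i < k" "k \<le> rt i" "tp i < k + 1" "k + 1 \<le> bt i"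
    using cover[OF k] by auto
  have ik: "i = k \<or> i = k + 1"
  proof (cases "i \<le> k")
    case True
    then show ?thesis using same_tile[OF i(1) k(1)] i diag[OF i(1)] by auto
  next
    case False
    then show ?thesis using same_tile[OF i(1) k(2)] i diag[OF i(1)] by auto
  qed
  obtain j where j: "j \<in> {1..n}" "lf j < k + 1" "k + 1 \<le> rt j" "tp j < k" "k \<le> bt j"
    using cover[OF k(2) k(1)] by auto
  have jk: "j = k \<or> j = k + 1"
  proof (cases "j \<le> k")
    case True
    then show ?thesis using same_tile[OF j(1) k(1)] j diag[OF j(1)] by auto
  next
    case False
    then show ?thesis using same_tile[OF j(1) k(2)] j diag[OF j(1)] by auto
  qed
  have "vert k" if "i = k"
  proof -
    have "j = k + 1" using jk i(5) that j d min_rt_bt[OF k(1)]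
      by (auto simp: min_def split: if_splits)
    then show ?thesis using that i j d assms unfolding vert_def
      by (auto simp: min_def max_def split: if_splits)
  qed
  moreover have "horiz k" if "i = k + 1"
  proof -
    have "j = k" using jk i that j d by (auto simp: max_def split: if_splits)
    then show ?thesis using that i j d assms unfolding horiz_def
      by (auto simp: min_def max_def split: if_splits)
  qed
  ultimately show ?thesis using ik by blast
qed

lemma not_vert_horiz: "vert k \<Longrightarrow> horiz k \<Longrightarrow> False"
  unfolding vert_def horiz_def by auto

text \<open>Consider the cell left of line \<open>k\<close> in row \<open>i\<close>. Its tile ends
  at column \<open>k\<close> and reaches below row \<open>k\<close>, so by \<open>min_rt_bt\<close>
  its label is \<open>k\<close>. Thus every tile that starts at line \<open>k\<close> faces tile
  \<open>k\<close>, and the line carries a single wall.\<close>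

lemma lf_vert:
  assumes i: "i \<in> {1..n}" and k: "lf i = k" "0 < k"
  shows "vert k" "k < i" "i \<le> bt k" "tp k < i"
proof -
  have ki: "k < i" using diag[OF i] k by auto
  obtain j where j: "j \<in> {1..n}" "lf j < k" "k \<le> rt j" "tp j < i" "i \<le> bt j"
    using cover[of k i] i k ki by auto
  have "rt j = k"
  proof (rule ccontr)
    assume "rt j \<noteq> k"
    then have "j = i" using disj[OF j(1) i, of "k + 1" i] j diag[OF i] k by auto
    then show False using j k by auto
  qed
  then have "j = k" using min_rt_bt[OF j(1)] j ki diag[OF j(1)] by auto
  then have "rt k = k" "i \<le> bt k" "tp k < i" using j \<open>rt j = k\<close> by auto
  then show "vert k" "i \<le> bt k" "tp k < i"
    using vert_or_horiz[of k] k ki i by (auto simp: horiz_def)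
  show "k < i" by fact
qed

lemma tp_horiz:
  assumes "i \<in> {1..n}" "tp i = k" "0 < k"
  shows "horiz k" "k < i" "i \<le> rt k" "lf k < i"
proof -
  interpret r: diagonal_grid n tp bt lf rt by (rule reflect)
  show "horiz k" "k < i" "i \<le> rt k" "lf k < i"
    using r.lf_vert[OF assms] unfolding horiz_def r.vert_def by auto
qed

lemma rt_vert:
  assumes i: "i \<in> {1..n}" and k: "rt i = k" "k < n"
  shows "vert k" "i \<le> k" "tp (k + 1) < i" "i \<le> bt (k + 1)"
proof -
  interpret r: diagonal_grid n "\<lambda>i. n - rt (n + 1 - i)" "\<lambda>i. n - lf (n + 1 - i)"
   "\<lambda>i. n - bt (n + 1 - i)" "\<lambda>i. n - tp (n + 1 - i)" by (rule rotate)
  have i': "n + 1 - i \<in> {1..n}" and ii: "n + 1 - (n + 1 - i) = i" using i by auto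
  have ik: "i \<le> k" using diag[OF i] k by auto
  have k1: "k + 1 \<in> {1..n}" using k by auto
  have e: "n + 1 - (n - k) = k + 1" using k by auto
  note l = r.lf_vert[OF i', unfolded ii, of "n - k", unfolded e]
  have 1: "tp (k + 1) < i" "i \<le> bt (k + 1)"
    using l(3,4) k i bounds[OF k1] by auto
  have "lf (k + 1) = k" using l(1) k e bounds[OF k1] i ik diag[OF k1] unfolding r.vert_def by auto
  then show "vert k" "i \<le> k" "tp (k + 1) < i" "i \<le> bt (k + 1)"
    using 1 vert_or_horiz[of k] k ik i by (auto simp: horiz_def)
qed

lemma bt_horiz:
  assumes "i \<in> {1..n}" "bt i = k" "k < n"
  shows "horiz k" "i \<le> k" "lf (k + 1) < i" "i \<le> rt (k + 1)"
proof -
  interpret r: diagonal_grid n tp bt lf rt by (rule reflect)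
  show "horiz k" "i \<le> k" "lf (k + 1) < i" "i \<le> rt (k + 1)"
    using r.rt_vert[OF assms] unfolding horiz_def r.vert_def by auto
qed

text \<open>Otherwise the cell left of the wall in row \<open>bt k + 1\<close> belongs to a tile
  that also ends at column \<open>k\<close>, and as in \<open>lf_vert\<close> this can only be tile
  \<open>k\<close>, which does not reach that row.\<close>

lemma bt_right_le:
  assumes c: "c \<in> {1..n}" "lf c = k" "0 < k" shows "bt c \<le> bt k"
proof (rule ccontr)
  assume n: "\<not> ?thesis"
  note l = lf_vert[OF c]
  have k: "k \<in> {1..n}" using l(1) by (auto simp: vert_def)
  obtain j where j: "j \<in> {1..n}" "lf j < k" "k \<le> rt j" "tp j < bt k + 1" "bt k + 1 \<le> bt j"
    using cover[of k "bt k + 1"] n bounds[OF c(1)] k by auto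
  have jc: "j \<noteq> c" using j c by auto
  have "rt j = k"
  proof (rule ccontr)
    assume "rt j \<noteq> k"
    then have "j = c" using disj[OF j(1) c(1), of "k + 1" "bt k + 1"] j diag[OF c(1)] c l n by auto
    then show False using jc by auto
  qed
  then have "j = k" using min_rt_bt[OF j(1)] j l diag[OF j(1)] by (auto simp: vert_def)
  then show False using j by auto
qed

text \<open>The tile under \<open>c\<close> cannot extend to the left of line \<open>k\<close>,
  because tile \<open>k\<close> still occupies the cell there.\<close>

lemma next_right:
  assumes c: "c \<in> {1..n}" "lf c = k" "0 < k" and b: "bt c < bt k"
  obtains c' where "c' \<in> {1..n}" "lf c' = k" "tp c' = bt c" "c < c'" "bt c < bt c'"
proof -
  note l = lf_vert[OF c]
  have k: "k \<in> {1..n}" using l(1) by (auto simp: vert_def)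
  have dc: "c \<le> bt c" "lf c < c" "c \<le> rt c" "tp c < c" using diag[OF c(1)] by auto
  have dk: "lf k < k" "tp k < k" "rt k = k" using diag[OF k] l(1) by (auto simp: vert_def)
  obtain d where d: "d \<in> {1..n}" "lf d < k + 1" "k + 1 \<le> rt d" "tp d < bt c + 1" "bt c + 1 \<le> bt d"
    using cover[of "k + 1" "bt c + 1"] b bounds[OF k] l(1) unfolding vert_def by auto
  have "\<not> lf d < k"
  proof
    assume "lf d < k"
    then have "d = k" using disj[OF d(1) k, of k "bt c + 1"] d b dk dc l(2) by auto
    then show False using d dk by auto
  qed
  then have lfd: "lf d = k" using d by auto
  have dc': "d \<noteq> c" using d by auto
  have tpd: "tp d = bt c"
  proof (rule ccontr)
    assume "tp d \<noteq> bt c"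
    then have "d = c" using disj[OF d(1) c(1), of "k + 1" "bt c"] d dc c(2) by auto
    then show False using dc' by auto
  qed
  have "c < d" using tpd dc diag[OF d(1)] by auto
  with d lfd tpd show thesis by (intro that[of d]) auto
qed

text \<open>\<open>V\<close> leads from each tile in the stack behind wall \<open>k\<close> to the
  next one, and the last tile of the stack ends level with tile \<open>k\<close>.\<close>

lemma below_right_end:
  assumes "c \<in> {1..n}" "lf c = k" "0 < k" "b \<in> {1..n}" "tp b = bt k"
  shows "(c, b) \<in> V\<^sup>+"
  using assms
proof (induction "bt k - bt c" arbitrary: c rule: less_induct)
  case less
  show ?case
  proof (cases "bt c < bt k")
    case False
    then have "bt c = bt k" using bt_right_le[OF less.prems(1-3)] by auto
    then show ?thesis using less.prems by (auto simp: V_def)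
  next
    case True
    obtain c' where c': "c' \<in> {1..n}" "lf c' = k" "tp c' = bt c" "c < c'" "bt c < bt c'"
      using next_right[OF less.prems(1-3) True] .
    have "(c', b) \<in> V\<^sup>+" by (rule less.hyps) (use c' True less.prems in auto)
    moreover have "(c, c') \<in> V" using c' less.prems by (auto simp: V_def)
    ultimately show ?thesis by (rule trancl_into_trancl2[rotated])
  qed
qed

section \<open>The order generated by the walls\<close>

lemma H_less: "(i, j) \<in> H \<Longrightarrow> i < j" 
  using diag[of i] diag[of j] by (auto simp: H_def)
lemma V_less: "(i, j) \<in> V \<Longrightarrow> i < j" 
  using diag[of i] diag[of j] by (auto simp: V_def)

lemma H_trancl: "(i, j) \<in> H\<^sup>+ \<Longrightarrow> i < j \<and> i \<in> {1..n} \<and> j \<in> {1..n}"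
  by (induction rule: trancl_induct) (use H_less in \<open>fastforce simp: H_def[THEN eqset_imp_iff]\<close>)+

lemma V_trancl: "(i, j) \<in> V\<^sup>+ \<Longrightarrow> i < j \<and> i \<in> {1..n} \<and> j \<in> {1..n}"
  by (induction rule: trancl_induct) (use V_less in \<open>fastforce simp: V_def[THEN eqset_imp_iff]\<close>)+

lemma reflect_H: "diagonal_grid.H n tp bt = V"
  using diagonal_grid.H_def[OF reflect] V_def by auto

lemma reflect_V: "diagonal_grid.V n lf rt = H"
  using diagonal_grid.V_def[OF reflect] H_def by auto

end

text \<open>Compare \<open>j\<close> with the last tile \<open>c\<close> behind the wall of
  \<open>i\<close> whose label is at most \<open>j\<close>. If \<open>c\<close> leads to
  \<open>j\<close> by \<open>H\<close>, so does \<open>i\<close>. If it leads there by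
  \<open>V\<close>, then \<open>c\<close> ends level with \<open>i\<close>, and both have the same
  successors in \<open>V\<close>.\<close>

lemma (in diagonal_grid) total_vert:
  assumes ij: "i \<in> {1..n}" "j \<in> {1..n}" "i < j" and v: "vert i"
    and IH: "\<And>c. c \<in> {1..n} \<Longrightarrow> i < c \<Longrightarrow> c < j \<Longrightarrow> (c, j) \<in> H\<^sup>+ \<or> (c, j) \<in> V\<^sup>+"
  shows "(i, j) \<in> H\<^sup>+ \<or> (i, j) \<in> V\<^sup>+"
proof -
  let ?C = "{c \<in> {1..n}. c \<le> j \<and> lf c = i}"
  define c where "c = Max ?C"
  have i0: "0 < i" "rt i = i" using v by (auto simp: vert_def)
  have "finite ?C" "i + 1 \<in> ?C" using v ij by (auto simp: vert_def)
  then have "c \<in> ?C" and cmax: "\<And>d. d \<in> ?C \<Longrightarrow> d \<le> c" unfolding c_def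
    by (intro Max_in; blast) (intro Max_ge; simp)
  then have c: "c \<in> {1..n}" "c \<le> j" "lf c = i" by auto
  have ic: "(i, c) \<in> H" using c ij i0 by (auto simp: H_def)
  show ?thesis
  proof (cases "c = j")
    case True then show ?thesis using ic by auto
  next
    case False
    then have cj: "c < j" using c by auto
    consider "(c, j) \<in> H\<^sup>+" | "(c, j) \<in> V\<^sup>+" using IH[OF c(1) _ cj] H_less[OF ic] by blast
    then show ?thesis
    proof cases
      case 1 then show ?thesis using ic by (meson trancl_into_trancl2)
    next
      case 2
      then obtain c' where c': "(c, c') \<in> V" "(c', j) \<in> V\<^sup>*" by (meson tranclD)
      have c'j: "c' \<le> j" using c'(2) V_trancl[of c' j] by (auto simp: rtrancl_eq_or_trancl)
      have tc': "tp c' = bt c" "c' \<in> {1..n}" using c'(1) by (auto simp: V_def)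
      \<comment> \<open>Otherwise the next tile \<open>d\<close> behind the wall has a label above
        \<open>j\<close>, so its upper line is \<open>d - 1 >= j\<close>. But that line is also the
        upper line of \<open>c'\<close>, which is less than \<open>c' <= j\<close>.\<close>
      have "\<not> bt c < bt i"
      proof
        assume "bt c < bt i"
        then obtain d where d: "d \<in> {1..n}" "lf d = i" "tp d = bt c" "c < d"
          using next_right[OF c(1,3) i0(1)] by metis
        have "j < d" using cmax[of d] d by force
        moreover have "tp d = d - 1" using max_lf_tp[OF d(1)] d \<open>j < d\<close> ij by auto
        ultimately show False using d tc' c'j diag[OF tc'(2)] by auto
      qed
      then have "bt c = bt i" using bt_right_le[OF c(1,3) i0(1)] by auto
      then have "(i, c') \<in> V" using tc' ij by (auto simp: V_def)
      then show ?thesis using c'(2) by (meson rtrancl_into_trancl2)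
    qed
  qed
qed

context diagonal_grid begin

lemma total:
  assumes "i \<in> {1..n}" "j \<in> {1..n}" "i < j"
  shows "(i, j) \<in> H\<^sup>+ \<or> (i, j) \<in> V\<^sup>+"
  using assms
proof (induction "j - i" arbitrary: i rule: less_induct)
  case less
  have IH: "(c, j) \<in> H\<^sup>+ \<or> (c, j) \<in> V\<^sup>+" if "c \<in> {1..n}" "i < c" "c < j" for c
    using less that by (intro less.hyps) auto
  interpret r: diagonal_grid n tp bt lf rt by (rule reflect)
  have "vert i \<or> r.vert i" using vert_or_horiz[of i] less unfolding horiz_def r.vert_def by auto
  then show ?case
  proof
    assume "vert i" then show ?thesis using total_vert IH less.prems by blast
  next
    assume "r.vert i"
    then have "(i, j) \<in> r.H\<^sup>+ \<or> (i, j) \<in> r.V\<^sup>+" 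
      by (rule r.total_vert[OF less.prems]) (use IH reflect_H reflect_V in auto)
    then show ?thesis using reflect_H reflect_V by auto
  qed
qed

end

text \<open>Let \<open>a\<close> and \<open>b\<close> be the first tiles after \<open>i\<close> on
  the two chains. Since \<open>a\<close> stands behind the wall of \<open>i\<close> and
  \<open>b\<close> starts where \<open>i\<close> ends, \<open>V\<close> leads from \<open>a\<close>
  to \<open>b\<close>. So \<open>a\<close>, which is larger than \<open>i\<close>, is also joined to
  \<open>j\<close> in both ways.\<close>

lemma (in diagonal_grid) exclusive_vert:
  assumes h: "(i, j) \<in> H\<^sup>+" and w: "(i, j) \<in> V\<^sup>+" and v: "vert i"
    and IH: "\<And>c. i < c \<Longrightarrow> (c, j) \<in> H\<^sup>+ \<Longrightarrow> (c, j) \<in> V\<^sup>+ \<Longrightarrow> False"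
  shows False
proof -
  obtain a where a: "(i, a) \<in> H" "(a, j) \<in> H\<^sup>*" using h by (meson tranclD)
  obtain b where b: "(i, b) \<in> V" "(b, j) \<in> V\<^sup>*" using w by (meson tranclD)
  have "(a, b) \<in> V\<^sup>+"
    by (rule below_right_end[of _ i]) (use a(1) b(1) v in \<open>auto simp: H_def V_def vert_def\<close>)
  then have "(a, j) \<in> V\<^sup>+" using b(2) by (rule trancl_rtrancl_trancl)
  then show False using IH[of a] a V_trancl[of a j] H_less[of i a]
    by (auto simp: rtrancl_eq_or_trancl)
qed

context diagonal_grid begin

lemma exclusive:
  assumes "(i, j) \<in> H\<^sup>+" "(i, j) \<in> V\<^sup>+"
  shows False
  using assms
proof (induction "j - i" arbitrary: i rule: less_induct)
  case less
  have ij: "i \<in> {1..n}" "j \<in> {1..n}" "i < j" using H_trancl less.prems by auto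
  have IH: "False" if "i < c" "(c, j) \<in> H\<^sup>+" "(c, j) \<in> V\<^sup>+" for c
    using less.hyps[of c] that ij H_trancl[of c j] by (meson diff_less_mono2)
  interpret r: diagonal_grid n tp bt lf rt by (rule reflect)
  have "vert i \<or> r.vert i" using vert_or_horiz[of i] ij unfolding horiz_def r.vert_def by auto
  then show ?case
  proof
    assume "vert i" then show ?thesis using exclusive_vert IH less.prems by blast
  next
    assume "r.vert i"
    then show ?thesis
      using r.exclusive_vert[of i j] less.prems IH by (auto simp: reflect_H reflect_V)
  qed
qed

lemma prec_range: "prec i j \<Longrightarrow> i \<in> {1..n} \<and> j \<in> {1..n} \<and> i \<noteq> j"
  using H_trancl V_trancl by (fastforce simp: prec_def)

lemma prec_irrefl: "\<not> prec i i" using prec_range by blast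

lemma prec_asym: "prec i j \<Longrightarrow> prec j i \<Longrightarrow> False"
  using exclusive[of i j] exclusive[of j i] H_trancl[of i j] H_trancl[of j i] V_trancl[of i j]
    V_trancl[of j i]
  by (auto simp: prec_def)

lemma prec_total: "i \<in> {1..n} \<Longrightarrow> j \<in> {1..n} \<Longrightarrow> i \<noteq> j \<Longrightarrow> prec i j \<or> prec j i"
  using total[of i j] total[of j i] unfolding prec_def by (meson linorder_neqE_nat)

text \<open>A failure gives a 3-cycle. Two cyclically consecutive steps of it come from the same
  relation; their composition either yields \<open>prec i k\<close> or contradicts
  \<open>exclusive\<close> together with the third step.\<close>

lemma prec_trans:
  assumes "prec i j" "prec j k" shows "prec i k"
proof (rule ccontr)
  assume n: "\<not> prec i k"
  show False
  proof (cases "i = k")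
    case True then show False using assms prec_asym by blast
  next
    case False
    then have ki: "prec k i" using prec_total[of i k] assms prec_range n by blast
    show False using assms ki exclusive n unfolding prec_def by (meson trancl_trans)
  qed
qed

lemma H_prec: "rt i = lf j \<Longrightarrow> i \<in> {1..n} \<Longrightarrow> j \<in> {1..n} \<Longrightarrow> prec i j"
  by (auto simp: prec_def H_def)
lemma V_prec: "bt i = tp j \<Longrightarrow> i \<in> {1..n} \<Longrightarrow> j \<in> {1..n} \<Longrightarrow> prec j i"
  by (auto simp: prec_def V_def)

lemma prec_less_H: "prec i j \<Longrightarrow> i < j \<Longrightarrow> (i, j) \<in> H\<^sup>+"
  using V_trancl[of j i] by (auto simp: prec_def)
lemma lf_ge:
  assumes "prec k j" "k < j" shows "k \<le> lf j"
proof -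
  obtain d where "(k, d) \<in> H\<^sup>*" "(d, j) \<in> H" using prec_less_H[OF assms] by (meson tranclD2)
  then have "k \<le> d" "d \<le> lf j" using H_trancl[of k d] diag[of d]
    by (auto simp: rtrancl_eq_or_trancl H_def)
  then show ?thesis by simp
qed

lemma rt_less:
  assumes "prec i k" "i < k" shows "rt i < k"
proof -
  obtain d where "(d, k) \<in> H\<^sup>*" "(i, d) \<in> H" using prec_less_H[OF assms] by (meson tranclD)
  then have "d \<le> k" "rt i < d" using H_trancl[of d k] diag[of d]
    by (auto simp: rtrancl_eq_or_trancl H_def)
  then show ?thesis by simp
qed

lemma prec_lf: "j \<in> {1..n} \<Longrightarrow> 0 < lf j \<Longrightarrow> prec (lf j) j"
  using lf_vert(1)[of j "lf j"] by (intro H_prec) (auto simp: vert_def)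

lemma prec_rt: "i \<in> {1..n} \<Longrightarrow> rt i < n \<Longrightarrow> prec i (rt i + 1)"
  using rt_vert(1)[of i "rt i"] by (intro H_prec) (auto simp: vert_def)

lemma reflect_prec: "diagonal_grid.prec n tp bt lf rt i j = prec j i"
  unfolding diagonal_grid.prec_def[OF reflect] prec_def reflect_H reflect_V by auto

text \<open>One inequality for each side is enough, because the roles of the two grids can be
  exchanged.\<close>

lemma lf_determined:
  assumes g: "diagonal_grid n lf' rt' tp' bt'"
    and p: "\<And>a b. a \<in> {1..n} \<Longrightarrow> b \<in> {1..n} \<Longrightarrow> diagonal_grid.prec n lf' rt' tp' bt' a b = prec a b"
    and j: "j \<in> {1..n}"
  shows "lf' j \<le> lf j" "rt j \<le> rt' j"
proof -
  interpret g: diagonal_grid n lf' rt' tp' bt' by fact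
  show "lf' j \<le> lf j"
    using g.prec_lf[OF j] p[of "lf' j" j] lf_ge[of "lf' j" j] g.diag[OF j] j
      by (cases "lf' j = 0") auto
  show "rt j \<le> rt' j"
    using g.prec_rt[OF j] p[of j "rt' j + 1"] rt_less[of j "rt' j + 1"] g.diag[OF j] j bounds[OF j]
    by (cases "rt' j < n") auto
qed

lemma grid_determined:
  assumes g: "diagonal_grid n lf' rt' tp' bt'"
    and p: "\<And>a b. a \<in> {1..n} \<Longrightarrow> b \<in> {1..n} \<Longrightarrow> diagonal_grid.prec n lf' rt' tp' bt' a b = prec a b"
    and j: "j \<in> {1..n}"
  shows "lf' j = lf j" "rt' j = rt j" "tp' j = tp j" "bt' j = bt j"
proof -
  interpret g: diagonal_grid n lf' rt' tp' bt' by fact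
  have G: "diagonal_grid n lf rt tp bt" by unfold_locales
  note r = reflect g.reflect
  have q: "diagonal_grid.prec n tp' bt' lf' rt' a b = diagonal_grid.prec n tp bt lf rt a b"
    if "a \<in> {1..n}" "b \<in> {1..n}" for a b
    using p that g.reflect_prec reflect_prec by auto
  show "lf' j = lf j" "rt' j = rt j"
    using lf_determined[OF g p j] g.lf_determined[OF G p[symmetric] j] by auto
  show "tp' j = tp j" "bt' j = bt j"
    using diagonal_grid.lf_determined[OF r q j] diagonal_grid.lf_determined[OF r(2,1) q[symmetric]
      j] by auto
qed

end

section \<open>Tilings of the square\<close>

text \<open>Heights are measured downwards from the upper side of the square, which makes the main
  diagonal
  symmetric in both coordinates.\<close>

definition rect :: "real \<Rightarrow> real \<Rightarrow> real \<Rightarrow> real \<Rightarrow> point set" where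
  "rect l r t b = cbox (l, 1 - b) (r, 1 - t)"

lemma mem_rect: "(x, y) \<in> rect l r t b \<longleftrightarrow> l \<le> x \<and> x \<le> r \<and> t \<le> 1 - y \<and> 1 - y \<le> b"
  by (auto simp: rect_def cbox_Pair_eq)

lemma mem_interior_rect:
  "(x, y) \<in> interior (rect l r t b) \<longleftrightarrow> l < x \<and> x < r \<and> t < 1 - y \<and> 1 - y < b"
  by (auto simp: rect_def cbox_Pair_eq interior_Times)

lemma mem_frontier_rect:
  "(x, y) \<in> frontier (rect l r t b) \<longleftrightarrow> l \<le> x \<and> x \<le> r \<and> t \<le> 1 - y \<and> 1 - y \<le> b \<and>
     (x = l \<or> x = r \<or> 1 - y = t \<or> 1 - y = b)"
proof -
  have "closure (rect l r t b) = rect l r t b" unfolding rect_def by (simp add: closure_closed)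
  then show ?thesis by (auto simp: frontier_def mem_rect mem_interior_rect)
qed

lemma closed_segment_vertical: "closed_segment (a, c) (a, d) = {a} \<times> closed_segment c (d::real)"
  for a :: real
proof -
  have "(1 - u) * a + u * a = a" for u by (simp add: algebra_simps)
  then show ?thesis by (auto simp: closed_segment_def)
qed

lemma closed_segment_horizontal: "closed_segment (c, a) (d, a) = closed_segment c (d::real) \<times> {a}"
  for a :: real
proof -
  have "(1 - u) * a + u * a = a" for u by (simp add: algebra_simps)
  then show ?thesis by (auto simp: closed_segment_def)
qed

lemma open_segment_vertical: "open_segment (a, c) (a, d) = {a} \<times> open_segment c (d::real)"
  for a :: real
  by (auto simp: open_segment_def closed_segment_vertical)

lemma open_segment_horizontal: "open_segment (c, a) (d, a) = open_segment c (d::real) \<times> {a}"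
  for a :: real
  by (auto simp: open_segment_def closed_segment_horizontal)

lemma extreme_point_of_rect:
  assumes "l < r" "t < b"
  shows "(x, y) extreme_point_of rect l r t b \<longleftrightarrow> (x = l \<or> x = r) \<and> (1 - y = t \<or> 1 - y = b)"
proof
  assume e: "(x, y) extreme_point_of rect l r t b"
  then have m: "l \<le> x" "x \<le> r" "t \<le> 1 - y" "1 - y \<le> b" by (auto simp: extreme_point_of_def mem_rect)
  have "\<not> (l < x \<and> x < r)"
  proof
    assume "l < x \<and> x < r"
    then have "(x, y) \<in> open_segment (l, y) (r, y)"
      by (auto simp: open_segment_horizontal open_segment_eq_real_ivl)
    moreover have "(l, y) \<in> rect l r t b" "(r, y) \<in> rect l r t b" using m assms
      by (auto simp: mem_rect)
    ultimately show False using e unfolding extreme_point_of_def by blast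
  qed
  moreover have "\<not> (t < 1 - y \<and> 1 - y < b)"
  proof
    assume "t < 1 - y \<and> 1 - y < b"
    then have "(x, y) \<in> open_segment (x, 1 - b) (x, 1 - t)"
      by (auto simp: open_segment_vertical open_segment_eq_real_ivl)
    moreover have "(x, 1 - b) \<in> rect l r t b" "(x, 1 - t) \<in> rect l r t b" using m assms
      by (auto simp: mem_rect)
    ultimately show False using e unfolding extreme_point_of_def by blast
  qed
  ultimately show "(x = l \<or> x = r) \<and> (1 - y = t \<or> 1 - y = b)" using m by auto
next
  assume c: "(x = l \<or> x = r) \<and> (1 - y = t \<or> 1 - y = b)"
  show "(x, y) extreme_point_of rect l r t b"
    unfolding extreme_point_of_def
  proof (intro conjI ballI notI)
    show "(x, y) \<in> rect l r t b" using c assms by (auto simp: mem_rect)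
    fix p q assume pq: "p \<in> rect l r t b" "q \<in> rect l r t b" and o: "(x, y) \<in> open_segment p q"
    obtain p1 p2 q1 q2 where eq: "p = (p1, p2)" "q = (q1, q2)" by (metis surj_pair)
    obtain u where u: "0 < u" "u < 1" "x = (1 - u) * p1 + u * q1" "y = (1 - u) * p2 + u * q2"
      "p \<noteq> q"
      using o unfolding in_segment eq by auto
    \<comment> \<open>A proper convex combination of two numbers on the same side of
      \<open>c\<close> equals \<open>c\<close> only if both are \<open>c\<close>. In each
      coordinate, \<open>c\<close> is the side of the rectangle on which the corner lies.\<close>
    have A: "a = c \<and> b' = c" if "(1 - u) * a + u * b' = c" "(a \<ge> c \<and> b' \<ge> c) \<or> (a \<le> c \<and> b' \<le> c)"
      for a b' c :: real
    proof -
      have s: "(1 - u) * (a - c) + u * (b' - c) = 0" using that(1) by (simp add: algebra_simps)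
      show ?thesis
      proof (cases "a \<ge> c \<and> b' \<ge> c")
        case True
        then have "0 \<le> (1 - u) * (a - c)" "0 \<le> u * (b' - c)" using u by auto
        then have "(1 - u) * (a - c) = 0" "u * (b' - c) = 0" using s by linarith+
        then show ?thesis using u by auto
      next
        case False
        then have "(1 - u) * (a - c) \<le> 0" "u * (b' - c) \<le> 0" using u that(2)
          by (auto simp: mult_le_0_iff)
        then have "(1 - u) * (a - c) = 0" "u * (b' - c) = 0" using s by linarith+
        then show ?thesis using u by auto
      qed
    qed
    have m: "l \<le> p1" "p1 \<le> r" "l \<le> q1" "q1 \<le> r" "t \<le> 1 - p2" "1 - p2 \<le> b" "t \<le> 1 - q2" "1 - q2 \<le> b"
      using pq unfolding eq mem_rect by auto
    have "p1 = x \<and> q1 = x" by (rule A) (use u m c in auto)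
    moreover have "p2 = y \<and> q2 = y" by (rule A) (use u m c in auto)
    ultimately show False using u eq by auto
  qed
qed

definition lc :: "point set \<Rightarrow> real" where "lc K = Inf (fst ` K)"
definition rc :: "point set \<Rightarrow> real" where "rc K = Sup (fst ` K)"
definition tc :: "point set \<Rightarrow> real" where "tc K = 1 - Sup (snd ` K)"
definition bc :: "point set \<Rightarrow> real" where "bc K = 1 - Inf (snd ` K)"

lemma coords_rect:
  assumes "l \<le> r" "t \<le> b"
  shows "lc (rect l r t b) = l" "rc (rect l r t b) = r" "tc (rect l r t b) = t"
    "bc (rect l r t b) = b"
proof -
  have "rect l r t b = {l..r} \<times> {1 - b..1 - t}" by (auto simp: rect_def cbox_Pair_eq)
  moreover have "{l..r} \<noteq> {}" "{1 - b..1 - t} \<noteq> {}" using assms by auto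
  ultimately have "fst ` rect l r t b = {l..r}" "snd ` rect l r t b = {1 - b..1 - t}"
    by (auto simp: fst_image_times snd_image_times)
  then show "lc (rect l r t b) = l" "rc (rect l r t b) = r" "tc (rect l r t b) = t"
    "bc (rect l r t b) = b"
    using assms by (auto simp: lc_def rc_def tc_def bc_def)
qed

definition is_rect :: "point set \<Rightarrow> bool" where
  "is_rect K \<longleftrightarrow> K = rect (lc K) (rc K) (tc K) (bc K) \<and> lc K < rc K \<and> tc K < bc K"

lemma is_rect_rect: "l < r \<Longrightarrow> t < b \<Longrightarrow> is_rect (rect l r t b)"
  by (simp add: is_rect_def coords_rect)

lemma rect_coords: "is_rect K \<Longrightarrow> rect (lc K) (rc K) (tc K) (bc K) = K"
  by (rule sym) (blast dest: is_rect_def[THEN iffD1])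

lemma is_rect_less: "is_rect K \<Longrightarrow> lc K < rc K" "is_rect K \<Longrightarrow> tc K < bc K"
  unfolding is_rect_def by blast+

lemma mem_is_rect: "is_rect K \<Longrightarrow> (x, y) \<in> K \<longleftrightarrow> lc K \<le> x \<and> x \<le> rc K \<and> tc K \<le> 1 - y \<and> 1 - y \<le> bc K"
  using mem_rect[of x y "lc K" "rc K" "tc K" "bc K"] rect_coords[of K] by simp

lemma mem_interior_is_rect:
  "is_rect K \<Longrightarrow> (x, y) \<in> interior K \<longleftrightarrow> lc K < x \<and> x < rc K \<and> tc K < 1 - y \<and> 1 - y < bc K"
  using mem_interior_rect[of x y "lc K" "rc K" "tc K" "bc K"] rect_coords[of K] by simp

lemma mem_frontier_is_rect:
  "is_rect K \<Longrightarrow> (x, y) \<in> frontier K \<longleftrightarrow> lc K \<le> x \<and> x \<le> rc K \<and> tc K \<le> 1 - y \<and> 1 - y \<le> bc K \<and>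
     (x = lc K \<or> x = rc K \<or> 1 - y = tc K \<or> 1 - y = bc K)"
  using mem_frontier_rect[of x y "lc K" "rc K" "tc K" "bc K"] rect_coords[of K] by simp

lemma extreme_point_of_is_rect:
  "is_rect K \<Longrightarrow> (x, y) extreme_point_of K \<longleftrightarrow> (x = lc K \<or> x = rc K) \<and> (1 - y = tc K \<or> 1 - y = bc K)"
  using extreme_point_of_rect[of "lc K" "rc K" "tc K" "bc K" x y] rect_coords[of K] is_rect_less[of
    K] by simp

lemma is_rect_eqI:
  "is_rect K \<Longrightarrow> is_rect L \<Longrightarrow> lc K = lc L \<Longrightarrow> rc K = rc L \<Longrightarrow> tc K = tc L \<Longrightarrow> bc K = bc L \<Longrightarrow> K = L"
  by (rule trans[OF rect_coords[symmetric] trans[OF _ rect_coords]]) simp_all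

definition tiling :: "point set set \<Rightarrow> bool" where
  "tiling R \<longleftrightarrow> R division_of unit_square \<and> (\<forall>K\<in>R. interior K \<noteq> {})"

lemma rectangulation_tiling: "rectangulation R \<Longrightarrow> tiling R"
  by (auto simp: rectangulation_def tiling_def)

lemma tiling_finite: "tiling R \<Longrightarrow> finite R"
  by (auto simp: tiling_def)

lemma tiling_rect:
  assumes "tiling R" "K \<in> R"
  shows "is_rect K" "0 \<le> lc K" "lc K < rc K" "rc K \<le> 1" "0 \<le> tc K" "tc K < bc K" "bc K \<le> 1"
proof -
  obtain a b where K: "K = cbox a b" "K \<subseteq> unit_square" "interior K \<noteq> {}"
    using assms unfolding tiling_def by blast
  obtain l b' r t' where ab: "a = (l, b')" "b = (r, t')" by (metis surj_pair)
  have e: "K = rect l r (1 - t') (1 - b')" using K ab by (simp add: rect_def)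
  obtain x y where "(x, y) \<in> interior K" using K(3) by (metis ex_in_conv surj_pair)
  then have lt: "l < r" "1 - t' < 1 - b'" unfolding e mem_interior_rect by linarith+
  then show i: "is_rect K" unfolding e by (simp add: is_rect_rect)
  then show "lc K < rc K" "tc K < bc K" using is_rect_less by auto
  then have "(lc K, 1 - tc K) \<in> K" "(rc K, 1 - bc K) \<in> K" using i by (auto simp: mem_is_rect)
  then have "(lc K, 1 - tc K) \<in> unit_square" "(rc K, 1 - bc K) \<in> unit_square" using K by blast+
  then show "0 \<le> lc K" "rc K \<le> 1" "0 \<le> tc K" "bc K \<le> 1" by auto
qed

lemma tiling_cover:
  assumes "tiling R" "0 \<le> x" "x \<le> 1" "0 \<le> w" "w \<le> 1"
  obtains K where "K \<in> R" "lc K \<le> x" "x \<le> rc K" "tc K \<le> w" "w \<le> bc K"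
proof -
  have "(x, 1 - w) \<in> \<Union>R" using assms by (auto simp: tiling_def division_of_def)
  then obtain K where "K \<in> R" "(x, 1 - w) \<in> K" by blast
  then show thesis using that[of K] tiling_rect(1)[OF assms(1), of K] by (auto simp: mem_is_rect)
qed

lemma tiling_disjoint:
  assumes "tiling R" "K \<in> R" "L \<in> R" "lc K < rc L" "lc L < rc K" "tc K < bc L" "tc L < bc K"
  shows "K = L"
proof (rule ccontr)
  assume "K \<noteq> L"
  then have d: "interior K \<inter> interior L = {}" using assms unfolding tiling_def division_of_def
    by blast
  note k = tiling_rect[OF assms(1,2)] and l = tiling_rect[OF assms(1,3)]
  obtain x where "max (lc K) (lc L) < x" "x < min (rc K) (rc L)" 
    using dense[of "max (lc K) (lc L)" "min (rc K) (rc L)"] assms k l by auto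
  moreover obtain w where "max (tc K) (tc L) < w" "w < min (bc K) (bc L)" 
    using dense[of "max (tc K) (tc L)" "min (bc K) (bc L)"] assms k l by auto
  ultimately have "(x, 1 - w) \<in> interior K \<inter> interior L"
    using k(1) l(1) by (auto simp: mem_interior_is_rect)
  then show False using d by blast
qed

lemma tilingI:
  assumes "finite I"
    and c: "\<And>i. i \<in> I \<Longrightarrow> 0 \<le> l i \<and> l i < r i \<and> r i \<le> 1 \<and> 0 \<le> t i \<and> t i < b i \<and> b i \<le> 1"
    and cov: "\<And>x w. 0 \<le> x \<Longrightarrow> x \<le> 1 \<Longrightarrow> 0 \<le> w \<Longrightarrow> w \<le> 1 \<Longrightarrow>
       \<exists>i\<in>I. l i \<le> x \<and> x \<le> r i \<and> t i \<le> w \<and> w \<le> b i"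
    and dis: "\<And>i j x w. i \<in> I \<Longrightarrow> j \<in> I \<Longrightarrow> l i < x \<Longrightarrow> x < r i \<Longrightarrow> t i < w \<Longrightarrow> w < b i \<Longrightarrow>
       l j < x \<Longrightarrow> x < r j \<Longrightarrow> t j < w \<Longrightarrow> w < b j \<Longrightarrow> i = j"
  shows "tiling ((\<lambda>i. rect (l i) (r i) (t i) (b i)) ` I)" (is "tiling (?f ` I)")
    and "inj_on (\<lambda>i. rect (l i) (r i) (t i) (b i)) I"
proof -
  have ne: "interior (?f i) \<noteq> {}" if "i \<in> I" for i
  proof -
    have "((l i + r i) / 2, 1 - (t i + b i) / 2) \<in> interior (?f i)"
      using c[OF that] by (auto simp: mem_interior_rect field_simps)
    then show ?thesis by blast
  qed
  have dis': "i = j" if ij: "i \<in> I" "j \<in> I"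
    and "interior (?f i) \<inter> interior (?f j) \<noteq> {}" (is "?S \<noteq> {}") for i j
  proof -
    from that(3) obtain x y where "(x, y) \<in> interior (?f i)" "(x, y) \<in> interior (?f j)" by auto
    then show ?thesis using dis[OF ij, of x "1 - y"] by (auto simp: mem_interior_rect)
  qed
  show "inj_on ?f I"
  proof (rule inj_onI)
    fix i j assume "i \<in> I" "j \<in> I" "?f i = ?f j"
    then show "i = j" using dis'[of i j] ne[of i] by auto
  qed
  have "?f ` I division_of unit_square"
  proof (rule division_ofI)
    show "finite (?f ` I)" using assms(1) by simp
    show "\<Union> (?f ` I) = unit_square"
    proof (intro set_eqI iffI)
      fix p assume "p \<in> \<Union> (?f ` I)"
      then show "p \<in> unit_square" using c by (cases p) (force simp: mem_rect)
    next
      fix p assume "p \<in> unit_square"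
      then show "p \<in> \<Union> (?f ` I)" using cov[of "fst p" "1 - snd p"]
        by (cases p) (auto simp: mem_rect)
    qed
    fix K assume K: "K \<in> ?f ` I"
    show "K \<subseteq> unit_square" using \<open>\<Union> (?f ` I) = unit_square\<close> K by blast
    show "K \<noteq> {}" using K ne interior_subset by fastforce
    show "\<exists>a b. K = cbox a b" using K by (auto simp: rect_def)
    fix L assume "L \<in> ?f ` I" "K \<noteq> L"
    then show "interior K \<inter> interior L = {}" using K dis' by fastforce
  qed
  then show "tiling (?f ` I)" using ne by (auto simp: tiling_def)
qed

lemma left_of_is_rect:
  assumes K: "is_rect K" and L: "is_rect L"
  shows "left_of K L \<longleftrightarrow> rc K = lc L \<and> tc K < bc L \<and> tc L < bc K"
proof
  assume "left_of K L"
  then obtain x y y' where y: "y < y'" and s: "{x} \<times> {y..y'} \<subseteq> K \<inter> L" and k: "K \<subseteq> {..x} \<times> UNIV"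
    and l: "L \<subseteq> {x..} \<times> UNIV"
    by (auto simp: left_of_def)
  have "(x, y) \<in> K \<inter> L" "(x, y') \<in> K \<inter> L" using s y by auto
  moreover have "(rc K, 1 - tc K) \<in> K" "(lc L, 1 - tc L) \<in> L"
    using K L is_rect_less[OF K] is_rect_less[OF L] by (auto simp: mem_is_rect)
  then have "rc K \<le> x" "x \<le> lc L" using k l by auto
  ultimately show "rc K = lc L \<and> tc K < bc L \<and> tc L < bc K" using y by (auto simp: mem_is_rect K L)
next
  assume a: "rc K = lc L \<and> tc K < bc L \<and> tc L < bc K"
  let ?y = "1 - min (bc K) (bc L)" and ?y' = "1 - max (tc K) (tc L)"
  have "?y < ?y'" using a K L is_rect_less[OF K] is_rect_less[OF L] by (auto simp:)
  moreover have "{rc K} \<times> {?y..?y'} \<subseteq> K \<inter> L" using a K L is_rect_less[OF K] is_rect_less[OF L]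
    by (auto simp: mem_is_rect)
  moreover have "K \<subseteq> {..rc K} \<times> UNIV" "L \<subseteq> {rc K..} \<times> UNIV" using a by (auto simp: mem_is_rect K L)
  ultimately show "left_of K L" unfolding left_of_def by blast
qed

lemma below_is_rect:
  assumes K: "is_rect K" and L: "is_rect L"
  shows "below K L \<longleftrightarrow> tc K = bc L \<and> lc K < rc L \<and> lc L < rc K"
proof
  assume "below K L"
  then obtain y x x' where x: "x < x'" and s: "{x..x'} \<times> {y} \<subseteq> K \<inter> L" and k: "K \<subseteq> UNIV \<times> {..y}"
    and l: "L \<subseteq> UNIV \<times> {y..}"
    by (auto simp: below_def)
  have "(x, y) \<in> K \<inter> L" "(x', y) \<in> K \<inter> L" using s x by auto
  moreover have "(rc K, 1 - tc K) \<in> K" "(lc L, 1 - bc L) \<in> L"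
    using K L is_rect_less[OF K] is_rect_less[OF L] by (auto simp: mem_is_rect)
  then have "1 - tc K \<le> y" "y \<le> 1 - bc L" using k l by auto
  ultimately show "tc K = bc L \<and> lc K < rc L \<and> lc L < rc K" using x by (auto simp: mem_is_rect K L)
next
  assume a: "tc K = bc L \<and> lc K < rc L \<and> lc L < rc K"
  let ?x' = "min (rc K) (rc L)" and ?x = "max (lc K) (lc L)"
  have "?x < ?x'" using a K L is_rect_less[OF K] is_rect_less[OF L] by (auto simp:)
  moreover have "{?x..?x'} \<times> {1 - tc K} \<subseteq> K \<inter> L" using a K L is_rect_less[OF K] is_rect_less[OF L]
    by (auto simp: mem_is_rect)
  moreover have "K \<subseteq> UNIV \<times> {..1 - tc K}" "L \<subseteq> UNIV \<times> {1 - tc K..}" using a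
    by (auto simp: mem_is_rect K L)
  ultimately show "below K L" unfolding below_def by blast
qed

lemma mem_vertices:
  assumes "tiling R"
  shows "(x, y) \<in> vertices R \<longleftrightarrow> (\<exists>K\<in>R. (x = lc K \<or> x = rc K) \<and> (1 - y = tc K \<or> 1 - y = bc K))"
  using extreme_point_of_is_rect tiling_rect(1)[OF assms] by (auto simp: vertices_def)

lemma mem_skeleton:
  assumes "tiling R"
  shows "(x, y) \<in> skeleton R \<longleftrightarrow> (\<exists>K\<in>R. lc K \<le> x \<and> x \<le> rc K \<and> tc K \<le> 1 - y \<and> 1 - y \<le> bc K \<and>
     (x = lc K \<or> x = rc K \<or> 1 - y = tc K \<or> 1 - y = bc K))"
  using mem_frontier_is_rect tiling_rect(1)[OF assms] by (auto simp: skeleton_def)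

lemma not_skeleton:
  assumes R: "tiling R" "K \<in> R" and x: "lc K < x" "x < rc K" and y: "tc K < 1 - y" "1 - y < bc K"
  shows "(x, y) \<notin> skeleton R"
proof
  assume "(x, y) \<in> skeleton R"
  then obtain L where L: "L \<in> R" "lc L \<le> x" "x \<le> rc L" "tc L \<le> 1 - y" "1 - y \<le> bc L"
     "x = lc L \<or> x = rc L \<or> 1 - y = tc L \<or> 1 - y = bc L" using mem_skeleton[OF R(1)] by auto
  have "K = L" by (rule tiling_disjoint[OF R L(1)]) (use L x y in auto)
  then show False using L x y by auto
qed

lemma finite_vertices:
  assumes "tiling R" shows "finite (vertices R)"
proof (rule finite_subset)
  show "vertices R \<subseteq> (\<Union>K\<in>R. {lc K, rc K} \<times> {1 - tc K, 1 - bc K})"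
  proof
    fix p assume "p \<in> vertices R"
    then show "p \<in> (\<Union>K\<in>R. {lc K, rc K} \<times> {1 - tc K, 1 - bc K})"
      by (cases p) (fastforce simp: mem_vertices[OF assms])
  qed
qed (use tiling_finite[OF assms] in auto)

lemma mem_main_diagonal: "(x, y) \<in> main_diagonal \<longleftrightarrow> 0 \<le> x \<and> x \<le> 1 \<and> y = 1 - x"
  by (auto simp: main_diagonal_def closed_segment_def algebra_simps)

lemma mem_anti_diagonal: "(x, y) \<in> anti_diagonal \<longleftrightarrow> 0 \<le> x \<and> x \<le> 1 \<and> y = x"
  by (auto simp: anti_diagonal_def closed_segment_def algebra_simps)

section \<open>Numbering the tiles along the diagonal\<close>

locale diagonal_family =
  fixes I :: "'a set" and l r t b :: "'a \<Rightarrow> real"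
  assumes fin: "finite I"
    and unit: "i \<in> I \<Longrightarrow> 0 \<le> l i \<and> r i \<le> 1 \<and> 0 \<le> t i \<and> b i \<le> 1"
    and cover: "0 \<le> x \<Longrightarrow> x \<le> 1 \<Longrightarrow> 0 \<le> w \<Longrightarrow> w \<le> 1 \<Longrightarrow> \<exists>i\<in>I. l i \<le> x \<and> x \<le> r i \<and> t i \<le> w \<and> w \<le> b i"
    and disj: "i \<in> I \<Longrightarrow> j \<in> I \<Longrightarrow> l i < r j \<Longrightarrow> l j < r i \<Longrightarrow> t i < b j \<Longrightarrow> t j < b i \<Longrightarrow> i = j"
    and diag: "i \<in> I \<Longrightarrow> max (l i) (t i) < min (r i) (b i)"
begin

lemma transposed: "diagonal_family I t b l r"
proof (unfold_locales, goal_cases)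
  case (3 x w) then show ?case using cover[of w x] by blast
next
  case (4 i j) then show ?case using disj[of i j] by blast
next
  case (5 i) then show ?case using diag[of i] by linarith
qed (use fin unit in auto)

lemma rotated: "diagonal_family I (\<lambda>i. 1 - r i) (\<lambda>i. 1 - l i) (\<lambda>i. 1 - b i) (\<lambda>i. 1 - t i)"
proof (unfold_locales, goal_cases)
  case (3 x w)
  then obtain i where "i\<in>I" "l i \<le> 1 - x" "1 - x \<le> r i" "t i \<le> 1 - w" "1 - w \<le> b i"
    using cover[of "1 - x" "1 - w"] by auto
  then show ?case by (intro bexI[of _ i]) auto
next
  case (4 i j) then show ?case using disj[of i j] by auto
next
  case (5 i) then show ?case using diag[of i] by auto
qed (use fin unit in auto)

lemma disj_diag:
  assumes "i \<in> I" "j \<in> I" "max (l i) (t i) < min (r j) (b j)" "max (l j) (t j) < min (r i) (b i)"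
  shows "i = j"
  using disj[OF assms(1,2)] assms(3,4) by auto

text \<open>The diagonal passes from \<open>i\<close> directly into another tile. The point
  \<open>z\<close> lies after the end of \<open>i\<close> but before every later left or upper side,
  so the tile over \<open>z\<close> starts no later than \<open>i\<close> ends. It does not start
  earlier, because the tiles meet the diagonal in disjoint intervals.\<close>

lemma hi_cases:
  assumes i: "i \<in> I"
  shows "min (r i) (b i) = 1 \<or> (\<exists>j\<in>I. max (l j) (t j) = min (r i) (b i))"
proof (cases "min (r i) (b i) = 1")
  case False
  define h where "h = min (r i) (b i)"
  have h1: "h < 1" using False unit[OF i] by (auto simp: h_def)
  have h0: "0 < h" using diag[OF i] unit[OF i] by (auto simp: h_def)
  define E where "E = {e \<in> l ` I \<union> t ` I \<union> {1}. h < e}"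
  have E: "finite E" "E \<noteq> {}" using fin h1 by (auto simp: E_def)
  have "h < Min E" using E Min_in[OF E] by (auto simp: E_def)
  moreover have "Min E \<le> 1" using E h1 by (intro Min_le) (auto simp: E_def)
  ultimately obtain z where z: "h < z" "z < Min E" "z < 1" using dense[of h "Min E"] by auto
  obtain j where j: "j \<in> I" "l j \<le> z" "z \<le> r j" "t j \<le> z" "z \<le> b j" using cover[of z z] z h0 by auto
  have le: "l j \<le> h" 
  proof (rule ccontr)
    assume "\<not> l j \<le> h"
    then have "Min E \<le> l j" using j E by (intro Min_le) (auto simp: E_def)
    then show False using j z by auto
  qed
  have te: "t j \<le> h" 
  proof (rule ccontr)
    assume "\<not> t j \<le> h"
    then have "Min E \<le> t j" using j E by (intro Min_le) (auto simp: E_def)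
    then show False using j z by auto
  qed
  have "i \<noteq> j" using j z h_def by auto
  moreover have "max (l i) (t i) < min (r j) (b j)" using diag[OF i] j z h_def by linarith
  ultimately have "\<not> max (l j) (t j) < h" using disj_diag[OF i j(1)] unfolding h_def by blast
  then have "max (l j) (t j) = h" using le te by auto
  then show ?thesis using j(1) h_def by auto
qed auto

text \<open>Suppose the diagonal enters tile \<open>i\<close> through its upper side. Take a row
  \<open>w\<close> inside the tile and \<open>z\<close> left of \<open>l i\<close>, but beyond all
  right sides that are smaller than \<open>l i\<close>. The tile over \<open>(z, w)\<close> has its
  right side at \<open>l i\<close>, and since \<open>w > l i\<close> this is where the diagonal
  leaves it.\<close>

lemma side_cases:
  assumes i: "i \<in> I"
  shows "l i = 0 \<or> l i = max (l i) (t i) \<or> (\<exists>j\<in>I. l i = min (r j) (b j))"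
proof (rule ccontr)
  assume n: "\<not> ?thesis"
  then have lt: "l i < t i" and l0: "0 < l i" using unit[OF i] by auto
  define E where "E = {e \<in> r ` I \<union> {0}. e < l i}"
  have E: "finite E" "E \<noteq> {}" using fin l0 by (auto simp: E_def)
  have "Max E < l i" using Max_in[OF E] by (auto simp: E_def)
  then obtain z where z: "Max E < z" "z < l i" using dense by blast
  have "0 \<le> Max E" using E l0 by (intro Max_ge) (auto simp: E_def)
  obtain w where w: "t i < w" "w < min (r i) (b i)"
    using diag[OF i] dense[of "t i" "min (r i) (b i)"] lt by auto
  obtain j where j: "j \<in> I" "l j \<le> z" "z \<le> r j" "t j \<le> w" "w \<le> b j" 
    using cover[of z w] z w unit[OF i] \<open>0 \<le> Max E\<close> lt by force
  have rj: "l i \<le> r j"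
  proof (rule ccontr)
    assume "\<not> l i \<le> r j"
    then have "r j \<le> Max E" using j E by (intro Max_ge) (auto simp: E_def)
    then show False using j z by auto
  qed
  have "i \<noteq> j" using j z by auto
  then have "r j = l i" using disj[OF i j(1)] j z w rj diag[OF i] by fastforce
  then have "l i = min (r j) (b j)" using j w lt by auto
  then show False using n j(1) by blast
qed

end

text \<open>One function places columns and rows: with heights measured downwards the diagonal is
  the line of equal coordinates, so a wall of either direction lies at the position where the
  diagonal crosses it.\<close>

definition represents :: "point set set \<Rightarrow> nat \<Rightarrow> (nat \<Rightarrow> nat) \<Rightarrow> (nat \<Rightarrow> nat) \<Rightarrow> (nat \<Rightarrow> nat) \<Rightarrow> (nat \<Rightarrow>
  nat) \<Rightarrow> (nat \<Rightarrow> real) \<Rightarrow> bool" where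
  "represents R n lf rt tp bt s \<longleftrightarrow> diagonal_grid n lf rt tp bt \<and> s 0 = 0 \<and> s n = 1 \<and>
     (\<forall>i j. i < j \<longrightarrow> j \<le> n \<longrightarrow> s i < s j) \<and>
     R = (\<lambda>i. rect (s (lf i)) (s (rt i)) (s (tp i)) (s (bt i))) ` {1..n}"

text \<open>\<open>P\<close> consists of the points where the diagonal enters a tile, and of 1. By
  \<open>hi_cases\<close> and by \<open>side_cases\<close> in four orientations, every side of every
  tile is at such a point, so all coordinates become indices into the sorted list of
  \<open>P\<close>.\<close>

lemma (in diagonal_family) enumeration:
  obtains n f and s :: "nat \<Rightarrow> real" and lf rt tp bt
    where "diagonal_grid n lf rt tp bt" "s 0 = 0" "s n = 1"
    "\<And>i j. i < j \<Longrightarrow> j \<le> n \<Longrightarrow> s i < s j" "bij_betw f {1..n} I"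
    "\<And>i. i \<in> {1..n} \<Longrightarrow> l (f i) = s (lf i) \<and> r (f i) = s (rt i) \<and> t (f i) = s (tp i) \<and> b (f i) =
      s (bt i)"
proof -
  define lo where "lo i = max (l i) (t i)" for i
  define hi where "hi i = min (r i) (b i)" for i
  define P where "P = insert 1 (lo ` I)"
  have lohi: "lo i < hi i" "0 \<le> lo i" "hi i \<le> 1" if "i \<in> I" for i
    using diag[OF that] unit[OF that] by (auto simp: lo_def hi_def)
  have ov: "i = j" if "i \<in> I" "j \<in> I" "lo i < hi j" "lo j < hi i" for i j
    using disj_diag that by (simp add: lo_def hi_def)
  have inj: "inj_on lo I"
    by (rule inj_onI) (metis ov lohi(1))
  have one: "1 \<notin> lo ` I" using lohi by force
  have finP: "finite P" using fin by (simp add: P_def)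
  define n where "n = card I"
  have cP: "card P = Suc n" using fin one card_image[OF inj] by (simp add: P_def n_def)
  define xs where "xs = sorted_list_of_set P"
  define s where "s k = xs ! k" for k
  have len: "length xs = Suc n" using cP finP by (simp add: xs_def)
  have setxs: "set xs = P" using finP by (simp add: xs_def)
  have mono: "s i < s j" if "i < j" "j \<le> n" for i j
    using that len strict_sorted_list_of_set[of P] unfolding s_def xs_def
    by (auto simp: sorted_wrt_iff_nth_less)
  have mono': "s i < s j \<longleftrightarrow> i < j" if "i \<le> n" "j \<le> n" for i j
    using mono[of i j] mono[of j i] that by (metis less_asym linorder_neqE_nat order_less_irrefl)
  have sP: "\<exists>k\<le>n. s k = p" if "p \<in> P" for p
    using that len unfolding setxs[symmetric] s_def by (metis in_set_conv_nth less_Suc_eq_le)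
  have sP': "s k \<in> P" if "k \<le> n" for k
    using that len unfolding setxs[symmetric] s_def by auto
  obtain i0 where i0: "i0 \<in> I" "lo i0 = 0" using cover[of 0 0] unit by (force simp: lo_def)
  have "n > 0" using i0 fin by (auto simp: n_def card_gt_0_iff)
  have P01: "0 \<le> p" "p \<le> 1" if "p \<in> P" for p using that lohi by (force simp: P_def)+
  have s0: "s 0 = 0"
  proof -
    obtain k where k: "k \<le> n" "s k = 0" using sP[of 0] i0 by (force simp: P_def)
    then show ?thesis using mono[of 0 k] P01(1)[OF sP'[of 0]] by (cases "k = 0") auto
  qed
  have s1: "s n = 1"
  proof -
    obtain k where k: "k \<le> n" "s k = 1" using sP[of 1] by (auto simp: P_def)
    then show ?thesis using mono[of k n] P01(2)[OF sP'[of n]] by (cases "k = n") auto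
  qed
  have ex: "\<exists>i. i \<in> I \<and> lo i = s (k - 1)" if "k \<in> {1..n}" for k
  proof -
    have "s (k - 1) \<in> P" using that sP' by auto
    moreover have "k - 1 < n" using that by auto
    then have "s (k - 1) \<noteq> 1" using mono[of "k - 1" n] s1 by auto
    ultimately show ?thesis by (auto simp: P_def)
  qed
  define f where "f k = (SOME i. i \<in> I \<and> lo i = s (k - 1))" for k
  have f: "f k \<in> I" "lo (f k) = s (k - 1)" if "k \<in> {1..n}" for k
    using someI_ex[OF ex[OF that]] by (auto simp: f_def)
  have hiP: "hi i \<in> P" if "i \<in> I" for i
    using hi_cases[OF that] unfolding hi_def lo_def P_def
      by (metis (no_types, lifting) image_eqI insertCI)
  have hi: "hi (f k) = s k" if k: "k \<in> {1..n}" for k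
  proof -
    obtain m where m: "m \<le> n" "s m = hi (f k)" using sP[OF hiP[OF f(1)[OF k]]] by auto
    have "k - 1 < m" using lohi(1)[OF f(1)[OF k]] f(2)[OF k] m mono'[of "k - 1" m] k by auto
    moreover have "\<not> k < m"
    proof
      assume km: "k < m"
      then have k1: "k + 1 \<in> {1..n}" using m by auto
      have "lo (f k) < lo (f (k + 1))" using f(2)[OF k] f(2)[OF k1] mono[of "k - 1" k] k by auto
      moreover have "lo (f (k + 1)) < hi (f k)" using f(2)[OF k1] mono[of k m] km m by auto
      ultimately have "f k = f (k + 1)" using ov[OF f(1)[OF k] f(1)[OF k1]] lohi(1)[OF f(1)[OF k1]]
        by auto
      then show False using \<open>lo (f k) < lo (f (k + 1))\<close> by auto
    qed
    ultimately have "m = k" by auto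
    then show ?thesis using m by auto
  qed
  have bij: "bij_betw f {1..n} I"
  proof -
    have "inj_on f {1..n}"
    proof (rule inj_onI)
      fix x y assume "x \<in> {1..n}" "y \<in> {1..n}" "f x = f y"
      then have "s x = s y" using hi[of x] hi[of y] by auto
      then show "x = y" using mono'[of x y] mono'[of y x] \<open>x \<in> {1..n}\<close> \<open>y \<in> {1..n}\<close> by auto
    qed
    moreover have "f ` {1..n} \<subseteq> I" using f by auto
    moreover have "card (f ` {1..n}) = card I" using card_image[OF \<open>inj_on f {1..n}\<close>]
      by (simp add: n_def)
    ultimately show ?thesis using card_subset_eq[OF fin] by (auto simp: bij_betw_def)
  qed
  have loP: "lo i \<in> P" if "i \<in> I" for i using that by (auto simp: P_def)
  have P0: "0 \<in> P" "1 \<in> P" using i0 by (force simp: P_def)+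
  interpret T: diagonal_family I t b l r by (rule transposed)
  interpret Q: diagonal_family I "\<lambda>i. 1 - r i" "\<lambda>i. 1 - l i" "\<lambda>i. 1 - b i" "\<lambda>i. 1 - t i"
    by (rule rotated)
  interpret TQ: diagonal_family I "\<lambda>i. 1 - b i" "\<lambda>i. 1 - t i" "\<lambda>i. 1 - r i" "\<lambda>i. 1 - l i"
    by (rule Q.transposed)
  have minmax: "max (1 - x) (1 - y) = 1 - min x y" "min (1 - x) (1 - y) = 1 - max x y"
    for x y :: real by auto
  have inP: "l i \<in> P \<and> t i \<in> P \<and> r i \<in> P \<and> b i \<in> P" if i: "i \<in> I" for i
  proof (intro conjI)
    show "l i \<in> P" using side_cases[OF i] P0 hiP loP[OF i] unfolding hi_def lo_def by metis
    show "t i \<in> P" using T.side_cases[OF i] P0 hiP loP[OF i] unfolding hi_def lo_def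
      by (metis max.commute min.commute)
    have "r i = 1 \<or> r i = min (r i) (b i) \<or> (\<exists>j\<in>I. r i = max (l j) (t j))"
      using Q.side_cases[OF i] unfolding minmax by auto
    then show "r i \<in> P" using P0 hiP[OF i] loP unfolding hi_def lo_def by metis
    have "b i = 1 \<or> b i = min (b i) (r i) \<or> (\<exists>j\<in>I. b i = max (t j) (l j))"
      using TQ.side_cases[OF i] unfolding minmax by auto
    then show "b i \<in> P" using P0 hiP[OF i] loP unfolding hi_def lo_def
      by (metis max.commute min.commute)
  qed
  define ix where "ix p = (SOME k. k \<le> n \<and> s k = p)" for p
  have ix: "ix p \<le> n" "s (ix p) = p" if "p \<in> P" for p
    using someI_ex[of "\<lambda>k. k \<le> n \<and> s k = p"] sP[OF that] by (auto simp: ix_def)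
  define lf where "lf k = ix (l (f k))" for k
  define rt where "rt k = ix (r (f k))" for k
  define tp where "tp k = ix (t (f k))" for k
  define bt where "bt k = ix (b (f k))" for k
  have co: "l (f i) = s (lf i) \<and> r (f i) = s (rt i) \<and> t (f i) = s (tp i) \<and> b (f i) = s (bt i)"
    and bd: "lf i \<le> n \<and> rt i \<le> n \<and> tp i \<le> n \<and> bt i \<le> n" if "i \<in> {1..n}" for i
    using inP[OF f(1)[OF that]] ix by (auto simp: lf_def rt_def tp_def bt_def)
  have le': "s i \<le> s j \<longleftrightarrow> i \<le> j" if "i \<le> n" "j \<le> n" for i j
    using mono'[of j i] that by auto
  have dg: "lf i < i \<and> i \<le> rt i \<and> tp i < i \<and> i \<le> bt i" if i: "i \<in> {1..n}" for i
  proof -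
    have "s (lf i) \<le> s (i - 1)" "s (tp i) \<le> s (i - 1)" "s i \<le> s (rt i)" "s i \<le> s (bt i)"
      using f(2)[OF i] hi[OF i] co[OF i] unfolding lo_def hi_def by linarith+
    then show ?thesis using le' bd[OF i] i by auto
  qed
  \<comment> \<open>A grid cell is tested at its midpoint, whose coordinates are those of no
    side.\<close>
  have mid: "s (u - 1) < (s (u - 1) + s u) / 2" "(s (u - 1) + s u) / 2 < s u"
    "(s (u - 1) + s u) / 2 \<le> s k \<longleftrightarrow> u \<le> k" "s k \<le> (s (u - 1) + s u) / 2 \<longleftrightarrow> k < u"
    "0 \<le> (s (u - 1) + s u) / 2" "(s (u - 1) + s u) / 2 \<le> 1" if u: "u \<in> {1..n}" and k: "k \<le> n"
      for u k
  proof -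
    have a: "s (u - 1) < s u" "0 \<le> s (u - 1)" "s u \<le> 1"
      using mono[of "u - 1" u] u le'[of 0 "u - 1"] le'[of u n] s0 s1 by auto
    then show "s (u - 1) < (s (u - 1) + s u) / 2" "(s (u - 1) + s u) / 2 < s u" 
      "0 \<le> (s (u - 1) + s u) / 2" "(s (u - 1) + s u) / 2 \<le> 1" by auto
    have "u \<le> k \<Longrightarrow> s u \<le> s k" "k < u \<Longrightarrow> s k \<le> s (u - 1)" using le'[of u k] le'[of k "u - 1"] u k
      by auto
    then show "(s (u - 1) + s u) / 2 \<le> s k \<longleftrightarrow> u \<le> k" "s k \<le> (s (u - 1) + s u) / 2 \<longleftrightarrow> k < u"
      using a by (cases "k < u"; auto)+
  qed
  have "diagonal_grid n lf rt tp bt"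
  proof
    show "0 < n" by fact
    fix i assume i: "i \<in> {1..n}"
    show "lf i < i \<and> i \<le> rt i \<and> tp i < i \<and> i \<le> bt i" "rt i \<le> n \<and> bt i \<le> n" using dg bd i by auto
  next
    fix u v assume uv: "u \<in> {1..n}" "v \<in> {1..n}"
    note m = mid[OF uv(1)] mid[OF uv(2)]
    obtain i where "i \<in> I" "l i \<le> (s (u - 1) + s u) / 2" "(s (u - 1) + s u) / 2 \<le> r i"
       "t i \<le> (s (v - 1) + s v) / 2" "(s (v - 1) + s v) / 2 \<le> b i"
      using cover[of "(s (u - 1) + s u) / 2" "(s (v - 1) + s v) / 2"] m(5,6,11,12)[of 0] by auto
    moreover obtain k where k: "k \<in> {1..n}" "i = f k" using bij \<open>i \<in> I\<close> by (auto simp: bij_betw_def)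
    ultimately have "lf k < u \<and> u \<le> rt k \<and> tp k < v \<and> v \<le> bt k"
      using m(3,4,9,10) co[OF k(1)] bd[OF k(1)] by auto
    then show "\<exists>i\<in>{1..n}. lf i < u \<and> u \<le> rt i \<and> tp i < v \<and> v \<le> bt i" using k by auto
  next
    fix i j u v
    assume ij: "i \<in> {1..n}" "j \<in> {1..n}" and c: "lf i < u" "u \<le> rt i" "tp i < v" "v \<le> bt i"
       "lf j < u" "u \<le> rt j" "tp j < v" "v \<le> bt j"
    have "f i = f j"
    proof (rule disj[OF f(1)[OF ij(1)] f(1)[OF ij(2)]])
      have lt: "lf i < rt j" "lf j < rt i" "tp i < bt j" "tp j < bt i"
        using c by (blast intro: less_le_trans)+
      have le: "rt j \<le> n" "rt i \<le> n" "bt j \<le> n" "bt i \<le> n" using bd ij by blast+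
      note m = mono[OF lt(1) le(1)] mono[OF lt(2) le(2)] mono[OF lt(3) le(3)] mono[OF lt(4) le(4)]
      show "l (f i) < r (f j)" "l (f j) < r (f i)" "t (f i) < b (f j)" "t (f j) < b (f i)"
        using m co[OF ij(1)] co[OF ij(2)] by metis+
    qed
    then show "i = j" using bij_betw_imp_inj_on[OF bij] ij by (meson inj_onD)
  qed
  then show thesis using that[of n lf rt tp bt s f] s0 s1 mono bij co by blast
qed

lemma diagonal_represents:
  assumes R: "tiling R" and d: "\<And>K. K \<in> R \<Longrightarrow> interior K \<inter> main_diagonal \<noteq> {}"
  obtains n lf rt tp bt s where "represents R n lf rt tp bt s"
proof -
  interpret diagonal_family R lc rc tc bc
  proof (unfold_locales, goal_cases)
    case 1 show ?case using R by (rule tiling_finite)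
  next
    case (2 i) then show ?case using tiling_rect[OF R] by auto
  next
    case (3 x w) then show ?case using tiling_cover[OF R] by metis
  next
    case (4 i j) then show ?case using tiling_disjoint[OF R] by blast
  next
    case (5 K)
    obtain x y where "(x, y) \<in> interior K" "(x, y) \<in> main_diagonal" using d[OF 5] by fastforce
    then show ?case using tiling_rect(1)[OF R 5]
      by (auto simp: mem_main_diagonal mem_interior_is_rect)
  qed
  obtain n f s lf rt tp bt where g: "diagonal_grid n lf rt tp bt" "s 0 = 0" "s n = 1"
    "\<And>i j. i < j \<Longrightarrow> j \<le> n \<Longrightarrow> s i < s j" "bij_betw f {1..n} R"
    "\<And>i. i \<in> {1..n} \<Longrightarrow> lc (f i) = s (lf i) \<and> rc (f i) = s (rt i) \<and> tc (f i) = s (tp i) \<and> bc (f i) =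
      s (bt i)"
    by (rule enumeration) blast
  have "R = f ` {1..n}" using g(5) by (auto simp: bij_betw_def)
  also have "\<dots> = (\<lambda>i. rect (s (lf i)) (s (rt i)) (s (tp i)) (s (bt i))) ` {1..n}"
  proof (rule image_cong[OF refl])
    fix i assume i: "i \<in> {1..n}"
    then have "f i \<in> R" using g(5) by (auto simp: bij_betw_def)
    then show "f i = rect (s (lf i)) (s (rt i)) (s (tp i)) (s (bt i))"
      using rect_coords[OF tiling_rect(1)[OF R]] g(6)[OF i] by metis
  qed
  finally show thesis using that g(1-4) unfolding represents_def by blast
qed

section \<open>Drawings of a grid with freely placed walls\<close>

context diagonal_grid begin

definition draw :: "(nat \<Rightarrow> real) \<Rightarrow> (nat \<Rightarrow> real) \<Rightarrow> nat \<Rightarrow> point set" where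
  "draw X Y i = rect (X (lf i)) (X (rt i)) (Y (tp i)) (Y (bt i))"

text \<open>Write both differences as sums over unit columns and rows. Each cell (u, v) belongs to
  exactly one tile, so summing over the tiles leaves a product of two telescoping sums. Nothing
  relates \<open>F\<close> and \<open>G\<close> to the order of the indices.\<close>

lemma double_telescope:
  fixes F G :: "nat \<Rightarrow> int"
  shows "(\<Sum>i\<in>{1..n}. (F (rt i) - F (lf i)) * (G (bt i) - G (tp i))) = (F n - F 0) * (G n - G 0)"
proof -
  define c where "c i u v = (of_bool (lf i < u \<and> u \<le> rt i) * of_bool (tp i < v \<and> v \<le> bt i) :: int)"
    for i u v
  have tel: "F b - F a = (\<Sum>u\<in>{1..n}. (F u - F (u - 1)) * of_bool (a < u \<and> u \<le> b))"
    if "a \<le> b" "b \<le> n" for F :: "nat \<Rightarrow> int" and a b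
  proof -
    have "F b - F a = (\<Sum>u\<in>{Suc a..b}. F u - F (u - 1))" using sum_telescope''[OF that(1), of F]
      by simp
    also have "\<dots> = (\<Sum>u\<in>{1..n}. if u \<in> {Suc a..b} then F u - F (u - 1) else 0)"
      using that by (intro sum.mono_neutral_cong_left) auto
    also have "\<dots> = (\<Sum>u\<in>{1..n}. (F u - F (u - 1)) * of_bool (a < u \<and> u \<le> b))"
      by (intro sum.cong) auto
    finally show ?thesis .
  qed
  have one: "(\<Sum>i\<in>{1..n}. c i u v) = 1" if uv: "u \<in> {1..n}" "v \<in> {1..n}" for u v
  proof -
    obtain k where k: "k \<in> {1..n}" "lf k < u \<and> u \<le> rt k \<and> tp k < v \<and> v \<le> bt k" using cover[OF uv]
      by blast
    have "c i u v = (if i = k then 1 else 0)" if "i \<in> {1..n}" for i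
    proof (cases "i = k")
      case True
      then show ?thesis using k(2) by (simp add: c_def)
    next
      case False
      then have "\<not> (lf i < u \<and> u \<le> rt i \<and> tp i < v \<and> v \<le> bt i)" using disj[OF that k(1)] k(2)
        by blast
      then show ?thesis using False by (auto simp: c_def)
    qed
    then have "(\<Sum>i\<in>{1..n}. c i u v) = (\<Sum>i\<in>{1..n}. if i = k then 1 else 0)" by (intro sum.cong) auto
    then show ?thesis using k(1) by simp
  qed
  have "(\<Sum>i\<in>{1..n}. (F (rt i) - F (lf i)) * (G (bt i) - G (tp i)))
     = (\<Sum>i\<in>{1..n}. \<Sum>u\<in>{1..n}. \<Sum>v\<in>{1..n}. (F u - F (u - 1)) * (G v - G (v - 1)) * c i u v)"
  proof (rule sum.cong[OF refl])
    fix i assume i: "i \<in> {1..n}"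
    have "F (rt i) - F (lf i) = (\<Sum>u\<in>{1..n}. (F u - F (u - 1)) * of_bool (lf i < u \<and> u \<le> rt i))"
      using diag[OF i] bounds[OF i] by (intro tel) auto
    moreover have "G (bt i) - G (tp i) = (\<Sum>u\<in>{1..n}. (G u - G (u - 1)) * of_bool (tp i < u \<and>
      u \<le> bt i))"
      using diag[OF i] bounds[OF i] by (intro tel) auto
    ultimately show "(F (rt i) - F (lf i)) * (G (bt i) - G (tp i)) = (\<Sum>u\<in>{1..n}. \<Sum>v\<in>{1..n}.
      (F u - F (u - 1)) * (G v - G (v - 1)) * c i u v)"
      unfolding c_def by (simp only: sum_product) (intro sum.cong; simp)
  qed
  also have "\<dots> = (\<Sum>u\<in>{1..n}. \<Sum>i\<in>{1..n}. \<Sum>v\<in>{1..n}. (F u - F (u - 1)) * (G v - G (v - 1)) * c i u v)"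
    by (rule sum.swap)
  also have "\<dots> = (\<Sum>u\<in>{1..n}. \<Sum>v\<in>{1..n}. \<Sum>i\<in>{1..n}. (F u - F (u - 1)) * (G v - G (v - 1)) * c i u v)"
    by (intro sum.cong refl sum.swap)
  also have "\<dots> = (\<Sum>u\<in>{1..n}. \<Sum>v\<in>{1..n}. (F u - F (u - 1)) * (G v - G (v - 1)))"
    using one by (intro sum.cong refl) (simp add: sum_distrib_left[symmetric])
  also have "\<dots> = (\<Sum>u\<in>{1..n}. F u - F (u - 1)) * (\<Sum>v\<in>{1..n}. G v - G (v - 1))"
    by (simp only: sum_product)
  also have "\<dots> = (F n - F 0) * (G n - G 0)"
    using sum_telescope''[of 0 n F] sum_telescope''[of 0 n G] by simp
  finally show ?thesis .
qed

text \<open>Positions need not increase with the index; what counts is the positive extent of every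
  tile. Injectivity on the indices of walls keeps different walls off a common line, which prevents
  accidental contacts and vertices of degree four.\<close>

definition drawing :: "(nat \<Rightarrow> real) \<Rightarrow> (nat \<Rightarrow> real) \<Rightarrow> bool" where
  "drawing X Y \<longleftrightarrow> X 0 = 0 \<and> X n = 1 \<and> Y 0 = 0 \<and> Y n = 1 \<and>
     (\<forall>i\<in>{1..n}. X (lf i) < X (rt i) \<and> Y (tp i) < Y (bt i)) \<and>
     inj_on X ({0, n} \<union> {k. vert k}) \<and> inj_on Y ({0, n} \<union> {k. horiz k})"

text \<open>In \<open>double_telescope\<close> let \<open>F k\<close> be the indicator of
  \<open>x < X k\<close>, and \<open>G k\<close> that of \<open>w < Y k\<close>. As all extents are
  positive, the term of tile \<open>i\<close> is the indicator of the half-open tile, so the sum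
  counts the tiles around the point.\<close>

lemma card_containing:
  assumes d: "drawing X Y"
  shows "card {i \<in> {1..n}. X (lf i) \<le> x \<and> x < X (rt i) \<and> Y (tp i) \<le> w \<and> w < Y (bt i)} =
    (if 0 \<le> x \<and> x < 1 \<and> 0 \<le> w \<and> w < 1 then 1 else 0)" (is "card {i \<in> _. ?P i} = _")
proof -
  have "int (card {i \<in> {1..n}. ?P i}) = (\<Sum>i\<in>{1..n}. if ?P i then 1 else 0)"
    by (simp only: sum.inter_filter[symmetric] finite_atLeastAtMost) simp
  also have "\<dots> = (\<Sum>i\<in>{1..n}. (of_bool (x < X (rt i)) - of_bool (x < X (lf i))) * (of_bool (w < Y (bt
    i)) - of_bool (w < Y (tp i))))"
  proof (rule sum.cong[OF refl])
    fix i assume i: "i \<in> {1..n}"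
    then have "X (lf i) < X (rt i)" "Y (tp i) < Y (bt i)" using d by (simp_all add: drawing_def)
    then have "of_bool (x < X (rt i)) - of_bool (x < X (lf i)) = (of_bool (X (lf i) \<le> x \<and>
      x < X (rt i)) :: int)"
      "of_bool (w < Y (bt i)) - of_bool (w < Y (tp i)) = (of_bool (Y (tp i) \<le> w \<and>
        w < Y (bt i)) :: int)"
      by (simp_all add: of_bool_def)
    then show "(if ?P i then 1 else 0) = (of_bool (x < X (rt i)) - of_bool (x < X (lf i))) *
      (of_bool (w < Y (bt i)) - of_bool (w < Y (tp i)) :: int)"
      by simp
  qed
  also have "\<dots> = (of_bool (x < X n) - of_bool (x < X 0)) * (of_bool (w < Y n) - of_bool (w < Y 0))"
    by (rule double_telescope)
  also have "\<dots> = (if 0 \<le> x \<and> x < 1 \<and> 0 \<le> w \<and> w < 1 then 1 else 0)"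
    using d unfolding drawing_def by auto
  finally show ?thesis by (auto split: if_splits)
qed

lemma containing:
  assumes d: "drawing X Y" and x: "0 \<le> x" "x < 1" "0 \<le> w" "w < 1"
  shows "\<exists>!i. i \<in> {1..n} \<and> X (lf i) \<le> x \<and> x < X (rt i) \<and> Y (tp i) \<le> w \<and> w < Y (bt i)"
proof -
  have "card {i \<in> {1..n}. X (lf i) \<le> x \<and> x < X (rt i) \<and> Y (tp i) \<le> w \<and> w < Y (bt i)} = 1"
    using card_containing[OF d, of x w] x by simp
  then obtain a where "{i \<in> {1..n}. X (lf i) \<le> x \<and> x < X (rt i) \<and> Y (tp i) \<le> w \<and> w < Y (bt i)} =
    {a}"
    by (rule card_1_singletonE)
  then have "i \<in> {1..n} \<and> X (lf i) \<le> x \<and> x < X (rt i) \<and> Y (tp i) \<le> w \<and> w < Y (bt i) \<longleftrightarrow> i = a" for i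
    by (simp add: set_eq_iff)
  then show ?thesis by (intro ex1I[of _ a]) blast+
qed

text \<open>A tile that left the square would contain a point which, by
  \<open>card_containing\<close>, lies in no tile.\<close>

lemma drawing_bounds:
  assumes d: "drawing X Y" and i: "i \<in> {1..n}"
  shows "0 \<le> X (lf i)" "X (rt i) \<le> 1" "0 \<le> Y (tp i)" "Y (bt i) \<le> 1"
proof -
  have lt: "X (lf i) < X (rt i)" "Y (tp i) < Y (bt i)" using d i by (auto simp: drawing_def)
  have in01: "0 \<le> x \<and> x < 1 \<and> 0 \<le> w \<and> w < 1"
    if "X (lf i) \<le> x" "x < X (rt i)" "Y (tp i) \<le> w" "w < Y (bt i)" for x w
  proof (rule ccontr)
    assume "\<not> ?thesis"
    then have "card {i \<in> {1..n}. X (lf i) \<le> x \<and> x < X (rt i) \<and> Y (tp i) \<le> w \<and> w < Y (bt i)} = 0"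
      using card_containing[OF d, of x w] by auto
    then show False using i that by auto
  qed
  show "0 \<le> X (lf i)" "0 \<le> Y (tp i)" using in01[of "X (lf i)" "Y (tp i)"] lt by auto
  show "X (rt i) \<le> 1"
  proof (rule ccontr)
    assume "\<not> ?thesis"
    then show False using in01[of "max 1 (X (lf i))" "Y (tp i)"] lt by auto
  qed
  show "Y (bt i) \<le> 1"
  proof (rule ccontr)
    assume "\<not> ?thesis"
    then show False using in01[of "X (lf i)" "max 1 (Y (tp i))"] lt by auto
  qed
qed

end

lemma gap_left:
  fixes E :: "real set"
  assumes "finite E" "lo < a"
  obtains z where "lo < z" "z < a" "\<And>e. e \<in> E \<Longrightarrow> z \<le> e \<Longrightarrow> a \<le> e"
proof -
  define D where "D = insert lo {e \<in> E. e < a}"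
  have D: "finite D" "D \<noteq> {}" using assms by (auto simp: D_def)
  have "Max D < a" using Max_in[OF D] assms by (auto simp: D_def)
  then obtain z where z: "Max D < z" "z < a" using dense by blast
  have "lo < z" using z Max_ge[OF D(1), of lo] by (auto simp: D_def)
  moreover have "a \<le> e" if "e \<in> E" "z \<le> e" for e
    using z Max_ge[OF D(1), of e] that by (auto simp: D_def) force
  ultimately show thesis using that z by blast
qed

lemma gap_right:
  fixes E :: "real set"
  assumes "finite E" "a < hi"
  obtains z where "a < z" "z < hi" "\<And>e. e \<in> E \<Longrightarrow> e \<le> z \<Longrightarrow> e \<le> a"
proof -
  obtain z where z: "- hi < z" "z < - a" "\<And>e. e \<in> uminus ` E \<Longrightarrow> z \<le> e \<Longrightarrow> - a \<le> e"
    using gap_left[of "uminus ` E" "- hi" "- a"] assms by auto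
  show thesis by (rule that[of "- z"]) (use z in force)+
qed

lemma (in diagonal_grid) draw_tiling:
  assumes d: "drawing X Y"
  shows "tiling (draw X Y ` {1..n})" "inj_on (draw X Y) {1..n}"
proof -
  have A: "finite {1..n}" by simp
  have B: "0 \<le> X (lf i) \<and> X (lf i) < X (rt i) \<and> X (rt i) \<le> 1 \<and> 0 \<le> Y (tp i) \<and> Y (tp i) < Y (bt i) \<and>
    Y (bt i) \<le> 1"
    if "i \<in> {1..n}" for i using drawing_bounds[OF d that] d that by (auto simp: drawing_def)
  have C: "\<exists>i\<in>{1..n}. X (lf i) \<le> x \<and> x \<le> X (rt i) \<and> Y (tp i) \<le> w \<and> w \<le> Y (bt i)"
    if x: "0 \<le> x" "x \<le> 1" "0 \<le> w" "w \<le> 1" for x w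
  proof -
    \<comment> \<open>A point with a coordinate 1 lies in no half-open tile. It is replaced by a
      nearby point with no side position in between; the closed tile around the new point also
      contains the old one.\<close>
    have ap: "\<exists>z. 0 \<le> z \<and> z < 1 \<and> (\<forall>e\<in>E. (z < e \<longrightarrow> x \<le> e) \<and> (e \<le> z \<longrightarrow> e \<le> x))"
      if E: "finite E" "0 \<le> x" "x \<le> 1" for E and x :: real
    proof (cases "x < 1")
      case True
      then show ?thesis using E by (intro exI[of _ x]) auto
    next
      case False
      obtain z where "0 < z" "z < 1" "\<And>e. e \<in> E \<Longrightarrow> z \<le> e \<Longrightarrow> 1 \<le> e" using gap_left[of E 0 1] E by auto
      then show ?thesis using E False by (intro exI[of _ z]) force
    qed
    have fin: "finite (X ` lf ` {1..n} \<union> X ` rt ` {1..n})"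
      "finite (Y ` tp ` {1..n} \<union> Y ` bt ` {1..n})" by auto
    obtain x' where x': "0 \<le> x'" "x' < 1"
      "\<And>e. e \<in> X ` lf ` {1..n} \<union> X ` rt ` {1..n} \<Longrightarrow> (x' < e \<longrightarrow> x \<le> e) \<and> (e \<le> x' \<longrightarrow> e \<le> x)"
      using ap[OF fin(1) x(1,2)] by auto
    obtain w' where w': "0 \<le> w'" "w' < 1"
      "\<And>e. e \<in> Y ` tp ` {1..n} \<union> Y ` bt ` {1..n} \<Longrightarrow> (w' < e \<longrightarrow> w \<le> e) \<and> (e \<le> w' \<longrightarrow> e \<le> w)"
      using ap[OF fin(2) x(3,4)] by auto
    obtain i where "i \<in> {1..n}" "X (lf i) \<le> x' \<and> x' < X (rt i) \<and> Y (tp i) \<le> w' \<and> w' < Y (bt i)"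
      using containing[OF d x'(1,2) w'(1,2)] by blast
    then show ?thesis using x'(3) w'(3) by (intro bexI[of _ i]) auto
  qed
  have D: "i = j" if ij: "i \<in> {1..n}" "j \<in> {1..n}"
    and "X (lf i) < x" "x < X (rt i)" "Y (tp i) < w" "w < Y (bt i)"
     "X (lf j) < x" "x < X (rt j)" "Y (tp j) < w" "w < Y (bt j)" for i j x w
  proof -
    have "0 \<le> x" "x < 1" "0 \<le> w" "w < 1" using B[OF ij(1)] that by auto
    then show ?thesis using containing[OF d, of x w] that by (metis less_imp_le)
  qed
  show "tiling (draw X Y ` {1..n})" unfolding draw_def
    by (rule tilingI(1)) (use A B C D in blast)+
  show "inj_on (draw X Y) {1..n}" unfolding draw_def
    by (rule tilingI(2)) (use A B C D in blast)+
qed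

section \<open>Edges at a vertex and the degree condition\<close>

lemma skeletonI:
  assumes "tiling R" "K \<in> R" "lc K \<le> x" "x \<le> rc K" "tc K \<le> 1 - y" "1 - y \<le> bc K"
    "x = lc K \<or> x = rc K \<or> 1 - y = tc K \<or> 1 - y = bc K"
  shows "(x, y) \<in> skeleton R"
  using assms mem_skeleton by blast

text \<open>An oblique segment has infinitely many points but meets each of the finitely many lines
  that carry sides at most once.\<close>

lemma segment_in_skeleton_axis_parallel:
  assumes R: "tiling R" and s: "closed_segment p q \<subseteq> skeleton R"
  shows "fst p = fst q \<or> snd p = snd q"
proof (rule ccontr)
  assume n: "\<not> ?thesis"
  define f where "f u = (1 - u) * fst p + u * fst q" for u
  define g where "g u = (1 - u) * snd p + u * snd q" for u
  have fg: "inj f" "inj g"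
  proof -
    have "(u - v) * (fst q - fst p) = 0" if "f u = f v" for u v using that
      by (simp add: f_def algebra_simps)
    then show "inj f" using n by (auto simp: inj_def)
    have "(u - v) * (snd q - snd p) = 0" if "g u = g v" for u v using that
      by (simp add: g_def algebra_simps)
    then show "inj g" using n by (auto simp: inj_def)
  qed
  define A where "A = (\<Union>K\<in>R. {lc K, rc K})"
  define B where "B = (\<Union>K\<in>R. {1 - tc K, 1 - bc K})"
  have AB: "finite A" "finite B" using tiling_finite[OF R] by (auto simp: A_def B_def)
  have "{0..1} \<subseteq> f -` A \<union> g -` B"
  proof
    fix u :: real assume u: "u \<in> {0..1}"
    have "(f u, g u) = (1 - u) *\<^sub>R p + u *\<^sub>R q" by (simp add: f_def g_def prod_eq_iff)
    then have "(f u, g u) \<in> closed_segment p q" using u by (auto simp: closed_segment_def)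
    then have "(f u, g u) \<in> skeleton R" using s by blast
    then obtain K where K: "K \<in> R" "f u = lc K \<or> f u = rc K \<or> 1 - g u = tc K \<or> 1 - g u = bc K"
      using mem_skeleton[OF R] by blast
    have "f u = lc K \<or> f u = rc K \<or> g u = 1 - tc K \<or> g u = 1 - bc K" using K(2) by linarith
    then have "f u \<in> A \<or> g u \<in> B" using K(1) unfolding A_def B_def by blast
    then show "u \<in> f -` A \<union> g -` B" by blast
  qed
  moreover have "finite (f -` A \<union> g -` B)" using AB fg by (simp add: finite_vimageI)
  ultimately have "finite {0..1::real}" by (rule finite_subset)
  then show False using infinite_Icc[of 0 "1::real"] by simp
qed

lemma next_vertex:
  assumes R: "tiling R" and v: "v \<in> vertices R" and w: "w \<in> vertices R" "v \<noteq> w"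
    and s: "closed_segment v w \<subseteq> skeleton R"
  obtains r where "edge R v r" "r \<in> closed_segment v w"
proof -
  define S where "S = closed_segment v w \<inter> vertices R - {v}"
  have S: "finite S" "S \<noteq> {}" using finite_vertices[OF R] w by (auto simp: S_def)
  then obtain r where r: "r \<in> S" "\<And>z. z \<in> S \<Longrightarrow> dist v r \<le> dist v z"
    using ex_min_if_finite[of "dist v ` S"]
      by (metis (mono_tags, lifting) arg_min_if_finite(1) arg_min_least)
  have rs: "closed_segment v r \<subseteq> closed_segment v w"
    using r(1) by (simp add: S_def subset_closed_segment)
  have "open_segment v r \<inter> vertices R = {}"
  proof (rule ccontr)
    assume "\<not> ?thesis"
    then obtain z where z: "z \<in> open_segment v r" "z \<in> vertices R" by blast
    have "z \<in> S" using z rs unfolding S_def by (auto simp: open_segment_def)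
    moreover have "dist v z < dist v r" using dist_in_open_segment[OF z(1)]
      by (simp add: dist_commute)
    ultimately show False using r(2)[of z] by simp
  qed
  then have "edge R v r" using r(1) rs s v by (auto simp: edge_def S_def)
  then show thesis using that r(1) by (auto simp: S_def)
qed

lemma edge_unique:
  assumes "edge R v p" "edge R v q" "p \<in> closed_segment v q"
  shows "p = q"
  using assms unfolding edge_def open_segment_def by blast

definition ray_edges :: "point set set \<Rightarrow> point \<Rightarrow> point \<Rightarrow> point set" where
  "ray_edges R v d = {r. edge R v r \<and> (\<exists>a>0. r = v + a *\<^sub>R d)}"

lemma ray_segment:
  fixes v d :: point
  assumes "0 \<le> a" "a \<le> b" 
  shows "v + a *\<^sub>R d \<in> closed_segment v (v + b *\<^sub>R d)"
proof (cases "b = 0")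
  case True then show ?thesis using assms by auto
next
  case False
  then have "v + a *\<^sub>R d = (1 - a / b) *\<^sub>R v + (a / b) *\<^sub>R (v + b *\<^sub>R d)"
    by (simp add: algebra_simps)
  then show ?thesis using assms False unfolding closed_segment_def
    by (auto intro!: exI[of _ "a / b"])
qed

lemma card_ray_edges:
  assumes R: "tiling R" and v: "v \<in> vertices R"
  shows "v + a *\<^sub>R d \<in> vertices R \<Longrightarrow> 0 < a \<Longrightarrow> d \<noteq> 0 \<Longrightarrow> closed_segment v (v + a *\<^sub>R d) \<subseteq> skeleton R \<Longrightarrow>
    card (ray_edges R v d) = 1 \<and> finite (ray_edges R v d)"
    and "(\<And>a. 0 < a \<Longrightarrow> \<exists>z. z \<in> closed_segment v (v + a *\<^sub>R d) \<and> z \<notin> skeleton R) \<Longrightarrow> ray_edges R v d =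
      {}"
proof -
  assume w: "v + a *\<^sub>R d \<in> vertices R" "0 < a" "d \<noteq> 0"
    and s: "closed_segment v (v + a *\<^sub>R d) \<subseteq> skeleton R"
  obtain r where r: "edge R v r" "r \<in> closed_segment v (v + a *\<^sub>R d)"
    using next_vertex[OF R v w(1) _ s] w by auto
  obtain u where u: "0 \<le> u" "r = (1 - u) *\<^sub>R v + u *\<^sub>R (v + a *\<^sub>R d)"
    using r(2) by (auto simp: closed_segment_def)
  have "r = v + (u * a) *\<^sub>R d" using u by (simp add: algebra_simps)
  moreover have "r \<noteq> v" using r(1) by (auto simp: edge_def)
  ultimately have "r \<in> ray_edges R v d" using r(1) u w
    unfolding ray_edges_def by (intro CollectI conjI exI[of _ "u * a"]) (auto simp: less_le)
  moreover have "p = q" if pq: "p \<in> ray_edges R v d" "q \<in> ray_edges R v d" for p q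
  proof -
    obtain x y where xy: "0 < x" "p = v + x *\<^sub>R d" "0 < y" "q = v + y *\<^sub>R d" "edge R v p"
      "edge R v q"
      using pq unfolding ray_edges_def by blast
    show ?thesis
    proof (cases "x \<le> y")
      case True
      then show ?thesis using edge_unique[OF xy(5,6)] ray_segment[of x y v d] xy by auto
    next
      case False
      then show ?thesis using edge_unique[OF xy(6,5)] ray_segment[of y x v d] xy by auto
    qed
  qed
  ultimately have "ray_edges R v d = {r}" by blast
  then show "card (ray_edges R v d) = 1 \<and> finite (ray_edges R v d)" by simp
next
  assume n: "\<And>a. 0 < a \<Longrightarrow> \<exists>z. z \<in> closed_segment v (v + a *\<^sub>R d) \<and> z \<notin> skeleton R"
  show "ray_edges R v d = {}"
  proof (rule ccontr)
    assume "ray_edges R v d \<noteq> {}"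
    then obtain r a where "edge R v r" "0 < a" "r = v + a *\<^sub>R d" by (auto simp: ray_edges_def)
    then show False using n[of a] by (auto simp: edge_def)
  qed
qed

lemma edges_as_rays:
  assumes "tiling R"
  shows "{w. edge R v w} = ray_edges R v (1, 0) \<union> ray_edges R v (-1, 0) \<union> ray_edges R v (0, 1) \<union>
    ray_edges R v (0, -1)"
    (is "_ = ?S")
proof (intro set_eqI iffI)
  fix w assume "w \<in> {w. edge R v w}"
  then have e: "edge R v w" by simp
  obtain a b c d where vw: "v = (a, b)" "w = (c, d)" by (metis surj_pair)
  have "a = c \<or> b = d" using segment_in_skeleton_axis_parallel[OF assms, of v w] e vw
    by (auto simp: edge_def)
  moreover have "v \<noteq> w" using e by (auto simp: edge_def)
  ultimately consider "a = c" "b < d" | "a = c" "d < b" | "b = d" "a < c" | "b = d" "c < a" using vw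
    by force
  then show "w \<in> ?S"
  proof cases
    case 1 then show ?thesis using e vw by (auto simp: ray_edges_def intro!: exI[of _ "d - b"])
  next
    case 2 then show ?thesis using e vw by (auto simp: ray_edges_def intro!: exI[of _ "b - d"])
  next
    case 3 then show ?thesis using e vw by (auto simp: ray_edges_def intro!: exI[of _ "c - a"])
  next
    case 4 then show ?thesis using e vw by (auto simp: ray_edges_def intro!: exI[of _ "a - c"])
  qed
qed (auto simp: ray_edges_def)

lemma card_edges_as_rays:
  assumes R: "tiling R" and fin: "\<And>d. d \<in> {(1, 0), (-1, 0), (0, 1), (0, -1)} \<Longrightarrow>
    finite (ray_edges R v d)"
  shows "card {w. edge R v w} = card (ray_edges R v (1, 0)) + card (ray_edges R v (-1, 0)) +
    card (ray_edges R v (0, 1)) + card (ray_edges R v (0, -1))"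
proof -
  have "ray_edges R v (1, 0) \<inter> ray_edges R v (-1, 0) = {}"
    "(ray_edges R v (1, 0) \<union> ray_edges R v (-1, 0)) \<inter> ray_edges R v (0, 1) = {}"
    "(ray_edges R v (1, 0) \<union> ray_edges R v (-1, 0) \<union> ray_edges R v (0, 1)) \<inter> ray_edges R v (0, -1) =
      {}"
    by (cases v; auto simp: ray_edges_def)+
  then show ?thesis unfolding edges_as_rays[OF R] using fin by (simp add: card_Un_disjoint)
qed

text \<open>\<open>K1\<close> to \<open>K4\<close> are the tiles to the upper right, upper left,
  lower left and lower right of the point. They are found at nearby points that no side separates
  from it.\<close>

lemma quadrants:
  assumes R: "tiling R" and a: "0 < a" "a < 1" "0 < c" "c < 1"
  obtains K1 K2 K3 K4 where
    "K1 \<in> R" "lc K1 \<le> a" "a < rc K1" "tc K1 < c" "c \<le> bc K1"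
    "K2 \<in> R" "lc K2 < a" "a \<le> rc K2" "tc K2 < c" "c \<le> bc K2"
    "K3 \<in> R" "lc K3 < a" "a \<le> rc K3" "tc K3 \<le> c" "c < bc K3"
    "K4 \<in> R" "lc K4 \<le> a" "a < rc K4" "tc K4 \<le> c" "c < bc K4"
proof -
  define E where "E = lc ` R \<union> rc ` R \<union> tc ` R \<union> bc ` R"
  have E: "finite E" using tiling_finite[OF R] by (simp add: E_def)
  obtain a1 where a1: "0 < a1" "a1 < a" "\<And>e. e \<in> E \<Longrightarrow> a1 \<le> e \<Longrightarrow> a \<le> e" using gap_left[OF E a(1)]
    by blast
  obtain a2 where a2: "a < a2" "a2 < 1" "\<And>e. e \<in> E \<Longrightarrow> e \<le> a2 \<Longrightarrow> e \<le> a" using gap_right[OF E a(2)]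
    by blast
  obtain c1 where c1: "0 < c1" "c1 < c" "\<And>e. e \<in> E \<Longrightarrow> c1 \<le> e \<Longrightarrow> c \<le> e" using gap_left[OF E a(3)]
    by blast
  obtain c2 where c2: "c < c2" "c2 < 1" "\<And>e. e \<in> E \<Longrightarrow> e \<le> c2 \<Longrightarrow> e \<le> c" using gap_right[OF E a(4)]
    by blast
  have inE: "lc K \<in> E \<and> rc K \<in> E \<and> tc K \<in> E \<and> bc K \<in> E" if "K \<in> R" for K using that
    by (auto simp: E_def)
  obtain K1 where "K1 \<in> R" "lc K1 \<le> a2" "a2 \<le> rc K1" "tc K1 \<le> c1" "c1 \<le> bc K1"
    using tiling_cover[OF R, of a2 c1] a a2 c1 by auto
  moreover obtain K2 where "K2 \<in> R" "lc K2 \<le> a1" "a1 \<le> rc K2" "tc K2 \<le> c1" "c1 \<le> bc K2"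
    using tiling_cover[OF R, of a1 c1] a a1 c1 by auto
  moreover obtain K3 where "K3 \<in> R" "lc K3 \<le> a1" "a1 \<le> rc K3" "tc K3 \<le> c2" "c2 \<le> bc K3"
    using tiling_cover[OF R, of a1 c2] a a1 c2 by auto
  moreover obtain K4 where "K4 \<in> R" "lc K4 \<le> a2" "a2 \<le> rc K4" "tc K4 \<le> c2" "c2 \<le> bc K4"
    using tiling_cover[OF R, of a2 c2] a a2 c2 by auto
  ultimately show thesis using a1(2,3) a2(1,3) c1(2,3) c2(1,3) inE
    by (intro that[of K1 K2 K3 K4]) (meson le_less_trans less_le_trans not_le order_trans)+
qed

text \<open>The edges at an interior vertex correspond to the unequal neighbours in the cycle of the
  four tiles around it. If all four pairs were unequal, the upper right and the lower left tile
  would meet in the excluded corner. Fewer than three are impossible, because the vertex is the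
  corner of a tile and tiles are rectangles.\<close>

lemma rectangulationI:
  assumes R: "tiling R"
    and nc: "\<And>K L. K \<in> R \<Longrightarrow> L \<in> R \<Longrightarrow> lc K = rc L \<Longrightarrow> bc K = tc L \<Longrightarrow> False"
  shows "rectangulation R"
proof -
  have "card {w. edge R v w} = 3" if v: "v \<in> vertices R" "v \<in> interior unit_square" for v
  proof -
    obtain a y where vy: "v = (a, y)" by fastforce
    define c where "c = 1 - y"
    have ac: "0 < a" "a < 1" "0 < c" "c < 1" and vc: "v = (a, 1 - c)"
      using v(2) unfolding vy c_def by (auto simp: cbox_Pair_eq interior_Times)
    obtain K1 K2 K3 K4 where K:
      "K1 \<in> R" "lc K1 \<le> a" "a < rc K1" "tc K1 < c" "c \<le> bc K1"
      "K2 \<in> R" "lc K2 < a" "a \<le> rc K2" "tc K2 < c" "c \<le> bc K2"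
      "K3 \<in> R" "lc K3 < a" "a \<le> rc K3" "tc K3 \<le> c" "c < bc K3"
      "K4 \<in> R" "lc K4 \<le> a" "a < rc K4" "tc K4 \<le> c" "c < bc K4"
      using quadrants[OF R ac] by blast
    have d12: "lc K1 = a" "rc K2 = a" if "K1 \<noteq> K2"
      using tiling_disjoint[OF R K(1,6)] K(1-10) that by (smt (verit))+
    have d23: "bc K2 = c" "tc K3 = c" if "K2 \<noteq> K3"
      using tiling_disjoint[OF R K(6,11)] K(6-15) that by (smt (verit))+
    have d34: "rc K3 = a" "lc K4 = a" if "K3 \<noteq> K4"
      using tiling_disjoint[OF R K(11,16)] K(11-20) that by (smt (verit))+
    have d41: "tc K4 = c" "bc K1 = c" if "K4 \<noteq> K1"
      using tiling_disjoint[OF R K(16,1)] K(16-20) K(1-5) that by (smt (verit))+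
    note C1 = card_ray_edges(1)[OF R v(1)] and C2 = card_ray_edges(2)[OF R v(1)]
    have N: "card (ray_edges R v (0, 1)) = of_bool (K1 \<noteq> K2) \<and> finite (ray_edges R v (0, 1))"
    proof (cases "K1 = K2")
      case True
      have "ray_edges R v (0, 1) = {}"
      proof (rule C2)
        fix e :: real assume e: "0 < e"
        obtain w where w: "max (tc K1) (c - e) < w" "w < c"
          using dense[of "max (tc K1) (c - e)" c] e K(4) by auto
        have "(a, 1 - w) \<notin> skeleton R" by (rule not_skeleton[OF R K(1)]) (use w K True in auto)
        moreover have "(a, 1 - w) \<in> closed_segment v (v + e *\<^sub>R (0, 1))"
          using w e by (auto simp: vc closed_segment_vertical closed_segment_eq_real_ivl)
        ultimately show "\<exists>z. z \<in> closed_segment v (v + e *\<^sub>R (0, 1)) \<and> z \<notin> skeleton R" by blast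
      qed
      then show ?thesis using True by simp
    next
      case False
      have w: "v + (c - tc K1) *\<^sub>R (0, 1) = (a, 1 - tc K1)" by (simp add: vc)
      have "(a, 1 - tc K1) \<in> vertices R" using d12(1)[OF False] K(1)
        by (auto simp: mem_vertices[OF R])
      moreover have "closed_segment v (a, 1 - tc K1) \<subseteq> skeleton R"
        using d12(1)[OF False] K(1-5)
          by (auto simp: vc closed_segment_vertical closed_segment_eq_real_ivl intro!: skeletonI[OF
          R K(1)])
      ultimately show ?thesis using C1[of "c - tc K1" "(0, 1)", unfolded w] K(4) False
        by (simp add: zero_prod_def)
    qed
    have S: "card (ray_edges R v (0, -1)) = of_bool (K3 \<noteq> K4) \<and> finite (ray_edges R v (0, -1))"
    proof (cases "K3 = K4")
      case True
      have "ray_edges R v (0, -1) = {}"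
      proof (rule C2)
        fix e :: real assume e: "0 < e"
        obtain w where w: "c < w" "w < min (bc K3) (c + e)"
          using dense[of c "min (bc K3) (c + e)"] e K(15) by auto
        have "(a, 1 - w) \<notin> skeleton R" by (rule not_skeleton[OF R K(11)]) (use w K True in auto)
        moreover have "(a, 1 - w) \<in> closed_segment v (v + e *\<^sub>R (0, -1))"
          using w e by (auto simp: vc closed_segment_vertical closed_segment_eq_real_ivl)
        ultimately show "\<exists>z. z \<in> closed_segment v (v + e *\<^sub>R (0, -1)) \<and> z \<notin> skeleton R" by blast
      qed
      then show ?thesis using True by simp
    next
      case False
      have w: "v + (bc K3 - c) *\<^sub>R (0, -1) = (a, 1 - bc K3)" by (simp add: vc)
      have "(a, 1 - bc K3) \<in> vertices R" using d34(1)[OF False] K(11)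
        by (auto simp: mem_vertices[OF R])
      moreover have "closed_segment v (a, 1 - bc K3) \<subseteq> skeleton R"
        using d34(1)[OF False] K(11-15)
          by (auto simp: vc closed_segment_vertical closed_segment_eq_real_ivl intro!: skeletonI[OF
          R K(11)])
      ultimately show ?thesis using C1[of "bc K3 - c" "(0, -1)", unfolded w] K(15) False
        by (simp add: zero_prod_def)
    qed
    have W: "card (ray_edges R v (-1, 0)) = of_bool (K2 \<noteq> K3) \<and> finite (ray_edges R v (-1, 0))"
    proof (cases "K2 = K3")
      case True
      have "ray_edges R v (-1, 0) = {}"
      proof (rule C2)
        fix e :: real assume e: "0 < e"
        obtain x where x: "max (lc K2) (a - e) < x" "x < a"
          using dense[of "max (lc K2) (a - e)" a] e K(7) by auto
        have "(x, 1 - c) \<notin> skeleton R" by (rule not_skeleton[OF R K(6)]) (use x K True in auto)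
        moreover have "(x, 1 - c) \<in> closed_segment v (v + e *\<^sub>R (-1, 0))"
          using x e by (auto simp: vc closed_segment_horizontal closed_segment_eq_real_ivl)
        ultimately show "\<exists>z. z \<in> closed_segment v (v + e *\<^sub>R (-1, 0)) \<and> z \<notin> skeleton R" by blast
      qed
      then show ?thesis using True by simp
    next
      case False
      have w: "v + (a - lc K2) *\<^sub>R (-1, 0) = (lc K2, 1 - c)" by (simp add: vc)
      have "(lc K2, 1 - c) \<in> vertices R" using d23(1)[OF False] K(6)
        by (auto simp: mem_vertices[OF R])
      moreover have "closed_segment v (lc K2, 1 - c) \<subseteq> skeleton R"
        using d23(1)[OF False] K(6-10)
          by (auto simp: vc closed_segment_horizontal closed_segment_eq_real_ivl intro!:
          skeletonI[OF R K(6)])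
      ultimately show ?thesis using C1[of "a - lc K2" "(-1, 0)", unfolded w] K(7) False
        by (simp add: zero_prod_def)
    qed
    have Ea: "card (ray_edges R v (1, 0)) = of_bool (K4 \<noteq> K1) \<and> finite (ray_edges R v (1, 0))"
    proof (cases "K4 = K1")
      case True
      have "ray_edges R v (1, 0) = {}"
      proof (rule C2)
        fix e :: real assume e: "0 < e"
        obtain x where x: "a < x" "x < min (rc K4) (a + e)"
          using dense[of a "min (rc K4) (a + e)"] e K(18) by auto
        have "(x, 1 - c) \<notin> skeleton R" by (rule not_skeleton[OF R K(16)]) (use x K True in auto)
        moreover have "(x, 1 - c) \<in> closed_segment v (v + e *\<^sub>R (1, 0))"
          using x e by (auto simp: vc closed_segment_horizontal closed_segment_eq_real_ivl)
        ultimately show "\<exists>z. z \<in> closed_segment v (v + e *\<^sub>R (1, 0)) \<and> z \<notin> skeleton R" by blast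
      qed
      then show ?thesis using True by simp
    next
      case False
      have w: "v + (rc K4 - a) *\<^sub>R (1, 0) = (rc K4, 1 - c)" by (simp add: vc)
      have "(rc K4, 1 - c) \<in> vertices R" using d41(1)[OF False] K(16)
        by (auto simp: mem_vertices[OF R])
      moreover have "closed_segment v (rc K4, 1 - c) \<subseteq> skeleton R"
        using d41(1)[OF False] K(16-20)
          by (auto simp: vc closed_segment_horizontal closed_segment_eq_real_ivl intro!:
          skeletonI[OF R K(16)])
      ultimately show ?thesis using C1[of "rc K4 - a" "(1, 0)", unfolded w] K(18) False
        by (simp add: zero_prod_def)
    qed
    have cr: "\<not> (K1 \<noteq> K2 \<and> K2 \<noteq> K3 \<and> K3 \<noteq> K4 \<and> K4 \<noteq> K1)"
      using nc[OF K(1,11)] d12 d23 d34 d41 by metis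
    \<comment> \<open>A rectangle that covers three quadrants around a point covers the fourth as
      well.\<close>
    have o1: "\<not> (K1 = K2 \<and> K2 = K3)" if "K3 \<noteq> K4 \<or> K4 \<noteq> K1"
      using that d34 d41 K(2-5,7-10,12-15,17-20) by (smt (verit))
    have o2: "\<not> (K2 = K3 \<and> K3 = K4)" if "K1 \<noteq> K2" using that d12 d41 K(2-5,7-10,12-15,17-20)
      by (smt (verit))
    have o3: "\<not> (K3 = K4 \<and> K4 = K1)" if "K1 \<noteq> K2" using that d12 d23 K(2-5,7-10,12-15,17-20)
      by (smt (verit))
    have o4: "\<not> (K4 = K1 \<and> K1 = K2)" if "K2 \<noteq> K3" using that d23 d34 K(2-5,7-10,12-15,17-20)
      by (smt (verit))
    obtain L where L: "L \<in> R" "a = lc L \<or> a = rc L" "c = tc L \<or> c = bc L"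
      using v(1) unfolding vc mem_vertices[OF R] by auto
    note Lr = tiling_rect[OF R L(1)]
    have corner: "(K1 \<noteq> K2 \<or> K3 \<noteq> K4) \<and> (K2 \<noteq> K3 \<or> K4 \<noteq> K1)"
    proof -
      consider "a = lc L" "c = bc L" | "a = rc L" "c = bc L" | "a = rc L" "c = tc L" | "a = lc L"
        "c = tc L"
        using L by blast
      then show ?thesis
      proof cases
        case 1
        then have "L = K1" using tiling_disjoint[OF R L(1) K(1)] K Lr by auto
        then show ?thesis using 1 K(2-5,7-10,12-15,17-20) by (smt (verit))
      next
        case 2
        then have "L = K2" using tiling_disjoint[OF R L(1) K(6)] K Lr by auto
        then show ?thesis using 2 K(2-5,7-10,12-15,17-20) by (smt (verit))
      next
        case 3
        then have "L = K3" using tiling_disjoint[OF R L(1) K(11)] K Lr by auto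
        then show ?thesis using 3 K(2-5,7-10,12-15,17-20) by (smt (verit))
      next
        case 4
        then have "L = K4" using tiling_disjoint[OF R L(1) K(16)] K Lr by auto
        then show ?thesis using 4 K(2-5,7-10,12-15,17-20) by (smt (verit))
      qed
    qed
    have "card {w. edge R v w} = of_bool (K4 \<noteq> K1) + of_bool (K2 \<noteq> K3) + of_bool (K1 \<noteq> K2) + of_bool
      (K3 \<noteq> K4)"
      by (subst card_edges_as_rays[OF R]) (use N S W Ea in auto)
    also have "\<dots> = 3"
    proof -
      have *: "of_bool s + of_bool q + of_bool p + of_bool r = (3 :: nat)"
        if "p \<or> r" "q \<or> s" "\<not> (p \<and> q \<and> r \<and> s)" "r \<or> s \<Longrightarrow> p \<or> q" "p \<Longrightarrow> q \<or> r" "p \<Longrightarrow> r \<or> s" "q \<Longrightarrow> s \<or> p"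
        for p q r s using that by (cases p; cases q; cases r; cases s) auto
      show ?thesis by (rule *) (use cr o1 o2 o3 o4 corner in blast)+
    qed
    finally show ?thesis .
  qed
  then show ?thesis using R unfolding rectangulation_def tiling_def by blast
qed

lemma (in diagonal_grid) draw_rectangulation:
  assumes d: "drawing X Y"
  shows "rectangulation (draw X Y ` {1..n})"
proof (rule rectangulationI[OF draw_tiling(1)[OF d]])
  fix K L assume "K \<in> draw X Y ` {1..n}" "L \<in> draw X Y ` {1..n}" and c: "lc K = rc L" "bc K = tc L"
  then obtain i j where i: "i \<in> {1..n}" "K = draw X Y i" and j: "j \<in> {1..n}" "L = draw X Y j"
    by auto
  have co: "lc (draw X Y i) = X (lf i)" "rc (draw X Y i) = X (rt i)" "tc (draw X Y i) = Y (tp i)"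
    "bc (draw X Y i) = Y (bt i)"
    if "i \<in> {1..n}" for i
    using d that coords_rect[of "X (lf i)" "X (rt i)" "Y (tp i)" "Y (bt i)"]
      by (simp_all add: drawing_def draw_def less_imp_le)
  have e: "X (lf i) = X (rt j)" "Y (bt i) = Y (tp j)" using c co i j by auto
  have l: "lf i \<in> {0, n} \<union> {k. vert k}" "rt j \<in> {0, n} \<union> {k. vert k}"
    using lf_vert(1)[OF i(1) refl] rt_vert(1)[OF j(1) refl] bounds[OF j(1)] by (auto simp: le_less)
  have t: "tp j \<in> {0, n} \<union> {k. horiz k}" "bt i \<in> {0, n} \<union> {k. horiz k}"
    using tp_horiz(1)[OF j(1) refl] bt_horiz(1)[OF i(1) refl] bounds[OF i(1)]
      by (auto simp: le_less)
  \<comment> \<open>A corner of this kind would give the cycle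
    \<open>j <= rt j = lf i < i <= bt i = tp j < j\<close>.\<close>
  have "lf i = rt j" "bt i = tp j"
    using d e l t unfolding drawing_def by (meson inj_onD)+
  then show False using diag[OF i(1)] diag[OF j(1)] by linarith
qed

section \<open>Wall slides\<close>

context diagonal_grid begin

definition lines :: "nat set" where "lines = {0, n} \<union> {k. horiz k}"

text \<open>The half of \<open>drawing\<close> that concerns horizontal walls, separated so that
  these can be moved while the vertical walls stay in place.\<close>

definition vdrawing :: "(nat \<Rightarrow> real) \<Rightarrow> bool" where
  "vdrawing Y \<longleftrightarrow> Y 0 = 0 \<and> Y n = 1 \<and> (\<forall>i\<in>{1..n}. Y (tp i) < Y (bt i)) \<and> inj_on Y lines"

text \<open>The grid fixes which tiles stand at the same vertical wall, and \<open>Y\<close> alone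
  decides which of them overlap along it. Hence horizontal contacts do not involve the positions of
  the vertical walls.\<close>

definition hcontacts :: "(nat \<Rightarrow> real) \<Rightarrow> (nat \<times> nat) set" where
  "hcontacts Y = {(i, j). i \<in> {1..n} \<and> j \<in> {1..n} \<and> rt i = lf j \<and> Y (tp i) < Y (bt j) \<and>
    Y (tp j) < Y (bt i)}"

lemma drawing_standard: "drawing (\<lambda>k. real k / real n) (\<lambda>k. real k / real n)"
  using n_pos diag by (fastforce simp: drawing_def inj_on_def divide_strict_right_mono)

lemma vdrawing_drawing: "vdrawing Y \<Longrightarrow> drawing (\<lambda>k. real k / real n) Y"
  using drawing_standard unfolding drawing_def vdrawing_def lines_def by blast

lemma tp_lines: "i \<in> {1..n} \<Longrightarrow> tp i \<in> lines"
  using tp_horiz(1)[of i "tp i"] by (auto simp: lines_def)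

lemma bt_lines: "i \<in> {1..n} \<Longrightarrow> bt i \<in> lines"
  using bt_horiz(1)[of i "bt i"] bounds[of i] by (auto simp: lines_def le_less)

lemma vdrawing_unique:
  assumes Y: "vdrawing Y" and ij: "i \<in> {1..n}" "j \<in> {1..n}"
    and c: "lf i < u" "u \<le> rt i" "lf j < u" "u \<le> rt j" "Y (tp i) < Y (bt j)" "Y (tp j) < Y (bt i)"
  shows "i = j"
proof -
  define w where "w = max (Y (tp i)) (Y (tp j))"
  define x where "x = real (u - 1) / real n"
  have d: "drawing (\<lambda>k. real k / real n) Y" by (rule vdrawing_drawing[OF Y])
  have u: "1 \<le> u" "u \<le> n" using c bounds[OF ij(1)] by auto
  have w: "Y (tp i) \<le> w" "w < Y (bt i)" "Y (tp j) \<le> w" "w < Y (bt j)"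
    using c Y ij by (auto simp: w_def vdrawing_def)
  have x: "real k / real n \<le> x \<longleftrightarrow> k < u" "x < real k / real n \<longleftrightarrow> u \<le> k" for k
    using n_pos u by (auto simp: x_def divide_le_cancel divide_less_cancel)
  have "0 \<le> x" "x < 1" using u n_pos by (auto simp: x_def)
  moreover have "0 \<le> w" "w < 1" using drawing_bounds[OF d ij(1)] w by auto
  ultimately show ?thesis using containing[OF d, of x w] ij c(1-4) w x by blast
qed

text \<open>In use, \<open>p\<close> and \<open>q\<close> are the two columns beside a vertical
  wall. The upper side of \<open>j\<close> reaches this wall from the side of \<open>q\<close>,
  while on the other side tile \<open>i\<close> passes that height. A tile above \<open>j\<close>
  that crossed the wall would have, in column \<open>p\<close>, a tile with upper line
  \<open>k\<close> under it, and that tile would overlap \<open>i\<close>.\<close>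

lemma corner_above:
  assumes Y: "vdrawing Y" and pq: "p \<in> {1..n}" "q \<in> {1..n}"
    and j: "j \<in> {1..n}" "lf j < q" "q \<le> rt j" "\<not> (lf j < p \<and> p \<le> rt j)" "tp j = k" "0 < k"
    and i: "i \<in> {1..n}" "lf i < p" "p \<le> rt i" "Y (tp i) < Y k" "Y k < Y (bt i)"
  obtains d where "d \<in> {1..n}" "lf d < q" "q \<le> rt d" "\<not> (lf d < p \<and> p \<le> rt d)" "bt d = k"
proof -
  have dj: "tp j < j" "j \<le> bt j" using diag[OF j(1)] by auto
  have k: "k \<in> {1..n}" "k + 1 \<in> {1..n}" using j dj by auto
  obtain d where d: "d \<in> {1..n}" "lf d < q" "q \<le> rt d" "tp d < k" "k \<le> bt d"
    using cover[OF pq(2) k(1)] by blast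
  have "bt d = k"
  proof (rule ccontr)
    assume "bt d \<noteq> k"
    then have "d = j" using disj[OF d(1) j(1), of q "k + 1"] d j dj by auto
    then show False using d j by auto
  qed
  moreover have "\<not> (lf d < p \<and> p \<le> rt d)"
  proof
    assume dp: "lf d < p \<and> p \<le> rt d"
    obtain e where e: "e \<in> {1..n}" "lf e < p" "p \<le> rt e" "tp e < k + 1" "k + 1 \<le> bt e"
      using cover[OF pq(1) k(2)] by blast
    have "tp e = k"
    proof (rule ccontr)
      assume "tp e \<noteq> k"
      then have "e = d" using disj[OF e(1) d(1), of p k] e d dp by auto
      then show False using e \<open>bt d = k\<close> by auto
    qed
    moreover have "Y (tp e) < Y (bt e)" using Y e(1) by (auto simp: vdrawing_def)
    ultimately have "i = e" using vdrawing_unique[OF Y i(1) e(1) i(2,3) e(2,3)] i by auto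
    then show False using i \<open>tp e = k\<close> by auto
  qed
  ultimately show thesis using that d by blast
qed

lemma corner_below:
  assumes Y: "vdrawing Y" and pq: "p \<in> {1..n}" "q \<in> {1..n}"
    and j: "j \<in> {1..n}" "lf j < q" "q \<le> rt j" "\<not> (lf j < p \<and> p \<le> rt j)" "bt j = k" "k < n"
    and i: "i \<in> {1..n}" "lf i < p" "p \<le> rt i" "Y (tp i) < Y k" "Y k < Y (bt i)"
  obtains d where "d \<in> {1..n}" "lf d < q" "q \<le> rt d" "\<not> (lf d < p \<and> p \<le> rt d)" "tp d = k"
proof -
  have dj: "tp j < j" "j \<le> bt j" using diag[OF j(1)] by auto
  have k: "k \<in> {1..n}" "k + 1 \<in> {1..n}" using j dj by auto
  obtain d where d: "d \<in> {1..n}" "lf d < q" "q \<le> rt d" "tp d < k + 1" "k + 1 \<le> bt d"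
    using cover[OF pq(2) k(2)] by blast
  have "tp d = k"
  proof (rule ccontr)
    assume "tp d \<noteq> k"
    then have "d = j" using disj[OF d(1) j(1), of q k] d j dj by auto
    then show False using d j by auto
  qed
  moreover have "\<not> (lf d < p \<and> p \<le> rt d)"
  proof
    assume dp: "lf d < p \<and> p \<le> rt d"
    obtain e where e: "e \<in> {1..n}" "lf e < p" "p \<le> rt e" "tp e < k" "k \<le> bt e"
      using cover[OF pq(1) k(1)] by blast
    have "bt e = k"
    proof (rule ccontr)
      assume "bt e \<noteq> k"
      then have "e = d" using disj[OF e(1) d(1), of p "k + 1"] e d dp by auto
      then show False using e \<open>tp d = k\<close> by auto
    qed
    moreover have "Y (tp e) < Y (bt e)" using Y e(1) by (auto simp: vdrawing_def)
    ultimately have "i = e" using vdrawing_unique[OF Y i(1) e(1) i(2,3) e(2,3)] i by auto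
    then show False using i \<open>bt e = k\<close> by auto
  qed
  ultimately show thesis using that d by blast
qed

text \<open>Only the vertical order of the lines matters for contacts. This is an exchange of two
  neighbours in that order, one step of a sorting by adjacent exchanges.\<close>

definition swapped :: "(nat \<Rightarrow> real) \<Rightarrow> (nat \<Rightarrow> real) \<Rightarrow> nat \<Rightarrow> nat \<Rightarrow> bool" where
  "swapped Y Z k1 k2 \<longleftrightarrow> vdrawing Y \<and> vdrawing Z \<and> horiz k1 \<and> horiz k2 \<and> Y k1 < Y k2 \<and> Z k2 < Z k1 \<and>
     (\<forall>p\<in>lines. \<forall>q\<in>lines. {p, q} \<noteq> {k1, k2} \<longrightarrow> (Y p < Y q \<longleftrightarrow> Z p < Z q)) \<and>
     (\<forall>p\<in>lines. p \<noteq> k1 \<longrightarrow> p \<noteq> k2 \<longrightarrow> (Y p < Y k1 \<longleftrightarrow> Y p < Y k2))"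

lemma swapped_sym: "swapped Y Z k1 k2 \<Longrightarrow> swapped Z Y k2 k1"
proof -
  assume s: "swapped Y Z k1 k2"
  have k: "k1 \<in> lines" "k2 \<in> lines" using s by (auto simp: swapped_def lines_def)
  have "Z p < Z k2 \<longleftrightarrow> Z p < Z k1" if p: "p \<in> lines" "p \<noteq> k1" "p \<noteq> k2" for p
  proof -
    have "{p, k1} \<noteq> {k1, k2}" "{p, k2} \<noteq> {k1, k2}" using p by auto
    then have "Y p < Y k1 \<longleftrightarrow> Z p < Z k1" "Y p < Y k2 \<longleftrightarrow> Z p < Z k2" using s p k unfolding swapped_def
      by blast+
    moreover have "Y p < Y k1 \<longleftrightarrow> Y p < Y k2" using s p unfolding swapped_def by blast
    ultimately show ?thesis by blast
  qed
  then show ?thesis using s unfolding swapped_def by (simp add: insert_commute)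
qed

definition slides :: "(nat \<Rightarrow> real) \<Rightarrow> (nat \<Rightarrow> real) \<Rightarrow> bool" where
  "slides Y Z \<longleftrightarrow> (\<exists>a\<in>{1..n}. \<exists>b\<in>{1..n}. \<exists>c\<in>{1..n}. \<exists>d\<in>{1..n}. tp a = bt b \<and> tp c = bt d \<and> rt a =
    rt b \<and> lf c = lf d \<and>
     (a, c) \<in> hcontacts Y \<and> (b, c) \<in> hcontacts Y \<and> (b, d) \<in> hcontacts Y \<and>
     hcontacts Z = insert (a, d) (hcontacts Y - {(b, c)}))"

text \<open>On the wall between \<open>x\<close> and \<open>y\<close> one of the two exchanged horizontal walls ends from the
  left and the other one from the right.\<close>

lemma swapped_corners_down:
  assumes s: "swapped Y Z k1 k2" and xy: "x \<in> {1..n}" "y \<in> {1..n}" "rt x = lf y" "tp y = k1"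
    "bt x = k2"
    and c: "Y (tp x) < Y (bt y)"
  obtains a d where "a \<in> {1..n}" "rt a = rt x" "tp a = k2" "d \<in> {1..n}" "lf d = lf y" "bt d = k1"
    "Y (tp x) < Y k1" "Y k2 < Y (bt y)" "k2 < rt x" "lf y < k1" "x = k2" "y = k1 + 1"
proof -
  have Y: "vdrawing Y" "vdrawing Z" "Y k1 < Y k2" "Z k2 < Z k1" and k: "horiz k1" "horiz k2" using s
    by (auto simp: swapped_def)
  have kl: "k1 \<in> lines" "k2 \<in> lines" using k by (auto simp: lines_def)
  have n12: "tp i \<noteq> k1 \<or> bt i \<noteq> k2" if "i \<in> {1..n}" for i
    using Y(2,4) that unfolding vdrawing_def by force
  have adj: "Y p < Y k1 \<longleftrightarrow> Y p < Y k2" if "p \<in> lines" "p \<noteq> k1" "p \<noteq> k2" for p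
    using s that unfolding swapped_def by blast
  have injY: "Y p \<noteq> Y q" if "p \<in> lines" "q \<in> lines" "p \<noteq> q" for p q
    using Y(1) that unfolding vdrawing_def inj_on_def by blast
  have dx: "lf x < rt x" "0 < rt x" "rt y > lf y" "lf y < y" "x \<le> rt x"
    using diag[OF xy(1)] diag[OF xy(2)] by auto
  have m: "rt x \<in> {1..n}" "rt x + 1 \<in> {1..n}" using dx xy by auto
  have x1: "Y (tp x) < Y k1"
  proof -
    have lt: "Y (tp x) < Y k2" using Y(1) xy by (auto simp: vdrawing_def)
    then have "tp x \<noteq> k2" by auto
    moreover have "tp x \<noteq> k1" using n12[OF xy(1)] xy by auto
    ultimately show ?thesis using adj[OF tp_lines[OF xy(1)]] lt by auto
  qed
  have y2: "Y k2 < Y (bt y)"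
  proof -
    have lt: "Y k1 < Y (bt y)" using Y(1) xy by (auto simp: vdrawing_def)
    then have "bt y \<noteq> k1" by auto
    moreover have "bt y \<noteq> k2" using n12[OF xy(2)] xy by auto
    ultimately show ?thesis using adj[OF bt_lines[OF xy(2)]] lt injY[OF bt_lines[OF xy(2)] kl(2)]
      by force
  qed
  obtain d where d: "d \<in> {1..n}" "lf d < rt x + 1" "rt x + 1 \<le> rt d" "\<not> (lf d < rt x \<and> rt x \<le> rt d)"
    "bt d = k1"
    by (rule corner_above[OF Y(1) m(1,2) xy(2) _ _ _ xy(4) _ xy(1)])
      (use dx xy x1 Y k in \<open>auto simp: horiz_def\<close>)
  obtain a where a: "a \<in> {1..n}" "lf a < rt x" "rt x \<le> rt a" "\<not> (lf a < rt x + 1 \<and> rt x + 1 \<le> rt a)"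
    "tp a = k2"
    by (rule corner_below[OF Y(1) m(2,1) xy(1) _ _ _ xy(5) _ xy(2)])
      (use dx xy y2 Y k in \<open>auto simp: horiz_def\<close>)
  have ra: "rt a = rt x" "lf d = lf y" using a d xy by auto
  have "k2 < rt x" using diag[OF a(1)] a ra by auto
  moreover have "lf y < k1" using diag[OF d(1)] d ra by auto
  moreover have "x = k2" using min_rt_bt[OF xy(1)] xy \<open>k2 < rt x\<close> by auto
  moreover have "y = k1 + 1" using max_lf_tp[OF xy(2)] xy \<open>lf y < k1\<close> dx by auto
  ultimately show thesis using that[of a d] a d ra x1 y2 by auto
qed

text \<open>The same with the two sides of the wall exchanged: \<open>k1\<close> now ends at it from
  the left and \<open>k2\<close> from the right. Here the index of the vertical wall is between
  \<open>k1\<close> and \<open>k2\<close>, in \<open>swapped_corners_down\<close> between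
  \<open>k2\<close> and \<open>k1\<close>; so one pair of lines cannot show both patterns.\<close>

lemma swapped_corners_up:
  assumes s: "swapped Y Z k1 k2" and xy: "x \<in> {1..n}" "y \<in> {1..n}" "rt x = lf y" "tp x = k1"
    "bt y = k2"
    and c: "Y (tp y) < Y (bt x)"
  obtains b c where "b \<in> {1..n}" "rt b = rt x" "bt b = k1" "c \<in> {1..n}" "lf c = lf y" "tp c = k2"
    "k1 < rt x" "lf y < k2" "b = k1" "c = k2 + 1"
proof -
  have Y: "vdrawing Y" "vdrawing Z" "Y k1 < Y k2" "Z k2 < Z k1" and k: "horiz k1" "horiz k2" using s
    by (auto simp: swapped_def)
  have kl: "k1 \<in> lines" "k2 \<in> lines" using k by (auto simp: lines_def)
  have n12: "tp i \<noteq> k1 \<or> bt i \<noteq> k2" if "i \<in> {1..n}" for i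
    using Y(2,4) that unfolding vdrawing_def by force
  have adj: "Y p < Y k1 \<longleftrightarrow> Y p < Y k2" if "p \<in> lines" "p \<noteq> k1" "p \<noteq> k2" for p
    using s that unfolding swapped_def by blast
  have injY: "Y p \<noteq> Y q" if "p \<in> lines" "q \<in> lines" "p \<noteq> q" for p q
    using Y(1) that unfolding vdrawing_def inj_on_def by blast
  have dx: "lf x < rt x" "0 < rt x" "rt y > lf y" "lf y < y" "x \<le> rt x"
    using diag[OF xy(1)] diag[OF xy(2)] by auto
  have m: "rt x \<in> {1..n}" "rt x + 1 \<in> {1..n}" using dx xy by auto
  have y1: "Y (tp y) < Y k1"
  proof -
    have lt: "Y (tp y) < Y k2" using Y(1) xy by (auto simp: vdrawing_def)
    then have "tp y \<noteq> k2" by auto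
    moreover have "tp y \<noteq> k1" using n12[OF xy(2)] xy by auto
    ultimately show ?thesis using adj[OF tp_lines[OF xy(2)]] lt by auto
  qed
  have x2: "Y k2 < Y (bt x)"
  proof -
    have lt: "Y k1 < Y (bt x)" using Y(1) xy by (auto simp: vdrawing_def)
    then have "bt x \<noteq> k1" by auto
    moreover have "bt x \<noteq> k2" using n12[OF xy(1)] xy by auto
    ultimately show ?thesis using adj[OF bt_lines[OF xy(1)]] lt injY[OF bt_lines[OF xy(1)] kl(2)]
      by force
  qed
  obtain b where b: "b \<in> {1..n}" "lf b < rt x" "rt x \<le> rt b" "\<not> (lf b < rt x + 1 \<and> rt x + 1 \<le> rt b)"
    "bt b = k1"
    by (rule corner_above[OF Y(1) m(2,1) xy(1) _ _ _ xy(4) _ xy(2)])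
      (use dx xy y1 Y k in \<open>auto simp: horiz_def\<close>)
  obtain c where c: "c \<in> {1..n}" "lf c < rt x + 1" "rt x + 1 \<le> rt c" "\<not> (lf c < rt x \<and> rt x \<le> rt c)"
    "tp c = k2"
    by (rule corner_below[OF Y(1) m(1,2) xy(2) _ _ _ xy(5) _ xy(1)])
      (use dx xy x2 Y k in \<open>auto simp: horiz_def\<close>)
  have ra: "rt b = rt x" "lf c = lf y" using b c xy by auto
  have l1: "k1 < rt x" using diag[OF xy(1)] xy by auto
  moreover have l2: "lf y < k2" using diag[OF xy(2)] xy by auto
  moreover have "b = k1" using min_rt_bt[OF b(1)] b ra l1 by auto
  moreover have "c = k2 + 1" using max_lf_tp[OF c(1)] c ra l2 diag[OF c(1)] by auto
  ultimately show thesis using that[of b c] b c ra by auto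
qed

text \<open>The corners identify \<open>b\<close> and \<open>c\<close> as the tiles
  \<open>k2\<close> and \<open>k1 + 1\<close>, so no other contact can be lost. The same argument
  for the reverse exchange leaves \<open>(a, d)\<close> as the only contact gained.\<close>

lemma swapped_slides:
  assumes s: "swapped Y Z k1 k2" and bc: "b \<in> {1..n}" "c \<in> {1..n}" "rt b = lf c" "tp c = k1"
    "bt b = k2"
    and o: "Y (tp b) < Y (bt c)"
  shows "slides Y Z"
proof -
  have s': "swapped Z Y k2 k1" by (rule swapped_sym[OF s])
  have Y: "vdrawing Y" "vdrawing Z" "Y k1 < Y k2" "Z k2 < Z k1" and k: "horiz k1" "horiz k2" using s
    by (auto simp: swapped_def)
  have kl: "k1 \<in> lines" "k2 \<in> lines" using k by (auto simp: lines_def)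
  have cmp: "Y p < Y q \<longleftrightarrow> Z p < Z q"
    if "p \<in> lines" "q \<in> lines" "\<not> (p = k1 \<and> q = k2)" "\<not> (p = k2 \<and> q = k1)" for p q
  proof -
    have "{p, q} \<noteq> {k1, k2}" using that by (auto simp: doubleton_eq_iff)
    then show ?thesis using s that unfolding swapped_def by blast
  qed
  have tb: "Y (tp i) < Y (bt i)" "Z (tp i) < Z (bt i)" if "i \<in> {1..n}" for i
    using Y that by (auto simp: vdrawing_def)
  obtain a d where ad: "a \<in> {1..n}" "rt a = rt b" "tp a = k2" "d \<in> {1..n}" "lf d = lf c" "bt d = k1"
    "Y (tp b) < Y k1" "Y k2 < Y (bt c)" "k2 < rt b" "lf c < k1" "b = k2" "c = k1 + 1"
    using swapped_corners_down[OF s bc o] by metis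
  have m: "rt b < n" "0 < rt b" using diag[OF bc(2)] bc diag[OF bc(1)] by auto
  have no_up: "False" if "x \<in> {1..n}" "y \<in> {1..n}" "rt x = lf y" "tp x = k1" "bt y = k2"
    "Y (tp y) < Y (bt x)" for x y
    using swapped_corners_up[OF s that] ad that bc by (metis less_asym' less_trans)
  have no_up': "False" if "x \<in> {1..n}" "y \<in> {1..n}" "rt x = lf y" "tp y = k2" "bt x = k1"
    "Z (tp x) < Z (bt y)" for x y
    using swapped_corners_down[OF s' that] ad that bc by (metis less_asym' less_trans)
  have lost: "(x, y) = (b, c)" if "(x, y) \<in> hcontacts Y" "(x, y) \<notin> hcontacts Z" for x y
  proof -
    have h: "x \<in> {1..n}" "y \<in> {1..n}" "rt x = lf y" "Y (tp x) < Y (bt y)" "Y (tp y) < Y (bt x)"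
      using that(1) by (auto simp: hcontacts_def)
    then have "\<not> Z (tp x) < Z (bt y) \<or> \<not> Z (tp y) < Z (bt x)" using that(2)
      by (auto simp: hcontacts_def)
    then have "(tp x = k1 \<and> bt y = k2) \<or> (tp y = k1 \<and> bt x = k2)"
      using cmp[OF tp_lines[OF h(1)] bt_lines[OF h(2)]] cmp[OF tp_lines[OF h(2)] bt_lines[OF h(1)]]
        h Y(3)
      by (metis less_asym')
    then have "tp y = k1 \<and> bt x = k2" using no_up h by blast
    then show ?thesis using swapped_corners_down[OF s h(1,2,3) _ _ h(4)] ad by (metis)
  qed
  have gain: "(x, y) = (a, d)" if "(x, y) \<in> hcontacts Z" "(x, y) \<notin> hcontacts Y" for x y
  proof -
    have h: "x \<in> {1..n}" "y \<in> {1..n}" "rt x = lf y" "Z (tp x) < Z (bt y)" "Z (tp y) < Z (bt x)"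
      using that(1) by (auto simp: hcontacts_def)
    then have "\<not> Y (tp x) < Y (bt y) \<or> \<not> Y (tp y) < Y (bt x)" using that(2)
      by (auto simp: hcontacts_def)
    then have "(tp x = k2 \<and> bt y = k1) \<or> (tp y = k2 \<and> bt x = k1)"
      using cmp[OF tp_lines[OF h(1)] bt_lines[OF h(2)]] cmp[OF tp_lines[OF h(2)] bt_lines[OF h(1)]]
        h Y(4)
      by (metis less_asym')
    then have e: "tp x = k2 \<and> bt y = k1" using no_up' h by blast
    then obtain b' where b': "b' = k2" "rt b' = rt x"
      using swapped_corners_up[OF s' h(1,2,3) _ _ h(5)] by metis
    have rx: "rt x = rt b" using b' ad by auto
    have "x = a" by (rule disj[OF h(1) ad(1), of "rt b" "k2 + 1"])
      (use e rx ad diag[OF h(1)] diag[OF ad(1)] in auto)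
    moreover have "y = d" by (rule disj[OF h(2) ad(4), of "rt b + 1" k1])
      (use e rx ad diag[OF h(2)] diag[OF ad(4)] h bc in auto)
    ultimately show ?thesis by simp
  qed
  have ac: "(a, c) \<in> hcontacts Y" using ad bc tb[OF ad(1)] Y(3) by (auto simp: hcontacts_def)
  have bc': "(b, c) \<in> hcontacts Y" using bc o Y(3) by (auto simp: hcontacts_def)
  have bd: "(b, d) \<in> hcontacts Y" using ad bc tb[OF ad(4)] Y(3) by (auto simp: hcontacts_def)
  have bcZ: "(b, c) \<notin> hcontacts Z" using bc Y(4) by (auto simp: hcontacts_def)
  have adY: "(a, d) \<notin> hcontacts Y" using ad Y(3) by (auto simp: hcontacts_def)
  have "Z (tp d) < Z (bt a)"
  proof -
    have "Y (tp d) < Y (bt a)" using tb[OF ad(1)] tb[OF ad(4)] ad Y(3) by auto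
    moreover have "\<not> (tp d = k1 \<and> bt a = k2)" using tb[OF ad(1)] ad by auto
    moreover have "\<not> (tp d = k2 \<and> bt a = k1)" using tb[OF ad(1)] ad Y by auto
    ultimately show ?thesis using cmp[OF tp_lines[OF ad(4)] bt_lines[OF ad(1)]] by blast
  qed
  then have adZ: "(a, d) \<in> hcontacts Z" using ad bc Y(4) by (auto simp: hcontacts_def)
  have "hcontacts Z = insert (a, d) (hcontacts Y - {(b, c)})"
  proof (intro set_eqI)
    fix z :: "nat \<times> nat"
    obtain x y where z: "z = (x, y)" by fastforce
    show "z \<in> hcontacts Z \<longleftrightarrow> z \<in> insert (a, d) (hcontacts Y - {(b, c)})"
      using lost[of x y] gain[of x y] bcZ adZ unfolding z by blast
  qed
  then show ?thesis unfolding slides_def using ac bc' bd ad bc by (metis (no_types, lifting))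
qed

lemma swapped_cases:
  assumes s: "swapped Y Z k1 k2"
  shows "hcontacts Y = hcontacts Z \<or> slides Y Z \<or> slides Z Y"
proof -
  have main: "slides Y Z \<or> slides Z Y"
    if s: "swapped Y Z k1 k2" and h: "(x, y) \<in> hcontacts Y" "(x, y) \<notin> hcontacts Z" for Y Z k1 k2 x y
  proof -
    have Y: "vdrawing Y" "vdrawing Z" "Y k1 < Y k2" "Z k2 < Z k1" and k: "horiz k1" "horiz k2"
      using s by (auto simp: swapped_def)
    have cmp: "Y p < Y q \<longleftrightarrow> Z p < Z q"
      if "p \<in> lines" "q \<in> lines" "\<not> (p = k1 \<and> q = k2)" "\<not> (p = k2 \<and> q = k1)" for p q
    proof -
      have "{p, q} \<noteq> {k1, k2}" using that by (auto simp: doubleton_eq_iff)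
      then show ?thesis using s that unfolding swapped_def by blast
    qed
    have xy: "x \<in> {1..n}" "y \<in> {1..n}" "rt x = lf y" "Y (tp x) < Y (bt y)" "Y (tp y) < Y (bt x)"
      using h(1) by (auto simp: hcontacts_def)
    then have "\<not> Z (tp x) < Z (bt y) \<or> \<not> Z (tp y) < Z (bt x)" using h(2)
      by (auto simp: hcontacts_def)
    then consider "tp x = k1" "bt y = k2" | "tp y = k1" "bt x = k2"
      using cmp[OF tp_lines[OF xy(1)] bt_lines[OF xy(2)]] cmp[OF tp_lines[OF xy(2)] bt_lines[OF
        xy(1)]] xy Y(3)
      by (metis less_asym')
    then show ?thesis
    proof cases
      case 1
      obtain b c where bc: "b \<in> {1..n}" "rt b = rt x" "bt b = k1" "c \<in> {1..n}" "lf c = lf y"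
        "tp c = k2"
        using swapped_corners_up[OF s xy(1,2,3) 1 xy(5)] by metis
      have yy: "Y (tp b) < Y k1" "Y k2 < Y (bt c)" using Y(1) bc unfolding vdrawing_def by auto
      then have "Y (tp b) < Y (bt c)" using Y(3) by linarith
      moreover have "\<not> (tp b = k1 \<and> bt c = k2)" "\<not> (tp b = k2 \<and> bt c = k1)"
        using yy Y(3) by auto
      ultimately have "Z (tp b) < Z (bt c)" using cmp[OF tp_lines[OF bc(1)] bt_lines[OF bc(4)]]
        by blast
      then have "slides Z Y"
        using swapped_slides[OF swapped_sym[OF s] bc(1,4) _ bc(6,3)] bc xy by auto
      then show ?thesis ..
    next
      case 2
      then show ?thesis using swapped_slides[OF s xy(1,2,3) 2 xy(4)] by blast
    qed
  qed
  show ?thesis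
  proof (cases "hcontacts Y = hcontacts Z")
    case False
    then obtain x y where "(x, y) \<in> hcontacts Y \<and> (x, y) \<notin> hcontacts Z \<or> (x, y) \<in> hcontacts Z \<and>
      (x, y) \<notin> hcontacts Y" by auto
    then show ?thesis using main[OF s] main[OF swapped_sym[OF s]] by blast
  qed blast
qed

section \<open>Sorting the walls by adjacent exchanges\<close>

lemma finite_lines: "finite lines"
proof -
  have "{k. horiz k} \<subseteq> {..n}" by (auto simp: horiz_def)
  then show ?thesis using finite_subset by (auto simp: lines_def)
qed

lemma vdrawing_horiz:
  assumes "vdrawing Y" "horiz k" shows "0 < Y k" "Y k < 1"
proof -
  have d: "drawing (\<lambda>k. real k / real n) Y" by (rule vdrawing_drawing[OF assms(1)])
  have k: "k \<in> {1..n}" "k + 1 \<in> {1..n}" "bt k = k" "tp (k + 1) = k" "k \<noteq> 0" "k \<noteq> n" using assms(2)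
    by (auto simp: horiz_def)
  have "0 \<le> Y k" "Y k \<le> 1" using drawing_bounds(3)[OF d k(2)] drawing_bounds(4)[OF d k(1)] k by auto
  moreover have "Y k \<noteq> Y 0" "Y k \<noteq> Y n" using assms k unfolding vdrawing_def inj_on_def lines_def
    by blast+
  ultimately show "0 < Y k" "Y k < 1" using assms(1) by (auto simp: vdrawing_def)
qed

definition inversions :: "(nat \<Rightarrow> real) \<Rightarrow> (nat \<Rightarrow> real) \<Rightarrow> (nat \<times> nat) set" where
  "inversions Y Z = {(p, q). p \<in> lines \<and> q \<in> lines \<and> Y p < Y q \<and> Z q < Z p}"

lemma finite_inversions: "finite (inversions Y Z)"
  using finite_lines by (auto simp: inversions_def intro: finite_subset[of _ "lines \<times> lines"])

text \<open>Take an inversion with the fewest lines between its members. A line between them would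
  form an inversion with one of them, and this one would have fewer lines in between.\<close>

lemma adjacent_inversion:
  assumes Y: "vdrawing Y" "vdrawing Z" and ne: "inversions Y Z \<noteq> {}"
  obtains k1 k2 where "(k1, k2) \<in> inversions Y Z" "horiz k1" "horiz k2"
    "\<And>r. r \<in> lines \<Longrightarrow> Y k1 < Y r \<Longrightarrow> Y r < Y k2 \<Longrightarrow> False"
proof -
  define g where "g = (\<lambda>(p, q). card {r \<in> lines. Y p < Y r \<and> Y r < Y q})"
  obtain k1 k2 where k: "(k1, k2) \<in> inversions Y Z"
    and min: "\<And>p q. (p, q) \<in> inversions Y Z \<Longrightarrow> g (k1, k2) \<le> g (p, q)"
    using ex_has_least_nat[of "\<lambda>z. z \<in> inversions Y Z" _ g] ne by (metis ex_in_conv surj_pair)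
  have kk: "k1 \<in> lines" "k2 \<in> lines" "Y k1 < Y k2" "Z k2 < Z k1" using k
    by (auto simp: inversions_def)
  have injZ: "Z p \<noteq> Z q" if "p \<in> lines" "q \<in> lines" "p \<noteq> q" for p q
    using Y(2) that unfolding vdrawing_def inj_on_def by blast
  have bd: "0 \<le> Y p \<and> Y p \<le> 1 \<and> 0 \<le> Z p \<and> Z p \<le> 1" if "p \<in> lines" for p
    using that vdrawing_horiz[OF Y(1)] vdrawing_horiz[OF Y(2)] Y
      by (auto simp: lines_def vdrawing_def less_imp_le)
  have Y01: "Y 0 = 0" "Y n = 1" "Z 0 = 0" "Z n = 1" using Y by (auto simp: vdrawing_def)
  have "k1 \<noteq> 0 \<and> k1 \<noteq> n \<and> k2 \<noteq> 0 \<and> k2 \<noteq> n"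
    using kk bd[OF kk(1)] bd[OF kk(2)] Y01 by (intro conjI notI) auto
  then have "horiz k1" "horiz k2" using kk by (auto simp: lines_def)
  moreover have "False" if r: "r \<in> lines" "Y k1 < Y r" "Y r < Y k2" for r
  proof (cases "Z r < Z k1")
    case True
    then have "(k1, r) \<in> inversions Y Z" using kk r by (auto simp: inversions_def)
    moreover have "g (k1, r) < g (k1, k2)" unfolding g_def prod.case
      by (rule psubset_card_mono) (use finite_lines r in auto)
    ultimately show False using min[of k1 r] by auto
  next
    case False
    then have "(r, k2) \<in> inversions Y Z" using kk r by (auto simp: inversions_def)
    moreover have "g (r, k2) < g (k1, k2)" unfolding g_def prod.case
      by (rule psubset_card_mono) (use finite_lines r in auto)
    ultimately show False using min[of r k2] by auto
  qed
  ultimately show thesis using that k by blast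
qed

text \<open>Exchanging an adjacent inversion reduces the number of inversions with respect to
  \<open>Z\<close>. The result is again a drawing: a tile bounded by the lines \<open>k1\<close> and
  \<open>k2\<close> would have negative height in \<open>Y\<close> or in \<open>Z\<close>, so no
  tile is turned upside down.\<close>

lemma hcontacts_reachable:
  assumes "vdrawing Y" "vdrawing Z"
    and step: "\<And>Y Y'. P Y \<Longrightarrow> vdrawing Y \<Longrightarrow> vdrawing Y' \<Longrightarrow> hcontacts Y = hcontacts Y' \<or> slides Y Y' \<or>
      slides Y' Y \<Longrightarrow> P Y'"
    and "P Y"
  shows "P Z"
  using assms(1,4)
proof (induction "card (inversions Y Z)" arbitrary: Y rule: less_induct)
  case (less Y)
  note Y = less.prems(1) assms(2)
  show ?case
  proof (cases "inversions Y Z = {}")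
    case True
    have cmp: "Y p < Y q \<longleftrightarrow> Z p < Z q" if "p \<in> lines" "q \<in> lines" for p q
    proof (cases "p = q")
      case False
      then have "Y p \<noteq> Y q" "Z p \<noteq> Z q" using Y that unfolding vdrawing_def inj_on_def by blast+
      moreover have "(p, q) \<notin> inversions Y Z" "(q, p) \<notin> inversions Y Z" using True by auto
      ultimately show ?thesis using that by (auto simp: inversions_def)
    qed simp
    have "hcontacts Y = hcontacts Z"
      using cmp tp_lines bt_lines by (auto simp: hcontacts_def)
    then show ?thesis using step[OF less.prems(2) Y] by blast
  next
    case False
    obtain k1 k2 where k: "(k1, k2) \<in> inversions Y Z" "horiz k1" "horiz k2" 
      and adj: "\<And>r. r \<in> lines \<Longrightarrow> Y k1 < Y r \<Longrightarrow> Y r < Y k2 \<Longrightarrow> False"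
      using adjacent_inversion[OF Y False] by metis
    have kk: "k1 \<in> lines" "k2 \<in> lines" "Y k1 < Y k2" "Z k2 < Z k1" using k
      by (auto simp: inversions_def)
    have injY: "Y p \<noteq> Y q" if "p \<in> lines" "q \<in> lines" "p \<noteq> q" for p q
      using Y(1) that unfolding vdrawing_def inj_on_def by blast
    define Y' where "Y' = Y(k1 := Y k2, k2 := Y k1)"
    have k12: "k1 \<noteq> k2" "k1 \<noteq> 0" "k1 \<noteq> n" "k2 \<noteq> 0" "k2 \<noteq> n" using kk k(2,3)
      by (auto simp: horiz_def)
    have Y'v: "Y' k1 = Y k2" "Y' k2 = Y k1" "\<And>p. p \<noteq> k1 \<Longrightarrow> p \<noteq> k2 \<Longrightarrow> Y' p = Y p" using k12
      by (auto simp: Y'_def)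
    have adj': "Y p < Y k1 \<longleftrightarrow> Y p < Y k2" if "p \<in> lines" "p \<noteq> k1" "p \<noteq> k2" for p
      using adj[OF that(1)] injY[OF that(1) kk(1) that(2)] kk(3) by (smt (verit))
    have adj'': "Y k1 < Y p \<longleftrightarrow> Y k2 < Y p" if "p \<in> lines" "p \<noteq> k1" "p \<noteq> k2" for p
      using adj[OF that(1)] injY[OF that(1) kk(2) that(3)] kk(3) by (smt (verit))
    have cmp: "Y p < Y q \<longleftrightarrow> Y' p < Y' q" if pq: "p \<in> lines" "q \<in> lines" "{p, q} \<noteq> {k1, k2}" for p q
    proof -
      consider "p = q" | "p \<noteq> q" "p = k1" "q \<noteq> k2" | "p \<noteq> q" "p = k2" "q \<noteq> k1" | "p \<noteq> k1" "p \<noteq> k2"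
        using pq(3) by auto
      then show ?thesis
      proof cases
        case 1 then show ?thesis by simp
      next
        case 2 then show ?thesis using Y'v(1) Y'v(3)[of q] adj''[OF that(2)] by auto
      next
        case 3 then show ?thesis using Y'v(2) Y'v(3)[of q] adj''[OF that(2)] by auto
      next
        case 4 then show ?thesis using Y'v Y'v(3)[of p] adj'[OF that(1)] by metis
      qed
    qed
    have "vdrawing Y'"
      unfolding vdrawing_def
    proof (intro conjI ballI)
      show "Y' 0 = 0" "Y' n = 1" using Y(1) Y'v(3) k12 by (auto simp: vdrawing_def)
      fix i assume i: "i \<in> {1..n}"
      have "{tp i, bt i} \<noteq> {k1, k2}"
        using Y kk i unfolding vdrawing_def doubleton_eq_iff by (metis less_asym')
      then show "Y' (tp i) < Y' (bt i)"
        using cmp[OF tp_lines[OF i] bt_lines[OF i]] Y(1) i by (auto simp: vdrawing_def)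
    next
      show "inj_on Y' lines"
      proof (rule inj_onI, rule ccontr)
        fix p q assume pq: "p \<in> lines" "q \<in> lines" "Y' p = Y' q" "p \<noteq> q"
        show False
        proof (cases "{p, q} = {k1, k2}")
          case True
          then show False using pq kk(3) Y'v by (auto simp: doubleton_eq_iff)
        next
          case False
          then have "{q, p} \<noteq> {k1, k2}" by (simp add: insert_commute)
          then show False using cmp[OF pq(1,2) False] cmp[OF pq(2,1)] injY[OF pq(1,2,4)] pq(3)
            by auto
        qed
      qed
    qed
    moreover have "swapped Y Y' k1 k2"
      unfolding swapped_def using calculation Y(1) k(2,3) kk(3) Y'v(1,2) cmp adj' by simp
    then have "P Y'" using step[OF less.prems(2) Y(1) calculation] swapped_cases by blast
    moreover have "inversions Y' Z \<subset> inversions Y Z"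
    proof -
      have "inversions Y' Z \<subseteq> inversions Y Z"
      proof (intro subsetI)
        fix z assume z: "z \<in> inversions Y' Z"
        obtain p q where pq: "z = (p, q)" by fastforce
        have h: "p \<in> lines" "q \<in> lines" "Y' p < Y' q" "Z q < Z p" using z pq
          by (auto simp: inversions_def)
        have "{p, q} \<noteq> {k1, k2}"
        proof
          assume "{p, q} = {k1, k2}"
          then show False using h kk Y'v by (auto simp: doubleton_eq_iff)
        qed
        then show "z \<in> inversions Y Z" using cmp[OF h(1,2)] h pq by (auto simp: inversions_def)
      qed
      moreover have "(k1, k2) \<notin> inversions Y' Z" using kk Y'v by (auto simp: inversions_def)
      ultimately show ?thesis using k(1) by blast
    qed
    then have "card (inversions Y' Z) < card (inversions Y Z)"
      by (intro psubset_card_mono finite_inversions)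
    ultimately show ?thesis using less.hyps by blast
  qed
qed

end

section \<open>Contacts of drawn lists and R-equivalence of drawings\<close>

context diagonal_grid begin

definition draw_list :: "(nat \<Rightarrow> real) \<Rightarrow> (nat \<Rightarrow> real) \<Rightarrow> point set list" where
  "draw_list X Y = map (draw X Y) [1..<Suc n]"

lemma length_draw_list [simp]: "length (draw_list X Y) = n"
  by (simp add: draw_list_def)

lemma nth_draw_list: "k < n \<Longrightarrow> draw_list X Y ! k = draw X Y (Suc k)"
  by (simp add: draw_list_def del: upt_Suc)

lemma set_draw_list: "set (draw_list X Y) = draw X Y ` {1..n}"
  by (auto simp: draw_list_def simp del: upt_Suc)

lemma drawing_iff: "drawing X Y \<longleftrightarrow> diagonal_grid.vdrawing n lf rt tp bt Y \<and>
  diagonal_grid.vdrawing n tp bt lf rt X"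
proof -
  interpret r: diagonal_grid n tp bt lf rt by (rule reflect)
  have "r.horiz = vert" by (auto simp: r.horiz_def vert_def)
  then show ?thesis by (auto simp: drawing_def vdrawing_def r.vdrawing_def lines_def r.lines_def)
qed

lemma draw_coords:
  assumes "drawing X Y" "i \<in> {1..n}"
  shows "is_rect (draw X Y i)" "lc (draw X Y i) = X (lf i)" "rc (draw X Y i) = X (rt i)"
    "tc (draw X Y i) = Y (tp i)" "bc (draw X Y i) = Y (bt i)"
proof -
  have "X (lf i) < X (rt i)" "Y (tp i) < Y (bt i)" using assms by (auto simp: drawing_def)
  then show "is_rect (draw X Y i)" "lc (draw X Y i) = X (lf i)" "rc (draw X Y i) = X (rt i)"
    "tc (draw X Y i) = Y (tp i)" "bc (draw X Y i) = Y (bt i)"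
    unfolding draw_def by (auto simp: is_rect_rect coords_rect)
qed

lemma lf_rt_eq:
  assumes "drawing X Y" "i \<in> {1..n}" "j \<in> {1..n}" "X (rt i) = X (lf j)" shows "rt i = lf j"
proof -
  have "lf j \<in> {0, n} \<union> {k. vert k}" "rt i \<in> {0, n} \<union> {k. vert k}"
    using lf_vert(1)[OF assms(3) refl] rt_vert(1)[OF assms(2) refl] bounds[OF assms(2)]
      by (auto simp: le_less)
  then show ?thesis using assms unfolding drawing_def by (meson inj_onD)
qed

lemma left_of_draw:
  assumes d: "drawing X Y" and ij: "i \<in> {1..n}" "j \<in> {1..n}"
  shows "left_of (draw X Y i) (draw X Y j) \<longleftrightarrow> (i, j) \<in> hcontacts Y"
proof -
  have e: "X (rt i) = X (lf j) \<longleftrightarrow> rt i = lf j" using lf_rt_eq[OF d ij] by metis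
  note K = draw_coords[OF d ij(1)] and L = draw_coords[OF d ij(2)]
  show ?thesis unfolding left_of_is_rect[OF K(1) L(1)] K L e hcontacts_def using ij by auto
qed

lemma below_draw:
  assumes d: "drawing X Y" and ij: "i \<in> {1..n}" "j \<in> {1..n}"
  shows "below (draw X Y i) (draw X Y j) \<longleftrightarrow> (j, i) \<in> diagonal_grid.hcontacts n tp bt lf rt X"
proof -
  interpret r: diagonal_grid n tp bt lf rt by (rule reflect)
  have "r.drawing Y X" using d drawing_iff r.drawing_iff by blast
  then have e: "Y (tp i) = Y (bt j) \<longleftrightarrow> bt j = tp i" using r.lf_rt_eq[OF _ ij(2,1), of Y X] by metis
  note K = draw_coords[OF d ij(1)] and L = draw_coords[OF d ij(2)]
  show ?thesis unfolding below_is_rect[OF K(1) L(1)] K L e r.hcontacts_def using ij by auto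
qed

lemma h_contacts_draw:
  assumes d: "drawing X Y"
  shows "h_contacts (draw_list X Y) = {(i, j). (Suc i, Suc j) \<in> hcontacts Y}"
proof -
  have "(i, j) \<in> h_contacts (draw_list X Y) \<longleftrightarrow> (Suc i, Suc j) \<in> hcontacts Y" for i j
  proof (cases "i < n \<and> j < n")
    case True
    then show ?thesis using left_of_draw[OF d, of "Suc i" "Suc j"]
      by (simp add: h_contacts_def nth_draw_list)
  next
    case False
    then show ?thesis by (auto simp: h_contacts_def hcontacts_def)
  qed
  then show ?thesis by auto
qed

lemma v_contacts_draw:
  assumes d: "drawing X Y"
  shows "v_contacts (draw_list X Y) = {(i, j). (Suc j, Suc i) \<in> diagonal_grid.hcontacts n tp bt lf
    rt X}"
proof -
  interpret r: diagonal_grid n tp bt lf rt by (rule reflect)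
  have "(i, j) \<in> v_contacts (draw_list X Y) \<longleftrightarrow> (Suc j, Suc i) \<in> r.hcontacts X" for i j
  proof (cases "i < n \<and> j < n")
    case True
    then show ?thesis using below_draw[OF d, of "Suc i" "Suc j"]
      by (simp add: v_contacts_def nth_draw_list)
  next
    case False
    then show ?thesis by (auto simp: v_contacts_def r.hcontacts_def)
  qed
  then show ?thesis by auto
qed

lemma labeled_draw: "drawing X Y \<Longrightarrow> labeled_rectangulation (draw_list X Y)"
  using draw_rectangulation draw_tiling(2) unfolding labeled_rectangulation_def set_draw_list
  by (auto simp: draw_list_def distinct_map atLeastLessThanSuc_atLeastAtMost simp del: upt_Suc)

text \<open>Translates between labels, which start at 1, and list indices, which start at 0.\<close>

lemma shift_insert:
  assumes "S = insert (a, d) (T - {(b, c)})" "0 < a" "0 < b" "0 < c" "0 < d"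
  shows "{(i, j). (Suc i, Suc j) \<in> S} = insert (a - 1, d - 1) ({(i, j).
    (Suc i, Suc j) \<in> T} - {(b - 1, c - 1)})"
  using assms by auto

lemma shift_insert_swap:
  assumes "S = insert (a, d) (T - {(b, c)})" "0 < a" "0 < b" "0 < c" "0 < d"
  shows "{(i, j). (Suc j, Suc i) \<in> S} = insert (d - 1, a - 1) ({(i, j).
    (Suc j, Suc i) \<in> T} - {(c - 1, b - 1)})"
  using assms by auto

lemma slides_wall_slide:
  assumes d: "drawing X Y" "drawing X Z" and s: "slides Y Z"
  shows "wall_slide (draw_list X Y) (draw_list X Z)"
proof -
  obtain a b c e where abce: "a \<in> {1..n}" "b \<in> {1..n}" "c \<in> {1..n}" "e \<in> {1..n}"
    "tp a = bt b" "tp c = bt e" "rt a = rt b" "lf c = lf e"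
     "(a, c) \<in> hcontacts Y" "(b, c) \<in> hcontacts Y" "(b, e) \<in> hcontacts Y"
     "hcontacts Z = insert (a, e) (hcontacts Y - {(b, c)})" using s unfolding slides_def by blast
  have lt: "X (lf i) < X (rt i)" if "i \<in> {1..n}" for i using d(1) that by (auto simp: drawing_def)
  have v: "{(a - 1, b - 1), (c - 1, e - 1)} \<subseteq> v_contacts (draw_list X Y)"
    using abce lt[of a] lt[of b] lt[of c] lt[of e]
    unfolding v_contacts_draw[OF d(1)] diagonal_grid.hcontacts_def[OF reflect] by auto
  have h: "{(a - 1, c - 1), (b - 1, c - 1), (b - 1, e - 1)} \<subseteq> h_contacts (draw_list X Y)"
    using abce unfolding h_contacts_draw[OF d(1)] by auto
  have "v_contacts (draw_list X Z) = v_contacts (draw_list X Y)"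
    by (simp add: v_contacts_draw[OF d(1)] v_contacts_draw[OF d(2)])
  moreover have "h_contacts (draw_list X Z) = insert (a - 1, e - 1) (h_contacts (draw_list X Y) -
    {(b - 1, c - 1)})"
    unfolding h_contacts_draw[OF d(1)] h_contacts_draw[OF d(2)]
    by (rule shift_insert[OF abce(12)]) (use abce in auto)
  ultimately show ?thesis
    unfolding wall_slide_def using v h labeled_draw[OF d(1)] labeled_draw[OF d(2)] by auto
qed

text \<open>Vertical contacts are written from the lower tile to the upper one, against the
  direction of the rows. So the four tiles enter the pattern of \<open>wall_slide\<close> in the
  order \<open>e\<close>, \<open>c\<close>, \<open>b\<close>, \<open>a\<close>.\<close>

lemma slides_wall_slide_reflected:
  assumes d: "drawing X Y" "drawing Z Y" and s: "diagonal_grid.slides n tp bt lf rt X Z"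
  shows "wall_slide (draw_list X Y) (draw_list Z Y)"
proof -
  interpret r: diagonal_grid n tp bt lf rt by (rule reflect)
  obtain a b c e where abce: "a \<in> {1..n}" "b \<in> {1..n}" "c \<in> {1..n}" "e \<in> {1..n}"
    "lf a = rt b" "lf c = rt e" "bt a = bt b" "tp c = tp e"
     "(a, c) \<in> r.hcontacts X" "(b, c) \<in> r.hcontacts X" "(b, e) \<in> r.hcontacts X"
     "r.hcontacts Z = insert (a, e) (r.hcontacts X - {(b, c)})" using s unfolding r.slides_def
       by blast
  have lt: "Y (tp i) < Y (bt i)" if "i \<in> {1..n}" for i using d(1) that by (auto simp: drawing_def)
  have v: "{(e - 1, c - 1), (b - 1, a - 1)} \<subseteq> h_contacts (draw_list X Y)"
    using abce lt[of a] lt[of b] lt[of c] lt[of e]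
    unfolding h_contacts_draw[OF d(1)] hcontacts_def by auto
  have h: "{(e - 1, b - 1), (c - 1, b - 1), (c - 1, a - 1)} \<subseteq> v_contacts (draw_list X Y)"
    using abce unfolding v_contacts_draw[OF d(1)] by auto
  have "h_contacts (draw_list Z Y) = h_contacts (draw_list X Y)"
    by (simp add: h_contacts_draw[OF d(1)] h_contacts_draw[OF d(2)])
  moreover have "v_contacts (draw_list Z Y) = insert (e - 1, a - 1) (v_contacts (draw_list X Y) -
    {(c - 1, b - 1)})"
    unfolding v_contacts_draw[OF d(1)] v_contacts_draw[OF d(2)]
    by (rule shift_insert_swap[OF abce(12)]) (use abce in auto)
  ultimately show ?thesis
    unfolding wall_slide_def using v h labeled_draw[OF d(1)] labeled_draw[OF d(2)] by auto
qed

text \<open>The horizontal walls are moved first, with \<open>X\<close> fixed; then the vertical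
  walls are moved in the reflected grid, with \<open>Y'\<close> fixed.\<close>

lemma R_equivalent_drawings:
  assumes d: "drawing X Y" and d': "drawing X' Y'"
  shows "R_equivalent (draw_list X Y) (draw_list X' Y')"
proof -
  interpret r: diagonal_grid n tp bt lf rt by (rule reflect)
  let ?r = "\<lambda>xs ys. labeled_equiv xs ys \<or> wall_slide xs ys"
  have v: "vdrawing Y" "r.vdrawing X" "vdrawing Y'" "r.vdrawing X'" using d d' drawing_iff by auto
  have "equivclp ?r (draw_list X Y) (draw_list X Y')"
  proof (rule hcontacts_reachable[OF v(1,3),
    where P = "\<lambda>Z. equivclp ?r (draw_list X Y) (draw_list X Z)"])
    fix Z Z' assume IH: "equivclp ?r (draw_list X Y) (draw_list X Z)"
      and z: "vdrawing Z" "vdrawing Z'"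
      and "hcontacts Z = hcontacts Z' \<or> slides Z Z' \<or> slides Z' Z"
    moreover have dz: "drawing X Z" "drawing X Z'" using z v drawing_iff by auto
    ultimately have "?r (draw_list X Z) (draw_list X Z') \<or> ?r (draw_list X Z') (draw_list X Z)"
      using slides_wall_slide labeled_draw h_contacts_draw v_contacts_draw
        by (auto simp: labeled_equiv_def)
    then show "equivclp ?r (draw_list X Y) (draw_list X Z')" by (rule equivclp_into_equivclp[OF IH])
  qed simp
  also have "equivclp ?r (draw_list X Y') (draw_list X' Y')"
  proof (rule r.hcontacts_reachable[OF v(2,4),
    where P = "\<lambda>Z. equivclp ?r (draw_list X Y') (draw_list Z Y')"])
    fix Z Z' assume IH: "equivclp ?r (draw_list X Y') (draw_list Z Y')"
      and z: "r.vdrawing Z" "r.vdrawing Z'"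
      and "r.hcontacts Z = r.hcontacts Z' \<or> r.slides Z Z' \<or> r.slides Z' Z"
    moreover have dz: "drawing Z Y'" "drawing Z' Y'" using z v drawing_iff by auto
    ultimately have "?r (draw_list Z Y') (draw_list Z' Y') \<or> ?r (draw_list Z' Y') (draw_list Z Y')"
      using slides_wall_slide_reflected labeled_draw h_contacts_draw v_contacts_draw
        by (auto simp: labeled_equiv_def)
    then show "equivclp ?r (draw_list X Y') (draw_list Z' Y')"
      by (rule equivclp_into_equivclp[OF IH])
  qed simp
  finally show ?thesis by (simp add: R_equivalent_def)
qed

section \<open>The anti-diagonal drawing\<close>

definition pos :: "nat \<Rightarrow> nat" where
  "pos i = Suc (card {j. prec j i})"

lemma finite_prec: "finite {j. prec j i}"
  by (rule finite_subset[of _ "{1..n}"]) (use prec_range in auto)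

lemma pos_less: "prec i j \<Longrightarrow> pos i < pos j"
  unfolding pos_def using prec_trans[of _ i j] prec_irrefl[of i] finite_prec
  by (auto intro!: psubset_card_mono)

lemma pos_less_iff: "i \<in> {1..n} \<Longrightarrow> j \<in> {1..n} \<Longrightarrow> pos i < pos j \<longleftrightarrow> prec i j"
  using pos_less[of i j] pos_less[of j i] prec_total[of i j] by (cases "i = j") auto

lemma pos_range:
  assumes "i \<in> {1..n}" shows "1 \<le> pos i" "pos i \<le> n"
proof -
  have "{j. prec j i} \<subseteq> {1..n} - {i}" using prec_range by auto
  then have "card {j. prec j i} \<le> n - 1" using card_mono[of "{1..n} - {i}"] assms by auto
  then show "1 \<le> pos i" "pos i \<le> n" using n_pos by (auto simp: pos_def)
qed

lemma pos_inj: "i \<in> {1..n} \<Longrightarrow> j \<in> {1..n} \<Longrightarrow> pos i = pos j \<Longrightarrow> i = j"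
  using pos_less[of i j] pos_less[of j i] prec_total[of i j] by fastforce

text \<open>Reflection reverses \<open>prec\<close>. The complementary rank is what turns heights
  measured downwards into positions along the anti-diagonal, which runs upwards.\<close>

lemma pos_reflect:
  assumes i: "i \<in> {1..n}" shows "diagonal_grid.pos n tp bt lf rt i + pos i = n + 1"
proof -
  have "{1..n} = insert i ({j. prec j i} \<union> {j. prec i j})" using prec_total[of _ i] prec_range i
    by fast
  moreover have "finite {j. prec i j}"
    by (rule finite_subset[of _ "{1..n}"]) (use prec_range in auto)
  moreover have "{j. prec j i} \<inter> {j. prec i j} = {}" using prec_asym by auto
  moreover have "i \<notin> {j. prec j i} \<union> {j. prec i j}" using prec_irrefl by auto
  ultimately have "n = Suc (card {j. prec j i} + card {j. prec i j})"
    by (metis card_Un_disjoint card_atLeastAtMost card_insert_disjoint diff_Suc_1 finite_UnI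
      finite_prec)
  then show ?thesis by (simp add: diagonal_grid.pos_def[OF reflect] reflect_prec pos_def)
qed

text \<open>Tile \<open>i\<close> is to contain the piece of the anti-diagonal between
  \<open>(pos i - 1) / n\<close> and \<open>pos i / n\<close>. All tiles to the left of a wall
  precede those to its right, so the largest rank on the left is an admissible position for the
  wall.\<close>

definition anti_x :: "nat \<Rightarrow> real" where
  "anti_x k = (if k = 0 then 0 else if k = n then 1 else real (Max (pos ` {i \<in> {1..n}. rt i =
    k})) / real n)"

lemma anti_x_vert:
  assumes "vert k"
  obtains i where "i \<in> {1..n}" "rt i = k" "anti_x k = real (pos i) / real n" "pos i < n"
    "\<And>j. j \<in> {1..n} \<Longrightarrow> rt j = k \<Longrightarrow> pos j \<le> pos i"
proof -
  let ?S = "{i \<in> {1..n}. rt i = k}"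
  have "k \<in> ?S" using assms by (auto simp: vert_def)
  then have "finite (pos ` ?S)" "pos ` ?S \<noteq> {}" by auto
  then have "Max (pos ` ?S) \<in> pos ` ?S" and mx: "\<And>j. j \<in> ?S \<Longrightarrow> pos j \<le> Max (pos ` ?S)"
    by (blast intro: Max_in, simp)
  then obtain i where i: "i \<in> ?S" "Max (pos ` ?S) = pos i" by auto
  have "pos i < n"
  proof -
    have k: "k + 1 \<in> {1..n}" "lf (k + 1) = k" using assms by (auto simp: vert_def)
    then have "prec i (k + 1)" using i(1) by (intro H_prec) auto
    then show ?thesis using pos_less[of i "k + 1"] pos_range[OF k(1)] by auto
  qed
  then show thesis using that[of i] i mx assms by (auto simp: anti_x_def vert_def)
qed

lemma anti_x_bounds:
  assumes i: "i \<in> {1..n}"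
  shows "anti_x (lf i) \<le> (real (pos i) - 1) / real n" "real (pos i) / real n \<le> anti_x (rt i)"
proof -
  show "anti_x (lf i) \<le> (real (pos i) - 1) / real n"
  proof (cases "lf i = 0")
    case True
    then show ?thesis using pos_range[OF i] n_pos by (auto simp: anti_x_def)
  next
    case False
    then have "vert (lf i)" using lf_vert(1)[OF i refl] by auto
    then obtain j where j: "j \<in> {1..n}" "rt j = lf i" "anti_x (lf i) = real (pos j) / real n"
      by (rule anti_x_vert)
    have "pos j < pos i" using pos_less H_prec[OF j(2,1) i] by auto
    then show ?thesis using j n_pos by (simp add: divide_right_mono)
  qed
  show "real (pos i) / real n \<le> anti_x (rt i)"
  proof (cases "rt i = n")
    case True
    then show ?thesis using pos_range[OF i] n_pos by (auto simp: anti_x_def)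
  next
    case False
    then have "vert (rt i)" using rt_vert(1)[OF i refl] bounds[OF i] by auto
    then obtain j where "anti_x (rt i) = real (pos j) / real n" "pos i \<le> pos j"
      using i by (metis anti_x_vert)
    then show ?thesis using n_pos by (simp add: divide_right_mono)
  qed
qed

lemma vdrawing_anti_x: "diagonal_grid.vdrawing n tp bt lf rt anti_x"
proof -
  interpret r: diagonal_grid n tp bt lf rt by (rule reflect)
  have "inj_on anti_x ({0, n} \<union> {k. vert k})"
  proof (rule inj_onI)
    fix p q assume pq: "p \<in> {0, n} \<union> {k. vert k}" "q \<in> {0, n} \<union> {k. vert k}" "anti_x p = anti_x q"
    have e: "anti_x 0 = 0" "anti_x n = 1" using n_pos by (auto simp: anti_x_def)
    have v01: "0 < anti_x k \<and> anti_x k < 1" if k: "vert k" for k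
    proof -
      obtain i where "i \<in> {1..n}" "anti_x k = real (pos i) / real n" "pos i < n" using k
        by (rule anti_x_vert)
      then show ?thesis using pos_range[of i] n_pos by auto
    qed
    have vv: "k = l" if kl: "vert k" "vert l" "anti_x k = anti_x l" for k l
    proof -
      obtain i where i: "i \<in> {1..n}" "rt i = k" "anti_x k = real (pos i) / real n" using kl(1)
        by (rule anti_x_vert)
      obtain j where j: "j \<in> {1..n}" "rt j = l" "anti_x l = real (pos j) / real n" using kl(2)
        by (rule anti_x_vert)
      have "pos i = pos j" using i j kl(3) n_pos by simp
      then show ?thesis using pos_inj[OF i(1) j(1)] i j by simp
    qed
    show "p = q" using pq e v01[of p] v01[of q] vv[of p q] n_pos by auto
  qed
  moreover have "anti_x (lf i) < anti_x (rt i)" if i: "i \<in> {1..n}" for i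
    using anti_x_bounds[OF i] n_pos by (smt (verit) divide_strict_right_mono of_nat_0_less_iff)
  moreover have "r.horiz = vert" by (auto simp: r.horiz_def vert_def)
  ultimately show ?thesis using n_pos by (auto simp: r.vdrawing_def r.lines_def anti_x_def)
qed

definition anti_y :: "nat \<Rightarrow> real" where "anti_y = diagonal_grid.anti_x n tp bt lf rt"

lemma drawing_anti: "drawing anti_x anti_y"
  using vdrawing_anti_x diagonal_grid.vdrawing_anti_x[OF reflect]
    by (simp add: drawing_iff anti_y_def)

lemma anti_y_bounds:
  assumes i: "i \<in> {1..n}"
  shows "anti_y (tp i) \<le> 1 - real (pos i) / real n"
    "1 - (real (pos i) - 1) / real n \<le> anti_y (bt i)"
proof -
  interpret r: diagonal_grid n tp bt lf rt by (rule reflect)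
  have "real (r.pos i) + real (pos i) = real n + 1" using pos_reflect[OF i]
    by (metis of_nat_add of_nat_1)
  then have rp: "real (r.pos i) = real n + 1 - real (pos i)" by simp
  have "(real (r.pos i) - 1) / real n = 1 - real (pos i) / real n"
    "real (r.pos i) / real n = 1 - (real (pos i) - 1) / real n"
    unfolding rp using n_pos by (simp_all add: field_simps)
  then show "anti_y (tp i) \<le> 1 - real (pos i) / real n"
    "1 - (real (pos i) - 1) / real n \<le> anti_y (bt i)"
    using r.anti_x_bounds[OF i] by (simp_all add: anti_y_def)
qed

lemma mid_anti:
  assumes i: "i \<in> {1..n}"
  defines "m \<equiv> (real (pos i) - 1 / 2) / real n"
  shows "(m, m) \<in> interior (draw anti_x anti_y i)" "(m, m) \<in> anti_diagonal"
proof -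
  have n: "real n > 0" using n_pos by simp
  have m: "(real (pos i) - 1) / real n < m" "m < real (pos i) / real n"
    using n by (auto simp: m_def divide_strict_right_mono)
  show "(m, m) \<in> interior (draw anti_x anti_y i)"
    using anti_x_bounds[OF i] anti_y_bounds[OF i] m unfolding draw_def mem_interior_rect by linarith
  have "real (pos i) \<ge> 1" "real (pos i) \<le> real n" using pos_range[OF i] by auto
  then show "(m, m) \<in> anti_diagonal" using n unfolding mem_anti_diagonal m_def by auto
qed

text \<open>Each tile contains the middle of its own piece of the anti-diagonal. If \<open>q\<close>
  did not come after \<open>p\<close>, the two tiles would overlap in both directions and hence
  coincide.\<close>

lemma anti_order:
  assumes ij: "prec i j"
    and p: "p \<in> interior (draw anti_x anti_y i) \<inter> anti_diagonal"
      "q \<in> interior (draw anti_x anti_y j) \<inter> anti_diagonal"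
  shows "fst p < fst q"
proof (rule ccontr)
  assume n: "\<not> ?thesis"
  have i: "i \<in> {1..n}" "j \<in> {1..n}" using prec_range[OF ij] by auto
  let ?m = "\<lambda>i. (real (pos i) - 1 / 2) / real n"
  have m: "?m i < ?m j" using pos_less[OF ij] n_pos by (simp add: divide_strict_right_mono)
  obtain x y where xy: "p = (x, x)" "q = (y, y)" using p mem_anti_diagonal
    by (metis Int_iff surj_pair)
  have yx: "y \<le> x" using n xy by auto
  let ?K = "draw anti_x anti_y i" and ?L = "draw anti_x anti_y j"
  note K = draw_coords(1)[OF drawing_anti i(1)] and L = draw_coords(1)[OF drawing_anti i(2)]
  have "?K = ?L"
  proof (rule tiling_disjoint[OF draw_tiling(1)[OF drawing_anti]])
    show "?K \<in> draw anti_x anti_y ` {1..n}" "?L \<in> draw anti_x anti_y ` {1..n}" using i by auto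
    have "lc ?K < ?m i" "tc ?K < 1 - ?m i" "?m i < rc ?K" "1 - ?m i < bc ?K"
      using mid_anti(1)[OF i(1)] by (auto simp: mem_interior_is_rect[OF K])
    moreover have "lc ?L < ?m j" "tc ?L < 1 - ?m j" "?m j < rc ?L" "1 - ?m j < bc ?L"
      using mid_anti(1)[OF i(2)] by (auto simp: mem_interior_is_rect[OF L])
    moreover have "lc ?K < x" "x < rc ?K" "tc ?K < 1 - x" "1 - x < bc ?K" using p(1) unfolding xy
      by (auto simp: mem_interior_is_rect[OF K])
    moreover have "lc ?L < y" "y < rc ?L" "tc ?L < 1 - y" "1 - y < bc ?L" using p(2) unfolding xy
      by (auto simp: mem_interior_is_rect[OF L])
    ultimately show "lc ?K < rc ?L" "lc ?L < rc ?K" "tc ?K < bc ?L" "tc ?L < bc ?K" using m yx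
      by linarith+
  qed
  then have "i = j" using draw_tiling(2)[OF drawing_anti] i by (meson inj_onD)
  then show False using ij prec_irrefl by simp
qed

lemma sorted_list_exists:
  obtains p where "distinct p" "set p = {1..n}" "sorted_wrt prec p"
proof -
  define p where "p = sort_key pos [1..<Suc n]"
  have d: "distinct p" "set p = {1..n}" by (auto simp: p_def)
  have "sorted (map pos p)" by (simp add: p_def)
  then have "sorted_wrt (\<lambda>x y. pos x \<le> pos y) p" by (simp add: sorted_map)
  then have le: "pos (p ! i) \<le> pos (p ! j)" if "i < j" "j < length p" for i j
    using that by (simp add: sorted_wrt_iff_nth_less)
  have "sorted_wrt prec p"
    unfolding sorted_wrt_iff_nth_less
  proof (intro allI impI)
    fix i j assume ij: "i < j" "j < length p"
    then have m: "p ! i \<in> {1..n}" "p ! j \<in> {1..n}" using d(2) nth_mem[of i p] nth_mem[of j p]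
      by auto
    have "p ! i \<noteq> p ! j" using d(1) ij by (simp add: nth_eq_iff_index_eq)
    then have "pos (p ! i) \<noteq> pos (p ! j)" using pos_inj[OF m] by blast
    then show "prec (p ! i) (p ! j)" using le[OF ij] pos_less_iff[OF m] by linarith
  qed
  then show thesis using that d by blast
qed

end

section \<open>The Baxter permutation as a sorted list\<close>

lemma representsD:
  assumes "represents R n lf rt tp bt s"
  shows "diagonal_grid n lf rt tp bt" "s 0 = 0" "s n = 1" "\<And>i j. i < j \<Longrightarrow> j \<le> n \<Longrightarrow> s i < s j"
    "R = diagonal_grid.draw lf rt tp bt s s ` {1..n}" "diagonal_grid.drawing n lf rt tp bt s s"
proof -
  show g: "diagonal_grid n lf rt tp bt" and s: "s 0 = 0" "s n = 1" "\<And>i j. i < j \<Longrightarrow> j \<le> n \<Longrightarrow> s i < s j"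
    using assms by (auto simp: represents_def)
  interpret diagonal_grid n lf rt tp bt by (rule g)
  show "R = draw s s ` {1..n}" using assms by (auto simp: represents_def draw_def)
  have inj: "inj_on s {..n}" by (rule inj_onI) (metis atMost_iff s(3) less_irrefl linorder_neqE_nat)
  show "drawing s s" unfolding drawing_def
  proof (intro conjI ballI)
    fix i assume i: "i \<in> {1..n}"
    then have "lf i < rt i" "tp i < bt i" using diag[OF i] by auto
    then show "s (lf i) < s (rt i)" "s (tp i) < s (bt i)" using s(3) bounds[OF i] by auto
  next
    show "inj_on s ({0, n} \<union> {k. vert k})" by (rule inj_on_subset[OF inj]) (auto simp: vert_def)
    show "inj_on s ({0, n} \<union> {k. horiz k})" by (rule inj_on_subset[OF inj]) (auto simp: horiz_def)
  qed (use s in auto)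
qed

lemma sorted_wrt_unique:
  assumes "sorted_wrt P xs" "sorted_wrt P ys" "distinct xs" "distinct ys" "set xs = set ys"
    and "\<And>x y. x \<in> set xs \<Longrightarrow> y \<in> set xs \<Longrightarrow> P x y \<Longrightarrow> P y x \<Longrightarrow> False"
  shows "xs = ys"
  using assms
proof (induction xs arbitrary: ys)
  case Nil then show ?case by simp
next
  case (Cons x xs)
  then obtain y ys' where ys: "ys = y # ys'" by (cases ys) auto
  have "x = y"
  proof (rule ccontr)
    assume ne: "x \<noteq> y"
    then have "y \<in> set xs" "x \<in> set ys'" using Cons.prems(5) ys by auto
    then have "P x y" "P y x" using Cons.prems(1,2) ys by auto
    then show False using Cons.prems(6)[of x y] \<open>y \<in> set xs\<close> by auto
  qed
  moreover have "xs = ys'"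
  proof (rule Cons.IH)
    show "set xs = set ys'" using Cons.prems(3-5) ys \<open>x = y\<close> by auto
    show "False" if "u \<in> set xs" "v \<in> set xs" "P u v" "P v u" for u v
      using Cons.prems(6)[of u v] that by auto
  qed (use Cons.prems ys in auto)
  ultimately show ?case using ys by simp
qed

lemma met_in_order_unique:
  assumes "met_in_order D xs" "met_in_order D ys" "distinct xs" "distinct ys" "set xs = set ys"
    and ne: "\<And>K. K \<in> set xs \<Longrightarrow> interior K \<inter> D \<noteq> {}"
  shows "xs = ys"
proof (rule sorted_wrt_unique)
  show "sorted_wrt (\<lambda>K L. \<forall>p\<in>interior K \<inter> D. \<forall>q\<in>interior L \<inter> D. fst p < fst q) xs"
    "sorted_wrt (\<lambda>K L. \<forall>p\<in>interior K \<inter> D. \<forall>q\<in>interior L \<inter> D. fst p < fst q) ys"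
    using assms by (auto simp: met_in_order_def)
  fix K L assume "K \<in> set xs" "L \<in> set xs"
    and o: "\<forall>p\<in>interior K \<inter> D. \<forall>q\<in>interior L \<inter> D. fst p < fst q"
      "\<forall>p\<in>interior L \<inter> D. \<forall>q\<in>interior K \<inter> D. fst p < fst q"
  then obtain p q where "p \<in> interior K \<inter> D" "q \<in> interior L \<inter> D" using ne by (meson ex_in_conv)
  then have "fst p < fst q" "fst q < fst p" using o by blast+
  then show False by simp
qed (use assms in auto)

lemma represents_mono:
  assumes "represents R n lf rt tp bt s" "i \<le> j" "j \<le> n"
  shows "s i \<le> s j"
  using representsD(4)[OF assms(1), of i j] assms(2,3) by (cases "i = j") auto

lemma represents_meets_diagonal:
  assumes r: "represents R n lf rt tp bt s" and i: "i \<in> {1..n}"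
  shows "(x, 1 - x) \<in> interior (diagonal_grid.draw lf rt tp bt s s i) \<longleftrightarrow> s (i - 1) < x \<and> x < s i"
proof -
  note R = representsD[OF r]
  interpret diagonal_grid n lf rt tp bt by (rule R)
  have "max (s (lf i)) (s (tp i)) = s (i - 1)"
  proof -
    have "lf i \<le> i - 1" "tp i \<le> i - 1" "i - 1 \<le> n" using diag[OF i] i by auto
    then have "s (lf i) \<le> s (i - 1)" "s (tp i) \<le> s (i - 1)" using represents_mono[OF r] by blast+
    moreover have "lf i = i - 1 \<or> tp i = i - 1" using max_lf_tp[OF i] by linarith
    ultimately show ?thesis by auto
  qed
  moreover have "min (s (rt i)) (s (bt i)) = s i"
  proof -
    have "s i \<le> s (rt i)" "s i \<le> s (bt i)"
      using diag[OF i] bounds[OF i] represents_mono[OF r] by blast+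
    moreover have "rt i = i \<or> bt i = i" using min_rt_bt[OF i] by linarith
    ultimately show ?thesis by auto
  qed
  ultimately show ?thesis unfolding draw_def mem_interior_rect by auto
qed

lemma represents_diagonal_point:
  assumes r: "represents R n lf rt tp bt s" and i: "i \<in> {1..n}"
  shows "interior (diagonal_grid.draw lf rt tp bt s s i) \<inter> main_diagonal = {(x, 1 - x) |x.
    s (i - 1) < x \<and> x < s i}"
    "s (i - 1) < s i" "0 \<le> s (i - 1)" "s i \<le> 1"
proof -
  note R = representsD[OF r]
  have si: "s (i - 1) < s i" using R(4)[of "i - 1" i] i by auto
  have "i - 1 \<le> n" "i \<le> n" using i by auto
  then have s0: "0 \<le> s (i - 1)" and s1: "s i \<le> 1"
    using represents_mono[OF r, of 0 "i - 1"] represents_mono[OF r, of i n] R(2,3) by auto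
  show "interior (diagonal_grid.draw lf rt tp bt s s i) \<inter> main_diagonal = {(x, 1 - x) |x.
    s (i - 1) < x \<and> x < s i}"
    using represents_meets_diagonal[OF r i] s0 s1 by (force simp: mem_main_diagonal)
  show "s (i - 1) < s i" "0 \<le> s (i - 1)" "s i \<le> 1" by fact+
qed

lemma met_in_order_represents:
  assumes r: "represents R n lf rt tp bt s"
  shows "met_in_order main_diagonal (diagonal_grid.draw_list n lf rt tp bt s s)"
    "distinct (diagonal_grid.draw_list n lf rt tp bt s s)"
    "set (diagonal_grid.draw_list n lf rt tp bt s s) = R"
proof -
  note R = representsD[OF r]
  interpret diagonal_grid n lf rt tp bt by (rule R)
  show "set (draw_list s s) = R" using set_draw_list R(5) by simp
  show "distinct (draw_list s s)" using labeled_draw[OF R(6)]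
    by (simp add: labeled_rectangulation_def)
  show "met_in_order main_diagonal (draw_list s s)"
    unfolding met_in_order_def sorted_wrt_iff_nth_less length_draw_list
  proof (intro allI impI ballI)
    fix i j p q assume ij: "i < j" "j < n" 
      and p: "p \<in> interior (draw_list s s ! i) \<inter> main_diagonal"
        "q \<in> interior (draw_list s s ! j) \<inter> main_diagonal"
    have I: "Suc i \<in> {1..n}" "Suc j \<in> {1..n}" using ij by auto
    have "fst p < s (Suc i)" "s j < fst q"
      using p represents_diagonal_point(1)[OF r I(1)] represents_diagonal_point(1)[OF r I(2)] ij
        by (auto simp: nth_draw_list)
    moreover have "s (Suc i) \<le> s j" using R(4)[of "Suc i" j] ij by (cases "Suc i = j") auto
    ultimately show "fst p < fst q" by linarith
  qed
qed

lemma meets_diagonal_represents: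
  assumes r: "represents R n lf rt tp bt s" and K: "K \<in> R"
  shows "interior K \<inter> main_diagonal \<noteq> {}"
proof -
  obtain i where i: "i \<in> {1..n}" "K = diagonal_grid.draw lf rt tp bt s s i"
    using K representsD(5)[OF r] by auto
  have "((s (i - 1) + s i) / 2, 1 - (s (i - 1) + s i) / 2) \<in> interior K \<inter> main_diagonal"
    unfolding i(2) represents_diagonal_point(1)[OF r i(1)]
      using represents_diagonal_point(2)[OF r i(1)]
    by (intro CollectI exI[of _ "(s (i - 1) + s i) / 2"]) auto
  then show ?thesis by blast
qed

lemma diagonal_list_represents:
  assumes r: "represents R n lf rt tp bt s"
    and xs: "set xs = R" "distinct xs" "met_in_order main_diagonal xs"
  shows "xs = diagonal_grid.draw_list n lf rt tp bt s s"
  using met_in_order_unique[OF xs(3) met_in_order_represents(1)[OF r] xs(2)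
    met_in_order_represents(2)[OF r]]
    met_in_order_represents(3)[OF r] xs(1) meets_diagonal_represents[OF r] by auto

lemma consecutive_contact:
  assumes r: "represents R n lf rt tp bt s" and k: "0 < k" "k < n"
  shows "left_of (diagonal_grid.draw lf rt tp bt s s k) (diagonal_grid.draw lf rt tp bt s s (Suc k))
    \<or>
    below (diagonal_grid.draw lf rt tp bt s s (Suc k)) (diagonal_grid.draw lf rt tp bt s s k)"
proof -
  note R = representsD[OF r]
  interpret diagonal_grid n lf rt tp bt by (rule R)
  interpret r: diagonal_grid n tp bt lf rt by (rule reflect)
  have kk: "k \<in> {1..n}" "Suc k \<in> {1..n}" using k by auto
  have le: "s i < s j" if "i < j" "j \<le> n" for i j using R(4) that by blast
  show ?thesis
  proof (cases "vert k")
    case True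
    then have "(k, Suc k) \<in> hcontacts s"
      using kk diag[OF kk(1)] diag[OF kk(2)] bounds[OF kk(1)] bounds[OF kk(2)]
      by (auto simp: hcontacts_def vert_def intro!: le)
    then show ?thesis using left_of_draw[OF R(6) kk] by blast
  next
    case False
    then have "horiz k" using vert_or_horiz[OF k] by blast
    then have "(k, Suc k) \<in> r.hcontacts s"
      using kk diag[OF kk(1)] diag[OF kk(2)] bounds[OF kk(1)] bounds[OF kk(2)]
      by (auto simp: r.hcontacts_def horiz_def intro!: le)
    then show ?thesis using below_draw[OF R(6) kk(2,1)] by blast
  qed
qed

text \<open>The reflection exchanging the two diagonals, which keeps left and right.\<close>

definition mirror :: "point set \<Rightarrow> point set" where
  "mirror K = rect (lc K) (rc K) (1 - bc K) (1 - tc K)"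

lemma mirror_tiling:
  assumes R: "tiling R"
  shows "tiling (mirror ` R)" "inj_on mirror R"
    "\<And>K x. K \<in> R \<Longrightarrow> (x, 1 - x) \<in> interior (mirror K) \<longleftrightarrow> (x, x) \<in> interior K"
    "\<And>K L. K \<in> R \<Longrightarrow> L \<in> R \<Longrightarrow> left_of (mirror K) (mirror L) \<longleftrightarrow> left_of K L"
    "\<And>K L. K \<in> R \<Longrightarrow> L \<in> R \<Longrightarrow> below (mirror K) (mirror L) \<longleftrightarrow> below L K"
proof -
  note r = tiling_rect[OF R]
  have A: "finite R" by (rule tiling_finite[OF R])
  have B: "0 \<le> lc K \<and> lc K < rc K \<and> rc K \<le> 1 \<and> 0 \<le> 1 - bc K \<and> 1 - bc K < 1 - tc K \<and> 1 - tc K \<le> 1"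
    if "K \<in> R" for K
    using r[OF that] by auto
  have C: "\<exists>K\<in>R. lc K \<le> x \<and> x \<le> rc K \<and> 1 - bc K \<le> w \<and> w \<le> 1 - tc K"
    if x: "0 \<le> x" "x \<le> 1" "0 \<le> w" "w \<le> 1" for x w
  proof -
    obtain K where "K \<in> R" "lc K \<le> x" "x \<le> rc K" "tc K \<le> 1 - w" "1 - w \<le> bc K" 
      using tiling_cover[OF R, of x "1 - w"] x by auto
    then show ?thesis by (intro bexI[of _ K]) auto
  qed
  have D: "K = L" if "K \<in> R" "L \<in> R" "lc K < x" "x < rc K" "1 - bc K < w" "w < 1 - tc K"
     "lc L < x" "x < rc L" "1 - bc L < w" "w < 1 - tc L" for K L x w
    by (rule tiling_disjoint[OF R that(1,2)]) (use that in linarith)+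
  show "tiling (mirror ` R)" unfolding mirror_def by (rule tilingI(1)) (use A B C D in blast)+
  show "inj_on mirror R" unfolding mirror_def by (rule tilingI(2)) (use A B C D in blast)+
  have m: "is_rect (mirror K)" "lc (mirror K) = lc K" "rc (mirror K) = rc K"
    "tc (mirror K) = 1 - bc K" "bc (mirror K) = 1 - tc K"
    if "K \<in> R" for K using B[OF that] unfolding mirror_def by (auto simp: is_rect_rect coords_rect)
  show "(x, 1 - x) \<in> interior (mirror K) \<longleftrightarrow> (x, x) \<in> interior K" if "K \<in> R" for K x
    unfolding mem_interior_is_rect[OF r(1)[OF that]] mem_interior_is_rect[OF m(1)[OF that]] m[OF
      that] by auto
  show "left_of (mirror K) (mirror L) \<longleftrightarrow> left_of K L" if "K \<in> R" "L \<in> R" for K L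
    unfolding left_of_is_rect[OF m(1)[OF that(1)] m(1)[OF that(2)]] left_of_is_rect[OF r(1)[OF
      that(1)] r(1)[OF that(2)]]
      m[OF that(1)] m[OF that(2)] by auto
  show "below (mirror K) (mirror L) \<longleftrightarrow> below L K" if "K \<in> R" "L \<in> R" for K L
    unfolding below_is_rect[OF m(1)[OF that(1)] m(1)[OF that(2)]] below_is_rect[OF r(1)[OF that(2)]
      r(1)[OF that(1)]]
      m[OF that(1)] m[OF that(2)] by auto
qed

text \<open>\<open>mirror\<close> turns an anti-diagonal rectangulation into a diagonal tiling with
  the same order of the tiles, and there neighbours touch at the wall where the diagonal passes
  between them.\<close>

lemma anti_consecutive_contact:
  assumes S: "antidiagonal_rectangulation S"
    and zs: "set zs = S" "distinct zs" "met_in_order anti_diagonal zs"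
    and k: "Suc k < length zs"
  shows "left_of (zs ! k) (zs ! Suc k) \<or> below (zs ! k) (zs ! Suc k)"
proof -
  have T: "tiling S" using S by (simp add: antidiagonal_rectangulation_def rectangulation_tiling)
  note m = mirror_tiling[OF T]
  have iff: "(x, y) \<in> interior (mirror K) \<inter> main_diagonal \<longleftrightarrow> y = 1 - x \<and>
    (x, x) \<in> interior K \<inter> anti_diagonal" if "K \<in> S" for K x y
    using m(3)[OF that, of x] by (auto simp: mem_main_diagonal mem_anti_diagonal)
  have d: "interior K \<inter> main_diagonal \<noteq> {}" if K: "K \<in> mirror ` S" for K
  proof -
    obtain L where L: "L \<in> S" "K = mirror L" using K by blast
    then obtain x y where "(x, y) \<in> interior L \<inter> anti_diagonal" using S
      unfolding antidiagonal_rectangulation_def by fast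
    then have "(x, x) \<in> interior L \<inter> anti_diagonal" by (auto simp: mem_anti_diagonal)
    then have "(x, 1 - x) \<in> interior K \<inter> main_diagonal" using iff[OF L(1), of x "1 - x"] L(2)
      by blast
    then show ?thesis by blast
  qed
  obtain n lf rt tp bt s where r: "represents (mirror ` S) n lf rt tp bt s"
    using diagonal_represents[OF m(1) d] by blast
  interpret diagonal_grid n lf rt tp bt by (rule representsD[OF r])
  have "met_in_order main_diagonal (map mirror zs)"
    unfolding met_in_order_def sorted_wrt_map
  proof (rule sorted_wrt_mono_rel[OF _ zs(3)[unfolded met_in_order_def]], intro ballI)
    fix K L p q assume KL: "K \<in> set zs" "L \<in> set zs"
      and o: "\<forall>p\<in>interior K \<inter> anti_diagonal. \<forall>q\<in>interior L \<inter> anti_diagonal. fst p < fst q"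
      and p: "p \<in> interior (mirror K) \<inter> main_diagonal"
        and q: "q \<in> interior (mirror L) \<inter> main_diagonal"
    have "(fst p, fst p) \<in> interior K \<inter> anti_diagonal" "(fst q, fst q) \<in> interior L \<inter> anti_diagonal"
      using p q iff KL zs(1) by (metis surjective_pairing)+
    then show "fst p < fst q" using o by (metis fst_conv)
  qed
  moreover have "distinct (map mirror zs)" "set (map mirror zs) = mirror ` S"
    using zs m(2) by (auto simp: distinct_map)
  ultimately have e: "map mirror zs = draw_list s s" using diagonal_list_represents[OF r] by blast
  then have l: "length zs = n" by (metis length_draw_list length_map)
  have "mirror (zs ! k) = draw s s (Suc k)" "mirror (zs ! Suc k) = draw s s (Suc (Suc k))"
    using k l nth_draw_list[of k s s] nth_draw_list[of "Suc k" s s] unfolding e[symmetric] by auto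
  then have "left_of (mirror (zs ! k)) (mirror (zs ! Suc k)) \<or>
    below (mirror (zs ! Suc k)) (mirror (zs ! k))"
    using consecutive_contact[OF r, of "Suc k"] k l by simp
  moreover have "zs ! k \<in> S" "zs ! Suc k \<in> S" using k zs(1) nth_mem[of k zs] nth_mem[of "Suc k" zs]
    by auto
  ultimately show ?thesis using m(4,5) by blast
qed

section \<open>Wall identities under slides, and the sorted list\<close>

lemma labeled_is_rect: "labeled_rectangulation xs \<Longrightarrow> i < length xs \<Longrightarrow> is_rect (xs ! i)"
  using tiling_rect(1)[OF rectangulation_tiling] nth_mem unfolding labeled_rectangulation_def
    by blast

text \<open>\<open>f i\<close> is meant as the wall to the right of \<open>i\<close> and
  \<open>g j\<close> as the wall to the left of \<open>j\<close>; \<open>f'\<close> and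
  \<open>g'\<close> are the upper and the lower wall. The three old contacts give
  \<open>f a = g c = f b = g d\<close>, which includes the new contact. Conversely, the contacts
  after the slide give \<open>f b = g d = f a = g c\<close>, which includes the removed one.\<close>

lemma wall_slide_invariant:
  assumes s: "wall_slide xs ys"
  shows "(\<forall>(i, j)\<in>h_contacts xs. f i = (g j :: 'a)) \<and> (\<forall>(i, j)\<in>v_contacts xs. f' i = (g' j :: 'b)) \<longleftrightarrow>
    (\<forall>(i, j)\<in>h_contacts ys. f i = g j) \<and> (\<forall>(i, j)\<in>v_contacts ys. f' i = g' j)"
proof -
  have key: "(\<forall>(i, j)\<in>S. p i = (q j :: 'c)) \<longleftrightarrow> (\<forall>(i, j)\<in>insert (a, d) (S - {(b, c)}). p i = q j)"
    if "{(a, c), (b, c), (b, d)} \<subseteq> S" "a \<noteq> b" "c \<noteq> d" for S p and q :: "nat \<Rightarrow> 'c" and a b c d :: nat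
  proof -
    have S: "(a, c) \<in> S" "(b, c) \<in> S" "(b, d) \<in> S" using that(1) by auto
    show ?thesis
    proof
      assume h: "\<forall>(i, j)\<in>S. p i = q j"
      then have "p a = q c" "p b = q c" "p b = q d" using S by auto
      then show "\<forall>(i, j)\<in>insert (a, d) (S - {(b, c)}). p i = q j" using h by auto
    next
      assume h: "\<forall>(i, j)\<in>insert (a, d) (S - {(b, c)}). p i = q j"
      then have ad: "p a = q d" by auto
      have h': "p i = q j" if "(i, j) \<in> S" "(i, j) \<noteq> (b, c)" for i j using h that by blast
      have "p a = q c" "p b = q d" by (rule h'; use S that(2,3) in simp)+
      then have bc: "p b = q c" using ad by simp
      then show "\<forall>(i, j)\<in>S. p i = q j" using h by auto
    qed
  qed
  have irr: "(i, i) \<notin> h_contacts xs" "(i, i) \<notin> v_contacts xs" for i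
  proof -
    have "labeled_rectangulation xs" using s unfolding wall_slide_def by (rule conjunct1)
    then have r: "is_rect (xs ! i)" if "i < length xs"
      using that by (rule labeled_is_rect)
    show "(i, i) \<notin> h_contacts xs"
      using left_of_is_rect[OF r r] is_rect_less[OF r] by (auto simp: h_contacts_def)
    show "(i, i) \<notin> v_contacts xs"
      using below_is_rect[OF r r] is_rect_less[OF r] by (auto simp: v_contacts_def)
  qed
  obtain a b c d where "({(a, b), (c, d)} \<subseteq> v_contacts xs \<and> {(a, c), (b, c), (b, d)} \<subseteq> h_contacts xs
    \<and> v_contacts ys = v_contacts xs \<and>
         h_contacts ys = insert (a, d) (h_contacts xs - {(b, c)})) \<or>
        ({(a, b), (c, d)} \<subseteq> h_contacts xs \<and> {(a, c), (b, c), (b, d)} \<subseteq> v_contacts xs \<and> h_contacts ys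
          = h_contacts xs \<and>
         v_contacts ys = insert (a, d) (v_contacts xs - {(b,
           c)}))" using s unfolding wall_slide_def by blast
  moreover from this have ne: "a \<noteq> b" "c \<noteq> d" using irr by auto
  ultimately show ?thesis
  proof (elim disjE)
    assume a: "{(a, b), (c, d)} \<subseteq> v_contacts xs \<and> {(a, c), (b, c), (b, d)} \<subseteq> h_contacts xs \<and>
      v_contacts ys = v_contacts xs \<and>
         h_contacts ys = insert (a, d) (h_contacts xs - {(b, c)})"
    show ?thesis using key[of a c b d "h_contacts xs" f g, OF _ ne] a by metis
  next
    assume a: "{(a, b), (c, d)} \<subseteq> h_contacts xs \<and> {(a, c), (b, c), (b, d)} \<subseteq> v_contacts xs \<and>
      h_contacts ys = h_contacts xs \<and>
         v_contacts ys = insert (a, d) (v_contacts xs - {(b, c)})"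
    show ?thesis using key[of a c b d "v_contacts xs" f' g', OF _ ne] a by metis
  qed
qed

lemma R_equivalent_invariant:
  assumes "R_equivalent xs ys"
    and "\<And>i j. (i, j) \<in> h_contacts xs \<Longrightarrow> f i = (g j :: 'a)"
      "\<And>i j. (i, j) \<in> v_contacts xs \<Longrightarrow> f' i = (g' j :: 'b)"
  shows "length ys = length xs" "\<And>i j. (i, j) \<in> h_contacts ys \<Longrightarrow> f i = g j"
    "\<And>i j. (i, j) \<in> v_contacts ys \<Longrightarrow> f' i = g' j"
proof -
  have "length ys = length xs \<and> (\<forall>(i, j)\<in>h_contacts ys. f i = g j) \<and> (\<forall>(i, j)\<in>v_contacts ys. f' i =
    g' j)"
    using assms(1) unfolding R_equivalent_def
  proof (induction rule: equivclp_induct)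
    case base show ?case using assms(2,3) by auto
  next
    case (step y z)
    consider "labeled_equiv y z \<or> labeled_equiv z y" | "wall_slide y z" | "wall_slide z y"
      using step.hyps by blast
    then show ?case
    proof cases
      case 1 then show ?thesis using step.IH by (auto simp: labeled_equiv_def)
    next
      case 2
      then have "length y = length z" unfolding wall_slide_def by blast
      then show ?thesis using step.IH wall_slide_invariant[OF 2, of f g f' g'] by metis
    next
      case 3
      then have "length y = length z" unfolding wall_slide_def by metis
      then show ?thesis using step.IH wall_slide_invariant[OF 3, of f g f' g'] by metis
    qed
  qed
  then show "length ys = length xs" "\<And>i j. (i, j) \<in> h_contacts ys \<Longrightarrow> f i = g j"
    "\<And>i j. (i, j) \<in> v_contacts ys \<Longrightarrow> f' i = g' j"
    by auto
qed

text \<open>The wall identities of the grid of \<open>R\<close> hold for all contacts in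
  \<open>ys\<close>, whichever slides lead there. Neighbours along the anti-diagonal touch, so
  either \<open>rt i = lf j\<close> or \<open>tp i = bt j\<close>, and both say that
  \<open>i\<close> precedes \<open>j\<close>.\<close>

lemma is_baxter_sorted:
  assumes r: "represents R n lf rt tp bt s" and b: "is_baxter_permutation R p"
  shows "distinct p" "set p = {1..n}" "sorted_wrt (diagonal_grid.prec n lf rt tp bt) p"
proof -
  note R = representsD[OF r]
  interpret diagonal_grid n lf rt tp bt by (rule R)
  obtain xs ys where x: "set xs = R" "distinct xs" "met_in_order main_diagonal xs"
     "R_equivalent xs ys" "antidiagonal_rectangulation (set ys)"
     "distinct p" "set p = {1..length ys}" "met_in_order anti_diagonal (map (\<lambda>i. ys ! (i - 1)) p)"
    using b unfolding is_baxter_permutation_def by blast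
  have xs: "xs = draw_list s s" by (rule diagonal_list_represents[OF r x(1-3)])
  have h: "rt (Suc i) = lf (Suc j)" if "(i, j) \<in> h_contacts xs" for i j
    using that unfolding xs h_contacts_draw[OF R(6)] by (auto simp: hcontacts_def)
  have v: "tp (Suc i) = bt (Suc j)" if "(i, j) \<in> v_contacts xs" for i j
    using that unfolding xs v_contacts_draw[OF R(6)]
      by (auto simp: diagonal_grid.hcontacts_def[OF reflect])
  note inv = R_equivalent_invariant[OF x(4), of "\<lambda>i. rt (Suc i)" "\<lambda>j. lf (Suc j)" "\<lambda>i. tp (Suc i)"
    "\<lambda>j. bt (Suc j)", OF h v]
  have ly: "length ys = n" using inv(1) xs by simp
  show "distinct p" "set p = {1..n}" using x ly by auto
  have dy: "distinct ys"
  proof -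
    have "length xs = length ys \<and> distinct ys"
      using x(4,2) unfolding R_equivalent_def
      by (induction rule: equivclp_induct) (auto simp: labeled_equiv_def wall_slide_def
        labeled_rectangulation_def)
    then show ?thesis by blast
  qed
  let ?zs = "map (\<lambda>i. ys ! (i - 1)) p"
  have sz: "set ?zs = set ys"
  proof -
    have "set ?zs = (\<lambda>i. ys ! (i - 1)) ` {1..n}" using x(7) ly by simp
    also have "{1..n} = Suc ` {..<n}"
      by (auto simp: image_iff Suc_le_eq) (metis Suc_le_eq not0_implies_Suc lessThan_iff
      less_Suc_eq_0_disj not_less_zero)
    also have "(\<lambda>i. ys ! (i - 1)) ` Suc ` {..<n} = set ys" using ly
      by (auto simp: set_conv_nth image_image)
    finally show ?thesis .
  qed
  have dz: "distinct ?zs"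
    unfolding distinct_map
  proof (intro conjI inj_onI)
    show "distinct p" by fact
    fix i j assume "i \<in> set p" "j \<in> set p" "ys ! (i - 1) = ys ! (j - 1)"
    then have "i - 1 = j - 1" "i \<ge> 1" "j \<ge> 1" using dy ly x(7) by (auto simp: nth_eq_iff_index_eq)
    then show "i = j" by linarith
  qed
  have "prec (p ! k) (p ! Suc k)" if k: "Suc k < length p" for k
  proof -
    let ?i = "p ! k" and ?j = "p ! Suc k"
    have ij: "?i \<in> {1..n}" "?j \<in> {1..n}" using k x(7) ly nth_mem[of k p] nth_mem[of "Suc k" p]
      by auto
    then have S: "Suc (?i - 1) = ?i" "Suc (?j - 1) = ?j" by auto
    have "left_of (?zs ! k) (?zs ! Suc k) \<or> below (?zs ! k) (?zs ! Suc k)"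
      by (rule anti_consecutive_contact[OF x(5) sz dz x(8)]) (use k in simp)
    then have "left_of (ys ! (?i - 1)) (ys ! (?j - 1)) \<or> below (ys ! (?i - 1)) (ys ! (?j - 1))"
      using k by simp
    then have "(?i - 1, ?j - 1) \<in> h_contacts ys \<or> (?i - 1, ?j - 1) \<in> v_contacts ys"
      using ij ly by (auto simp: h_contacts_def v_contacts_def)
    then have "rt ?i = lf ?j \<or> tp ?i = bt ?j" using inv(2,3) S by metis
    then show ?thesis using H_prec ij V_prec by metis
  qed
  moreover have "transp prec" using prec_trans by (auto simp: transp_def)
  ultimately show "sorted_wrt prec p" by (simp add: sorted_wrt_iff_nth_Suc_transp)
qed

text \<open>The anti-diagonal representative is the drawing of the same grid at
  \<open>anti_x\<close> and \<open>anti_y\<close>; slides reach it by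
  \<open>R_equivalent_drawings\<close>.\<close>

lemma sorted_is_baxter:
  assumes r: "represents R n lf rt tp bt s"
    and p: "distinct p" "set p = {1..n}" "sorted_wrt (diagonal_grid.prec n lf rt tp bt) p"
  shows "is_baxter_permutation R p"
proof -
  note R = representsD[OF r]
  interpret diagonal_grid n lf rt tp bt by (rule R)
  have y: "draw_list anti_x anti_y ! (i - 1) = draw anti_x anti_y i" if "i \<in> {1..n}" for i
    using that nth_draw_list[of "i - 1"] by auto
  have "antidiagonal_rectangulation (set (draw_list anti_x anti_y))"
    unfolding antidiagonal_rectangulation_def set_draw_list
  proof (intro conjI ballI)
    show "rectangulation (draw anti_x anti_y ` {1..n})"
      by (rule draw_rectangulation[OF drawing_anti])
    fix K assume "K \<in> draw anti_x anti_y ` {1..n}"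
    then show "interior K \<inter> anti_diagonal \<noteq> {}" using mid_anti by blast
  qed
  moreover have "met_in_order anti_diagonal (map (\<lambda>i. draw_list anti_x anti_y ! (i - 1)) p)"
    unfolding met_in_order_def sorted_wrt_map
  proof (rule sorted_wrt_mono_rel[OF _ p(3)], intro ballI)
    fix i j P Q assume "i \<in> set p" "j \<in> set p" "prec i j"
      "P \<in> interior (draw_list anti_x anti_y ! (i - 1)) \<inter> anti_diagonal"
        "Q \<in> interior (draw_list anti_x anti_y ! (j - 1)) \<inter> anti_diagonal"
    then show "fst P < fst Q" using anti_order[of i j P Q] y p(2) by simp
  qed
  ultimately show ?thesis
    unfolding is_baxter_permutation_def
      using met_in_order_represents[OF r] R_equivalent_drawings[OF R(6) drawing_anti] p(1,2)
    by (intro exI[of _ "draw_list s s"] exI[of _ "draw_list anti_x anti_y"]) auto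
qed

text \<open>All admissible permutations are sorted by one asymmetric order, hence equal; together
  with existence this makes the definite description meaningful.\<close>

theorem baxter_permutation_sorted:
  assumes r: "represents R n lf rt tp bt s"
  shows "distinct (baxter_permutation R)" "set (baxter_permutation R) = {1..n}"
    "sorted_wrt (diagonal_grid.prec n lf rt tp bt) (baxter_permutation R)"
proof -
  interpret diagonal_grid n lf rt tp bt by (rule representsD[OF r])
  obtain p where p: "distinct p" "set p = {1..n}" "sorted_wrt prec p" by (rule sorted_list_exists)
  have b: "is_baxter_permutation R p" by (rule sorted_is_baxter[OF r p])
  have "q = p" if "is_baxter_permutation R q" for q
    by (rule sorted_wrt_unique[of prec]) (use is_baxter_sorted[OF r that] p prec_asym in auto)
  then have "baxter_permutation R = p" using b unfolding baxter_permutation_def by blast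
  then show "distinct (baxter_permutation R)" "set (baxter_permutation R) = {1..n}"
    "sorted_wrt prec (baxter_permutation R)"
    using p by auto
qed

section \<open>Symmetries of the square\<close>

text \<open>The effect on contacts is hidden in \<open>equiv_image\<close>, because the two
  instances differ in it: the reflection exchanges horizontal and vertical contacts, the half turn
  keeps the two kinds apart. Preserved inner products of differences make \<open>g\<close> an
  isometry and keep perpendicular edges perpendicular.\<close>

locale square_symmetry =
  fixes g :: "point \<Rightarrow> point"
  assumes involution [simp]: "g (g p) = p"
    and affine: "g ((1 - u) *\<^sub>R p + u *\<^sub>R q) = (1 - u) *\<^sub>R g p + u *\<^sub>R g q"
    and inner_diff: "(g q - g p) \<bullet> (g q' - g p') = (q - p) \<bullet> (q' - p')"
    and cbox_image: "\<exists>c d. g ` cbox a b = cbox c d"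
    and square_image: "g ` unit_square = unit_square"
    and diagonal_image: "g ` main_diagonal = main_diagonal"
    and equiv_image: "labeled_equiv xs ys \<Longrightarrow> labeled_rectangulation (map ((`) g) xs) \<Longrightarrow>
      labeled_rectangulation (map ((`) g) ys) \<Longrightarrow> labeled_equiv (map ((`) g) xs) (map ((`) g) ys)"
begin

lemma inj: "inj g" by (metis injI involution)

lemma image_vimage: "g ` A = g -` A"
proof (intro set_eqI iffI)
  fix x assume "x \<in> g -` A" then show "x \<in> g ` A" by (intro image_eqI[of _ _ "g x"]) auto
qed auto

lemma mem_image [simp]: "x \<in> g ` A \<longleftrightarrow> g x \<in> A"
  by (simp add: image_vimage)

lemma image_image_id [simp]: "g ` g ` A = A"
  by (simp add: image_image)

lemma eq_iff: "g p = g q \<longleftrightarrow> p = q"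
  using inj by (rule inj_eq)

lemma continuous: "continuous_on UNIV g"
proof -
  have "dist (g p) (g q) = dist p q" for p q
    using inner_diff[of p q p q] by (simp add: dist_norm norm_eq_sqrt_inner)
  then show ?thesis by (intro continuous_onI) auto
qed

lemma open_image: "open U \<Longrightarrow> open (g ` U)"
  unfolding image_vimage using continuous by (simp add: continuous_on_open_vimage)

lemma interior_image: "interior (g ` A) = g ` interior A"
proof -
  have le: "g ` interior A \<subseteq> interior (g ` A)" for A
    by (intro interior_maximal open_image) (auto intro: subsetD[OF interior_subset])
  then have "g ` interior (g ` A) \<subseteq> interior A" using le[of "g ` A"] by simp
  then have "interior (g ` A) \<subseteq> g ` interior A" by (metis image_image_id image_mono)
  then show ?thesis using le by blast
qed

lemma frontier_image: "frontier (g ` A) = g ` frontier A"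
proof -
  have "- g ` A = g ` (- A)" for A by (rule set_eqI) simp
  then have "closure (g ` A) = g ` closure A" by (simp only: closure_interior interior_image)
  then show ?thesis by (intro set_eqI) (simp add: frontier_def interior_image)
qed

lemma closed_segment_mem [simp]: "g z \<in> closed_segment (g p) (g q) \<longleftrightarrow> z \<in> closed_segment p q"
proof -
  have *: "g z \<in> closed_segment (g p) (g q)" if z: "z \<in> closed_segment p q" for z p q
  proof -
    obtain u where "z = (1 - u) *\<^sub>R p + u *\<^sub>R q" "0 \<le> u" "u \<le> 1" using z
      by (auto simp: closed_segment_def)
    then show ?thesis using affine[of u p q] unfolding closed_segment_def by blast
  qed
  show ?thesis using *[of z p q] *[of "g z" "g p" "g q"] by auto
qed

lemma open_segment_mem [simp]: "g z \<in> open_segment (g p) (g q) \<longleftrightarrow> z \<in> open_segment p q"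
  by (simp add: open_segment_def eq_iff)

lemma closed_segment_image: "closed_segment (g p) (g q) = g ` closed_segment p q"
  by (metis closed_segment_mem involution mem_image set_eqI)

lemma open_segment_image: "open_segment (g p) (g q) = g ` open_segment p q"
  by (metis open_segment_mem involution mem_image set_eqI)

lemma extreme_point_image [simp]: "g p extreme_point_of g ` K \<longleftrightarrow> p extreme_point_of K"
  unfolding extreme_point_of_def by auto

abbreviation im :: "point set set \<Rightarrow> point set set" where "im R \<equiv> (`) g ` R"

lemma im_im [simp]: "im (im R) = R"
  by (simp add: image_comp comp_def)

lemma vertices_image: "vertices (im R) = g ` vertices R"
  unfolding vertices_def by (auto, metis extreme_point_image involution)

lemma skeleton_image: "skeleton (im R) = g ` skeleton R"
  unfolding skeleton_def by (auto simp: frontier_image)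

lemma edge_image [simp]: "edge (im R) (g p) (g q) \<longleftrightarrow> edge R p q"
proof -
  have "g ` A \<subseteq> g ` B \<longleftrightarrow> A \<subseteq> B" "g ` A \<inter> g ` B = {} \<longleftrightarrow> A \<inter> B = {}" for A B
    using inj by (auto simp: image_subset_iff inj_image_subset_iff image_Int[symmetric])
  then show ?thesis
    unfolding edge_def vertices_image skeleton_image closed_segment_image open_segment_image
    by (simp add: eq_iff)
qed

lemma rectangulation_image: "rectangulation R \<Longrightarrow> rectangulation (im R)"
proof -
  assume R: "rectangulation R"
  have "im R division_of unit_square"
  proof (rule division_ofI)
    have d: "R division_of unit_square" using R by (simp add: rectangulation_def)
    show "finite (im R)" using d by (simp add: division_of_finite)
    show "\<Union> (im R) = unit_square" using d square_image by (metis division_ofD(6) image_Union)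
    fix K assume K: "K \<in> im R"
    then obtain L where L: "L \<in> R" "K = g ` L" by auto
    show "K \<subseteq> unit_square" using \<open>\<Union> (im R) = unit_square\<close> K by blast
    show "K \<noteq> {}" using division_ofD(3)[OF d L(1)] L(2) by auto
    show "\<exists>a b. K = cbox a b" using division_ofD(4)[OF d L(1)] L(2) cbox_image by metis
    fix K' assume K': "K' \<in> im R" "K \<noteq> K'"
    then obtain L' where L': "L' \<in> R" "K' = g ` L'" by auto
    then have "interior L \<inter> interior L' = {}" using division_ofD(5)[OF d L(1) L'(1)] K' L by auto
    then show "interior K \<inter> interior K' = {}"
      unfolding L(2) L'(2) interior_image image_Int[OF inj, symmetric] by simp
  qed
  moreover have "interior K \<noteq> {}" if "K \<in> im R" for K
    using that R by (auto simp: rectangulation_def interior_image)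
  moreover have "card {w. edge (im R) v w} = 3" if v: "v \<in> vertices (im R) \<inter> interior unit_square"
    for v
  proof -
    have "{w. edge (im R) v w} = g ` {w. edge R (g v) w}"
      by (rule set_eqI) (use edge_image[of R "g v"] in \<open>metis involution mem_Collect_eq mem_image\<close>)
    then have "card {w. edge (im R) v w} = card {w. edge R (g v) w}" 
      by (simp add: card_image inj_on_subset[OF inj])
    moreover have "g v \<in> interior unit_square"
      using v interior_image[of unit_square] unfolding square_image by (metis IntD2 mem_image)
    moreover have "g v \<in> vertices R" using v by (simp add: vertices_image)
    ultimately show ?thesis using R unfolding rectangulation_def by auto
  qed
  ultimately show ?thesis unfolding rectangulation_def by blast
qed

lemma matched_at_image [simp]: "matched_at (im R) (g p) (g q) \<longleftrightarrow> matched_at R p q"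
  unfolding matched_at_def by (metis edge_image involution open_segment_mem)

lemma edge_replacement_image: "edge_replacement R p q R' p' q' \<Longrightarrow>
  edge_replacement (im R) (g p) (g q) (im R') (g p') (g q')"
proof -
  assume e: "edge_replacement R p q R' p' q'"
  then have "skeleton (im R') = g ` (skeleton R - open_segment p q \<union> closed_segment p' q')"
    by (simp add: edge_replacement_def skeleton_image)
  also have "\<dots> = skeleton (im R) - open_segment (g p) (g q) \<union> closed_segment (g p') (g q')"
    unfolding skeleton_image closed_segment_image open_segment_image by (rule set_eqI) simp
  finally show ?thesis using e unfolding edge_replacement_def
    by (simp add: rectangulation_image inner_diff)
qed

lemma rotation_flip_image: "rotation_flip R p q R' \<Longrightarrow> rotation_flip (im R) (g p) (g q) (im R')"
  using edge_replacement_image unfolding rotation_flip_def by (metis matched_at_image)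

lemma flip_image: "flip R p q R' \<Longrightarrow> flip (im R) (g p) (g q) (im R')"
proof -
  have s: "simple_flip (im R) (g p) (g q) (im R')" if s: "simple_flip R p q R'"
  proof -
    obtain p' q' z where r: "edge_replacement R p q R' p' q'"
      and z: "z \<in> open_segment p q" "z \<in> open_segment p' q'"
      using s unfolding simple_flip_def by blast
    have "g z \<in> open_segment (g p) (g q) \<inter> open_segment (g p') (g q')" using z by simp
    then show ?thesis using s edge_replacement_image[OF r]
      unfolding simple_flip_def matched_at_image by blast
  qed
  show "flip R p q R' \<Longrightarrow> ?thesis" using s rotation_flip_image unfolding flip_def by blast
qed

lemma diagonal_rectangulation_image: "diagonal_rectangulation R \<Longrightarrow> diagonal_rectangulation (im R)"
proof -
  assume R: "diagonal_rectangulation R"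
  have "interior K \<inter> main_diagonal \<noteq> {}" if K: "K \<in> im R" for K
  proof -
    obtain L where L: "L \<in> R" "K = g ` L" using K by auto
    obtain p where "p \<in> interior L \<inter> main_diagonal" using R L unfolding diagonal_rectangulation_def
      by blast
    then have "g p \<in> interior K \<inter> g ` main_diagonal" using L by (auto simp: interior_image)
    then show ?thesis unfolding diagonal_image by blast
  qed
  then show ?thesis using R rectangulation_image unfolding diagonal_rectangulation_def by blast
qed

lemma combinatorially_equivalent_image:
  assumes "combinatorially_equivalent R S" shows "combinatorially_equivalent (im R) (im S)"
proof -
  obtain xs ys where xy: "set xs = R" "set ys = S" "labeled_equiv xs ys" using assms
    unfolding combinatorially_equivalent_def by blast
  have "labeled_rectangulation (map ((`) g) zs)" if "labeled_rectangulation zs" for zs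
    using that rectangulation_image[of "set zs"] inj unfolding labeled_rectangulation_def
    by (auto simp: distinct_map inj_on_def inj_image_eq_iff)
  then have "labeled_equiv (map ((`) g) xs) (map ((`) g) ys)" using equiv_image[OF xy(3)] xy(3)
    unfolding labeled_equiv_def by blast
  then show ?thesis unfolding combinatorially_equivalent_def using xy
    by (intro exI[of _ "map ((`) g) xs"] exI[of _ "map ((`) g) ys"]) auto
qed

lemma barcelona_flip_image:
  assumes "barcelona_flip R R'" shows "barcelona_flip (im R) (im R')"
proof -
  obtain S S' p q where "combinatorially_equivalent R S" "diagonal_rectangulation S"
        "closed_segment p q \<inter> main_diagonal \<noteq> {}" "flip S p q S'" "combinatorially_equivalent S' R'"
    using assms unfolding barcelona_flip_def by blast
  moreover have "closed_segment (g p) (g q) \<inter> main_diagonal \<noteq> {}"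
    using calculation(3) diagonal_image unfolding closed_segment_image
      by (metis image_Int inj image_is_empty)
  ultimately show ?thesis using assms diagonal_rectangulation_image combinatorially_equivalent_image
    flip_image
    unfolding barcelona_flip_def by (metis)
qed

end

text \<open>The reflection in the main diagonal, which corresponds to \<open>reflect\<close> for
  grids, as \<open>turn\<close> corresponds to \<open>rotate\<close>.\<close>

definition rho :: "point \<Rightarrow> point" where "rho p = (1 - snd p, 1 - fst p)"
definition turn :: "point \<Rightarrow> point" where "turn p = (1 - fst p, 1 - snd p)"

lemma rho_rect: "rho ` rect l r t b = rect t b l r"
proof -
  have *: "(x, y) \<in> rho ` A \<longleftrightarrow> (1 - y, 1 - x) \<in> A" for x y A
    by (force simp: rho_def image_iff)
  show ?thesis
  proof (rule set_eqI)
    fix p :: point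
    obtain x y where p: "p = (x, y)" by fastforce
    show "p \<in> rho ` rect l r t b \<longleftrightarrow> p \<in> rect t b l r" unfolding p * mem_rect by auto
  qed
qed

lemma turn_rect: "turn ` rect l r t b = rect (1 - r) (1 - l) (1 - b) (1 - t)"
proof -
  have *: "(x, y) \<in> turn ` A \<longleftrightarrow> (1 - x, 1 - y) \<in> A" for x y A
    by (force simp: turn_def image_iff)
  show ?thesis
  proof (rule set_eqI)
    fix p :: point
    obtain x y where p: "p = (x, y)" by fastforce
    show "p \<in> turn ` rect l r t b \<longleftrightarrow> p \<in> rect (1 - r) (1 - l) (1 - b) (1 - t)" unfolding p * mem_rect
      by auto
  qed
qed

lemma rho_coords:
  assumes "is_rect K"
  shows "is_rect (rho ` K)" "lc (rho ` K) = tc K" "rc (rho ` K) = bc K" "tc (rho ` K) = lc K"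
    "bc (rho ` K) = rc K"
proof -
  have e: "rho ` K = rect (tc K) (bc K) (lc K) (rc K)" using rect_coords[OF assms] rho_rect by metis
  show "is_rect (rho ` K)" "lc (rho ` K) = tc K" "rc (rho ` K) = bc K" "tc (rho ` K) = lc K"
    "bc (rho ` K) = rc K"
    unfolding e using is_rect_less[OF assms] by (auto simp: is_rect_rect coords_rect)
qed

lemma turn_coords:
  assumes "is_rect K"
  shows "is_rect (turn ` K)" "lc (turn ` K) = 1 - rc K" "rc (turn ` K) = 1 - lc K"
    "tc (turn ` K) = 1 - bc K" "bc (turn ` K) = 1 - tc K"
proof -
  have e: "turn ` K = rect (1 - rc K) (1 - lc K) (1 - bc K) (1 - tc K)"
    using rect_coords[OF assms] turn_rect by metis
  show "is_rect (turn ` K)" "lc (turn ` K) = 1 - rc K" "rc (turn ` K) = 1 - lc K"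
    "tc (turn ` K) = 1 - bc K" "bc (turn ` K) = 1 - tc K"
    unfolding e using is_rect_less[OF assms] by (auto simp: is_rect_rect coords_rect)
qed

lemma rho_contacts:
  assumes "labeled_rectangulation xs"
  shows "h_contacts (map ((`) rho) xs) = (v_contacts xs)\<inverse>"
    "v_contacts (map ((`) rho) xs) = (h_contacts xs)\<inverse>"
proof -
  have "left_of (rho ` (xs ! i)) (rho ` (xs ! j)) \<longleftrightarrow> below (xs ! j) (xs ! i)"
    "below (rho ` (xs ! i)) (rho ` (xs ! j)) \<longleftrightarrow> left_of (xs ! j) (xs ! i)"
      if "i < length xs" "j < length xs" for i j
  proof -
    note i = labeled_is_rect[OF assms that(1)] and j = labeled_is_rect[OF assms that(2)]
    note I = rho_coords[OF i] and J = rho_coords[OF j]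
    show "left_of (rho ` (xs ! i)) (rho ` (xs ! j)) \<longleftrightarrow> below (xs ! j) (xs ! i)"
      unfolding left_of_is_rect[OF I(1) J(1)] below_is_rect[OF j i] I J by auto
    show "below (rho ` (xs ! i)) (rho ` (xs ! j)) \<longleftrightarrow> left_of (xs ! j) (xs ! i)"
      unfolding below_is_rect[OF I(1) J(1)] left_of_is_rect[OF j i] I J by auto
  qed
  then show "h_contacts (map ((`) rho) xs) = (v_contacts xs)\<inverse>"
    "v_contacts (map ((`) rho) xs) = (h_contacts xs)\<inverse>"
    by (auto simp: h_contacts_def v_contacts_def)
qed

lemma turn_contacts:
  assumes "labeled_rectangulation xs"
  shows "h_contacts (map ((`) turn) xs) = (h_contacts xs)\<inverse>"
    "v_contacts (map ((`) turn) xs) = (v_contacts xs)\<inverse>"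
proof -
  have "left_of (turn ` (xs ! i)) (turn ` (xs ! j)) \<longleftrightarrow> left_of (xs ! j) (xs ! i)"
    "below (turn ` (xs ! i)) (turn ` (xs ! j)) \<longleftrightarrow> below (xs ! j) (xs ! i)"
      if "i < length xs" "j < length xs" for i j
  proof -
    note i = labeled_is_rect[OF assms that(1)] and j = labeled_is_rect[OF assms that(2)]
    note I = turn_coords[OF i] and J = turn_coords[OF j]
    show "left_of (turn ` (xs ! i)) (turn ` (xs ! j)) \<longleftrightarrow> left_of (xs ! j) (xs ! i)"
      unfolding left_of_is_rect[OF I(1) J(1)] left_of_is_rect[OF j i] I J by auto
    show "below (turn ` (xs ! i)) (turn ` (xs ! j)) \<longleftrightarrow> below (xs ! j) (xs ! i)"
      unfolding below_is_rect[OF I(1) J(1)] below_is_rect[OF j i] I J by auto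
  qed
  then show "h_contacts (map ((`) turn) xs) = (h_contacts xs)\<inverse>"
    "v_contacts (map ((`) turn) xs) = (v_contacts xs)\<inverse>"
    by (auto simp: h_contacts_def v_contacts_def)
qed

lemma cbox_rect: "cbox (l, b) (r, t) = rect l r (1 - t) (1 - b)"
  by (simp add: rect_def)

interpretation rho: square_symmetry rho
proof
  show "rho (rho p) = p" for p by (simp add: rho_def)
  show "rho ((1 - u) *\<^sub>R p + u *\<^sub>R q) = (1 - u) *\<^sub>R rho p + u *\<^sub>R rho q" for u p q
    by (simp add: rho_def algebra_simps)
  show "(rho q - rho p) \<bullet> (rho q' - rho p') = (q - p) \<bullet> (q' - p')" for p q p' q'
    by (simp add: rho_def inner_prod_def algebra_simps)
  show "\<exists>c d. rho ` cbox a b = cbox c d" for a b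
    by (cases a; cases b) (metis cbox_rect rho_rect rect_def)
  show "rho ` unit_square = unit_square" unfolding cbox_rect rho_rect by simp
  show "rho ` main_diagonal = main_diagonal"
  proof -
    have "p \<in> rho ` main_diagonal" if "p \<in> main_diagonal" for p
      using that by (cases p) (auto simp: rho_def mem_main_diagonal intro!: image_eqI[of _ _ p])
    then show ?thesis by (auto simp: rho_def mem_main_diagonal)
  qed
  show "labeled_equiv (map ((`) rho) xs) (map ((`) rho) ys)" if "labeled_equiv xs ys" 
    "labeled_rectangulation (map ((`) rho) xs)" "labeled_rectangulation (map ((`) rho) ys)"
      for xs ys
    using that rho_contacts[of xs] rho_contacts[of ys] by (simp add: labeled_equiv_def)
qed

interpretation turn: square_symmetry turn
proof
  show "turn (turn p) = p" for p by (simp add: turn_def)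
  show "turn ((1 - u) *\<^sub>R p + u *\<^sub>R q) = (1 - u) *\<^sub>R turn p + u *\<^sub>R turn q" for u p q
    by (simp add: turn_def algebra_simps)
  show "(turn q - turn p) \<bullet> (turn q' - turn p') = (q - p) \<bullet> (q' - p')" for p q p' q'
    by (simp add: turn_def inner_prod_def algebra_simps)
  show "\<exists>c d. turn ` cbox a b = cbox c d" for a b
    by (cases a; cases b) (metis cbox_rect turn_rect rect_def)
  show "turn ` unit_square = unit_square" unfolding cbox_rect turn_rect by simp
  show "turn ` main_diagonal = main_diagonal"
  proof -
    have "p \<in> turn ` main_diagonal" if "p \<in> main_diagonal" for p
      using that by (cases p) (auto simp: turn_def mem_main_diagonal intro!: image_eqI[of _ _
        "turn p"])
    then show ?thesis by (auto simp: turn_def mem_main_diagonal)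
  qed
  show "labeled_equiv (map ((`) turn) xs) (map ((`) turn) ys)" if "labeled_equiv xs ys" 
    "labeled_rectangulation (map ((`) turn) xs)" "labeled_rectangulation (map ((`) turn) ys)"
      for xs ys
    using that turn_contacts[of xs] turn_contacts[of ys] by (simp add: labeled_equiv_def)
qed

lemma represents_rho: "represents R n lf rt tp bt s \<Longrightarrow> represents (rho.im R) n tp bt lf rt s"
  using diagonal_grid.reflect by (auto simp: represents_def image_image rho_rect)

abbreviation turned :: "nat \<Rightarrow> (nat \<Rightarrow> nat) \<Rightarrow> nat \<Rightarrow> nat" where
  "turned n f \<equiv> \<lambda>i. n - f (n + 1 - i)"

lemma represents_turn:
  assumes r: "represents R n lf rt tp bt s"
  shows "represents (turn.im R) n (turned n rt) (turned n lf) (turned n bt) (turned n tp) (\<lambda>k.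
    1 - s (n - k))"
proof -
  note R = representsD[OF r]
  interpret diagonal_grid n lf rt tp bt by (rule R)
  have m: "1 - s (n - i) < 1 - s (n - j)" if "i < j" "j \<le> n" for i j
    using R(4)[of "n - j" "n - i"] that by auto
  have b: "n - (n - f i) = f i" if "f \<in> {lf, rt, tp, bt}" "i \<in> {1..n}" for f i
    using that diag[OF that(2)] bounds[OF that(2)] by auto
  have sub: "{1..n} = (\<lambda>i. n + 1 - i) ` {1..n}"
  proof (intro set_eqI iffI)
    fix x assume "x \<in> {1..n}" then show "x \<in> (\<lambda>i. n + 1 - i) ` {1..n}"
      by (intro image_eqI[of _ _ "n + 1 - x"]) auto
  qed auto
  have "turn.im R = (\<lambda>i. rect (1 - s (rt i)) (1 - s (lf i)) (1 - s (bt i)) (1 - s (tp i))) ` {1..n}"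
    unfolding R(5) image_image draw_def turn_rect by simp
  also have "\<dots> = (\<lambda>i. rect (1 - s (rt (n + 1 - i))) (1 - s (lf (n + 1 - i))) (1 - s (bt (n + 1 -
    i))) (1 - s (tp (n + 1 - i)))) ` {1..n}"
    by (subst (1) sub) (simp only: image_image)
  also have "\<dots> = (\<lambda>i. rect (1 - s (n - turned n rt i)) (1 - s (n - turned n lf i)) (1 - s (n -
    turned n bt i)) (1 - s (n - turned n tp i))) ` {1..n}"
  proof (rule image_cong[OF refl])
    fix i assume "i \<in> {1..n}"
    then have i: "n + 1 - i \<in> {1..n}" by auto
    show "rect (1 - s (rt (n + 1 - i))) (1 - s (lf (n + 1 - i))) (1 - s (bt (n + 1 - i))) (1 - s (tp
      (n + 1 - i))) =
      rect (1 - s (n - turned n rt i)) (1 - s (n - turned n lf i)) (1 - s (n - turned n bt i)) (1 -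
        s (n - turned n tp i))"
      using b[OF _ i] by simp
  qed
  finally show ?thesis using R(2,3) m rotate by (auto simp: represents_def)
qed

text \<open>Only one implication is computed from the walls. The other one follows because both
  orders are total and asymmetric.\<close>

lemma (in diagonal_grid) prec_turned:
  assumes ab: "a \<in> {1..n}" "b \<in> {1..n}"
  shows "diagonal_grid.prec n (turned n rt) (turned n lf) (turned n bt) (turned n tp) a b \<longleftrightarrow>
    prec (n + 1 - b) (n + 1 - a)"
proof -
  interpret t: diagonal_grid n "turned n rt" "turned n lf" "turned n bt" "turned n tp"
    by (rule rotate)
  have r: "n + 1 - i \<in> {1..n}" if "i \<in> {1..n}" for i using that by auto
  have le: "lf (n + 1 - i) \<le> n \<and> tp (n + 1 - i) \<le> n \<and> rt (n + 1 - i) \<le> n \<and> bt (n + 1 - i) \<le> n"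
    if "i \<in> {1..n}" for i
    using diag[OF r[OF that]] bounds[OF r[OF that]] r[OF that] by auto
  have HH: "(n + 1 - j, n + 1 - i) \<in> H" if "(i, j) \<in> t.H" for i j
  proof -
    have ij: "i \<in> {1..n}" "j \<in> {1..n}" and e: "turned n lf i = turned n rt j" using that
      unfolding t.H_def by blast+
    have "lf (n + 1 - i) = rt (n + 1 - j)" using e le[OF ij(1)] le[OF ij(2)] by linarith
    then show ?thesis using r[OF ij(1)] r[OF ij(2)] unfolding H_def by simp
  qed
  have VV: "(n + 1 - j, n + 1 - i) \<in> V" if "(i, j) \<in> t.V" for i j
  proof -
    have ij: "i \<in> {1..n}" "j \<in> {1..n}" and e: "turned n tp i = turned n bt j" using that
      unfolding t.V_def by blast+
    have "tp (n + 1 - i) = bt (n + 1 - j)" using e le[OF ij(1)] le[OF ij(2)] by linarith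
    then show ?thesis using r[OF ij(1)] r[OF ij(2)] unfolding V_def by simp
  qed
  have H': "(n + 1 - j, n + 1 - i) \<in> H\<^sup>+" if "(i, j) \<in> t.H\<^sup>+" for i j
    using that by (induction rule: trancl_induct) (use HH in \<open>blast intro: trancl_into_trancl2\<close>)+
  have V': "(n + 1 - j, n + 1 - i) \<in> V\<^sup>+" if "(i, j) \<in> t.V\<^sup>+" for i j
    using that by (induction rule: trancl_induct) (use VV in \<open>blast intro: trancl_into_trancl2\<close>)+
  have imp: "prec (n + 1 - j) (n + 1 - i)" if "t.prec i j" for i j
    using that H' V' unfolding t.prec_def prec_def by blast
  show ?thesis
  proof
    assume p: "prec (n + 1 - b) (n + 1 - a)"
    then have "a \<noteq> b" using prec_irrefl by auto
    then show "t.prec a b" using t.prec_total[OF ab] imp[of b a] prec_asym[OF p] by blast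
  qed (rule imp)
qed

section \<open>Exchanging two consecutive labels\<close>

definition swap_next :: "nat \<Rightarrow> nat \<Rightarrow> nat" where
  "swap_next i a = (if a = i then Suc i else if a = Suc i then i else a)"

text \<open>The intermediate notion of the whole proof: it is compared with flips on one side and
  with Baxter permutations on the other.\<close>

definition swap_related :: "point set set \<Rightarrow> point set set \<Rightarrow> bool" where
  "swap_related R R' \<longleftrightarrow> (\<exists>n lf rt tp bt s lf' rt' tp' bt' s' i. represents R n lf rt tp bt s \<and>
    represents R' n lf' rt' tp' bt' s' \<and>
     0 < i \<and> i < n \<and> (\<forall>a\<in>{1..n}. \<forall>b\<in>{1..n}.
       diagonal_grid.prec n lf' rt' tp' bt' (swap_next i a) (swap_next i b) \<longleftrightarrow> diagonal_grid.prec n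
         lf rt tp bt a b))"

lemma swap_next_range: "0 < i \<Longrightarrow> i < n \<Longrightarrow> a \<in> {1..n} \<Longrightarrow> swap_next i a \<in> {1..n}"
  by (auto simp: swap_next_def)

lemma swap_related_rho: "swap_related R R' \<Longrightarrow> swap_related (rho.im R) (rho.im R')"
proof -
  assume "swap_related R R'"
  then obtain n lf rt tp bt s lf' rt' tp' bt' s' i
    where r: "represents R n lf rt tp bt s" "represents R' n lf' rt' tp' bt' s'"
     and i: "0 < i" "i < n" and p: "\<And>a b. a \<in> {1..n} \<Longrightarrow> b \<in> {1..n} \<Longrightarrow>
       diagonal_grid.prec n lf' rt' tp' bt' (swap_next i a) (swap_next i b) \<longleftrightarrow> diagonal_grid.prec n
         lf rt tp bt a b"
    unfolding swap_related_def by blast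
  note g = representsD(1)[OF r(1)] representsD(1)[OF r(2)]
  have "diagonal_grid.prec n tp' bt' lf' rt' (swap_next i a) (swap_next i b) \<longleftrightarrow>
    diagonal_grid.prec n tp bt lf rt a b"
    if "a \<in> {1..n}" "b \<in> {1..n}" for a b
    unfolding diagonal_grid.reflect_prec[OF g(1)] diagonal_grid.reflect_prec[OF g(2)] using p that
      by blast
  then show ?thesis unfolding swap_related_def
    using represents_rho[OF r(1)] represents_rho[OF r(2)] i by blast
qed

lemma turned_swap:
  assumes g: "diagonal_grid n lf rt tp bt" "diagonal_grid n lf' rt' tp' bt'" and i: "0 < i" "i < n"
    and p: "\<And>a b. a \<in> {1..n} \<Longrightarrow> b \<in> {1..n} \<Longrightarrow>
       diagonal_grid.prec n lf' rt' tp' bt' (swap_next i a) (swap_next i b) \<longleftrightarrow> diagonal_grid.prec n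
         lf rt tp bt a b"
    and ab: "a \<in> {1..n}" "b \<in> {1..n}"
  shows "diagonal_grid.prec n (turned n rt') (turned n lf') (turned n bt') (turned n tp') (swap_next
    (n - i) a) (swap_next (n - i) b) \<longleftrightarrow>
      diagonal_grid.prec n (turned n rt) (turned n lf) (turned n bt) (turned n tp) a b"
proof -
  have i': "0 < n - i" "n - i < n" using i by auto
  have t: "n + 1 - swap_next (n - i) a = swap_next i (n + 1 - a)" if "a \<in> {1..n}" for a
    using that i by (auto simp: swap_next_def)
  have ab': "n + 1 - a \<in> {1..n}" "n + 1 - b \<in> {1..n}" using ab by auto
  show ?thesis
    unfolding diagonal_grid.prec_turned[OF g(2) swap_next_range[OF i' ab(1)] swap_next_range[OF i'
      ab(2)]]
      diagonal_grid.prec_turned[OF g(1) ab] t[OF ab(1)] t[OF ab(2)] using p ab' by blast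
qed

lemma swap_related_turn: "swap_related R R' \<Longrightarrow> swap_related (turn.im R) (turn.im R')"
proof -
  assume "swap_related R R'"
  then obtain n lf rt tp bt s lf' rt' tp' bt' s' i
    where r: "represents R n lf rt tp bt s" "represents R' n lf' rt' tp' bt' s'"
     and i: "0 < i" "i < n" and p: "\<And>a b. a \<in> {1..n} \<Longrightarrow> b \<in> {1..n} \<Longrightarrow>
       diagonal_grid.prec n lf' rt' tp' bt' (swap_next i a) (swap_next i b) \<longleftrightarrow> diagonal_grid.prec n
         lf rt tp bt a b"
    unfolding swap_related_def by blast
  note g = representsD(1)[OF r(1)] representsD(1)[OF r(2)]
  have i': "0 < n - i" "n - i < n" using i by auto
  note turned_swap[OF g i p]
  then show ?thesis unfolding swap_related_def
    using represents_turn[OF r(1)] represents_turn[OF r(2)] i' by blast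
qed

section \<open>Flips across a vertical edge\<close>

lemma down_point:
  fixes p :: point
  obtains x w where "p = (x, 1 - w)"
  by (rule that[of "fst p" "1 - snd p"]) simp

lemma nonempty_down:
  fixes A :: "point set"
  assumes "A \<noteq> {}"
  obtains x w where "(x, 1 - w) \<in> A"
  using assms down_point by (metis ex_in_conv)

text \<open>The tile \<open>B\<close> over the centre of \<open>A\<close> has the same four sides. A
  side of \<open>B\<close> strictly inside \<open>A\<close> would put the skeleton into the interior
  of \<open>A\<close>, and a side beyond \<open>A\<close> would let the frontier of \<open>A\<close>
  run through the interior of \<open>B\<close>.\<close>

lemma tile_in_tilingI:
  assumes T: "tiling T" and A: "is_rect A" and unit: "0 \<le> lc A" "rc A \<le> 1" "0 \<le> tc A" "bc A \<le> 1"
    and fr: "frontier A \<subseteq> skeleton T" and int: "interior A \<inter> skeleton T = {}"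
  shows "A \<in> T"
proof -
  note less = is_rect_less[OF A]
  define x where "x = (lc A + rc A) / 2"
  define w where "w = (tc A + bc A) / 2"
  have x: "lc A < x" "x < rc A" and w: "tc A < w" "w < bc A" using less by (auto simp: x_def w_def)
  have intA: "(u, 1 - v) \<notin> skeleton T" if "lc A < u" "u < rc A" "tc A < v" "v < bc A" for u v
    using that int mem_interior_is_rect[OF A, of u "1 - v"] by auto
  have frA: "(u, 1 - v) \<in> skeleton T"
    if "lc A \<le> u" "u \<le> rc A" "tc A \<le> v" "v \<le> bc A" "u = lc A \<or> u = rc A \<or> v = tc A \<or> v = bc A"
    for u v
    using that fr mem_frontier_is_rect[OF A, of u "1 - v"] by auto
  have "0 \<le> x" "x \<le> 1" "0 \<le> w" "w \<le> 1" using x w unit by linarith+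
  then obtain B where B: "B \<in> T" "lc B \<le> x" "x \<le> rc B" "tc B \<le> w" "w \<le> bc B"
    using tiling_cover[OF T] by metis
  have frB: "(u, 1 - v) \<in> skeleton T"
    if "lc B \<le> u" "u \<le> rc B" "tc B \<le> v" "v \<le> bc B" "u = lc B \<or> u = rc B \<or> v = tc B \<or> v = bc B"
    for u v
    using that by (intro skeletonI[OF T B(1)]) auto
  have intB: "(u, 1 - v) \<notin> skeleton T" if "lc B < u" "u < rc B" "tc B < v" "v < bc B" for u v
    using that by (intro not_skeleton[OF T B(1)]) auto
  have "(x, 1 - w) \<notin> skeleton T" using intA x w by blast
  then have B': "lc B < x" "x < rc B" "tc B < w" "w < bc B" using frB[of x w] B by force+
  have "lc A = lc B"
    using intA[of "lc B" w] frA[of "lc A" w] intB[of "lc A" w] frB[of "lc B" w] x w B'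
      by (cases "lc A" "lc B" rule: linorder_cases) auto
  moreover have "rc A = rc B"
    using intA[of "rc B" w] frA[of "rc A" w] intB[of "rc A" w] frB[of "rc B" w] x w B'
      by (cases "rc A" "rc B" rule: linorder_cases) auto
  moreover have "tc A = tc B"
    using intA[of x "tc B"] frA[of x "tc A"] intB[of x "tc A"] frB[of x "tc B"] x w B'
      by (cases "tc A" "tc B" rule: linorder_cases) auto
  moreover have "bc A = bc B"
    using intA[of x "bc B"] frA[of x "bc A"] intB[of x "bc A"] frB[of x "bc B"] x w B'
      by (cases "bc A" "bc B" rule: linorder_cases) auto
  ultimately have "A = B" using is_rect_eqI A tiling_rect(1)[OF T B(1)] by blast
  then show ?thesis using B by simp
qed

lemma tiles_at_common_side:
  assumes T: "tiling T" and KL: "K \<in> T" "L \<in> T" "rc K = x" "lc L = x" "tc K < w" "w < bc K"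
    "tc L < w" "w < bc L"
    and J: "J \<in> T" "lc J \<le> x" "x \<le> rc J" "tc J \<le> w" "w \<le> bc J"
  shows "J = K \<or> J = L"
proof (cases "lc J < x")
  case True
  then have "J = K" using tiling_rect(3)[OF T KL(1)] KL J
    by (intro tiling_disjoint[OF T J(1) KL(1)]) auto
  then show ?thesis ..
next
  case False
  then have "J = L" using tiling_rect(3)[OF T J(1)] tiling_rect(3)[OF T KL(2)] KL J
    by (intro tiling_disjoint[OF T J(1) KL(2)]) auto
  then show ?thesis ..
qed

lemma boundary_skeleton:
  assumes T: "tiling T" and p: "0 \<le> x" "x \<le> 1" "0 \<le> w" "w \<le> 1" "x = 0 \<or> x = 1 \<or> w = 0 \<or> w = 1"
  shows "(x, 1 - w) \<in> skeleton T"
proof -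
  obtain K where K: "K \<in> T" "lc K \<le> x" "x \<le> rc K" "tc K \<le> w" "w \<le> bc K"
    using tiling_cover[OF T p(1-4)] by blast
  then show ?thesis using tiling_rect[OF T K(1)] p by (intro skeletonI[OF T K(1)]) auto
qed

lemma skeleton_unit: "tiling T \<Longrightarrow> (x, 1 - w) \<in> skeleton T \<Longrightarrow> 0 \<le> x \<and> x \<le> 1 \<and> 0 \<le> w \<and> w \<le> 1"
proof -
  assume T: "tiling T" and "(x, 1 - w) \<in> skeleton T"
  then obtain K where K: "K \<in> T" "lc K \<le> x" "x \<le> rc K" "tc K \<le> w" "w \<le> bc K"
    unfolding mem_skeleton[OF T] by auto
  then show ?thesis using tiling_rect[OF T K(1)] by auto
qed

lemma edge_commute: "edge R p q \<longleftrightarrow> edge R q p"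
  by (auto simp: edge_def closed_segment_commute open_segment_commute)

lemma flip_commute: "flip R p q R' \<longleftrightarrow> flip R q p R'"
proof -
  have e: "edge_replacement R p q R' p' q' \<Longrightarrow> edge_replacement R q p R' p' q'" for p q p' q'
  proof -
    have "(p - q) \<bullet> (q' - p') = - ((q - p) \<bullet> (q' - p'))" by (metis inner_minus_left minus_diff_eq)
    then show "edge_replacement R p q R' p' q' \<Longrightarrow> edge_replacement R q p R' p' q'"
      unfolding edge_replacement_def edge_commute[of R q p] open_segment_commute[of q p] by simp
  qed
  have "simple_flip R p q R' \<Longrightarrow> simple_flip R q p R'" for p q
    unfolding simple_flip_def using e open_segment_commute by metis
  then show ?thesis unfolding flip_def by blast
qed

text \<open>Otherwise the new edge contains two different points of the old one, which is
  perpendicular to it. The parameters 1/2 and 1/3 merely pick two such points.\<close>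

lemma replaced_not_boundary:
  assumes e: "edge_replacement R p q R' p' q'"
  shows "\<not> open_segment p q \<subseteq> skeleton R'"
proof
  assume s: "open_segment p q \<subseteq> skeleton R'"
  have pq: "p \<noteq> q" and o: "(q - p) \<bullet> (q' - p') = 0"
    and sk: "skeleton R' = (skeleton R - open_segment p q) \<union> closed_segment p' q'"
    using e by (auto simp: edge_replacement_def edge_def)
  define u where "u = (1 - 1/2) *\<^sub>R p + (1/2) *\<^sub>R q"
  define v where "v = (1 - 1/3) *\<^sub>R p + (1/3) *\<^sub>R q"
  have "u \<in> open_segment p q"
    using pq unfolding in_segment u_def by (intro conjI exI[of _ "1/2"]) auto
  moreover have "v \<in> open_segment p q"
    using pq unfolding in_segment v_def by (intro conjI exI[of _ "1/3"]) auto
  ultimately have "u \<in> closed_segment p' q'" "v \<in> closed_segment p' q'" using s sk by blast+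
  then obtain a b where uv: "u = (1 - a) *\<^sub>R p' + a *\<^sub>R q'" "v = (1 - b) *\<^sub>R p' + b *\<^sub>R q'"
    by (auto simp: closed_segment_def)
  have 1: "u - v = (a - b) *\<^sub>R (q' - p')" unfolding uv by (simp add: algebra_simps)
  have 2: "u - v = (1/6) *\<^sub>R (q - p)"
    by (simp add: prod_eq_iff u_def v_def field_simps)
  have "(u - v) \<bullet> (u - v) = ((1/6) *\<^sub>R (q - p)) \<bullet> ((a - b) *\<^sub>R (q' - p'))" using 1 2 by metis
  also have "\<dots> = 0" using o by simp
  finally have "u - v = 0" by simp
  then show False using 2 pq by simp
qed

text \<open>The diagonal also touches the edges at its two end corners. These edges stay in every
  skeleton, so \<open>replaced_not_boundary\<close> shows that they are never flipped.\<close>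

lemma corner_edge_boundary:
  assumes R: "tiling R" "tiling R'" and e: "edge R p q" and c: "p = (0, 1) \<or> p = (1, 0)"
  shows "open_segment p q \<subseteq> skeleton R'"
proof
  fix z assume z: "z \<in> open_segment p q"
  have s: "closed_segment p q \<subseteq> skeleton R" using e by (simp add: edge_def)
  have zc: "z \<in> closed_segment p q" using z by (simp add: open_segment_def)
  have "fst p = fst q \<or> snd p = snd q" by (rule segment_in_skeleton_axis_parallel[OF R(1) s])
  then have "fst z = fst p \<or> snd z = snd p"
  proof
    assume "fst p = fst q"
    then have "z \<in> closed_segment (fst p, snd p) (fst p, snd q)" using zc by (metis prod.collapse)
    then show ?thesis unfolding closed_segment_vertical by auto
  next
    assume "snd p = snd q"
    then have "z \<in> closed_segment (fst p, snd p) (fst q, snd p)" using zc by (metis prod.collapse)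
    then show ?thesis unfolding closed_segment_horizontal by auto
  qed
  moreover have "0 \<le> fst z \<and> fst z \<le> 1 \<and> 0 \<le> 1 - snd z \<and> 1 - snd z \<le> 1"
    using skeleton_unit[OF R(1), of "fst z" "1 - snd z"] zc s by auto
  ultimately show "z \<in> skeleton R'" using boundary_skeleton[OF R(2), of "fst z" "1 - snd z"] c
    by auto
qed

lemma diagonal_crossing:
  assumes r: "represents S n lf rt tp bt s" and T: "tiling S"
    and e: "edge_replacement S p q S' p' q'"
    and z: "z \<in> closed_segment p q" "z \<in> main_diagonal"
  obtains k where "0 < k" "k < n" "(s k, 1 - s k) \<in> open_segment p q"
proof -
  note R = representsD[OF r]
  interpret diagonal_grid n lf rt tp bt by (rule R)
  have ed: "edge S p q" using e by (simp add: edge_replacement_def)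
  have T': "tiling S'" using e rectangulation_tiling by (auto simp: edge_replacement_def)
  obtain x where x: "z = (x, 1 - x)" "0 \<le> x" "x \<le> 1" using z(2)
    by (cases z) (auto simp: mem_main_diagonal)
  \<comment> \<open>The first crossing at or after \<open>z\<close>. If \<open>z\<close> lay
    strictly before it, \<open>z\<close> would be in the interior of tile \<open>k\<close>.\<close>
  define k where "k = (LEAST k. x \<le> s k)"
  have k: "x \<le> s k" "k \<le> n" unfolding k_def using x R(3)
    by (auto intro: LeastI[of "\<lambda>k. x \<le> s k" n] Least_le)
  have xk: "x = s k"
  proof (cases "k = 0")
    case True then show ?thesis using k x R(2) by simp
  next
    case False
    then have k1: "k \<in> {1..n}" using k by auto
    have "s (k - 1) < x" using not_less_Least[of "k - 1" "\<lambda>k. x \<le> s k"] False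
      unfolding k_def[symmetric] by force
    show ?thesis
    proof (rule ccontr)
      assume "x \<noteq> s k"
      then have "(x, 1 - x) \<in> interior (draw s s k)" 
        using represents_meets_diagonal[OF r k1, of x] k \<open>s (k - 1) < x\<close> by simp
      moreover have "draw s s k \<in> S" using R(5) k1 by auto
      ultimately have "z \<notin> skeleton S" using not_skeleton[OF T, of "draw s s k" x "1 - x"] x
          mem_interior_is_rect[OF tiling_rect(1)[OF T], of "draw s s k" x "1 - x"] by auto
      then show False using z(1) ed by (auto simp: edge_def)
    qed
  qed
  have nb: "p \<noteq> (0, 1)" "p \<noteq> (1, 0)" "q \<noteq> (0, 1)" "q \<noteq> (1, 0)"
    using corner_edge_boundary[OF T T' ed] corner_edge_boundary[OF T T', of q p] ed edge_commute[of
      S p q] replaced_not_boundary[OF e]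
      open_segment_commute[of p q] by auto
  \<comment> \<open>A vertex at the crossing would lie on a vertical and on a horizontal side with
    line \<open>k\<close>, and the wall crossed there would have both directions.\<close>
  have vert_in: "z \<notin> vertices S" if "0 < k" "k < n"
  proof
    assume "z \<in> vertices S"
    then obtain K where K: "K \<in> S" "x = lc K \<or> x = rc K" "x = tc K \<or> x = bc K"
      using x mem_vertices[OF T] by auto
    obtain j where j: "j \<in> {1..n}" "K = draw s s j" using K R(5) by auto
    have inj: "a = k" if "s k = s a" "a \<le> n" for a
    proof (rule linorder_cases[of a k])
      assume "a < k" then show ?thesis using R(4)[of a k] k(2) that(1) by simp
    next
      assume "k < a" then show ?thesis using R(4)[of k a] that by simp
    qed
    have bd: "lf j \<le> n" "tp j \<le> n" "rt j \<le> n" "bt j \<le> n" using diag[OF j(1)] bounds[OF j(1)] j(1)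
      by auto
    have "lf j = k \<or> rt j = k" "tp j = k \<or> bt j = k"
      using K(2,3) draw_coords[OF R(6) j(1)] inj bd xk j(2) by metis+
    then have "vert k" "horiz k" using lf_vert(1)[OF j(1)] rt_vert(1)[OF j(1)] tp_horiz(1)[OF j(1)]
      bt_horiz(1)[OF j(1)] that by blast+
    then show False using not_vert_horiz by blast
  qed
  have pqv: "p \<in> vertices S" "q \<in> vertices S" "open_segment p q \<inter> vertices S = {}" using ed
    by (auto simp: edge_def)
  have "0 < k \<and> k < n"
  proof (rule ccontr)
    assume n: "\<not> ?thesis"
    have one: "1 \<in> {1..n}" "n \<in> {1..n}" using n_pos by auto
    have "z \<in> vertices S \<and> (z = (0, 1) \<or> z = (1, 0))"
    proof (cases "k = 0")
      case True
      have "lf 1 = 0" "tp 1 = 0" using diag[OF one(1)] by auto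
      then have "(0, 1) \<in> vertices S"
        using mem_vertices[OF T, of 0 1] R(2,5) draw_coords[OF R(6) one(1)] one by force
      then show ?thesis using True x xk R(2) by auto
    next
      case False
      then have kn: "k = n" using n k by auto
      have "rt n = n" "bt n = n" using diag[OF one(2)] bounds[OF one(2)] by auto
      then have "(1, 0) \<in> vertices S"
        using mem_vertices[OF T, of 1 0] R(3,5) draw_coords[OF R(6) one(2)] one by force
      then show ?thesis using kn x xk R(3) by auto
    qed
    then show False using z(1) pqv nb by (auto simp: open_segment_def)
  qed
  moreover have "z \<in> open_segment p q" using z(1) pqv vert_in calculation
    by (auto simp: open_segment_def)
  ultimately show thesis using that[of k] x xk by auto
qed

text \<open>To the left of \<open>xR\<close> the region meets the skeleton only at height
  \<open>y\<close>. The edge cannot stop inside, because a tile with a corner at its end has a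
  vertical side that leaves this height. It cannot pass \<open>xR\<close> either, because its
  crossing with that line would be a vertex in its interior.\<close>

lemma edge_right_end:
  assumes T: "tiling T" and e: "edge T (a, 1 - y) (e, 1 - y)"
    and ae: "a < e" "x0 < e" "x0 < xR" "a < xR" and y: "t < y" "y < b"
    and int: "\<And>x w. x0 < x \<Longrightarrow> x < xR \<Longrightarrow> t < w \<Longrightarrow> w < b \<Longrightarrow> w \<noteq> y \<Longrightarrow> (x, 1 - w) \<notin> skeleton T"
    and side: "\<And>w. t < w \<Longrightarrow> w < b \<Longrightarrow> (xR, 1 - w) \<in> skeleton T"
  shows "e = xR"
proof (rule linorder_cases[of e xR])
  assume lt: "e < xR"
  obtain J where J: "J \<in> T" "e = lc J \<or> e = rc J" "y = tc J \<or> y = bc J"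
    using e mem_vertices[OF T] by (auto simp: edge_def)
  note Jr = tiling_rect[OF T J(1)]
  obtain w where "w \<noteq> y" "t < w" "w < b" "tc J \<le> w" "w \<le> bc J"
  proof (cases "y = tc J")
    case True
    obtain w where "y < w" "w < min b (bc J)" using dense[of y "min b (bc J)"] y Jr True by auto
    then show thesis using that[of w] y True by auto
  next
    case False
    then obtain w where "max t (tc J) < w" "w < y" using dense[of "max t (tc J)" y] y Jr J by auto
    then show thesis using that[of w] y False J by auto
  qed
  moreover have "(e, 1 - w) \<in> skeleton T" using J(2) Jr calculation
    by (intro skeletonI[OF T J(1)]) auto
  ultimately show ?thesis using int[of e w] ae lt by blast
next
  assume gt: "xR < e"
  have sk: "closed_segment (a, 1 - y) (e, 1 - y) \<subseteq> skeleton T"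
    and nv: "open_segment (a, 1 - y) (e, 1 - y) \<inter> vertices T = {}"
    using e by (auto simp: edge_def)
  have yy: "0 < y" "y < 1" using skeleton_unit[OF T side, of "(t + y) / 2"] skeleton_unit[OF T side,
    of "(y + b) / 2"] y by auto
  have "0 \<le> a" "e \<le> 1" using skeleton_unit[OF T, of a y] skeleton_unit[OF T, of e y] sk by auto
  then have xx: "0 < xR" "xR < 1" using ae gt by auto
  obtain J where J: "J \<in> T" "lc J \<le> xR" "xR < rc J" "tc J < y" "y \<le> bc J"
    using quadrants[OF T xx yy] by metis
  have "lc J = xR"
  proof (rule ccontr)
    assume n: "lc J \<noteq> xR"
    obtain w where w: "max t (tc J) < w" "w < y" using dense[of "max t (tc J)" y] y J by auto
    show False using not_skeleton[OF T J(1), of xR "1 - w"] side[of w] w n J y by auto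
  qed
  moreover have "bc J = y"
  proof (rule ccontr)
    assume n: "bc J \<noteq> y"
    obtain x where x: "xR < x" "x < min e (rc J)" using dense[of xR "min e (rc J)"] gt J by auto
    have "(x, 1 - y) \<in> closed_segment (a, 1 - y) (e, 1 - y)"
      using x ae by (auto simp: closed_segment_horizontal closed_segment_eq_real_ivl)
    then show False using sk not_skeleton[OF T J(1), of x "1 - y"] x n J by auto
  qed
  ultimately have "(xR, 1 - y) \<in> vertices T" using J(1) by (auto simp: mem_vertices[OF T])
  moreover have "(xR, 1 - y) \<in> open_segment (a, 1 - y) (e, 1 - y)"
    using ae gt by (auto simp: open_segment_horizontal open_segment_eq_real_ivl)
  ultimately show ?thesis using nv by blast
qed

lemma edge_left_end:
  assumes T: "tiling T" and e: "edge T (a, 1 - y) (e, 1 - y)"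
    and ae: "a < e" "a < x0" "xL < x0" "xL < e" and y: "t < y" "y < b"
    and int: "\<And>x w. xL < x \<Longrightarrow> x < x0 \<Longrightarrow> t < w \<Longrightarrow> w < b \<Longrightarrow> w \<noteq> y \<Longrightarrow> (x, 1 - w) \<notin> skeleton T"
    and side: "\<And>w. t < w \<Longrightarrow> w < b \<Longrightarrow> (xL, 1 - w) \<in> skeleton T"
  shows "a = xL"
proof (rule linorder_cases[of xL a])
  assume lt: "xL < a"
  obtain J where J: "J \<in> T" "a = lc J \<or> a = rc J" "y = tc J \<or> y = bc J"
    using e mem_vertices[OF T] by (auto simp: edge_def)
  note Jr = tiling_rect[OF T J(1)]
  obtain w where "w \<noteq> y" "t < w" "w < b" "tc J \<le> w" "w \<le> bc J"
  proof (cases "y = tc J")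
    case True
    obtain w where "y < w" "w < min b (bc J)" using dense[of y "min b (bc J)"] y Jr True by auto
    then show thesis using that[of w] y True by auto
  next
    case False
    then obtain w where "max t (tc J) < w" "w < y" using dense[of "max t (tc J)" y] y Jr J by auto
    then show thesis using that[of w] y False J by auto
  qed
  moreover have "(a, 1 - w) \<in> skeleton T" using J(2) Jr calculation
    by (intro skeletonI[OF T J(1)]) auto
  ultimately show ?thesis using int[of a w] ae lt by blast
next
  assume gt: "a < xL"
  have sk: "closed_segment (a, 1 - y) (e, 1 - y) \<subseteq> skeleton T"
    and nv: "open_segment (a, 1 - y) (e, 1 - y) \<inter> vertices T = {}"
    using e by (auto simp: edge_def)
  have yy: "0 < y" "y < 1" using skeleton_unit[OF T side, of "(t + y) / 2"] skeleton_unit[OF T side,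
    of "(y + b) / 2"] y by auto
  have "0 \<le> a" "e \<le> 1" using skeleton_unit[OF T, of a y] skeleton_unit[OF T, of e y] sk by auto
  then have xx: "0 < xL" "xL < 1" using ae gt by auto
  obtain J where J: "J \<in> T" "lc J < xL" "xL \<le> rc J" "tc J < y" "y \<le> bc J"
    using quadrants[OF T xx yy] by metis
  have "rc J = xL"
  proof (rule ccontr)
    assume n: "rc J \<noteq> xL"
    obtain w where w: "max t (tc J) < w" "w < y" using dense[of "max t (tc J)" y] y J by auto
    show False using not_skeleton[OF T J(1), of xL "1 - w"] side[of w] w n J y by auto
  qed
  moreover have "bc J = y"
  proof (rule ccontr)
    assume n: "bc J \<noteq> y"
    obtain x where x: "max a (lc J) < x" "x < xL" using dense[of "max a (lc J)" xL] gt J by auto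
    have "(x, 1 - y) \<in> closed_segment (a, 1 - y) (e, 1 - y)"
      using x ae by (auto simp: closed_segment_horizontal closed_segment_eq_real_ivl)
    then show False using sk not_skeleton[OF T J(1), of x "1 - y"] x n J by auto
  qed
  ultimately have "(xL, 1 - y) \<in> vertices T" using J(1) by (auto simp: mem_vertices[OF T])
  moreover have "(xL, 1 - y) \<in> open_segment (a, 1 - y) (e, 1 - y)"
    using ae gt by (auto simp: open_segment_horizontal open_segment_eq_real_ivl)
  ultimately show ?thesis using nv by blast
qed simp

text \<open>Two neighbours \<open>K\<close> and \<open>L\<close> separated by an edge that ends at the bottom of both. A flip of
  that edge cuts their union along the height \<open>y\<close>: the first case is a simple flip, the second one
  a rotation about the upper endpoint, where \<open>L\<close> reaches further up than \<open>K\<close>.\<close>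

locale flip_region =
  fixes S :: "point set set" and K L :: "point set" and x0 xl xr tk tl b x1 y :: real
  assumes S: "tiling S" and KL: "K \<in> S" "L \<in> S"
    and K: "lc K = xl" "rc K = x0" "tc K = tk" "bc K = b"
    and L: "lc L = x0" "rc L = xr" "tc L = tl" "bc L = b"
    and cut: "x1 = xl \<and> tl = tk \<and> tk < y \<and> y < b \<or> x1 = x0 \<and> tl < tk \<and> y = tk"
begin

lemma ord: "xl < x0" "x0 < xr" "tk < b" "tl \<le> tk" "0 \<le> xl" "xr \<le> 1" "0 \<le> tl" "b \<le> 1" "tk \<le> y"
  "y < b" "tl < y" "x1 \<le> x0" "xl \<le> x1"
  using tiling_rect[OF S KL(1)] tiling_rect[OF S KL(2)] K L cut by auto

abbreviation "old \<equiv> open_segment (x0, 1 - tk) (x0, 1 - b)"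
abbreviation "new \<equiv> closed_segment (x1, 1 - y) (xr, 1 - y)"
definition "K' = rect xl xr y b"
definition "L' = rect x1 xr tl y"

lemma mem_old: "(x, 1 - w) \<in> old \<longleftrightarrow> x = x0 \<and> tk < w \<and> w < b"
  using ord by (auto simp: open_segment_vertical open_segment_eq_real_ivl)

lemma mem_new: "(x, 1 - w) \<in> new \<longleftrightarrow> w = y \<and> x1 \<le> x \<and> x \<le> xr"
  using ord by (auto simp: closed_segment_horizontal closed_segment_eq_real_ivl)

lemma K'_coords: "is_rect K'" "lc K' = xl" "rc K' = xr" "tc K' = y" "bc K' = b"
  using ord unfolding K'_def by (auto simp: is_rect_rect coords_rect)

lemma L'_coords: "is_rect L'" "lc L' = x1" "rc L' = xr" "tc L' = tl" "bc L' = y"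
  using ord unfolding L'_def by (auto simp: is_rect_rect coords_rect)

lemma frontiers: "frontier K' \<union> frontier L' = (frontier K \<union> frontier L - old) \<union> new"
proof (rule set_eqI)
  fix p :: point
  obtain x w where p: "p = (x, 1 - w)" by (rule down_point)
  note fr = mem_frontier_is_rect[OF tiling_rect(1)[OF S KL(1)], of x "1 - w"]
    mem_frontier_is_rect[OF tiling_rect(1)[OF S KL(2)], of x "1 - w"]
  have "p \<in> frontier K \<union> frontier L - old \<union> new \<longleftrightarrow>
    ((xl \<le> x \<and> x \<le> x0 \<and> tk \<le> w \<and> w \<le> b \<and> (x = xl \<or> x = x0 \<or> w = tk \<or> w = b)) \<or>
     (x0 \<le> x \<and> x \<le> xr \<and> tl \<le> w \<and> w \<le> b \<and> (x = x0 \<or> x = xr \<or> w = tl \<or> w = b))) \<and> \<not> (x = x0 \<and> tk < w \<and>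
       w < b) \<or>
      (w = y \<and> x1 \<le> x \<and> x \<le> xr)"
    unfolding p Un_iff Diff_iff fr mem_old mem_new K L by simp
  moreover have "p \<in> frontier K' \<union> frontier L' \<longleftrightarrow>
    (xl \<le> x \<and> x \<le> xr \<and> y \<le> w \<and> w \<le> b \<and> (x = xl \<or> x = xr \<or> w = y \<or> w = b)) \<or>
    (x1 \<le> x \<and> x \<le> xr \<and> tl \<le> w \<and> w \<le> y \<and> (x = x1 \<or> x = xr \<or> w = tl \<or> w = y))"
    unfolding p Un_iff mem_frontier_is_rect[OF K'_coords(1)] mem_frontier_is_rect[OF L'_coords(1)]
      K'_coords L'_coords by simp
  ultimately show "p \<in> frontier K' \<union> frontier L' \<longleftrightarrow> p \<in> frontier K \<union> frontier L - old \<union> new"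
    using ord cut by (smt (verit))
qed

lemma other_tile_old:
  assumes "J \<in> S" "lc J \<le> x0" "x0 \<le> rc J" "tc J \<le> w" "w \<le> bc J" "tk < w" "w < b"
    shows "J = K \<or> J = L"
  by (rule tiles_at_common_side[OF S KL _ _ _ _ _ _ assms(1-5)]) (use K L assms ord in auto)

lemma frontier_other_old:
  assumes "J \<in> S" "J \<noteq> K" "J \<noteq> L" shows "frontier J \<inter> old = {}"
proof (rule ccontr)
  assume "\<not> ?thesis"
  then obtain x w where "(x, 1 - w) \<in> frontier J" "(x, 1 - w) \<in> old" by (metis IntE nonempty_down)
  then show False using other_tile_old[OF assms(1), of w] assms(2,3) unfolding mem_old
    by (simp add: mem_frontier_is_rect[OF tiling_rect(1)[OF S assms(1)]])
qed

lemma skeleton_cut: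
  "skeleton (S - {K, L} \<union> {K', L'}) = (skeleton S - old) \<union> new"
proof -
  have "skeleton (S - {K, L} \<union> {K', L'}) = (\<Union>J\<in>S - {K, L}.
    frontier J) \<union> (frontier K' \<union> frontier L')"
    by (auto simp: skeleton_def)
  also have "\<dots> = ((\<Union>J\<in>S - {K, L}. frontier J) - old) \<union> ((frontier K \<union> frontier L - old) \<union> new)"
    unfolding frontiers using frontier_other_old by blast
  also have "\<dots> = (skeleton S - old) \<union> new" using KL by (auto simp: skeleton_def)
  finally show ?thesis .
qed

lemma disjoint_other:
  assumes J: "J \<in> S" "J \<noteq> K" "J \<noteq> L" and c: "lc J < x" "x < rc J" "tc J < w" "w < bc J"
    and m: "xl \<le> x \<and> x \<le> x0 \<and> tk \<le> w \<and> w \<le> b \<or> x0 \<le> x \<and> x \<le> xr \<and> tl \<le> w \<and> w \<le> b"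
  shows False
  using m
proof
  assume a: "xl \<le> x \<and> x \<le> x0 \<and> tk \<le> w \<and> w \<le> b"
  have "J = K" by (rule tiling_disjoint[OF S J(1) KL(1)]) (use a c K in auto)
  then show False using J by simp
next
  assume a: "x0 \<le> x \<and> x \<le> xr \<and> tl \<le> w \<and> w \<le> b"
  have "J = L" by (rule tiling_disjoint[OF S J(1) KL(2)]) (use a c L in auto)
  then show False using J by simp
qed

text \<open>A tiling is determined by its skeleton: the unaffected tiles and the two new rectangles
  satisfy \<open>tile_in_tilingI\<close>, and together they leave no room for other tiles.\<close>

lemma replaced_tiles:
  assumes S': "tiling S'" and sk: "skeleton S' = (skeleton S - old) \<union> new"
  shows "S' = S - {K, L} \<union> {K', L'}"
proof -
  have other: "J \<in> S'" if J: "J \<in> S - {K, L}" for J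
  proof (rule tile_in_tilingI[OF S'])
    note Jr = tiling_rect[OF S, of J]
    show "is_rect J" "0 \<le> lc J" "rc J \<le> 1" "0 \<le> tc J" "bc J \<le> 1" using Jr J by auto
    have "frontier J \<subseteq> skeleton S" using J by (auto simp: skeleton_def)
    then show "frontier J \<subseteq> skeleton S'" using frontier_other_old[of J] J sk by blast
    show "interior J \<inter> skeleton S' = {}"
    proof (rule ccontr)
      assume "\<not> ?thesis"
      then obtain x w where p: "(x, 1 - w) \<in> interior J" "(x, 1 - w) \<in> skeleton S'"
        by (metis IntE nonempty_down)
      then have c: "lc J < x" "x < rc J" "tc J < w" "w < bc J" using Jr(1) J
        by (auto simp: mem_interior_is_rect)
      then have "(x, 1 - w) \<notin> skeleton S" using not_skeleton[OF S, of J x "1 - w"] J by auto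
      then have "(x, 1 - w) \<in> new" using p sk by blast
      then show False using disjoint_other[of J x w] J c ord cut unfolding mem_new
        by (smt (verit) DiffD1 DiffD2 insertCI)
    qed
  qed
  have inside: "(x, 1 - w) \<notin> skeleton S'" 
    if "xl < x \<and> x < xr \<and> y < w \<and> w < b \<or> x1 < x \<and> x < xr \<and> tl < w \<and> w < y" for x w
  proof
    assume "(x, 1 - w) \<in> skeleton S'"
    moreover have "(x, 1 - w) \<notin> new" using that unfolding mem_new by auto
    ultimately have s: "(x, 1 - w) \<in> skeleton S" "(x, 1 - w) \<notin> old" using sk by auto
    have "xl < x \<and> x < x0 \<and> tk < w \<and> w < b \<or> x0 < x \<and> x < xr \<and> tl < w \<and> w < b"
      using s(2) that ord cut unfolding mem_old by (smt (verit))
    then show False using not_skeleton[OF S KL(1), of x "1 - w"] not_skeleton[OF S KL(2), of x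
      "1 - w"] s(1) K L by auto
  qed
  have fr: "frontier K' \<subseteq> skeleton S'" "frontier L' \<subseteq> skeleton S'"
  proof -
    have "frontier K \<union> frontier L \<subseteq> skeleton S" using KL by (auto simp: skeleton_def)
    then have "frontier K' \<union> frontier L' \<subseteq> skeleton S'" unfolding frontiers sk by blast
    then show "frontier K' \<subseteq> skeleton S'" "frontier L' \<subseteq> skeleton S'" by auto
  qed
  have K'S: "K' \<in> S'"
  proof (rule tile_in_tilingI[OF S' K'_coords(1)])
    show "interior K' \<inter> skeleton S' = {}"
    proof (rule ccontr)
      assume "\<not> ?thesis"
      then obtain x w where "(x, 1 - w) \<in> interior K'" "(x, 1 - w) \<in> skeleton S'"
        by (metis IntE nonempty_down)
      then show False using inside[of x w]
        by (auto simp: mem_interior_is_rect[OF K'_coords(1)] K'_coords)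
    qed
  qed (use ord fr K'_coords in auto)
  have L'S: "L' \<in> S'"
  proof (rule tile_in_tilingI[OF S' L'_coords(1)])
    show "interior L' \<inter> skeleton S' = {}"
    proof (rule ccontr)
      assume "\<not> ?thesis"
      then obtain x w where "(x, 1 - w) \<in> interior L'" "(x, 1 - w) \<in> skeleton S'"
        by (metis IntE nonempty_down)
      then show False using inside[of x w]
        by (auto simp: mem_interior_is_rect[OF L'_coords(1)] L'_coords)
    qed
  qed (use ord fr L'_coords in auto)
  have "J \<in> S - {K, L} \<union> {K', L'}" if J: "J \<in> S'" for J
  proof -
    note Jr = tiling_rect[OF S' J]
    define x where "x = (lc J + rc J) / 2"
    define w where "w = (tc J + bc J) / 2"
    have c: "lc J < x" "x < rc J" "tc J < w" "w < bc J" using Jr by (auto simp: x_def w_def)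
    obtain A where A: "A \<in> S" "lc A \<le> x" "x \<le> rc A" "tc A \<le> w" "w \<le> bc A"
      using tiling_cover[OF S, of x w] c Jr by auto
    show ?thesis
    proof (cases "A = K \<or> A = L")
      case False
      then have "A \<in> S'" using other A by auto
      then have "J = A" by (intro tiling_disjoint[OF S' J]) (use A c in auto)
      then show ?thesis using A False by auto
    next
      case True
      then have "xl \<le> x \<and> x \<le> xr \<and> y \<le> w \<and> w \<le> b \<or> x1 \<le> x \<and> x \<le> xr \<and> tl \<le> w \<and> w \<le> y"
        using A K L ord cut by auto
      then show ?thesis
      proof
        assume "xl \<le> x \<and> x \<le> xr \<and> y \<le> w \<and> w \<le> b"
        then have "J = K'" by (intro tiling_disjoint[OF S' J K'S]) (use c K'_coords in auto)
        then show ?thesis by simp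
      next
        assume "x1 \<le> x \<and> x \<le> xr \<and> tl \<le> w \<and> w \<le> y"
        then have "J = L'" by (intro tiling_disjoint[OF S' J L'S]) (use c L'_coords in auto)
        then show ?thesis by simp
      qed
    qed
  qed
  then show ?thesis using other K'S L'S by blast
qed

end

section \<open>The edge between two consecutive labels\<close>

context diagonal_grid begin

text \<open>The left tile reaches at least as far down and the right tile at least as far up.
  Therefore the common side runs from \<open>tp k\<close> to \<open>bt (k + 1)\<close>, the lines of
  the later endpoints \<open>upper\<close> and \<open>lower\<close>.\<close>

lemma tp_left_ge:
  assumes v: "vert k" shows "tp (k + 1) \<le> tp k" "bt (k + 1) \<le> bt k"
proof -
  have k: "k \<in> {1..n}" "k + 1 \<in> {1..n}" "rt k = k" "lf (k + 1) = k" "0 < k" using v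
    by (auto simp: vert_def)
  show "bt (k + 1) \<le> bt k" by (rule bt_right_le) (use k in auto)
  interpret t: diagonal_grid n "turned n rt" "turned n lf" "turned n bt" "turned n tp"
    by (rule rotate)
  have "turned n tp (n + 1 - k) \<le> turned n tp (n - k)"
    by (rule t.bt_right_le) (use k in auto)
  moreover have "n + 1 - (n + 1 - k) = k" "n + 1 - (n - k) = k + 1" using k by auto
  moreover have "tp k \<le> n" "tp (k + 1) \<le> n" using diag[OF k(1)] diag[OF k(2)] k by auto
  ultimately show "tp (k + 1) \<le> tp k" by auto
qed

text \<open>The tile above \<open>i + 1\<close> ends at line \<open>m < i\<close>, so its label is
  at most \<open>m\<close>; hence it starts left of line \<open>i\<close> and passes over the end of
  the wall.\<close>

lemma above_equal_top:
  assumes v: "vert i" and t: "tp i = m" "tp (i + 1) = m" "0 < m"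
  obtains c where "c \<in> {1..n}" "lf c < i" "i < rt c" "bt c = m"
proof -
  have i: "i \<in> {1..n}" "i + 1 \<in> {1..n}" "lf (i + 1) = i" using v by (auto simp: vert_def)
  note d = diag[OF i(1)] diag[OF i(2)]
  have m: "m \<in> {1..n}" "m < i" using t d i by auto
  obtain c where c: "c \<in> {1..n}" "lf c < i + 1" "i + 1 \<le> rt c" "tp c < m" "m \<le> bt c"
    using cover[OF i(2) m(1)] by blast
  have bm: "bt c = m"
  proof (rule ccontr)
    assume "bt c \<noteq> m"
    then have "c = i + 1" using disj[OF c(1) i(2), of "i + 1" "m + 1"] c d i t m by auto
    then show False using c t by auto
  qed
  then have "c \<le> m" using diag[OF c(1)] by auto
  then have "lf c < i" using diag[OF c(1)] m by auto
  then show thesis using that[of c] c bm by auto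
qed

lemma below_equal_bottom:
  assumes v: "vert i" and t: "bt i = m" "bt (i + 1) = m" "m < n"
  obtains c where "c \<in> {1..n}" "lf c < i" "i < rt c" "tp c = m"
proof -
  have i: "i \<in> {1..n}" "i + 1 \<in> {1..n}" "rt i = i" using v by (auto simp: vert_def)
  note d = diag[OF i(1)] diag[OF i(2)]
  have m: "m + 1 \<in> {1..n}" "i < m" using t d i by auto
  obtain c where c: "c \<in> {1..n}" "lf c < i" "i \<le> rt c" "tp c < m + 1" "m + 1 \<le> bt c"
    using cover[OF i(1) m(1)] by blast
  have bm: "tp c = m"
  proof (rule ccontr)
    assume "tp c \<noteq> m"
    then have "c = i" using disj[OF c(1) i(1), of i m] c d i t m by auto
    then show False using c t by auto
  qed
  then have "m < c" using diag[OF c(1)] by auto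
  then have "i < rt c" using diag[OF c(1)] m by auto
  then show thesis using that[of c] c bm by auto
qed

end

lemma vertexI:
  "tiling R \<Longrightarrow> K \<in> R \<Longrightarrow> x = lc K \<or> x = rc K \<Longrightarrow> 1 - y = tc K \<or> 1 - y = bc K \<Longrightarrow> (x, y) \<in> vertices R"
  using mem_vertices by blast

locale vertical_edge =
  fixes S :: "point set set" and n :: nat and lf rt tp bt :: "nat \<Rightarrow> nat" and s :: "nat \<Rightarrow> real"
    and i :: nat
  assumes r: "represents S n lf rt tp bt s" and T: "tiling S"
    and v: "diagonal_grid.vert n lf rt tp bt i"
begin

sublocale diagonal_grid n lf rt tp bt by (rule representsD[OF r])

abbreviation "D \<equiv> draw s s"
abbreviation "upper \<equiv> (s i, 1 - s (tp i))"
abbreviation "lower \<equiv> (s i, 1 - s (bt (Suc i)))"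

lemma less: "a < b \<Longrightarrow> b \<le> n \<Longrightarrow> s a < s b"
  using representsD(4)[OF r] by blast

lemma le: "a \<le> b \<Longrightarrow> b \<le> n \<Longrightarrow> s a \<le> s b"
  using represents_mono[OF r] by blast

lemma idx: "0 < i" "i < n" "i \<in> {1..n}" "Suc i \<in> {1..n}" "rt i = i" "lf (Suc i) = i" "lf i < i"
  "i < rt (Suc i)"
  "tp i < i" "i < bt i" "tp (Suc i) < i" "i < bt (Suc i)" "tp (Suc i) \<le> tp i" "bt (Suc i) \<le> bt i"
  "rt (Suc i) \<le> n" "bt i \<le> n"
  using v diag[of i] diag[of "Suc i"] bounds[of i] bounds[of "Suc i"] tp_left_ge[OF v]
    by (auto simp: vert_def)

lemma K: "D i \<in> S" "lc (D i) = s (lf i)" "rc (D i) = s i" "tc (D i) = s (tp i)"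
  "bc (D i) = s (bt i)"
  using draw_coords[OF representsD(6)[OF r] idx(3)] representsD(5)[OF r] idx by auto

lemma L: "D (Suc i) \<in> S" "lc (D (Suc i)) = s i" "rc (D (Suc i)) = s (rt (Suc i))"
  "tc (D (Suc i)) = s (tp (Suc i))" "bc (D (Suc i)) = s (bt (Suc i))"
  using draw_coords[OF representsD(6)[OF r] idx(4)] representsD(5)[OF r] idx by auto

lemma ord: "s (lf i) < s i" "s i < s (rt (Suc i))" "s (tp i) < s i" "s i < s (bt i)"
  "s i < s (bt (Suc i))"
  "s (tp (Suc i)) \<le> s (tp i)" "s (bt (Suc i)) \<le> s (bt i)" "s (tp (Suc i)) < s i"
  using idx by (auto intro: less le)

lemma common_side:
  assumes "J \<in> S" "lc J \<le> s i" "s i \<le> rc J" "tc J \<le> w" "w \<le> bc J" "s (tp i) < w"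
    "w < s (bt (Suc i))"
  shows "J = D i \<or> J = D (Suc i)"
  by (rule tiles_at_common_side[OF T K(1) L(1) _ _ _ _ _ _ assms(1-5)]) (use K L assms ord in auto)

lemma no_vertex: "s (tp i) < w \<Longrightarrow> w < s (bt (Suc i)) \<Longrightarrow> (s i, 1 - w) \<notin> vertices S"
proof
  assume w: "s (tp i) < w" "w < s (bt (Suc i))" and "(s i, 1 - w) \<in> vertices S"
  then obtain J where J: "J \<in> S" "s i = lc J \<or> s i = rc J" "w = tc J \<or> w = bc J"
    by (auto simp: mem_vertices[OF T])
  have "lc J \<le> s i" "s i \<le> rc J" "tc J \<le> w" "w \<le> bc J"
    using J(2,3) tiling_rect(3,6)[OF T J(1)] by (metis less_imp_le order_refl)+
  then have "J = D i \<or> J = D (Suc i)" using w by (intro common_side[OF J(1)])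
  then show False using J(3) w K(4,5) L(4,5) ord by (elim disjE) simp_all
qed

lemma edge_top_bot: "edge S upper lower"
  unfolding edge_def
proof (intro conjI)
  show "upper \<in> vertices S" by (rule vertexI[OF T K(1)]) (use K in simp_all)
  show "lower \<in> vertices S" by (rule vertexI[OF T L(1)]) (use L in simp_all)
  show "upper \<noteq> lower" using ord by auto
  show "closed_segment upper lower \<subseteq> skeleton S"
    using ord K by (auto simp: closed_segment_vertical closed_segment_eq_real_ivl intro!:
      skeletonI[OF T K(1)])
  show "open_segment upper lower \<inter> vertices S = {}"
  proof (rule ccontr)
    assume "\<not> ?thesis"
    then obtain x w where "(x, 1 - w) \<in> open_segment upper lower" "(x, 1 - w) \<in> vertices S"
      by (metis IntE nonempty_down)
    then show False using no_vertex[of w] ord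
      by (auto simp: open_segment_vertical open_segment_eq_real_ivl)
  qed
qed

lemma crossing_edge:
  assumes e: "edge S p q" and c: "(s i, 1 - s i) \<in> open_segment p q"
  shows "p = upper \<and> q = lower \<or> p = lower \<and> q = upper"
proof -
  have main: "p = upper \<and> q = lower"
    if e: "edge S p q" and c: "(s i, 1 - s i) \<in> open_segment p q"
      and o: "snd q < snd p \<or> snd p = snd q \<and> fst p \<le> fst q" for p q
  proof -
    obtain a y b z where pq: "p = (a, y)" "q = (b, z)" by fastforce
    have sk: "closed_segment p q \<subseteq> skeleton S"
      and nv: "open_segment p q \<inter> vertices S = {}" "p \<in> vertices S" "q \<in> vertices S"
      using e by (auto simp: edge_def)
    have "a = b"
    proof (rule ccontr)
      assume "a \<noteq> b"
      then have yz: "y = z" using segment_in_skeleton_axis_parallel[OF T sk] pq by auto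
      then have "a < b" using o \<open>a \<noteq> b\<close> pq by auto
      then have ab: "a < s i" "s i < b" "y = 1 - s i"
        using c unfolding pq yz by (auto simp: open_segment_horizontal open_segment_eq_real_ivl)
      obtain x where x: "max a (s (lf i)) < x" "x < s i"
        using dense[of "max a (s (lf i))" "s i"] ab ord by auto
      have "(x, 1 - s i) \<in> closed_segment p q"
        using x ab unfolding pq yz[symmetric]
          by (auto simp: closed_segment_horizontal closed_segment_eq_real_ivl)
      moreover have "(x, 1 - s i) \<notin> skeleton S"
        by (rule not_skeleton[OF T K(1)]) (use x K ord in auto)
      ultimately show False using sk by blast
    qed
    then have zy: "z < y" using o e pq by (auto simp: edge_def)
    have as: "a = s i" "z < 1 - s i" "1 - s i < y"
      using c zy unfolding pq \<open>a = b\<close> by (auto simp: open_segment_vertical open_segment_eq_real_ivl)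
    have op: "(s i, u) \<in> open_segment p q \<longleftrightarrow> z < u \<and> u < y" for u
      using zy as unfolding pq \<open>a = b\<close>
        by (auto simp: open_segment_vertical open_segment_eq_real_ivl)
    have tb: "upper \<in> vertices S" "lower \<in> vertices S" using edge_top_bot by (auto simp: edge_def)
    have "\<not> (z < 1 - s (tp i) \<and> 1 - s (tp i) < y)"
      "\<not> (z < 1 - s (bt (Suc i)) \<and> 1 - s (bt (Suc i)) < y)"
      using op nv(1) tb by blast+
    moreover have "\<not> (s (tp i) < 1 - y \<and> 1 - y < s (bt (Suc i)))"
      "\<not> (s (tp i) < 1 - z \<and> 1 - z < s (bt (Suc i)))"
      using no_vertex[of "1 - y"] no_vertex[of "1 - z"] nv(2,3) pq as \<open>a = b\<close> by auto
    ultimately have "y = 1 - s (tp i)" "z = 1 - s (bt (Suc i))" using as ord by linarith+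
    then show ?thesis using pq as \<open>a = b\<close> by auto
  qed
  consider "snd q < snd p \<or> snd p = snd q \<and> fst p \<le> fst q" |
    "snd p < snd q \<or> snd q = snd p \<and> fst q \<le> fst p" by linarith
  then show ?thesis
  proof cases
    case 1 then show ?thesis using main[OF e c] by blast
  next
    case 2 then show ?thesis using main[of q p] e c edge_commute open_segment_commute by metis
  qed
qed

text \<open>The left side of tile \<open>i + 1\<close> continues the wall beyond the end of tile
  \<open>i\<close>.\<close>

lemma matched_top:
  assumes "tp (Suc i) < tp i" shows "matched_at S upper lower"
proof -
  let ?w = "(s i, 1 - s (tp (Suc i)))"
  have lt: "s (tp (Suc i)) < s (tp i)" using assms idx by (intro less) auto
  have "?w \<in> vertices S" by (rule vertexI[OF T L(1)]) (use L in simp_all)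
  moreover have "closed_segment upper ?w \<subseteq> skeleton S"
    using lt L ord by (auto simp: closed_segment_vertical closed_segment_eq_real_ivl intro!:
      skeletonI[OF T L(1)])
  ultimately obtain q where q: "edge S upper q" "q \<in> closed_segment upper ?w"
    using next_vertex[OF T, of upper ?w] edge_top_bot lt by (auto simp: edge_def)
  then have "upper \<in> open_segment lower q" using lt ord
    by (auto simp: edge_def closed_segment_vertical open_segment_vertical closed_segment_eq_real_ivl
      open_segment_eq_real_ivl)
  then show ?thesis using q(1) unfolding matched_at_def by blast
qed

lemma matched_bot:
  assumes "bt (Suc i) < bt i" shows "matched_at S lower upper"
proof -
  let ?w = "(s i, 1 - s (bt i))"
  have lt: "s (bt (Suc i)) < s (bt i)" using assms idx by (intro less) auto
  have "?w \<in> vertices S" by (rule vertexI[OF T K(1)]) (use K in simp_all)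
  moreover have "closed_segment lower ?w \<subseteq> skeleton S"
    using lt K ord by (auto simp: closed_segment_vertical closed_segment_eq_real_ivl intro!:
      skeletonI[OF T K(1)])
  ultimately obtain q where q: "edge S lower q" "q \<in> closed_segment lower ?w"
    using next_vertex[OF T, of lower ?w] edge_top_bot lt by (auto simp: edge_def)
  then have "lower \<in> open_segment upper q" using lt ord
    by (auto simp: edge_def closed_segment_vertical open_segment_vertical closed_segment_eq_real_ivl
      open_segment_eq_real_ivl)
  then show ?thesis using q(1) unfolding matched_at_def by blast
qed

lemma collinear_continuation:
  assumes "(x, y) \<in> open_segment (x, y') (q :: point)"
  shows "fst q = x"
proof -
  obtain u where u: "0 < u" "u < 1" "(x, y) = (1 - u) *\<^sub>R (x, y') + u *\<^sub>R q" using assms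
    by (auto simp: in_segment)
  then have "x = (1 - u) * x + u * fst q" by (metis fst_add fst_conv fst_scaleR real_scaleR_def)
  then have "u * (fst q - x) = 0" by (auto simp: algebra_simps)
  then show ?thesis using u by auto
qed

text \<open>If the tops are level, the tile from \<open>above_equal_top\<close> lies across the line
  above the endpoint, so no collinear edge can leave it upwards. At the boundary of the square there
  is no room for one.\<close>

lemma not_matched_top:
  assumes eq: "tp (Suc i) = tp i" shows "\<not> matched_at S upper lower"
proof
  assume "matched_at S upper lower"
  then obtain q where q: "edge S upper q" "upper \<in> open_segment lower q" unfolding matched_at_def
    by blast
  obtain w where w: "q = (s i, 1 - w)" using collinear_continuation[OF q(2)]
    by (metis down_point fst_conv)
  have lt: "w < s (tp i)" using q(2) ord unfolding w
    by (auto simp: open_segment_vertical open_segment_eq_real_ivl split: if_splits)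
  have sk: "closed_segment upper q \<subseteq> skeleton S" using q(1) by (simp add: edge_def)
  have "0 \<le> w" using skeleton_unit[OF T, of "s i" w] sk w by auto
  then have "0 < tp i" using lt representsD(2)[OF r] by (cases "tp i = 0") auto
  then obtain c where c: "c \<in> {1..n}" "lf c < i" "i < rt c" "bt c = tp i"
    using above_equal_top[OF v, of "tp i"] eq by auto
  note C = draw_coords[OF representsD(6)[OF r] c(1)]
  have DS: "D c \<in> S" using representsD(5)[OF r] c by auto
  have o: "s (lf c) < s i" "s i < s (rt c)" "s (tp c) < s (tp i)"
    using c bounds[OF c(1)] diag[OF c(1)] idx by (auto intro!: less)
  obtain x where x: "max w (s (tp c)) < x" "x < s (tp i)"
    using dense[of "max w (s (tp c))" "s (tp i)"] lt o by auto
  have "(s i, 1 - x) \<in> closed_segment upper q" using x unfolding w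
    by (auto simp: closed_segment_vertical closed_segment_eq_real_ivl)
  moreover have "(s i, 1 - x) \<notin> skeleton S" by (rule not_skeleton[OF T DS]) (use x C c o in auto)
  ultimately show False using sk by blast
qed

lemma not_matched_bot:
  assumes eq: "bt (Suc i) = bt i" shows "\<not> matched_at S lower upper"
proof
  assume "matched_at S lower upper"
  then obtain q where q: "edge S lower q" "lower \<in> open_segment upper q" unfolding matched_at_def
    by blast
  obtain w where w: "q = (s i, 1 - w)" using collinear_continuation[OF q(2)]
    by (metis down_point fst_conv)
  have lt: "s (bt i) < w" using q(2) ord eq unfolding w
    by (auto simp: open_segment_vertical open_segment_eq_real_ivl split: if_splits)
  have sk: "closed_segment lower q \<subseteq> skeleton S" using q(1) by (simp add: edge_def)
  have "w \<le> 1" using skeleton_unit[OF T, of "s i" w] sk w by auto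
  then have "bt i < n" using lt representsD(3)[OF r] idx by (cases "bt i = n") auto
  then obtain c where c: "c \<in> {1..n}" "lf c < i" "i < rt c" "tp c = bt i"
    using below_equal_bottom[OF v, of "bt i"] eq by auto
  note C = draw_coords[OF representsD(6)[OF r] c(1)]
  have DS: "D c \<in> S" using representsD(5)[OF r] c by auto
  have o: "s (lf c) < s i" "s i < s (rt c)" "s (bt i) < s (bt c)"
    using c bounds[OF c(1)] diag[OF c(1)] idx by (auto intro!: less)
  obtain x where x: "s (bt i) < x" "x < min w (s (bt c))"
    using dense[of "s (bt i)" "min w (s (bt c))"] lt o by auto
  have "(s i, 1 - x) \<in> closed_segment lower q" using x eq unfolding w
    by (auto simp: closed_segment_vertical closed_segment_eq_real_ivl)
  moreover have "(s i, 1 - x) \<notin> skeleton S" by (rule not_skeleton[OF T DS]) (use x C c o in auto)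
  ultimately show False using sk by blast
qed

lemma flip_region_simple:
  assumes "tp (Suc i) = tp i" "bt (Suc i) = bt i" "s (tp i) < y" "y < s (bt i)"
  shows "flip_region S (D i) (D (Suc i)) (s i) (s (lf i)) (s (rt (Suc i))) (s (tp i)) (s (tp (Suc
    i))) (s (bt i)) (s (lf i)) y"
  using assms K L T by unfold_locales auto

lemma flip_region_rotation:
  assumes "tp (Suc i) < tp i" "bt (Suc i) = bt i"
  shows "flip_region S (D i) (D (Suc i)) (s i) (s (lf i)) (s (rt (Suc i))) (s (tp i)) (s (tp (Suc
    i))) (s (bt i)) (s i) (s (tp i))"
proof -
  have "s (tp (Suc i)) < s (tp i)" using assms idx by (intro less) auto
  then show ?thesis using assms K L T by unfold_locales auto
qed

lemma perpendicular:
  assumes "edge_replacement S upper lower S' p' q'" shows "snd p' = snd q'"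
proof -
  have "(lower - upper) \<bullet> (q' - p') = 0" using assms by (simp add: edge_replacement_def)
  then have "(s (tp i) - s (bt (Suc i))) * (snd q' - snd p') = 0" by (simp add: inner_prod_def)
  then show ?thesis using ord by auto
qed

text \<open>A flip prescribes only the skeleton. Perpendicularity makes the new edge horizontal, the
  common point with the old edge puts it into the union of the two tiles, and the end lemmas stretch
  it to both outer sides. Its height remains free.\<close>

lemma simple_flip_region:
  assumes eq: "tp (Suc i) = tp i" "bt (Suc i) = bt i"
    and e: "edge_replacement S upper lower S' p' q'"
      and z: "open_segment upper lower \<inter> open_segment p' q' \<noteq> {}"
  obtains y where "s (tp i) < y" "y < s (bt i)"
    "skeleton S' = (skeleton S - open_segment upper (s i, 1 - s (bt i))) \<union> closed_segment (s (lf i),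
      1 - y) (s (rt (Suc i)), 1 - y)"
proof -
  have T': "tiling S'" and ed: "edge S' p' q'"
    and sk: "skeleton S' = (skeleton S - open_segment upper lower) \<union> closed_segment p' q'"
    using e rectangulation_tiling by (auto simp: edge_replacement_def)
  obtain x y where xy: "(x, 1 - y) \<in> open_segment upper lower" "(x, 1 - y) \<in> open_segment p' q'"
    using z by (metis IntE nonempty_down)
  have y: "x = s i" "s (tp i) < y" "y < s (bt i)" 
    using xy(1) ord eq by (auto simp: open_segment_vertical open_segment_eq_real_ivl)
  have sp: "snd p' = snd q'" by (rule perpendicular[OF e])
  have "(x, 1 - y) \<in> open_segment (fst p', snd p') (fst q', snd p')" using xy(2) sp
    by (metis prod.collapse)
  then have h: "snd p' = 1 - y" "x \<in> open_segment (fst p') (fst q')"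
    unfolding open_segment_horizontal by auto
  define a where "a = min (fst p') (fst q')"
  define f where "f = max (fst p') (fst q')"
  have af: "a < s i" "s i < f" using h(2) y(1)
    by (auto simp: open_segment_eq_real_ivl a_def f_def split: if_splits)
  have pq: "p' = (fst p', 1 - y)" "q' = (fst q', 1 - y)" using h(1) sp
    by (simp_all add: prod_eq_iff)
  have seg: "edge S' (a, 1 - y) (f, 1 - y) \<and> closed_segment p' q' =
    closed_segment (a, 1 - y) (f, 1 - y)"
  proof (cases "fst p' \<le> fst q'")
    case True
    then have "p' = (a, 1 - y)" "q' = (f, 1 - y)" using pq
      by (simp_all add: a_def f_def prod_eq_iff)
    then show ?thesis using ed by simp
  next
    case False
    then have "q' = (a, 1 - y)" "p' = (f, 1 - y)" using pq
      by (simp_all add: a_def f_def prod_eq_iff)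
    then show ?thesis using ed edge_commute closed_segment_commute by metis
  qed
  have new: "(u, 1 - w) \<in> closed_segment p' q' \<longleftrightarrow> w = y \<and> a \<le> u \<and> u \<le> f" for u w
    using seg af by (auto simp: closed_segment_horizontal closed_segment_eq_real_ivl)
  have old: "(u, 1 - w) \<in> open_segment upper lower \<longleftrightarrow> u = s i \<and> s (tp i) < w \<and> w < s (bt i)" for u w
    using ord eq by (auto simp: open_segment_vertical open_segment_eq_real_ivl)
  have ns: "(u, 1 - w) \<notin> skeleton S'"
    if J: "J \<in> S" "lc J < u" "u < rc J" "tc J < w" "w < bc J" "w \<noteq> y" for J u w
    using not_skeleton[OF T J(1), of u "1 - w"] J(2-6) new[of u w] sk by auto
  have f: "f = s (rt (Suc i))"
  proof (rule edge_right_end[OF T' conjunct1[OF seg], of "s i" _ "s (tp i)" "s (bt i)"])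
    show "(u, 1 - w) \<notin> skeleton S'"
      if "s i < u" "u < s (rt (Suc i))" "s (tp i) < w" "w < s (bt i)" "w \<noteq> y" for u w
      by (rule ns[OF L(1)]) (use that L eq in auto)
    show "(s (rt (Suc i)), 1 - w) \<in> skeleton S'" if "s (tp i) < w" "w < s (bt i)" for w
      unfolding sk using old skeletonI[OF T L(1), of "s (rt (Suc i))" "1 - w"] that L eq ord by auto
  qed (use af y ord in auto)
  have a: "a = s (lf i)"
  proof (rule edge_left_end[OF T' conjunct1[OF seg], of "s i" _ "s (tp i)" "s (bt i)"])
    show "(u, 1 - w) \<notin> skeleton S'"
      if "s (lf i) < u" "u < s i" "s (tp i) < w" "w < s (bt i)" "w \<noteq> y" for u w
      by (rule ns[OF K(1)]) (use that K eq in auto)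
    show "(s (lf i), 1 - w) \<in> skeleton S'" if "s (tp i) < w" "w < s (bt i)" for w
      unfolding sk using old skeletonI[OF T K(1), of "s (lf i)" "1 - w"] that K eq ord by auto
  qed (use af y ord in auto)
  show thesis using that[of y] y sk seg a f eq by auto
qed

lemma rotation_flip_region:
  assumes lt: "tp (Suc i) < tp i" and eq: "bt (Suc i) = bt i"
    and e: "edge_replacement S upper lower S' upper q'"
  shows "skeleton S' = (skeleton S - open_segment upper (s i, 1 - s (bt i))) \<union> closed_segment upper
    (s (rt (Suc i)), 1 - s (tp i))"
proof -
  have T': "tiling S'" and ed: "edge S' upper q'"
    and sk: "skeleton S' = (skeleton S - open_segment upper lower) \<union> closed_segment upper q'"
    using e rectangulation_tiling by (auto simp: edge_replacement_def)
  define y where "y = s (tp i)"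
  have slt: "s (tp (Suc i)) < y" unfolding y_def using lt idx by (intro less) auto
  have yb: "y < s (bt i)" using ord by (auto simp: y_def)
  obtain f where q': "q' = (f, 1 - y)" using perpendicular[OF e]
    by (metis prod.collapse snd_conv y_def)
  have old: "(u, 1 - w) \<in> open_segment upper lower \<longleftrightarrow> u = s i \<and> y < w \<and> w < s (bt i)" for u w
    using ord eq by (auto simp: open_segment_vertical open_segment_eq_real_ivl y_def)
  have new: "(u, 1 - w) \<in> closed_segment upper q' \<longleftrightarrow> w = y \<and> u \<in> closed_segment (s i) f" for u w
    unfolding q' by (auto simp: closed_segment_horizontal y_def)
  have "f \<noteq> s i" using ed q' by (auto simp: edge_def y_def)
  have nL: "(u, 1 - w) \<notin> skeleton S"
    if "s i < u" "u < s (rt (Suc i))" "s (tp (Suc i)) < w" "w < s (bt i)" for u w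
    by (rule not_skeleton[OF T L(1)]) (use that L eq in auto)
  have sL: "(s i, 1 - w) \<in> skeleton S'" if "s (tp (Suc i)) < w" "w < y" for w
    unfolding sk using old skeletonI[OF T L(1), of "s i" "1 - w"] that L eq ord yb by auto
  \<comment> \<open>If the new edge went left, look at the tile \<open>J\<close> to the upper right
    of the endpoint. It starts at the wall. Its lower side cannot be at height \<open>y\<close>,
    since nothing was added to the right of the wall; and it cannot reach lower, since its left side
    would then contain part of the removed edge.\<close>
  have right: "s i < f"
  proof (rule ccontr)
    assume "\<not> ?thesis"
    then have fl: "f < s i" using \<open>f \<noteq> s i\<close> by auto
    have unit: "0 < s i" "s i < 1" "0 < y" "y < 1"
      using less[of 0 i] less[of i n] representsD(2,3)[OF r] idx slt yb skeleton_unit[OF T', of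
        "s i" "(s (tp (Suc i)) + y) / 2"] sL
        tiling_rect[OF T L(1)] L eq by auto
    obtain J where J: "J \<in> S'" "lc J \<le> s i" "s i < rc J" "tc J < y" "y \<le> bc J"
      using quadrants[OF T' unit] by metis
    have lJ: "lc J = s i"
    proof (rule ccontr)
      assume n: "lc J \<noteq> s i"
      obtain w where w: "max (s (tp (Suc i))) (tc J) < w" "w < y"
        using dense[of "max (s (tp (Suc i))) (tc J)" y] slt J by auto
      show False using not_skeleton[OF T' J(1), of "s i" "1 - w"] sL[of w] w n J by auto
    qed
    have "bc J \<noteq> y"
    proof
      assume n: "bc J = y"
      obtain x where x: "s i < x" "x < min (s (rt (Suc i))) (rc J)"
        using dense[of "s i" "min (s (rt (Suc i))) (rc J)"] ord J by auto
      have "(x, 1 - y) \<in> skeleton S'" using x J n lJ by (intro skeletonI[OF T' J(1)]) auto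
      then show False using nL[of x y] x slt yb new[of x y] fl unfolding sk
        by (auto simp: closed_segment_eq_real_ivl)
    qed
    then obtain w where w: "y < w" "w < min (s (bt i)) (bc J)"
      using dense[of y "min (s (bt i)) (bc J)"] J yb by auto
    have "(s i, 1 - w) \<in> skeleton S'" using w J lJ by (intro skeletonI[OF T' J(1)]) auto
    then show False using w old[of "s i" w] new[of "s i" w] unfolding sk by auto
  qed
  have "f = s (rt (Suc i))"
  proof (rule edge_right_end[OF T', of "s i" y f "s i" _ "s (tp (Suc i))" "s (bt i)"])
    show "edge S' (s i, 1 - y) (f, 1 - y)" using ed q' by (simp add: y_def)
    show "(u, 1 - w) \<notin> skeleton S'"
      if "s i < u" "u < s (rt (Suc i))" "s (tp (Suc i)) < w" "w < s (bt i)" "w \<noteq> y" for u w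
      using nL[OF that(1-4)] new[of u w] that(5) sk by auto
    show "(s (rt (Suc i)), 1 - w) \<in> skeleton S'" if "s (tp (Suc i)) < w" "w < s (bt i)" for w
      unfolding sk using old skeletonI[OF T L(1), of "s (rt (Suc i))" "1 - w"] that L eq ord by auto
  qed (use right ord slt yb in auto)
  then show ?thesis using sk q' eq by (simp add: y_def)
qed

end

lemma (in flip_region) new_tiles:
  assumes "J \<in> S" "J \<noteq> K" "J \<noteq> L" shows "J \<noteq> K'" "J \<noteq> L'"
proof -
  show "J \<noteq> K'"
  proof
    assume "J = K'"
    then have "lc J < (xl + x0) / 2" "(xl + x0) / 2 < rc J" "tc J < (y + b) / 2"
      "(y + b) / 2 < bc J"
      using K'_coords ord by auto
    then show False using disjoint_other[OF assms, of "(xl + x0) / 2" "(y + b) / 2"] ord by auto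
  qed
  show "J \<noteq> L'"
  proof
    assume "J = L'"
    then have "lc J < (x0 + xr) / 2" "(x0 + xr) / 2 < rc J" "tc J < (tl + y) / 2"
      "(tl + y) / 2 < bc J"
      using L'_coords ord by auto
    then show False using disjoint_other[OF assms, of "(x0 + xr) / 2" "(tl + y) / 2"] ord by auto
  qed
qed

lemma (in flip_region) new_tiles_distinct: "K' \<noteq> L'"
proof
  assume "K' = L'"
  then have "y = tl" using K'_coords(4) L'_coords(4) by simp
  then show False using ord by simp
qed

section \<open>From contacts back to the order\<close>

lemma increasing_self_map:
  fixes h :: "nat \<Rightarrow> nat"
  assumes r: "\<And>m. m \<in> {1..n} \<Longrightarrow> h m \<in> {1..n}" and inc: "\<And>m. 0 < m \<Longrightarrow> m < n \<Longrightarrow> h m < h (Suc m)"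
    and m: "m \<in> {1..n}"
  shows "h m = m"
proof -
  have lo: "1 \<le> k \<Longrightarrow> k \<le> n \<Longrightarrow> k \<le> h k" for k
  proof (induction k)
    case (Suc k)
    show ?case
    proof (cases "k = 0")
      case True then show ?thesis using r[of 1] Suc.prems by auto
    next
      case False then show ?thesis using Suc inc[of k] by auto
    qed
  qed simp
  have up: "d < n \<Longrightarrow> h (n - d) \<le> n - d" for d
  proof (induction d)
    case 0 then show ?case using r[of n] by auto
  next
    case (Suc d)
    have e: "Suc (n - Suc d) = n - d" using Suc.prems by auto
    have "h (n - Suc d) < h (n - d)" using inc[of "n - Suc d"] Suc.prems e by auto
    then show ?case using Suc by auto
  qed
  show ?thesis using lo[of m] up[of "n - m"] m by auto
qed

text \<open>The drawing \<open>A\<close> need not be diagonal, and different walls in it may be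
  collinear by accident, so it is used only through contacts. \<open>f\<close> and \<open>g\<close>
  name the right and the left wall of a tile, \<open>f'\<close> and \<open>g'\<close> the lower and
  the upper one, and \<open>Q\<close> is the expected order. Since consecutive tiles of
  \<open>R'\<close> touch and contacts of \<open>A\<close> increase labels, the correspondence of
  labels is increasing and thus the identity.\<close>

lemma contacts_determine_prec:
  assumes r: "represents R' n' lf rt tp bt s" and ceq: "combinatorially_equivalent (A ` {1..n}) R'"
    and inj: "inj_on A {1..n}"
    and h: "\<And>a b. a \<in> {1..n} \<Longrightarrow> b \<in> {1..n} \<Longrightarrow> left_of (A a) (A b) \<Longrightarrow> a < b \<and> f a = (g b :: 'b)"
    and w: "\<And>a b. a \<in> {1..n} \<Longrightarrow> b \<in> {1..n} \<Longrightarrow> below (A b) (A a) \<Longrightarrow> a < b \<and> f' a = (g' b :: 'c)"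
    and q: "\<And>a b. a \<in> {1..n} \<Longrightarrow> b \<in> {1..n} \<Longrightarrow> f a = g b \<Longrightarrow> Q a b"
    and q': "\<And>a b. a \<in> {1..n} \<Longrightarrow> b \<in> {1..n} \<Longrightarrow> f' a = g' b \<Longrightarrow> Q b a"
    and trans: "\<And>a b c. Q a b \<Longrightarrow> Q b c \<Longrightarrow> Q a c"
  shows "n' = n" "\<And>a b. diagonal_grid.prec n' lf rt tp bt a b \<Longrightarrow> Q a b"
proof -
  note R = representsD[OF r]
  interpret diagonal_grid n' lf rt tp bt by (rule R)
  interpret ref: diagonal_grid n' tp bt lf rt by (rule reflect)
  obtain zs ds where zd: "set zs = A ` {1..n}" "set ds = R'" "labeled_equiv zs ds" using ceq
    unfolding combinatorially_equivalent_def by blast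
  have dist: "distinct zs" "distinct ds" "length zs = length ds" using zd(3)
    by (auto simp: labeled_equiv_def labeled_rectangulation_def)
  have "length zs = n" using dist(1) zd(1) inj
    by (metis card_atLeastAtMost card_image diff_Suc_1 distinct_card)
  moreover have "length ds = n'" using dist(2) zd(2) R(5) draw_tiling(2)[OF R(6)]
    by (metis card_atLeastAtMost card_image diff_Suc_1 distinct_card)
  ultimately have nn: "n' = n" and len: "length zs = n" "length ds = n" using dist(3) by auto
  have "\<exists>k<n. ds ! k = draw s s m" if "m \<in> {1..n}" for m
    using that zd(2) R(5) nn len by (metis image_eqI in_set_conv_nth)
  then obtain k where k: "\<And>m. m \<in> {1..n} \<Longrightarrow> k m < n \<and> ds ! k m = draw s s m" by metis
  have "\<exists>a\<in>{1..n}. A a = zs ! k m" if "m \<in> {1..n}" for m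
  proof -
    have "zs ! k m \<in> A ` {1..n}" using k[OF that] zd(1) len by (metis nth_mem)
    then show ?thesis by auto
  qed
  \<comment> \<open>\<open>\<theta> m\<close> is the label in \<open>A\<close> of the tile that
    corresponds to tile \<open>m\<close> of the diagonal drawing.\<close>
  then obtain \<theta> where th: "\<And>m. m \<in> {1..n} \<Longrightarrow> \<theta> m \<in> {1..n} \<and> A (\<theta> m) = zs ! k m" by metis
  have hc: "left_of (draw s s a) (draw s s b) \<longleftrightarrow> left_of (A (\<theta> a)) (A (\<theta> b))"
    and vc: "below (draw s s a) (draw s s b) \<longleftrightarrow> below (A (\<theta> a)) (A (\<theta> b))"
      if ab: "a \<in> {1..n}" "b \<in> {1..n}" for a b
  proof -
    have ka: "k a < n" "ds ! k a = draw s s a" "A (\<theta> a) = zs ! k a"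
      and kb: "k b < n" "ds ! k b = draw s s b" "A (\<theta> b) = zs ! k b"
      using k th ab by auto
    have "h_contacts zs = h_contacts ds" "v_contacts zs = v_contacts ds" using zd(3)
      by (auto simp: labeled_equiv_def)
    then have "(k a, k b) \<in> h_contacts zs \<longleftrightarrow> (k a, k b) \<in> h_contacts ds"
      "(k a, k b) \<in> v_contacts zs \<longleftrightarrow> (k a, k b) \<in> v_contacts ds"
      by auto
    then show "left_of (draw s s a) (draw s s b) \<longleftrightarrow> left_of (A (\<theta> a)) (A (\<theta> b))"
      "below (draw s s a) (draw s s b) \<longleftrightarrow> below (A (\<theta> a)) (A (\<theta> b))"
      using ka kb len by (simp_all add: h_contacts_def v_contacts_def)
  qed
  have id: "\<theta> m = m" if m: "m \<in> {1..n}" for m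
  proof (rule increasing_self_map[OF _ _ m])
    fix m assume m: "0 < m" "m < n"
    then have mm: "m \<in> {1..n}" "Suc m \<in> {1..n}" by auto
    show "\<theta> m < \<theta> (Suc m)"
      using consecutive_contact[OF r, of m] m nn hc[OF mm] vc[OF mm(2,1)] h[of "\<theta> m" "\<theta> (Suc m)"]
        w[of "\<theta> m" "\<theta> (Suc m)"] th[OF mm(1)] th[OF mm(2)]
      by blast
  qed (use th in blast)
  have hc': "f a = g b" if ab: "(a, b) \<in> hcontacts s" for a b
  proof -
    have "a \<in> {1..n'}" "b \<in> {1..n'}" using ab by (auto simp: hcontacts_def)
    then have r: "a \<in> {1..n}" "b \<in> {1..n}" by (simp_all add: nn)
    then have "left_of (A a) (A b)"
      using ab left_of_draw[OF R(6), of a b] hc[OF r] id[OF r(1)] id[OF r(2)] nn by simp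
    then show ?thesis using h[OF r] by blast
  qed
  have vc': "f' a = g' b" if ab: "(a, b) \<in> ref.hcontacts s" for a b
  proof -
    have "a \<in> {1..n'}" "b \<in> {1..n'}" using ab by (auto simp: ref.hcontacts_def)
    then have r: "a \<in> {1..n}" "b \<in> {1..n}" by (simp_all add: nn)
    then have "below (A b) (A a)" using ab below_draw[OF R(6), of b a] vc[OF r(2,1)] id[OF r(1)]
      id[OF r(2)] nn by simp
    then show ?thesis using w[OF r] by blast
  qed
  have lt: "s x < s y" if "x < y" "y \<le> n" for x y using R(4) that nn by blast
  have HQ: "Q a b" if ab: "(a, b) \<in> H" for a b
  proof -
    have r: "a \<in> {1..n'}" "b \<in> {1..n'}" "rt a = lf b" using ab by (auto simp: H_def)
    define m where "m = rt a"
    have m: "0 < m" "m < n'" using diag[OF r(1)] diag[OF r(2)] r by (auto simp: m_def)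
    have v: "vert m" "tp (m + 1) < a" "a \<le> bt (m + 1)" using rt_vert[OF r(1) m_def[symmetric] m(2)]
      by auto
    have v': "b \<le> bt m" "tp m < b" using lf_vert[OF r(2)] r m by (auto simp: m_def)
    have mm: "m \<in> {1..n'}" "m + 1 \<in> {1..n'}" "rt m = m" "lf (m + 1) = m" "m < bt m" "tp (m + 1) < m"
      using v(1) by (auto simp: vert_def)
    note d = diag[OF r(1)] diag[OF r(2)] diag[OF mm(1)] diag[OF mm(2)] bounds[OF r(1)] bounds[OF
      r(2)] bounds[OF mm(1)] bounds[OF mm(2)]
    \<comment> \<open>Tiles \<open>a\<close> and \<open>b\<close> on the two sides of wall
      \<open>m\<close> need not touch. Tile \<open>m + 1\<close> touches every tile on the left of
      the wall and tile \<open>m\<close> every tile on its right, so these two connect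
      \<open>a\<close> with \<open>b\<close>.\<close>
    have "(a, m + 1) \<in> hcontacts s" "(m, m + 1) \<in> hcontacts s" "(m, b) \<in> hcontacts s"
      unfolding hcontacts_def using r mm v v' d nn by (auto simp: m_def[symmetric] intro!: lt)
    then have "f a = g (m + 1)" "f m = g (m + 1)" "f m = g b" using hc' by blast+
    then show ?thesis using q[of a b] r nn by simp
  qed
  have VQ: "Q b a" if ab: "(a, b) \<in> V" for a b
  proof -
    have r: "a \<in> {1..n'}" "b \<in> {1..n'}" "bt a = tp b" using ab by (auto simp: V_def)
    define m where "m = bt a"
    have m: "0 < m" "m < n'" using diag[OF r(1)] diag[OF r(2)] r by (auto simp: m_def)
    have v: "horiz m" "lf (m + 1) < a" "a \<le> rt (m + 1)"
      using bt_horiz[OF r(1) m_def[symmetric] m(2)] by auto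
    have v': "b \<le> rt m" "lf m < b" using tp_horiz[OF r(2)] r m by (auto simp: m_def)
    have mm: "m \<in> {1..n'}" "m + 1 \<in> {1..n'}" "bt m = m" "tp (m + 1) = m" "m < rt m" "lf (m + 1) < m"
      using v(1) by (auto simp: horiz_def)
    note d = diag[OF r(1)] diag[OF r(2)] diag[OF mm(1)] diag[OF mm(2)] bounds[OF r(1)] bounds[OF
      r(2)] bounds[OF mm(1)] bounds[OF mm(2)]
    have "(a, m + 1) \<in> ref.hcontacts s" "(m, m + 1) \<in> ref.hcontacts s" "(m, b) \<in> ref.hcontacts s"
      unfolding ref.hcontacts_def using r mm v v' d nn by (auto simp: m_def[symmetric] intro!: lt)
    then have "f' a = g' (m + 1)" "f' m = g' (m + 1)" "f' m = g' b" using vc' by blast+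
    then show ?thesis using q'[of a b] r nn by simp
  qed
  have "Q a b" if "(a, b) \<in> H\<^sup>+" for a b using that
    by (induction rule: trancl_induct) (use HQ trans in blast)+
  moreover have "Q b a" if "(a, b) \<in> V\<^sup>+" for a b using that
    by (induction rule: trancl_induct) (use VQ trans in blast)+
  ultimately show "\<And>a b. prec a b \<Longrightarrow> Q a b" unfolding prec_def by blast
  show "n' = n" by (rule nn)
qed

text \<open>Every step of \<open>V\<close> strictly increases the upper line, so two tiles with a
  common upper line can only be related by \<open>H\<close>.\<close>

lemma (in diagonal_grid) same_top_prec:
  assumes "a \<in> {1..n}" "b \<in> {1..n}" "a < b" "tp a = tp b" shows "prec a b"
proof (rule ccontr)
  assume "\<not> ?thesis"
  then have "(a, b) \<in> V\<^sup>+" using total[OF assms(1-3)] by (auto simp: prec_def)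
  moreover have "tp x < tp y" if "(x, y) \<in> V\<^sup>+" for x y
    using that
  proof (induction rule: trancl_induct)
    case (base y) then show ?case using diag[of x] by (auto simp: V_def)
  next
    case (step y z) then show ?case using diag[of y] by (auto simp: V_def)
  qed
  ultimately show False using assms(4) by force
qed

section \<open>The order after a flip\<close>

context vertical_edge begin

lemma s_inj: "a \<le> n \<Longrightarrow> b \<le> n \<Longrightarrow> s a = s b \<longleftrightarrow> a = b"
  using less[of a b] less[of b a] by (cases a b rule: linorder_cases) auto

lemma s_less_iff: "a \<le> n \<Longrightarrow> b \<le> n \<Longrightarrow> s a < s b \<longleftrightarrow> a < b"
  using less[of a b] le[of b a] by (cases "a < b") auto

lemma tile_coords: "m \<in> {1..n} \<Longrightarrow> D m \<in> S \<and> is_rect (D m) \<and> lc (D m) = s (lf m) \<and> rc (D m) =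
  s (rt m) \<and> tc (D m) = s (tp m) \<and> bc (D m) = s (bt m)"
  using draw_coords[OF representsD(6)[OF r]] representsD(5)[OF r] by auto

lemma line_le: "m \<in> {1..n} \<Longrightarrow> lf m \<le> n \<and> rt m \<le> n \<and> tp m \<le> n \<and> bt m \<le> n"
  using diag[of m] bounds[of m] by auto

text \<open>The new tiles are labelled in the order in which a diagonal redrawing meets them: the
  upper one gets \<open>i\<close>, the lower one \<open>Suc i\<close>.\<close>

definition flipped :: "real \<Rightarrow> real \<Rightarrow> nat \<Rightarrow> point set" where
  "flipped x1 y m = (if m = i then rect x1 (s (rt (Suc i))) (s (tp (Suc i))) y
     else if m = Suc i then rect (s (lf i)) (s (rt (Suc i))) y (s (bt i)) else D m)"

lemma flipped_tiles:
  assumes f: "flip_region S (D i) (D (Suc i)) (s i) (s (lf i)) (s (rt (Suc i))) (s (tp i)) (s (tp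
    (Suc i))) (s (bt i)) x1 y"
  shows "flipped x1 y ` {1..n} = S - {D i, D (Suc i)} \<union>
    {flip_region.K' (s (lf i)) (s (rt (Suc i))) (s (bt i)) y, flip_region.L' (s (rt (Suc i))) (s (tp
      (Suc i))) x1 y}"
    "inj_on (flipped x1 y) {1..n}"
    "is_rect (flipped x1 y i)" "lc (flipped x1 y i) = x1" "rc (flipped x1 y i) = s (rt (Suc i))"
      "tc (flipped x1 y i) = s (tp (Suc i))" "bc (flipped x1 y i) = y"
    "is_rect (flipped x1 y (Suc i))" "lc (flipped x1 y (Suc i)) = s (lf i)"
      "rc (flipped x1 y (Suc i)) = s (rt (Suc i))" "tc (flipped x1 y (Suc i)) = y"
      "bc (flipped x1 y (Suc i)) = s (bt i)"
proof -
  interpret F: flip_region S "D i" "D (Suc i)" "s i" "s (lf i)" "s (rt (Suc i))" "s (tp i)"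
    "s (tp (Suc i))" "s (bt i)" x1 y by (rule f)
  let ?A = "flipped x1 y"
  have A: "?A i = F.L'" "?A (Suc i) = F.K'" "\<And>m. m \<noteq> i \<Longrightarrow> m \<noteq> Suc i \<Longrightarrow> ?A m = D m"
    by (auto simp: flipped_def F.L'_def F.K'_def)
  have Dinj: "inj_on D {1..n}" using draw_tiling(2)[OF representsD(6)[OF r]] .
  have SD: "S = D ` {1..n}" using representsD(5)[OF r] .
  have e: "{1..n} = ({1..n} - {i, Suc i}) \<union> {i, Suc i}" using idx by auto
  have "?A ` ({1..n} - {i, Suc i}) = D ` ({1..n} - {i, Suc i})" using A(3)
    by (intro image_cong) auto
  also have "\<dots> = S - {D i, D (Suc i)}" using Dinj idx unfolding SD
    by (subst inj_on_image_set_diff[of _ "{1..n}"]) auto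
  finally show "?A ` {1..n} = S - {D i, D (Suc i)} \<union> {F.K', F.L'}" using A(1,2)
    by (subst e) (simp only: image_Un, auto)
  show "inj_on ?A {1..n}"
  proof (rule inj_onI)
    fix a b assume ab: "a \<in> {1..n}" "b \<in> {1..n}" "?A a = ?A b"
    have ne: "D m \<noteq> F.K' \<and> D m \<noteq> F.L'" if "m \<in> {1..n}" "m \<noteq> i" "m \<noteq> Suc i" for m
    proof -
      have "D m \<noteq> D i" "D m \<noteq> D (Suc i)" using Dinj that idx by (meson inj_onD)+
      then show ?thesis using F.new_tiles[of "D m"] tile_coords[OF that(1)] by blast
    qed
    have "a = b" if "a \<noteq> i" "a \<noteq> Suc i" "b \<noteq> i" "b \<noteq> Suc i" using Dinj ab A(3) that
      by (metis inj_onD)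
    moreover have "b = i \<or> b = Suc i" if "a = i \<or> a = Suc i" using ne[OF ab(2)] ab(3) A that
      by metis
    moreover have "a = i \<or> a = Suc i" if "b = i \<or> b = Suc i" using ne[OF ab(1)] ab(3) A that
      by metis
    moreover have "?A i \<noteq> ?A (Suc i)" using A F.new_tiles_distinct by metis
    ultimately show "a = b" using ab(3) by metis
  qed
  show "is_rect (?A i)" "lc (?A i) = x1" "rc (?A i) = s (rt (Suc i))" "tc (?A i) = s (tp (Suc i))"
    "bc (?A i) = y"
    unfolding A by (rule F.L'_coords)+
  show "is_rect (?A (Suc i))" "lc (?A (Suc i)) = s (lf i)" "rc (?A (Suc i)) = s (rt (Suc i))"
    "tc (?A (Suc i)) = y" "bc (?A (Suc i)) = s (bt i)"
    unfolding A by (rule F.K'_coords)+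
qed

lemma flipped_other: "m \<noteq> i \<Longrightarrow> m \<noteq> Suc i \<Longrightarrow> flipped x1 y m = D m"
  by (simp add: flipped_def)

text \<open>The order expected on the labels of the flipped rectangulation. Since
  \<open>swap_next\<close> is an involution, it does not matter on which of the two sides the labels
  are exchanged.\<close>

definition Q :: "nat \<Rightarrow> nat \<Rightarrow> bool" where
  "Q a b \<longleftrightarrow> prec (swap_next i a) (swap_next i b)"

lemma swap_next_simps: "swap_next i i = Suc i" "swap_next i (Suc i) = i"
  "m \<noteq> i \<Longrightarrow> m \<noteq> Suc i \<Longrightarrow> swap_next i m = m"
  by (auto simp: swap_next_def)

lemma prec_i: "prec i (Suc i)"
  using H_prec[of i "Suc i"] idx by auto

lemma flipped_h:
  assumes f: "flip_region S (D i) (D (Suc i)) (s i) (s (lf i)) (s (rt (Suc i))) (s (tp i)) (s (tp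
    (Suc i))) (s (bt i)) x1 y"
    and ab: "a \<in> {1..n}" "b \<in> {1..n}" and e: "rc (flipped x1 y a) = lc (flipped x1 y b)"
  shows "a < b \<and> Q a b"
proof -
  note F = flipped_tiles[OF f]
  have x1: "x1 = s (lf i) \<or> x1 = s i" using f by (auto simp: flip_region_def)
  consider "a \<noteq> i" "a \<noteq> Suc i" "b \<noteq> i" "b \<noteq> Suc i" | "a \<in> {i, Suc i}" "b \<notin> {i, Suc i}" |
    "a \<notin> {i, Suc i}" "b \<in> {i, Suc i}" | "a \<in> {i, Suc i}" "b \<in> {i, Suc i}"
    by blast
  then show ?thesis
  proof cases
    case 1
    then have "rt a = lf b" using e tile_coords[OF ab(1)] tile_coords[OF ab(2)] line_le[OF ab(1)]
      line_le[OF ab(2)] s_inj by (simp add: flipped_other)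
    then have "prec a b" "a < b" using H_prec ab H_less by (auto simp: H_def)
    then show ?thesis using 1 by (simp add: Q_def swap_next_simps)
  next
    case 2
    have "rc (flipped x1 y a) = s (rt (Suc i))" using 2 F(5,10) by auto
    then have "rt (Suc i) = lf b" using e tile_coords[OF ab(2)] 2 line_le[OF idx(4)] line_le[OF
      ab(2)] s_inj by (simp add: flipped_other)
    then have p: "prec (Suc i) b" "Suc i < b" using H_prec[of "Suc i" b] ab idx H_less[of "Suc i" b]
      by (auto simp: H_def)
    moreover have "prec i b" using prec_trans[OF prec_i p(1)] .
    ultimately show ?thesis using 2 by (auto simp: Q_def swap_next_simps)
  next
    case 3
    have rca: "rc (flipped x1 y a) = s (rt a)" using 3 tile_coords[OF ab(1)]
      by (simp add: flipped_other)
    have "lc (flipped x1 y b) = s (lf i) \<or> b = i \<and> lc (flipped x1 y b) = s i" using 3 F(4,9) x1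
      by auto
    then show ?thesis
    proof
      assume "lc (flipped x1 y b) = s (lf i)"
      then have "rt a = lf i" using e rca line_le[OF ab(1)] line_le[OF idx(3)] s_inj by simp
      then have p: "prec a i" "a < i" using H_prec[of a i] ab idx H_less[of a i]
        by (auto simp: H_def)
      moreover have "prec a (Suc i)" using prec_trans[OF p(1) prec_i] .
      ultimately show ?thesis using 3 by (auto simp: Q_def swap_next_simps)
    next
      \<comment> \<open>Here tile \<open>i\<close> has taken over the upper part of the wall from
        the old tile \<open>Suc i\<close>, and its place in the order as well.\<close>
      assume b: "b = i \<and> lc (flipped x1 y b) = s i"
      then have "s (rt a) = s i" using e rca by (elim conjE) (simp only:)
      then have "rt a = i" using line_le[OF ab(1)] idx(2) s_inj[of "rt a" i] by simp
      then have "prec a (Suc i)" "a < i" using H_prec[of a "Suc i"] ab idx diag[OF ab(1)] 3 by auto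
      then show ?thesis using 3 b by (auto simp: Q_def swap_next_simps)
    qed
  next
    case 4
    have "rc (flipped x1 y a) = s (rt (Suc i))" "lc (flipped x1 y b) \<in> {s (lf i), s i}"
      using 4 F(4,5,9,10) x1 by auto
    then show ?thesis using e ord by auto
  qed
qed

text \<open>The height \<open>y\<close> of the new wall is arbitrary and may also be the height of
  an unrelated wall. So the new wall gets the separate name \<open>None\<close>, while all other
  horizontal walls are named by their heights.\<close>

lemma flipped_simple_v:
  assumes eq: "tp (Suc i) = tp i" "bt (Suc i) = bt i" "s (tp i) < y" "y < s (bt i)"
    and ab: "a \<in> {1..n}" "b \<in> {1..n}"
  defines "A \<equiv> flipped (s (lf i)) y"
  defines "f \<equiv> \<lambda>a. if a = i then None else Some (bc (A a))"
    and "g \<equiv> \<lambda>b. if b = Suc i then None else Some (tc (A b))"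
  shows "f a = g b \<Longrightarrow> Q b a"
    and "tc (A b) = bc (A a) \<Longrightarrow> lc (A b) < rc (A a) \<Longrightarrow> lc (A a) < rc (A b) \<Longrightarrow> a < b \<and> f a = g b"
proof -
  have fr: "flip_region S (D i) (D (Suc i)) (s i) (s (lf i)) (s (rt (Suc i))) (s (tp i)) (s (tp (Suc
    i))) (s (bt i)) (s (lf i)) y"
    by (rule flip_region_simple[OF eq])
  note F = flipped_tiles[OF fr]
  have main: "a < b \<and> Q b a" if e: "tc (A b) = bc (A a)" and n: "a \<noteq> i" "b \<noteq> Suc i"
  proof -
    have bca: "bc (A a) = s (if a = Suc i then bt i else bt a)" using n tile_coords[OF ab(1)] F(12)
      by (auto simp: A_def flipped_other)
    have tcb: "tc (A b) = s (if b = i then tp (Suc i) else tp b)" using n tile_coords[OF ab(2)] F(6)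
      by (auto simp: A_def flipped_other)
    have ie: "(if a = Suc i then bt i else bt a) = (if b = i then tp (Suc i) else tp b)"
    proof -
      have "(if a = Suc i then bt i else bt a) \<le> n" "(if b = i then tp (Suc i) else tp b) \<le> n"
        using line_le[OF ab(1)] line_le[OF ab(2)] line_le[OF idx(3)] line_le[OF idx(4)] by auto
      then show ?thesis using s_inj e bca tcb by simp
    qed
    consider "a = Suc i" "b = i" | "a = Suc i" "b \<noteq> i" | "a \<noteq> Suc i" "b = i" | "a \<noteq> Suc i" "b \<noteq> i"
      by blast
    then show ?thesis
    proof cases
      case 1 then show ?thesis using ie idx by auto
    next
      case 2
      then have t: "bt i = tp b" using ie by auto
      then have "prec b i" "i < b" using V_prec[OF t idx(3) ab(2)] V_less[of i b] idx ab
        by (auto simp: V_def)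
      then show ?thesis using 2 n by (auto simp: Q_def swap_next_simps)
    next
      case 3
      then have t: "bt a = tp (Suc i)" using ie by auto
      then have "prec (Suc i) a" "a < i" using V_prec[OF t ab(1) idx(4)] diag[OF ab(1)] idx by auto
      then show ?thesis using 3 n by (auto simp: Q_def swap_next_simps)
    next
      case 4
      then have t: "bt a = tp b" using ie by auto
      then have "prec b a" "a < b" using V_prec[OF t ab] V_less[of a b] ab by (auto simp: V_def)
      then show ?thesis using 4 n by (auto simp: Q_def swap_next_simps)
    qed
  qed
  show "Q b a" if "f a = g b"
  proof (cases "a = i")
    case True
    then have "b = Suc i" using that by (auto simp: f_def g_def split: if_splits)
    then show ?thesis using True prec_i by (simp add: Q_def swap_next_simps)
  next
    case False
    then show ?thesis using that main by (auto simp: f_def g_def split: if_splits)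
  qed
  show "a < b \<and> f a = g b" if e: "tc (A b) = bc (A a)"
    and o: "lc (A b) < rc (A a)" "lc (A a) < rc (A b)"
  proof -
    \<comment> \<open>A tile that reaches height \<open>y\<close> and overlaps the region
      horizontally is one of the two old tiles. Hence only the two new tiles touch the new
      wall.\<close>
    have hit: "J = D i \<or> J = D (Suc i)"
      if J: "J \<in> S" "tc J \<le> y" "y \<le> bc J" "lc J < s (rt (Suc i))" "s (lf i) < rc J" for J
    proof (cases "lc J < s i")
      case True
      then have "J = D i" using J K tiling_rect[OF T J(1)] eq
        by (intro tiling_disjoint[OF T J(1) K(1)]) auto
      then show ?thesis ..
    next
      case False
      then have "J = D (Suc i)" using J L tiling_rect[OF T J(1)] eq ord
        by (intro tiling_disjoint[OF T J(1) L(1)]) auto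
      then show ?thesis ..
    qed
    have Dinj: "D m \<noteq> D i \<and> D m \<noteq> D (Suc i)" if "m \<in> {1..n}" "m \<noteq> i" "m \<noteq> Suc i" for m
      using draw_tiling(2)[OF representsD(6)[OF r]] that idx by (meson inj_onD)
    have y: "y \<noteq> s (tp (Suc i))" "y \<noteq> s (bt i)" using eq by auto
    have ai: "b = Suc i" if "a = i"
    proof (rule ccontr)
      assume nb: "b \<noteq> Suc i"
      then have nb': "b \<noteq> i" using e that y F(6,7) by (auto simp: A_def)
      have "D b = D i \<or> D b = D (Suc i)"
        using e o that nb nb' tile_coords[OF ab(2)] F(4,5,7) tiling_rect[OF T, of "D b"]
          by (intro hit) (auto simp: A_def flipped_other)
      then show False using Dinj[OF ab(2) nb' nb] by blast
    qed
    have bi: "a = i" if "b = Suc i"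
    proof (rule ccontr)
      assume na: "a \<noteq> i"
      then have na': "a \<noteq> Suc i" using e that y F(11,12) by (auto simp: A_def)
      have "D a = D i \<or> D a = D (Suc i)"
        using e o that na na' tile_coords[OF ab(1)] F(9-11) tiling_rect[OF T, of "D a"]
          by (intro hit) (auto simp: A_def flipped_other)
      then show False using Dinj[OF ab(1) na na'] by blast
    qed
    show ?thesis
    proof (cases "a = i")
      case True then show ?thesis using ai by (auto simp: f_def g_def)
    next
      case False then show ?thesis using bi main[OF e] e by (auto simp: f_def g_def)
    qed
  qed
qed

text \<open>The new edge prolongs the wall at \<open>tp i\<close>, so heights can serve as names of
  walls here. The delicate pairs consist of the new upper tile \<open>i\<close> and a tile
  \<open>b\<close> under the old part of this wall: they share the wall although
  \<open>b < i\<close>. They do not touch, and \<open>same_top_prec\<close> puts \<open>b\<close> in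
  its place.\<close>

lemma flipped_rotation_v:
  assumes eq: "tp (Suc i) < tp i" "bt (Suc i) = bt i"
    and ab: "a \<in> {1..n}" "b \<in> {1..n}"
  defines "A \<equiv> flipped (s i) (s (tp i))"
  assumes e: "tc (A b) = bc (A a)"
  shows "Q b a" and "lc (A b) < rc (A a) \<Longrightarrow> lc (A a) < rc (A b) \<Longrightarrow> a < b"
proof -
  have fr: "flip_region S (D i) (D (Suc i)) (s i) (s (lf i)) (s (rt (Suc i))) (s (tp i)) (s (tp (Suc
    i))) (s (bt i)) (s i) (s (tp i))"
    by (rule flip_region_rotation[OF eq])
  note F = flipped_tiles[OF fr]
  define u where "u = (if a = i then tp i else if a = Suc i then bt i else bt a)"
  define v where "v = (if b = i then tp (Suc i) else if b = Suc i then tp i else tp b)"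
  have "bc (A a) = s u" using tile_coords[OF ab(1)] F(7,12)
    by (auto simp: A_def flipped_other u_def)
  moreover have "tc (A b) = s v" using tile_coords[OF ab(2)] F(6,11)
    by (auto simp: A_def flipped_other v_def)
  moreover have "u \<le> n" "v \<le> n" using line_le[OF ab(1)] line_le[OF ab(2)] line_le[OF idx(3)]
    line_le[OF idx(4)] by (auto simp: u_def v_def)
  ultimately have uv: "u = v" using e s_inj by auto
  have Vp: "prec y x \<and> x < y" if "bt x = tp y" "x \<in> {1..n}" "y \<in> {1..n}" for x y
    using V_prec[OF that] V_less[of x y] that by (auto simp: V_def)
  consider "a = i" "b = i" | "a = i" "b = Suc i" | "a = i" "b \<noteq> i" "b \<noteq> Suc i" | "a = Suc i"
    "b = i \<or> b = Suc i" | "a = Suc i" "b \<noteq> i" "b \<noteq> Suc i"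
    | "a \<noteq> i" "a \<noteq> Suc i" "b = i" | "a \<noteq> i" "a \<noteq> Suc i" "b = Suc i" | "a \<noteq> i" "a \<noteq> Suc i" "b \<noteq> i"
      "b \<noteq> Suc i" by blast
  then have "Q b a \<and> (lc (A b) < rc (A a) \<longrightarrow> lc (A a) < rc (A b) \<longrightarrow> a < b)"
  proof cases
    case 1 then show ?thesis using uv eq by (simp add: u_def v_def)
  next
    case 2 then show ?thesis using prec_i by (simp add: Q_def swap_next_simps)
  next
    case 3
    then have t: "tp i = tp b" using uv by (simp add: u_def v_def)
    define k where "k = tp i"
    have k: "0 < k" "k < i" "tp (Suc i) < k" using eq idx by (auto simp: k_def)
    have nb: "\<not> i < b"
    proof
      assume ib: "i < b"
      have "b \<le> rt k" using tp_horiz(3)[OF ab(2)] t k by (simp add: k_def)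
      moreover have "horiz k" using tp_horiz(1)[OF ab(2)] t k by (simp add: k_def)
      then have "k \<in> {1..n}" "bt k = k" by (auto simp: horiz_def)
      ultimately have "k = Suc i"
        using disj[OF \<open>k \<in> {1..n}\<close> idx(4), of "Suc i" k] k ib idx diag[OF \<open>k \<in> {1..n}\<close>] by auto
      then show False using k by simp
    qed
    then have bi: "b < i" using 3 by auto
    have "prec b i" by (rule same_top_prec[OF ab(2) idx(3) bi t[symmetric]])
    then have "prec b (Suc i)" using prec_i prec_trans by blast
    moreover have "\<not> lc (A a) < rc (A b)"
    proof
      assume "lc (A a) < rc (A b)"
      then have "s i < s (rt b)" using 3 F(4) tile_coords[OF ab(2)]
        by (simp add: A_def flipped_other)
      then have "i < rt b" using s_less_iff[of i "rt b"] idx line_le[OF ab(2)] by auto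
      then have "b = i" using disj[OF ab(2) idx(3), of i "Suc (tp i)"] t idx bi diag[OF ab(2)]
        diag[OF idx(3)] by auto
      then show False using bi by simp
    qed
    ultimately show ?thesis using 3 by (simp add: Q_def swap_next_simps)
  next
    case 4 then show ?thesis using uv idx by (auto simp: u_def v_def)
  next
    case 5
    then have "bt i = tp b" using uv by (simp add: u_def v_def)
    then show ?thesis using Vp[of i b] idx ab 5 by (auto simp: Q_def swap_next_simps)
  next
    case 6
    then have t: "bt a = tp (Suc i)" using uv by (simp add: u_def v_def)
    then have "a < i" using diag[OF ab(1)] idx by auto
    then show ?thesis using Vp[OF t ab(1) idx(4)] 6 by (auto simp: Q_def swap_next_simps)
  next
    case 7
    then have "bt a = tp i" using uv by (simp add: u_def v_def)
    then show ?thesis using Vp[of a i] idx ab 7 by (auto simp: Q_def swap_next_simps)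
  next
    case 8
    then have "bt a = tp b" using uv by (simp add: u_def v_def)
    then show ?thesis using Vp[of a b] ab 8 by (auto simp: Q_def swap_next_simps)
  qed
  then show "Q b a" "lc (A b) < rc (A a) \<Longrightarrow> lc (A a) < rc (A b) \<Longrightarrow> a < b" by blast+
qed

lemma flipped_is_rect:
  assumes "flip_region S (D i) (D (Suc i)) (s i) (s (lf i)) (s (rt (Suc i))) (s (tp i)) (s (tp (Suc
    i))) (s (bt i)) x1 y" "m \<in> {1..n}"
  shows "is_rect (flipped x1 y m)"
  using flipped_tiles(3,8)[OF assms(1)] tile_coords[OF assms(2)]
    by (cases "m = i"; cases "m = Suc i"; simp add: flipped_other)

lemma Q_trans: "Q a b \<Longrightarrow> Q b c \<Longrightarrow> Q a c"
  unfolding Q_def by (rule prec_trans)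

text \<open>The contacts give one inclusion between the orders. Equivalence follows because both
  orders are total on the same labels and asymmetric.\<close>

lemma flipped_prec:
  assumes c: "tp (Suc i) = tp i \<and> bt (Suc i) = bt i \<and> s (tp i) < y \<and> y < s (bt i) \<and> x1 = s (lf i) \<or>
      tp (Suc i) < tp i \<and> bt (Suc i) = bt i \<and> y = s (tp i) \<and> x1 = s i"
    and ceq: "combinatorially_equivalent (flipped x1 y ` {1..n}) R'"
    and r': "represents R' n' lf' rt' tp' bt' s'"
  shows "n' = n" "\<And>a b. a \<in> {1..n} \<Longrightarrow> b \<in> {1..n} \<Longrightarrow>
     diagonal_grid.prec n' lf' rt' tp' bt' (swap_next i a) (swap_next i b) \<longleftrightarrow> prec a b"
proof -
  have f: "flip_region S (D i) (D (Suc i)) (s i) (s (lf i)) (s (rt (Suc i))) (s (tp i)) (s (tp (Suc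
    i))) (s (bt i)) x1 y"
    using c flip_region_simple[of y] flip_region_rotation by blast
  let ?A = "flipped x1 y"
  note rect = flipped_is_rect[OF f]
  have h: "a < b \<and> rc (?A a) = lc (?A b)" if "a \<in> {1..n}" "b \<in> {1..n}" "left_of (?A a) (?A b)"
    for a b
    using that left_of_is_rect[OF rect[OF that(1)] rect[OF that(2)]] flipped_h[OF f that(1,2)]
      by blast
  have q: "Q a b" if "a \<in> {1..n}" "b \<in> {1..n}" "rc (?A a) = lc (?A b)" for a b
    using flipped_h[OF f that] by blast
  have main: "n' = n \<and> (\<forall>a b. diagonal_grid.prec n' lf' rt' tp' bt' a b \<longrightarrow> Q a b)"
    using c
  proof
    assume c1: "tp (Suc i) = tp i \<and> bt (Suc i) = bt i \<and> s (tp i) < y \<and> y < s (bt i) \<and> x1 = s (lf i)"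
    then have c1': "tp (Suc i) = tp i" "bt (Suc i) = bt i" "s (tp i) < y" "y < s (bt i)"
      "x1 = s (lf i)" by auto
    note V = flipped_simple_v[OF c1'(1-4)]
    have w: "a < b \<and> (if a = i then None else Some (bc (?A a))) = (if b =
      Suc i then None else Some (tc (?A b)))"
      if "a \<in> {1..n}" "b \<in> {1..n}" "below (?A b) (?A a)" for a b
      using below_is_rect[OF rect[OF that(2)] rect[OF that(1)]] V(2)[OF that(1,2)] that(3) c1'(5)
        by blast
    have q': "Q b a" if "a \<in> {1..n}" "b \<in> {1..n}"
      "(if a = i then None else Some (bc (?A a))) = (if b = Suc i then None else Some (tc (?A b)))"
      for a b
      using V(1)[OF that(1,2)] that(3) c1'(5) by blast
    show ?thesis
    proof (intro conjI allI impI)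
      show "n' = n"
        by (rule contacts_determine_prec(1)[where f = "\<lambda>a. rc (?A a)" and g = "\<lambda>b. lc (?A b)"
          and Q = Q
        and f' = "\<lambda>a. if a = i then None else Some (bc (?A a))"
          and g' = "\<lambda>b. if b = Suc i then None else Some (tc (?A b))",
              OF r' ceq flipped_tiles(2)[OF f]])
          (use h in blast, use w in blast, use q in blast, use q' in blast, use Q_trans in blast)
      fix a b assume p: "diagonal_grid.prec n' lf' rt' tp' bt' a b"
      show "Q a b"
        by (rule contacts_determine_prec(2)[where f = "\<lambda>a. rc (?A a)" and g = "\<lambda>b. lc (?A b)"
          and Q = Q
        and f' = "\<lambda>a. if a = i then None else Some (bc (?A a))"
          and g' = "\<lambda>b. if b = Suc i then None else Some (tc (?A b))",
              OF r' ceq flipped_tiles(2)[OF f] _ _ _ _ _ p])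
          (use h in blast, use w in blast, use q in blast, use q' in blast, use Q_trans in blast)
    qed
  next
    assume c1: "tp (Suc i) < tp i \<and> bt (Suc i) = bt i \<and> y = s (tp i) \<and> x1 = s i"
    then have c1': "tp (Suc i) < tp i" "bt (Suc i) = bt i" "y = s (tp i)" "x1 = s i" by auto
    note V = flipped_rotation_v[OF c1'(1,2)]
    have w: "a < b \<and> bc (?A a) = tc (?A b)" if "a \<in> {1..n}" "b \<in> {1..n}" "below (?A b) (?A a)"
      for a b
      using below_is_rect[OF rect[OF that(2)] rect[OF that(1)]] V(2)[OF that(1,2)] that(3) c1'(3,4)
        by auto
    have q': "Q b a" if "a \<in> {1..n}" "b \<in> {1..n}" "bc (?A a) = tc (?A b)" for a b
      using V(1)[OF that(1,2)] that(3) c1'(3,4) by simp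
    show ?thesis
    proof (intro conjI allI impI)
      show "n' = n"
        by (rule contacts_determine_prec(1)[where f = "\<lambda>a. rc (?A a)" and g = "\<lambda>b. lc (?A b)"
          and Q = Q
        and f' = "\<lambda>a. bc (?A a)" and g' = "\<lambda>b. tc (?A b)",
              OF r' ceq flipped_tiles(2)[OF f]])
          (use h in blast, use w in blast, use q in blast, use q' in blast, use Q_trans in blast)
      fix a b assume p: "diagonal_grid.prec n' lf' rt' tp' bt' a b"
      show "Q a b"
        by (rule contacts_determine_prec(2)[where f = "\<lambda>a. rc (?A a)" and g = "\<lambda>b. lc (?A b)"
          and Q = Q
        and f' = "\<lambda>a. bc (?A a)" and g' = "\<lambda>b. tc (?A b)",
              OF r' ceq flipped_tiles(2)[OF f] _ _ _ _ _ p])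
          (use h in blast, use w in blast, use q in blast, use q' in blast, use Q_trans in blast)
    qed
  qed
  then show nn: "n' = n" by blast
  interpret g: diagonal_grid n' lf' rt' tp' bt' by (rule representsD(1)[OF r'])
  show "g.prec (swap_next i a) (swap_next i b) \<longleftrightarrow> prec a b" if ab: "a \<in> {1..n}" "b \<in> {1..n}" for a b
  proof -
    have sw: "swap_next i (swap_next i m) = m" for m by (auto simp: swap_next_def)
    have imp: "prec x y" if "g.prec (swap_next i x) (swap_next i y)" for x y
      using main that by (metis Q_def sw)
    have ab': "swap_next i a \<in> {1..n'}" "swap_next i b \<in> {1..n'}"
      using swap_next_range[of i n] idx ab nn by auto
    show ?thesis
    proof
      assume p: "prec a b"
      then have "swap_next i a \<noteq> swap_next i b" using sw prec_irrefl by metis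
      then show "g.prec (swap_next i a) (swap_next i b)"
        using g.prec_total[OF ab'] imp[of b a] prec_asym[OF p] by blast
    qed (rule imp)
  qed
qed

end

section \<open>From a flip to a transposition\<close>

lemma labeled_equiv_sym: "labeled_equiv xs ys \<Longrightarrow> labeled_equiv ys xs"
  by (auto simp: labeled_equiv_def)

lemma combinatorially_equivalent_sym:
  "combinatorially_equivalent R S \<Longrightarrow> combinatorially_equivalent S R"
  unfolding combinatorially_equivalent_def using labeled_equiv_sym by blast

text \<open>The case without a flip: in \<open>contacts_determine_prec\<close> the family is the
  diagonal drawing of \<open>S\<close>, the names of walls are its lines, and the expected order is
  its own.\<close>

lemma equivalent_same_prec:
  assumes r: "represents R n' lf' rt' tp' bt' s'" and q: "represents S n lf rt tp bt s"
    and ceq: "combinatorially_equivalent R S"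
  shows "n' = n" "\<And>a b. diagonal_grid.prec n' lf' rt' tp' bt' a b \<longleftrightarrow>
    diagonal_grid.prec n lf rt tp bt a b"
proof -
  note S = representsD[OF q]
  interpret diagonal_grid n lf rt tp bt by (rule S)
  interpret ref: diagonal_grid n tp bt lf rt by (rule reflect)
  interpret g: diagonal_grid n' lf' rt' tp' bt' by (rule representsD[OF r])
  let ?A = "draw s s"
  have c: "combinatorially_equivalent (?A ` {1..n}) R"
    using combinatorially_equivalent_sym[OF ceq] S(5) by simp
  have inj: "inj_on ?A {1..n}" by (rule draw_tiling(2)[OF S(6)])
  have h: "a < b \<and> rt a = lf b" if "a \<in> {1..n}" "b \<in> {1..n}" "left_of (?A a) (?A b)" for a b
    using that left_of_draw[OF S(6) that(1,2)] H_less[of a b] by (auto simp: hcontacts_def H_def)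
  have w: "a < b \<and> bt a = tp b" if "a \<in> {1..n}" "b \<in> {1..n}" "below (?A b) (?A a)" for a b
    using that below_draw[OF S(6) that(2,1)] V_less[of a b] by (auto simp: ref.hcontacts_def V_def)
  show nn: "n' = n"
    by (rule contacts_determine_prec(1)[where f = rt and g = lf and f' = bt and g' = tp
      and Q = prec, OF r c inj])
      (use h in blast, use w in blast, use H_prec in blast, use V_prec in blast, use prec_trans in
        blast)
  have imp: "prec a b" if p: "g.prec a b" for a b
    by (rule contacts_determine_prec(2)[where f = rt and g = lf and f' = bt and g' = tp
      and Q = prec, OF r c inj _ _ _ _ _ p])
      (use h in blast, use w in blast, use H_prec in blast, use V_prec in blast, use prec_trans in
        blast)
  show "g.prec a b \<longleftrightarrow> prec a b" for a b
    using imp[of a b] imp[of b a] g.prec_total[of a b] prec_range[of a b] prec_asym[of a b] nn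
      by blast
qed

lemma swap_relatedI:
  assumes r: "represents R m lf0 rt0 tp0 bt0 s0" and q: "represents S n lf rt tp bt s"
    and ceq: "combinatorially_equivalent R S" and r': "represents R' n lf' rt' tp' bt' s'"
    and i: "0 < i" "i < n"
    and p: "\<And>a b. a \<in> {1..n} \<Longrightarrow> b \<in> {1..n} \<Longrightarrow>
     diagonal_grid.prec n lf' rt' tp' bt' (swap_next i a) (swap_next i b) \<longleftrightarrow> diagonal_grid.prec n lf
       rt tp bt a b"
  shows "swap_related R R'"
proof -
  note e = equivalent_same_prec[OF r q ceq]
  have "represents R n lf0 rt0 tp0 bt0 s0" using r e(1) by simp
  moreover have "\<forall>a\<in>{1..n}. \<forall>b\<in>{1..n}.
       diagonal_grid.prec n lf' rt' tp' bt' (swap_next i a) (swap_next i b) \<longleftrightarrow> diagonal_grid.prec n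
         lf0 rt0 tp0 bt0 a b"
    using p e by simp
  ultimately show ?thesis unfolding swap_related_def using r' i by blast
qed

lemma labeled_equiv_refl: "labeled_rectangulation xs \<Longrightarrow> labeled_equiv xs xs"
  by (simp add: labeled_equiv_def)

lemma represents_equiv_refl:
  assumes "represents R n lf rt tp bt s" shows "combinatorially_equivalent R R"
proof -
  interpret diagonal_grid n lf rt tp bt by (rule representsD[OF assms])
  show ?thesis unfolding combinatorially_equivalent_def
    using labeled_equiv_refl[OF labeled_draw[OF representsD(6)[OF assms]]]
      met_in_order_represents(3)[OF assms] by blast
qed

lemma diagonal_rectangulation_represents:
  assumes "diagonal_rectangulation R"
  obtains n lf rt tp bt s where "represents R n lf rt tp bt s"
  using diagonal_represents[of R] assms rectangulation_tiling unfolding diagonal_rectangulation_def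
    by metis

lemma (in vertical_edge) flip_upper_prec:
  assumes f: "simple_flip S upper lower S' \<or> rotation_flip S upper lower S'"
    and ceq: "combinatorially_equivalent S' R'" and r': "represents R' n' lf' rt' tp' bt' s'"
  shows "n' = n \<and> (\<forall>a\<in>{1..n}. \<forall>b\<in>{1..n}.
     diagonal_grid.prec n' lf' rt' tp' bt' (swap_next i a) (swap_next i b) \<longleftrightarrow> prec a b)"
  using f
proof
  assume s: "simple_flip S upper lower S'"
  then obtain p' q' where nm: "\<not> matched_at S upper lower" "\<not> matched_at S lower upper"
    and e: "edge_replacement S upper lower S' p' q'"
      and z: "open_segment upper lower \<inter> open_segment p' q' \<noteq> {}"
    unfolding simple_flip_def by blast
  have eq: "tp (Suc i) = tp i" "bt (Suc i) = bt i" using nm matched_top matched_bot idx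
    by (meson le_neq_implies_less)+
  obtain y where y: "s (tp i) < y" "y < s (bt i)"
    and sk: "skeleton S' = (skeleton S - open_segment upper (s i, 1 - s (bt i))) \<union> closed_segment (s
      (lf i), 1 - y) (s (rt (Suc i)), 1 - y)"
    using simple_flip_region[OF eq e z] by blast
  have fr: "flip_region S (D i) (D (Suc i)) (s i) (s (lf i)) (s (rt (Suc i))) (s (tp i)) (s (tp (Suc
    i))) (s (bt i)) (s (lf i)) y"
    by (rule flip_region_simple[OF eq y])
  have T': "tiling S'" using e rectangulation_tiling by (auto simp: edge_replacement_def)
  have "S' = flipped (s (lf i)) y ` {1..n}"
    using flip_region.replaced_tiles[OF fr T' sk] flipped_tiles(1)[OF fr] by simp
  then show ?thesis using flipped_prec[of y "s (lf i)" R', OF _ _ r'] eq y ceq by blast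
next
  assume s: "rotation_flip S upper lower S'"
  then obtain q' where nm: "matched_at S upper lower" "\<not> matched_at S lower upper"
    and e: "edge_replacement S upper lower S' upper q'"
    unfolding rotation_flip_def by blast
  have eq: "tp (Suc i) < tp i" "bt (Suc i) = bt i" using nm not_matched_top matched_bot idx
    by (meson le_neq_implies_less)+
  have sk: "skeleton S' = (skeleton S - open_segment upper (s i, 1 - s (bt i))) \<union> closed_segment
    upper (s (rt (Suc i)), 1 - s (tp i))"
    by (rule rotation_flip_region[OF eq e])
  have fr: "flip_region S (D i) (D (Suc i)) (s i) (s (lf i)) (s (rt (Suc i))) (s (tp i)) (s (tp (Suc
    i))) (s (bt i)) (s i) (s (tp i))"
    by (rule flip_region_rotation[OF eq])
  have T': "tiling S'" using e rectangulation_tiling by (auto simp: edge_replacement_def)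
  have "S' = flipped (s i) (s (tp i)) ` {1..n}"
    using flip_region.replaced_tiles[OF fr T' sk] flipped_tiles(1)[OF fr] by simp
  then show ?thesis using flipped_prec[of "s (tp i)" "s i" R', OF _ _ r'] eq ceq by blast
qed

lemma flip_vertical_related:
  assumes r: "represents S n lf rt tp bt s" and T: "tiling S"
    and v: "diagonal_grid.vert n lf rt tp bt k"
    and f: "flip S p q S'" and e: "edge S p q" and c: "(s k, 1 - s k) \<in> open_segment p q"
    and ceq: "combinatorially_equivalent S' R'" and d': "diagonal_rectangulation R'"
  shows "swap_related S R'"
proof -
  interpret vertical_edge S n lf rt tp bt s k using r T v by unfold_locales
  have "flip S upper lower S'" using crossing_edge[OF e c] f flip_commute by blast
  then consider "simple_flip S upper lower S' \<or> rotation_flip S upper lower S'" |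
    "rotation_flip S lower upper S'"
    unfolding flip_def by blast
  then show ?thesis
  proof cases
    case 1
    obtain n' lf' rt' tp' bt' s' where r': "represents R' n' lf' rt' tp' bt' s'"
      using diagonal_rectangulation_represents[OF d'] .
    note F = flip_upper_prec[OF 1 ceq r']
    then have "represents R' n lf' rt' tp' bt' s'" using r' by simp
    then show ?thesis using swap_relatedI[OF r r represents_equiv_refl[OF r], of R' lf' rt' tp' bt'
      s' k] idx(1,2) F by blast
  next
    case 2
    let ?S = "turn.im S" and ?s = "\<lambda>k. 1 - s (n - k)" and ?i = "n - k"
    have rt': "represents ?S n (turned n rt) (turned n lf) (turned n bt) (turned n tp) ?s"
      by (rule represents_turn[OF r])
    interpret t: diagonal_grid n "turned n rt" "turned n lf" "turned n bt" "turned n tp"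
      by (rule rotate)
    have e1: "n + 1 - (n - k) = Suc k" "n + 1 - (n - k + 1) = k" "n - k + 1 = Suc (n - k)"
      "Suc (n - Suc (n - k)) = k" using idx by auto
    have vt: "t.vert ?i"
      unfolding t.vert_def e1 using idx diag[OF idx(4)] bounds[OF idx(4)] diag[OF idx(3)] by auto
    have "edge_replacement S lower upper S' lower (SOME q'.
      edge_replacement S lower upper S' lower q')"
      using 2 unfolding rotation_flip_def by (metis someI)
    then have "rectangulation S" by (simp add: edge_replacement_def)
    then have Tt: "tiling ?S" using turn.rectangulation_image rectangulation_tiling by blast
    interpret w: vertical_edge ?S n "turned n rt" "turned n lf" "turned n bt" "turned n tp" ?s ?i
      using rt' Tt vt by unfold_locales
    have nk: "n - (n - k) = k" using idx by auto
    have "(s k, 1 - s k) \<in> open_segment upper lower" using ord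
      by (auto simp: open_segment_vertical open_segment_eq_real_ivl)
    then have "(s k, 1 - s k) \<in> open_segment lower upper" by (simp add: open_segment_commute)
    then have "turn (s k, 1 - s k) \<in> open_segment (turn lower) (turn upper)" by simp
    moreover have "turn (s k, 1 - s k) = (?s ?i, 1 - ?s ?i)" by (simp add: turn_def nk)
    moreover have "edge ?S (turn lower) (turn upper)" using edge_top_bot edge_commute[of S] by simp
    ultimately have or: "turn lower = w.upper \<and> turn upper = w.lower \<or> turn lower = w.lower \<and>
      turn upper = w.upper"
      using w.crossing_edge[of "turn lower" "turn upper"] by simp
    have o1: "snd (turn lower) > snd (turn upper)" using ord by (simp add: turn_def)
    have o2: "snd w.upper > snd w.lower" using w.ord by simp
    have pq: "turn lower = w.upper" "turn upper = w.lower" using or o1 o2 by (metis less_asym)+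
    have rot: "rotation_flip ?S w.upper w.lower (turn.im S')" using turn.rotation_flip_image[OF 2]
      unfolding pq .
    have ceqt: "combinatorially_equivalent (turn.im S') (turn.im R')"
      by (rule turn.combinatorially_equivalent_image[OF ceq])
    obtain n' lf' rt'' tp' bt' s' where r': "represents (turn.im R') n' lf' rt'' tp' bt' s'"
      using diagonal_rectangulation_represents[OF turn.diagonal_rectangulation_image[OF d']] .
    note F = w.flip_upper_prec[OF disjI2[OF rot] ceqt r']
    then have "represents (turn.im R') n lf' rt'' tp' bt' s'" using r' by simp
    then have "swap_related ?S (turn.im R')"
      using swap_relatedI[OF rt' rt' represents_equiv_refl[OF rt'], of "turn.im R'" lf' rt'' tp' bt'
        s' ?i] w.idx(1,2) F by blast
    then show ?thesis using swap_related_turn[of ?S "turn.im R'"] by simp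
  qed
qed

lemma flip_replaces: "flip S p q S' \<Longrightarrow> \<exists>p' q'. edge_replacement S p q S' p' q'"
proof -
  assume "flip S p q S'"
  then have "(\<exists>p' q'. edge_replacement S p q S' p' q') \<or> (\<exists>p' q'. edge_replacement S q p S' p' q')"
    unfolding flip_def simple_flip_def rotation_flip_def by blast
  moreover have "edge_replacement S q p S' p' q' \<Longrightarrow> edge_replacement S p q S' p' q'" for p' q'
  proof -
    have "(p - q) \<bullet> (q' - p') = - ((q - p) \<bullet> (q' - p'))" by (metis inner_minus_left minus_diff_eq)
    then show "edge_replacement S q p S' p' q' \<Longrightarrow> edge_replacement S p q S' p' q'"
      unfolding edge_replacement_def edge_commute[of S q p] open_segment_commute[of q p] by simp
  qed
  ultimately show ?thesis by blast
qed

lemma flip_related: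
  assumes d: "diagonal_rectangulation S" and f: "flip S p q S'"
    and c: "closed_segment p q \<inter> main_diagonal \<noteq> {}"
    and ceq: "combinatorially_equivalent S' R'" and d': "diagonal_rectangulation R'"
  shows "swap_related S R'"
proof -
  obtain n lf rt tp bt s where r: "represents S n lf rt tp bt s"
    using diagonal_rectangulation_represents[OF d] .
  interpret diagonal_grid n lf rt tp bt by (rule representsD[OF r])
  have T: "tiling S" using d by (simp add: diagonal_rectangulation_def rectangulation_tiling)
  obtain p' q' where er: "edge_replacement S p q S' p' q'" using flip_replaces[OF f] by blast
  then have e: "edge S p q" by (simp add: edge_replacement_def)
  obtain z where "z \<in> closed_segment p q" "z \<in> main_diagonal" using c by blast
  then obtain k where k: "0 < k" "k < n" "(s k, 1 - s k) \<in> open_segment p q"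
    using diagonal_crossing[OF r T er] by blast
  consider "vert k" | "horiz k" using vert_or_horiz[OF k(1,2)] by blast
  then show ?thesis
  proof cases
    case 1 then show ?thesis using flip_vertical_related[OF r T 1 f e k(3) ceq d'] by blast
  next
    case 2
    have v: "diagonal_grid.vert n tp bt lf rt k" using 2
      unfolding horiz_def diagonal_grid.vert_def[OF reflect] by auto
    have Tr: "tiling (rho.im S)" using d rho.rectangulation_image rectangulation_tiling
      by (auto simp: diagonal_rectangulation_def)
    have "rho (s k, 1 - s k) \<in> open_segment (rho p) (rho q)" using k(3) by simp
    moreover have "rho (s k, 1 - s k) = (s k, 1 - s k)" by (simp add: rho_def)
    ultimately have "swap_related (rho.im S) (rho.im R')"
      using flip_vertical_related[OF represents_rho[OF r] Tr v rho.flip_image[OF f] _ _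
        rho.combinatorially_equivalent_image[OF ceq]
          rho.diagonal_rectangulation_image[OF d']] e by simp
    then show ?thesis using swap_related_rho[of "rho.im S" "rho.im R'"] by simp
  qed
qed

lemma barcelona_flip_related:
  assumes "barcelona_flip R R'" shows "swap_related R R'"
proof -
  obtain S S' p q where b: "diagonal_rectangulation R" "diagonal_rectangulation R'"
    "combinatorially_equivalent R S" "diagonal_rectangulation S"
        "closed_segment p q \<inter> main_diagonal \<noteq> {}" "flip S p q S'" "combinatorially_equivalent S' R'"
    using assms unfolding barcelona_flip_def by blast
  have "swap_related S R'" by (rule flip_related[OF b(4,6,5,7,2)])
  then obtain n lf rt tp bt s lf' rt' tp' bt' s' i
    where r: "represents S n lf rt tp bt s" "represents R' n lf' rt' tp' bt' s'"
     "0 < i" "i < n" "\<And>a b. a \<in> {1..n} \<Longrightarrow> b \<in> {1..n} \<Longrightarrow>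
       diagonal_grid.prec n lf' rt' tp' bt' (swap_next i a) (swap_next i b) \<longleftrightarrow> diagonal_grid.prec n
         lf rt tp bt a b"
    unfolding swap_related_def by blast
  obtain m lf0 rt0 tp0 bt0 s0 where "represents R m lf0 rt0 tp0 bt0 s0"
    using diagonal_rectangulation_represents[OF b(1)] .
  then show ?thesis using swap_relatedI[OF _ r(1) b(3) r(2-5)] by blast
qed

section \<open>Realising a transposition by a flip\<close>

context diagonal_grid begin

text \<open>\<open>P\<close> contains the indices that sides may use. An index outside
  \<open>P\<close> can have any position, which leaves its natural position free for another
  wall.\<close>

definition monotone_lines :: "nat set \<Rightarrow> (nat \<Rightarrow> nat) \<Rightarrow> (nat \<Rightarrow> nat) \<Rightarrow> (nat \<Rightarrow> real) \<Rightarrow> bool" where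
  "monotone_lines P l r X \<longleftrightarrow> 0 \<in> P \<and> n \<in> P \<and> X 0 = 0 \<and> X n = 1 \<and> (\<forall>i\<in>{1..n}. l i \<in> P \<and> r i \<in> P) \<and>
     (\<forall>p\<in>P. \<forall>q\<in>P. p < q \<longrightarrow> X p < X q)"

lemma monotone_lines_less:
  assumes "monotone_lines P l r X" "i \<in> {1..n}" "j \<in> {1..n}" shows "X (l i) < X (r j) \<longleftrightarrow> l i < r j"
proof -
  have P: "l i \<in> P" "r j \<in> P" and m: "\<And>p q. p \<in> P \<Longrightarrow> q \<in> P \<Longrightarrow> p < q \<Longrightarrow> X p < X q"
    using assms unfolding monotone_lines_def by blast+
  show ?thesis using m[OF P] m[OF P(2,1)] by (cases "l i" "r j" rule: linorder_cases) auto
qed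

lemma monotone_lines_inj: "monotone_lines P l r X \<Longrightarrow> inj_on X P"
  unfolding monotone_lines_def by (intro inj_onI) (metis less_irrefl linorder_neqE_nat)

lemma monotone_drawing:
  assumes X: "monotone_lines P lf rt X" and Y: "monotone_lines P' tp bt Y"
  shows "drawing X Y"
  unfolding drawing_def
proof (intro conjI ballI)
  have "{0, n} \<union> {k. vert k} \<subseteq> P"
  proof
    fix k assume "k \<in> {0, n} \<union> {k. vert k}"
    moreover have "k \<in> P" if "vert k"
    proof -
      have "k \<in> {1..n}" "rt k = k" using that by (auto simp: vert_def)
      then show ?thesis using X unfolding monotone_lines_def by metis
    qed
    ultimately show "k \<in> P" using X by (auto simp: monotone_lines_def)
  qed
  then show "inj_on X ({0, n} \<union> {k. vert k})" by (rule inj_on_subset[OF monotone_lines_inj[OF X]])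
  have "{0, n} \<union> {k. horiz k} \<subseteq> P'"
  proof
    fix k assume "k \<in> {0, n} \<union> {k. horiz k}"
    moreover have "k \<in> P'" if "horiz k"
    proof -
      have "k \<in> {1..n}" "bt k = k" using that by (auto simp: horiz_def)
      then show ?thesis using Y unfolding monotone_lines_def by metis
    qed
    ultimately show "k \<in> P'" using Y by (auto simp: monotone_lines_def)
  qed
  then show "inj_on Y ({0, n} \<union> {k. horiz k})" by (rule inj_on_subset[OF monotone_lines_inj[OF Y]])
  fix i assume i: "i \<in> {1..n}"
  show "X (lf i) < X (rt i)" "Y (tp i) < Y (bt i)"
    using monotone_lines_less[OF X i i] monotone_lines_less[OF Y i i] diag[OF i] by auto
qed (use X Y in \<open>auto simp: monotone_lines_def\<close>)

lemma monotone_hcontacts: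
  "monotone_lines P tp bt Y \<Longrightarrow> hcontacts Y = {(i, j). i \<in> {1..n} \<and> j \<in> {1..n} \<and> rt i = lf j \<and>
    tp i < bt j \<and> tp j < bt i}"
  unfolding hcontacts_def using monotone_lines_less by blast

end

lemma represents_monotone:
  assumes "represents R n lf rt tp bt s"
  shows "diagonal_grid.monotone_lines n {..n} lf rt s"
    "diagonal_grid.monotone_lines n {..n} tp bt s"
proof -
  interpret diagonal_grid n lf rt tp bt by (rule representsD[OF assms])
  show "monotone_lines {..n} lf rt s" "monotone_lines {..n} tp bt s"
    using representsD(2-4)[OF assms] diag bounds by (fastforce simp: monotone_lines_def)+
qed

text \<open>Monotone positions compare the lines in use as their indices do, so the contacts depend
  on the grid alone.\<close>

lemma same_grid_equivalent:
  assumes g: "diagonal_grid n lf rt tp bt"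
    and X: "diagonal_grid.monotone_lines n P lf rt X"
      and Y: "diagonal_grid.monotone_lines n P' tp bt Y"
    and r: "represents R n lf' rt' tp' bt' s"
    and eq: "\<And>i. i \<in> {1..n} \<Longrightarrow> lf' i = lf i \<and> rt' i = rt i \<and> tp' i = tp i \<and> bt' i = bt i"
  shows "combinatorially_equivalent (diagonal_grid.draw lf rt tp bt X Y ` {1..n}) R"
proof -
  interpret diagonal_grid n lf rt tp bt by (rule g)
  interpret ref: diagonal_grid n tp bt lf rt by (rule reflect)
  note R = representsD[OF r]
  interpret g: diagonal_grid n lf' rt' tp' bt' by (rule R)
  interpret gref: diagonal_grid n tp' bt' lf' rt' by (rule g.reflect)
  have d: "drawing X Y" by (rule monotone_drawing[OF X Y])
  have X': "ref.monotone_lines P lf rt X" using X by simp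
  have s': "gref.monotone_lines {..n} lf' rt' s" using represents_monotone(1)[OF r] by simp
  have "hcontacts Y = g.hcontacts s"
    unfolding monotone_hcontacts[OF Y] g.monotone_hcontacts[OF represents_monotone(2)[OF r]]
      using eq by auto
  moreover have "ref.hcontacts X = gref.hcontacts s"
    unfolding ref.monotone_hcontacts[OF X'] gref.monotone_hcontacts[OF s'] using eq by auto
  ultimately have "labeled_equiv (draw_list X Y) (g.draw_list s s)"
    unfolding labeled_equiv_def h_contacts_draw[OF d] v_contacts_draw[OF d] g.h_contacts_draw[OF
      R(6)] g.v_contacts_draw[OF R(6)]
    using labeled_draw[OF d] g.labeled_draw[OF R(6)] by simp
  then show ?thesis unfolding combinatorially_equivalent_def
    using set_draw_list g.set_draw_list R(5) by blast
qed

context vertical_edge begin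

lemma flip_exists:
  assumes c: "tp (Suc i) = tp i \<and> bt (Suc i) = bt i \<and> s (tp i) < y \<and> y < s (bt i) \<and> x1 = s (lf i) \<or>
      tp (Suc i) < tp i \<and> bt (Suc i) = bt i \<and> y = s (tp i) \<and> x1 = s i"
    and S: "rectangulation S" and S': "rectangulation (flipped x1 y ` {1..n})"
  shows "flip S upper lower (flipped x1 y ` {1..n})"
proof -
  have f: "flip_region S (D i) (D (Suc i)) (s i) (s (lf i)) (s (rt (Suc i))) (s (tp i)) (s (tp (Suc
    i))) (s (bt i)) x1 y"
    using c flip_region_simple[of y] flip_region_rotation by blast
  interpret F: flip_region S "D i" "D (Suc i)" "s i" "s (lf i)" "s (rt (Suc i))" "s (tp i)"
    "s (tp (Suc i))" "s (bt i)" x1 y by (rule f)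
  have beq: "bt (Suc i) = bt i" using c by blast
  let ?S' = "flipped x1 y ` {1..n}" and ?p = "(x1, 1 - y)" and ?q = "(s (rt (Suc i)), 1 - y)"
  have eS: "?S' = S - {D i, D (Suc i)} \<union> {F.K', F.L'}" by (rule flipped_tiles(1)[OF f])
  have T': "tiling ?S'" by (rule rectangulation_tiling[OF S'])
  have sk: "skeleton ?S' = skeleton S - open_segment upper lower \<union> closed_segment ?p ?q"
    unfolding eS beq by (rule F.skeleton_cut)
  have LS: "F.L' \<in> ?S'" unfolding eS by blast
  have ed: "edge ?S' ?p ?q"
    unfolding edge_def
  proof (intro conjI)
    show "?p \<in> vertices ?S'" "?q \<in> vertices ?S'"
      by (rule vertexI[OF T' LS]; simp add: F.L'_coords)+
    show "?p \<noteq> ?q" using F.ord by auto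
    show "closed_segment ?p ?q \<subseteq> skeleton ?S'" unfolding sk by blast
    \<comment> \<open>A vertex inside the new edge would be a corner of an unaffected tile, and this
      tile would overlap one of the two old tiles.\<close>
    show "open_segment ?p ?q \<inter> vertices ?S' = {}"
    proof (rule ccontr)
      assume "\<not> ?thesis"
      then obtain x w where xw: "(x, 1 - w) \<in> open_segment ?p ?q" "(x, 1 - w) \<in> vertices ?S'"
        by (metis IntE nonempty_down)
      have x: "x1 < x" "x < s (rt (Suc i))" "w = y"
        using xw(1) F.ord by (auto simp: open_segment_horizontal open_segment_eq_real_ivl split:
          if_splits)
      obtain J where J: "J \<in> ?S'" "x = lc J \<or> x = rc J" "w = tc J \<or> w = bc J" using xw(2)
        unfolding mem_vertices[OF T'] by auto
      have jr: "lc J \<le> x" "x \<le> rc J" "tc J \<le> y" "y \<le> bc J" using tiling_rect[OF T' J(1)] J(2,3) x(3)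
        by (metis less_imp_le order_refl)+
      have "J \<noteq> F.K'" "J \<noteq> F.L'" using J(2) x(1,2) F.K'_coords(2,3) F.L'_coords(2,3) F.ord by force+
      then have JS: "J \<in> S" "J \<noteq> D i" "J \<noteq> D (Suc i)" using J(1) eS by auto
      note Jr = tiling_rect[OF T JS(1)]
      show False
      proof (cases "s i < x")
        case True
        have "J = D (Suc i)" by (rule tiling_disjoint[OF T JS(1) L(1)]) (use True jr x L F.ord Jr
          beq in auto)
        then show False using JS by simp
      next
        case False
        then have tl: "s (tp i) < y" using c x(1) by auto
        show False
        proof (cases "lc J < s i")
          case True
          have "J = D i" by (rule tiling_disjoint[OF T JS(1) K(1)]) (use True tl jr x K F.ord Jr in
            auto)
          then show False using JS by simp
        next
          case nl: False
          have "J = D (Suc i)" by (rule tiling_disjoint[OF T JS(1) L(1)]) (use nl False tl jr x L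
            F.ord Jr beq in auto)
          then show False using JS by simp
        qed
      qed
    qed
  qed
  have er: "edge_replacement S upper lower ?S' ?p ?q"
    unfolding edge_replacement_def using S S' edge_top_bot ed sk by (simp add: inner_prod_def)
  show ?thesis
    using c
  proof
    assume a: "tp (Suc i) = tp i \<and> bt (Suc i) = bt i \<and> s (tp i) < y \<and> y < s (bt i) \<and> x1 = s (lf i)"
    have "(s i, 1 - y) \<in> open_segment upper lower" using a ord
      by (auto simp: open_segment_vertical open_segment_eq_real_ivl)
    moreover have "(s i, 1 - y) \<in> open_segment ?p ?q" using a ord
      by (auto simp: open_segment_horizontal open_segment_eq_real_ivl)
    ultimately have "simple_flip S upper lower ?S'"
      unfolding simple_flip_def using er not_matched_top not_matched_bot a by blast
    then show ?thesis unfolding flip_def ..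
  next
    assume b: "tp (Suc i) < tp i \<and> bt (Suc i) = bt i \<and> y = s (tp i) \<and> x1 = s i"
    then have "edge_replacement S upper lower ?S' upper ?q" using er by simp
    then have "rotation_flip S upper lower ?S'"
      unfolding rotation_flip_def using matched_top not_matched_bot b by blast
    then show ?thesis unfolding flip_def by blast
  qed
qed

text \<open>The grid of the flipped rectangulation is supplied explicitly.
  \<open>flipped_prec\<close> computes its order, which is the order of \<open>R'\<close>; by
  \<open>grid_determined\<close> the two grids agree, so \<open>R'\<close> is a diagonal redrawing
  of the result of the flip.\<close>

lemma barcelona_flip_by_grid:
  assumes c: "tp (Suc i) = tp i \<and> bt (Suc i) = bt i \<and> s (tp i) < y \<and> y < s (bt i) \<and> x1 = s (lf i) \<or>
      tp (Suc i) < tp i \<and> bt (Suc i) = bt i \<and> y = s (tp i) \<and> x1 = s i"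
    and g: "diagonal_grid n l2 r2 t2 b2"
    and X: "diagonal_grid.monotone_lines n P l2 r2 X"
      and Y: "diagonal_grid.monotone_lines n P' t2 b2 Y"
    and dr: "\<And>m. m \<in> {1..n} \<Longrightarrow> diagonal_grid.draw l2 r2 t2 b2 X Y m = flipped x1 y m"
    and d: "diagonal_rectangulation S" "diagonal_rectangulation R'"
    and r': "represents R' n lf' rt' tp' bt' s'"
    and p: "\<And>a b. a \<in> {1..n} \<Longrightarrow> b \<in> {1..n} \<Longrightarrow>
       diagonal_grid.prec n lf' rt' tp' bt' (swap_next i a) (swap_next i b) \<longleftrightarrow> prec a b"
  shows "barcelona_flip S R'"
proof -
  interpret g: diagonal_grid n l2 r2 t2 b2 by (rule g)
  interpret g': diagonal_grid n lf' rt' tp' bt' by (rule representsD(1)[OF r'])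
  have im: "g.draw X Y ` {1..n} = flipped x1 y ` {1..n}" using dr by (rule image_cong[OF refl])
  define R2 where "R2 = g.draw s s ` {1..n}"
  have r2: "represents R2 n l2 r2 t2 b2 s"
    using g representsD(2-4)[OF r] unfolding represents_def R2_def g.draw_def by blast
  have c2: "combinatorially_equivalent (flipped x1 y ` {1..n}) R2"
    using same_grid_equivalent[OF g X Y r2] im by simp
  note p2 = flipped_prec[OF c c2 r2]
  have "g'.prec a b = g.prec a b" if ab: "a \<in> {1..n}" "b \<in> {1..n}" for a b
  proof -
    have sw: "swap_next i (swap_next i m) = m" for m by (auto simp: swap_next_def)
    have "swap_next i a \<in> {1..n}" "swap_next i b \<in> {1..n}" using swap_next_range idx(1,2) ab
      by blast+
    then show ?thesis using p[of "swap_next i a" "swap_next i b"] p2(2)[of "swap_next i a"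
      "swap_next i b"] sw by metis
  qed
  then have "lf' m = l2 m \<and> rt' m = r2 m \<and> tp' m = t2 m \<and> bt' m = b2 m" if "m \<in> {1..n}" for m
    using g.grid_determined[OF g'.diagonal_grid_axioms _ that] by blast
  then have cR: "combinatorially_equivalent (flipped x1 y ` {1..n}) R'"
    using same_grid_equivalent[OF g X Y r'] im by simp
  have rS: "rectangulation S" using d(1) by (simp add: diagonal_rectangulation_def)
  have rS': "rectangulation (flipped x1 y ` {1..n})"
    using g.draw_rectangulation[OF g.monotone_drawing[OF X Y]] im by simp
  have "(s i, 1 - s i) \<in> closed_segment upper lower"
    using ord by (auto simp: closed_segment_vertical closed_segment_eq_real_ivl)
  moreover have "(s i, 1 - s i) \<in> main_diagonal"
    using le[of 0 i] le[of i n] representsD(2,3)[OF r] idx by (auto simp: mem_main_diagonal)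
  ultimately have "closed_segment upper lower \<inter> main_diagonal \<noteq> {}" by blast
  then show ?thesis
    unfolding barcelona_flip_def using d represents_equiv_refl[OF r] flip_exists[OF c rS rS'] cR
      by blast
qed

text \<open>Tiles \<open>m\<close> and \<open>Suc i\<close> both contain the cell in column
  \<open>Suc i\<close> and row \<open>m\<close>, because
  \<open>m <= bt m <= bt i = bt (Suc i)\<close>.\<close>

lemma right_of_wall:
  assumes b: "bt (Suc i) = bt i" and m: "m \<in> {1..n}" "lf m = i" shows "m = Suc i"
proof (rule disj[OF m(1) idx(4)])
  have "bt m \<le> bt i" by (rule bt_right_le[OF m]) (use idx in simp)
  then show "lf m < Suc i" "Suc i \<le> rt m" "tp m < m" "m \<le> bt m" "lf (Suc i) < Suc i"
    "Suc i \<le> rt (Suc i)" "tp (Suc i) < m" "m \<le> bt (Suc i)"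
    using m idx diag[OF m(1)] b by auto
qed

lemma no_vert_line:
  assumes "m \<in> {1..n}" shows "tp m \<noteq> i" "bt m \<noteq> i"
  using tp_horiz(1)[OF assms] bt_horiz(1)[OF assms] not_vert_horiz[OF v] idx by blast+

text \<open>Cutting at height \<open>s i\<close> keeps the drawing diagonal: the new horizontal wall
  crosses the diagonal where the vertical one did and inherits its index \<open>i\<close>.\<close>

lemma barcelona_flip_simple:
  assumes eq: "tp (Suc i) = tp i" "bt (Suc i) = bt i"
    and d: "diagonal_rectangulation S" "diagonal_rectangulation R'"
    and r': "represents R' n lf' rt' tp' bt' s'"
    and p: "\<And>a b. a \<in> {1..n} \<Longrightarrow> b \<in> {1..n} \<Longrightarrow>
       diagonal_grid.prec n lf' rt' tp' bt' (swap_next i a) (swap_next i b) \<longleftrightarrow> prec a b"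
  shows "barcelona_flip S R'"
proof -
  define l2 where "l2 = lf(Suc i := lf i)"
  define r2 where "r2 = rt(i := rt (Suc i))"
  define t2 where "t2 = tp(Suc i := i)"
  define b2 where "b2 = bt(i := i)"
  note defs = l2_def r2_def t2_def b2_def
  have g: "diagonal_grid n l2 r2 t2 b2"
  proof
    show "0 < n" by (rule n_pos)
    fix m assume m: "m \<in> {1..n}"
    show "l2 m < m \<and> m \<le> r2 m \<and> t2 m < m \<and> m \<le> b2 m" "r2 m \<le> n \<and> b2 m \<le> n"
      using diag[OF m] bounds[OF m] idx by (auto simp: defs)
  next
    fix u w assume uw: "u \<in> {1..n}" "w \<in> {1..n}"
    obtain m where m: "m \<in> {1..n}" "lf m < u" "u \<le> rt m" "tp m < w" "w \<le> bt m" using cover[OF uw]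
      by blast
    show "\<exists>m\<in>{1..n}. l2 m < u \<and> u \<le> r2 m \<and> t2 m < w \<and> w \<le> b2 m"
    proof (cases "m = i \<or> m = Suc i")
      case False
      then show ?thesis using m by (intro bexI[of _ m]) (auto simp: defs)
    next
      case True
      then have uu: "lf i < u" "u \<le> rt (Suc i)" "tp i < w" "w \<le> bt i" using m idx eq by auto
      show ?thesis
      proof (cases "w \<le> i")
        case True
        then show ?thesis using uu idx eq by (intro bexI[of _ i]) (auto simp: defs)
      next
        case False
        then show ?thesis using uu idx eq by (intro bexI[of _ "Suc i"]) (auto simp: defs)
      qed
    qed
  next
    fix a b u w
    assume ab: "a \<in> {1..n}" "b \<in> {1..n}"
      and c: "l2 a < u" "u \<le> r2 a" "t2 a < w" "w \<le> b2 a" "l2 b < u" "u \<le> r2 b" "t2 b < w" "w \<le> b2 b"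
    have oth: "lf m < u \<and> u \<le> rt m \<and> tp m < w \<and> w \<le> bt m"
      if "m \<noteq> i" "m \<noteq> Suc i" "l2 m < u" "u \<le> r2 m" "t2 m < w" "w \<le> b2 m" for m
      using that by (auto simp: defs)
    have reg: "(lf i < u \<and> u \<le> rt i \<and> tp i < w \<and> w \<le> bt i) \<or> (lf (Suc i) < u \<and> u \<le> rt (Suc i) \<and>
      tp (Suc i) < w \<and> w \<le> bt (Suc i))"
      if "m = i \<or> m = Suc i" "l2 m < u" "u \<le> r2 m" "t2 m < w" "w \<le> b2 m" for m
      using that idx eq by (auto simp: defs split: if_splits)
    show "a = b"
    proof (cases "a = i \<or> a = Suc i"; cases "b = i \<or> b = Suc i")
      assume "a = i \<or> a = Suc i" "b = i \<or> b = Suc i"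
      then show ?thesis using c idx by (auto simp: defs split: if_splits)
    next
      assume A: "a = i \<or> a = Suc i" and B: "\<not> (b = i \<or> b = Suc i)"
      then show ?thesis using reg[OF A c(1-4)] oth[of b] c(5-8) disj[OF ab(2) idx(3), of u w]
        disj[OF ab(2) idx(4), of u w] by blast
    next
      assume A: "\<not> (a = i \<or> a = Suc i)" and B: "b = i \<or> b = Suc i"
      then show ?thesis using reg[OF B c(5-8)] oth[of a] c(1-4) disj[OF ab(1) idx(3), of u w]
        disj[OF ab(1) idx(4), of u w] by blast
    next
      assume A: "\<not> (a = i \<or> a = Suc i)" and B: "\<not> (b = i \<or> b = Suc i)"
      then show ?thesis using oth[of a] oth[of b] c disj[OF ab, of u w] by blast
    qed
  qed
  interpret g: diagonal_grid n l2 r2 t2 b2 by (rule g)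
  have s: "s 0 = 0" "s n = 1" using representsD(2,3)[OF r] by auto
  have X: "g.monotone_lines {..n} l2 r2 s" and Y: "g.monotone_lines {..n} t2 b2 s"
    unfolding g.monotone_lines_def using s less line_le idx by (auto simp: defs)
  have dr: "g.draw s s m = flipped (s (lf i)) (s i) m" if "m \<in> {1..n}" for m
    unfolding g.draw_def flipped_def draw_def using eq idx by (simp add: defs)
  show ?thesis
    by (rule barcelona_flip_by_grid[OF _ g X Y dr d r' p]) (use eq ord in auto)
qed

text \<open>After the rotation the diagonal has to cross the vertical wall before the horizontal
  one, so the wall of \<open>i\<close> receives the index \<open>j = i - 1\<close> and the wall at
  \<open>tp i = j\<close> the index \<open>i\<close>. In the flipped drawing both keep their places,
  whence \<open>X j = s i\<close> and \<open>Y i = s j\<close>; the upper new tile misses the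
  diagonal there.\<close>

lemma barcelona_flip_rotation:
  assumes lt: "tp (Suc i) < tp i" and eq: "bt (Suc i) = bt i" and full: "tp i = i - 1"
    and d: "diagonal_rectangulation S" "diagonal_rectangulation R'"
    and r': "represents R' n lf' rt' tp' bt' s'"
    and p: "\<And>a b. a \<in> {1..n} \<Longrightarrow> b \<in> {1..n} \<Longrightarrow>
       diagonal_grid.prec n lf' rt' tp' bt' (swap_next i a) (swap_next i b) \<longleftrightarrow> prec a b"
  shows "barcelona_flip S R'"
proof -
  define j where "j = i - 1"
  have j: "i = Suc j" "0 < j" "tp i = j" using lt full idx by (auto simp: j_def)
  have hj: "horiz j" using tp_horiz(1)[OF idx(3) j(3) j(2)] .
  have nv: "lf m \<noteq> j" "rt m \<noteq> j" if m: "m \<in> {1..n}" for m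
    using lf_vert(1)[OF m, of j] rt_vert(1)[OF m, of j] not_vert_horiz[OF _ hj] j idx by auto
  have kj: "rt j \<le> i"
  proof (rule ccontr)
    assume n: "\<not> rt j \<le> i"
    have jr: "j \<in> {1..n}" "bt j = j" using hj by (auto simp: horiz_def)
    have "j = Suc i" by (rule disj[OF jr(1) idx(4), of "Suc i" j]) (use n jr diag[OF jr(1)] lt j idx
      in auto)
    then show False using j by simp
  qed
  have topj: "m = i" if m: "m \<in> {1..n}" "tp m = j" for m
    using tp_horiz(2,3)[OF m j(2)] kj j by auto
  have right: "m = Suc i" if "m \<in> {1..n}" "lf m = i" for m by (rule right_of_wall[OF eq that])
  define l2 where "l2 m = (if m = i then j else if m = Suc i then lf i else lf m)" for m
  define r2 where "r2 m = (if m = i \<or> m = Suc i then rt (Suc i) else if rt m = i then j else rt m)"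
    for m
  define t2 where "t2 m = (if m = i then tp (Suc i) else if m = Suc i then i else tp m)" for m
  define b2 where "b2 m = (if m = i then i else if m = Suc i then bt i else if bt m =
    j then i else bt m)" for m
  note defs = l2_def r2_def t2_def b2_def
  \<comment> \<open>Old columns \<open>j\<close> and \<open>i\<close> are not separated by a wall,
    new columns \<open>i\<close> and \<open>i + 1\<close> are not; for rows it is the other way
    round. \<open>U\<close> and \<open>W\<close> send a new column or row to an old one in the same
    place, which reduces covering and disjointness to the old grid.\<close>
  define U where "U u = (if u = i then Suc i else u)" for u
  define W where "W w = (if w = i then j else w)" for w
  have oth: "(l2 m < u \<longleftrightarrow> lf m < U u) \<and> (u \<le> r2 m \<longleftrightarrow> U u \<le> rt m) \<and> (t2 m < w \<longleftrightarrow> tp m < W w) \<and>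
    (w \<le> b2 m \<longleftrightarrow> W w \<le> bt m)"
    if m: "m \<in> {1..n}" "m \<noteq> i" "m \<noteq> Suc i" for m u w
  proof -
    have 1: "x < u \<longleftrightarrow> x < U u" if "x \<noteq> i" for x using that unfolding U_def by (cases "u = i") auto
    have 2: "u \<le> (if x = i then j else x) \<longleftrightarrow> U u \<le> x" if "x \<noteq> j" for x
      using that j(1) unfolding U_def by (cases "u = i"; cases "x = i") auto
    have 3: "x < w \<longleftrightarrow> x < W w" if "x \<noteq> j" for x using that j(1) unfolding W_def
      by (cases "w = i") auto
    have 4: "w \<le> (if x = j then i else x) \<longleftrightarrow> W w \<le> x" if "x \<noteq> i" for x
      using that j(1) unfolding W_def by (cases "w = i"; cases "x = j") auto
    have e: "l2 m = lf m" "r2 m = (if rt m = i then j else rt m)" "t2 m = tp m"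
      "b2 m = (if bt m = j then i else bt m)"
      using m(2,3) by (simp_all add: defs)
    have ne: "lf m \<noteq> i" "rt m \<noteq> j" "tp m \<noteq> j" "bt m \<noteq> i"
      using right[OF m(1)] m(2,3) nv(2)[OF m(1)] topj[OF m(1)] no_vert_line(2)[OF m(1)] by blast+
    show ?thesis unfolding e using 1[OF ne(1)] 2[OF ne(2)] 3[OF ne(3)] 4[OF ne(4)] by blast
  qed
  have ci: "(l2 i < u \<longleftrightarrow> i < U u) \<and> (u \<le> r2 i \<longleftrightarrow> U u \<le> rt (Suc i)) \<and> (t2 i < w \<longleftrightarrow> tp (Suc i) < W w) \<and>
    (w \<le> b2 i \<longleftrightarrow> W w \<le> j)" for u w
    using idx j lt by (auto simp: defs U_def W_def)
  have cs: "(l2 (Suc i) < u \<longleftrightarrow> lf i < U u) \<and> (u \<le> r2 (Suc i) \<longleftrightarrow> U u \<le> rt (Suc i)) \<and> (t2 (Suc i) < w \<longleftrightarrow>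
    j < W w) \<and> (w \<le> b2 (Suc i) \<longleftrightarrow> W w \<le> bt i)" for u w
    using idx j lt by (auto simp: defs U_def W_def)
  have UW: "U u \<in> {1..n}" "W w \<in> {1..n}" if "u \<in> {1..n}" "w \<in> {1..n}" for u w
    using that idx j by (auto simp: U_def W_def)
  have g: "diagonal_grid n l2 r2 t2 b2"
  proof
    show "0 < n" by (rule n_pos)
    fix m assume m: "m \<in> {1..n}"
    show "l2 m < m \<and> m \<le> r2 m \<and> t2 m < m \<and> m \<le> b2 m" "r2 m \<le> n \<and> b2 m \<le> n"
      using diag[OF m] bounds[OF m] idx j by (auto simp: defs)
  next
    fix u w assume uw: "u \<in> {1..n}" "w \<in> {1..n}"
    obtain m where m: "m \<in> {1..n}" "lf m < U u" "U u \<le> rt m" "tp m < W w" "W w \<le> bt m"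
      using cover[OF UW(1)[OF uw] UW(2)[OF uw]] by blast
    show "\<exists>m\<in>{1..n}. l2 m < u \<and> u \<le> r2 m \<and> t2 m < w \<and> w \<le> b2 m"
    proof (cases "m = i \<or> m = Suc i")
      case False
      then show ?thesis using m oth[OF m(1)] by (intro bexI[of _ m]) auto
    next
      case True
      then have uu: "lf i < U u" "U u \<le> rt (Suc i)" "tp (Suc i) < W w" "W w \<le> bt i"
        "W w \<le> j \<longrightarrow> i < U u" using m idx eq lt j by auto
      show ?thesis
      proof (cases "W w \<le> j")
        case True
        then show ?thesis using uu idx(3) ci[of u w] by (intro bexI[of _ i]) auto
      next
        case False
        then show ?thesis using uu idx(4) cs[of u w] by (intro bexI[of _ "Suc i"]) auto
      qed
    qed
  next
    fix a b u w
    assume ab: "a \<in> {1..n}" "b \<in> {1..n}"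
      and c: "l2 a < u" "u \<le> r2 a" "t2 a < w" "w \<le> b2 a" "l2 b < u" "u \<le> r2 b" "t2 b < w" "w \<le> b2 b"
    have reg: "(lf i < U u \<and> U u \<le> rt i \<and> tp i < W w \<and> W w \<le> bt i) \<or> (lf (Suc i) < U u \<and>
      U u \<le> rt (Suc i) \<and> tp (Suc i) < W w \<and> W w \<le> bt (Suc i))"
      if "m = i \<or> m = Suc i" "l2 m < u" "u \<le> r2 m" "t2 m < w" "w \<le> b2 m" for m
      using that
    proof (elim disjE)
      assume m: "m = i"
      then have "i < U u" "U u \<le> rt (Suc i)" "tp (Suc i) < W w" "W w \<le> j" using ci[of u w] that
        by auto
      then show ?thesis using idx j by auto
    next
      assume m: "m = Suc i"
      then have "lf i < U u" "U u \<le> rt (Suc i)" "j < W w" "W w \<le> bt i" using cs[of u w] that by auto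
      then show ?thesis using idx j eq lt by (cases "U u \<le> i") auto
    qed
    show "a = b"
    proof (cases "a = i \<or> a = Suc i"; cases "b = i \<or> b = Suc i")
      assume A: "a = i \<or> a = Suc i" and B: "b = i \<or> b = Suc i"
      have "a = i \<longleftrightarrow> W w \<le> j" using A c(3,4) ci[of u w] cs[of u w] by auto
      moreover have "b = i \<longleftrightarrow> W w \<le> j" using B c(7,8) ci[of u w] cs[of u w] by auto
      ultimately show ?thesis using A B by auto
    next
      assume A: "a = i \<or> a = Suc i" and B: "\<not> (b = i \<or> b = Suc i)"
      then show ?thesis using reg[OF A c(1-4)] oth[OF ab(2), of u w] c(5-8) disj[OF ab(2) idx(3), of
        "U u" "W w"] disj[OF ab(2) idx(4), of "U u" "W w"] by blast
    next
      assume A: "\<not> (a = i \<or> a = Suc i)" and B: "b = i \<or> b = Suc i"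
      then show ?thesis using reg[OF B c(5-8)] oth[OF ab(1), of u w] c(1-4) disj[OF ab(1) idx(3), of
        "U u" "W w"] disj[OF ab(1) idx(4), of "U u" "W w"] by blast
    next
      assume A: "\<not> (a = i \<or> a = Suc i)" and B: "\<not> (b = i \<or> b = Suc i)"
      then show ?thesis using oth[OF ab(1), of u w] oth[OF ab(2), of u w] c disj[OF ab, of "U u"
        "W w"] by blast
    qed
  qed
  interpret g: diagonal_grid n l2 r2 t2 b2 by (rule g)
  have s: "s 0 = 0" "s n = 1" using representsD(2,3)[OF r] by auto
  define X where "X = s(j := s i)"
  define Y where "Y = s(i := s j)"
  have X: "g.monotone_lines ({..n} - {i}) l2 r2 X"
    unfolding g.monotone_lines_def
  proof (intro conjI ballI impI)
    show "X 0 = 0" "X n = 1" using s j idx by (auto simp: X_def)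
    show "0 \<in> {..n} - {i}" "n \<in> {..n} - {i}" using idx by auto
    fix m assume m: "m \<in> {1..n}"
    show "l2 m \<in> {..n} - {i}" "r2 m \<in> {..n} - {i}"
      using conjunct1[OF line_le[OF m]] conjunct1[OF conjunct2[OF line_le[OF m]]] idx(2,3,7,8,15)
        j(1) right[OF m] unfolding defs
      by (cases "m = i"; cases "m = Suc i"; cases "rt m = i"; force)+
  next
    fix a b assume ab: "a \<in> {..n} - {i}" "b \<in> {..n} - {i}" "a < b"
    show "X a < X b"
    proof -
      have "b \<le> n" "a = j \<Longrightarrow> i < b" "b = j \<Longrightarrow> a < i" using ab j(1) by auto
      then show ?thesis using less[of a b] less[of i b] less[of a i] ab(3) idx(2) unfolding X_def
        by fastforce
    qed
  qed
  have Y: "g.monotone_lines ({..n} - {j}) t2 b2 Y"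
    unfolding g.monotone_lines_def
  proof (intro conjI ballI impI)
    show "Y 0 = 0" "Y n = 1" using s j idx by (auto simp: Y_def)
    show "0 \<in> {..n} - {j}" "n \<in> {..n} - {j}" using idx j by auto
    fix m assume m: "m \<in> {1..n}"
    show "t2 m \<in> {..n} - {j}" "b2 m \<in> {..n} - {j}"
      using line_le[OF m] idx(2,9,10,11,16) j(1) lt j(3) topj[OF m] unfolding defs
      by (cases "m = i"; cases "m = Suc i"; cases "bt m = j"; force)+
  next
    fix a b assume ab: "a \<in> {..n} - {j}" "b \<in> {..n} - {j}" "a < b"
    show "Y a < Y b"
    proof -
      have "b \<le> n" "j \<le> n" "a = i \<Longrightarrow> j < b" "b = i \<Longrightarrow> a < j" using ab j(1) idx(2) by auto
      then show ?thesis using less[of a b] less[of j b] less[of a j] ab(3) unfolding Y_def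
        by fastforce
    qed
  qed
  have dr: "g.draw X Y m = flipped (s i) (s (tp i)) m" if m: "m \<in> {1..n}" for m
  proof -
    consider "m = i" | "m = Suc i" | "m \<noteq> i" "m \<noteq> Suc i" by blast
    then show ?thesis
    proof cases
      case 1
      then show ?thesis unfolding g.draw_def flipped_def using idx j lt
        by (simp add: defs X_def Y_def)
    next
      case 2
      then show ?thesis unfolding g.draw_def flipped_def using idx j lt nv(1)[OF idx(3)]
        by (simp add: defs X_def Y_def)
    next
      case 3
      have "X (l2 m) = s (lf m)" "X (r2 m) = s (rt m)" "Y (t2 m) = s (tp m)" "Y (b2 m) = s (bt m)"
        using 3 nv[OF m] no_vert_line[OF m] j by (auto simp: defs X_def Y_def)
      then show ?thesis unfolding g.draw_def flipped_other[OF 3] draw_def by simp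
    qed
  qed
  show ?thesis
    by (rule barcelona_flip_by_grid[OF _ g X Y dr d r' p]) (use lt eq in auto)
qed

end

section \<open>Orders differing by a transposition\<close>

context diagonal_grid begin

text \<open>Tile \<open>k = tp i\<close> ends at the wall of \<open>i\<close>, because
  \<open>i + 1\<close> reaches further up beside it. In the second order it precedes
  \<open>i\<close> but not \<open>i + 1\<close>, and it precedes no label strictly between
  \<open>k\<close> and \<open>i\<close>; this fixes its new right line.\<close>

lemma swapped_top_corner:
  assumes v: "vert i" and lt: "tp (Suc i) < tp i"
    and g: "diagonal_grid n lf' rt' tp' bt'"
    and p: "\<And>a b. a \<in> {1..n} \<Longrightarrow> b \<in> {1..n} \<Longrightarrow>
       diagonal_grid.prec n lf' rt' tp' bt' (swap_next i a) (swap_next i b) \<longleftrightarrow> prec a b"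
  shows "tp i \<in> {1..n}" "tp i < i" "rt (tp i) = i" "rt' (tp i) = i - 1"
    "diagonal_grid.prec n lf' rt' tp' bt' (Suc i) (tp i)"
proof -
  interpret g: diagonal_grid n lf' rt' tp' bt' by (rule g)
  define k where "k = tp i"
  have i: "i \<in> {1..n}" "Suc i \<in> {1..n}" "lf (Suc i) = i" "rt i = i" using v by (auto simp: vert_def)
  have k: "horiz k" "i \<le> rt k" "0 < k" using tp_horiz[OF i(1)] lt by (auto simp: k_def)
  have kn: "k \<in> {1..n}" "bt k = k" "k < i" using k(1) diag[OF i(1)] by (auto simp: horiz_def k_def)
  have "rt k \<le> i"
  proof (rule ccontr)
    assume n: "\<not> rt k \<le> i"
    have "k = Suc i"
      by (rule disj[OF kn(1) i(2), of "Suc i" k])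
        (use n kn diag[OF kn(1)] diag[OF i(1)] diag[OF i(2)] lt i in \<open>auto simp: k_def\<close>)
    then show False using kn by simp
  qed
  then have rk: "rt k = i" using k by simp
  have "prec k (Suc i)" "prec i k" using H_prec[of k "Suc i"] V_prec[of k i] rk i kn
    by (auto simp: k_def)
  then have q: "g.prec k i" "g.prec (Suc i) k"
    using p[OF kn(1) i(2)] p[OF i(1) kn(1)] kn(3) by (simp_all add: swap_next_def)
  have l: "rt' k < i" using g.rt_less[OF q(1) kn(3)] .
  have "\<not> rt' k + 1 < i"
  proof
    assume a: "rt' k + 1 < i"
    have j: "rt' k + 1 \<in> {1..n}" "k < rt' k + 1" using a i g.diag[OF kn(1)] by auto
    have "g.prec k (rt' k + 1)" by (rule g.prec_rt[OF kn(1)]) (use a i in auto)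
    then have "prec k (rt' k + 1)" using p[OF kn(1) j(1)] a kn(3) by (simp add: swap_next_def)
    then show False using rt_less[of k "rt' k + 1"] j rk a by simp
  qed
  then have "rt' k = i - 1" using l by simp
  then show "tp i \<in> {1..n}" "tp i < i" "rt (tp i) = i" "rt' (tp i) = i - 1" "g.prec (Suc i) (tp i)"
    using kn rk q unfolding k_def by auto
qed

text \<open>Otherwise \<open>lf i = i - 1\<close>, and the second grid has to give
  \<open>i + 1\<close> the left line \<open>i - 1\<close>. This is the right line of tile
  \<open>tp i\<close> there, so \<open>tp i\<close> would precede \<open>i + 1\<close>, against
  \<open>swapped_top_corner\<close>.\<close>

lemma swap_top_adjacent:
  assumes v: "vert i" and lt: "tp (Suc i) < tp i"
    and g: "diagonal_grid n lf' rt' tp' bt'"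
    and p: "\<And>a b. a \<in> {1..n} \<Longrightarrow> b \<in> {1..n} \<Longrightarrow>
       diagonal_grid.prec n lf' rt' tp' bt' (swap_next i a) (swap_next i b) \<longleftrightarrow> prec a b"
  shows "tp i = i - 1"
proof (rule ccontr)
  assume n: "tp i \<noteq> i - 1"
  interpret g: diagonal_grid n lf' rt' tp' bt' by (rule g)
  note k = swapped_top_corner[OF v lt g p]
  have i: "i \<in> {1..n}" "Suc i \<in> {1..n}" "lf (Suc i) = i" "rt i = i" using v by (auto simp: vert_def)
  have l: "lf i = i - 1" using max_lf_tp[OF i(1)] n by (simp add: max_def split: if_splits)
  have j: "i - 1 \<in> {1..n}" using n k(1,2) i by auto
  have "prec (i - 1) i" "prec i (Suc i)" using prec_lf[OF i(1)] l j H_prec[of i "Suc i"] i by auto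
  then have q: "g.prec (i - 1) (Suc i)" "g.prec (Suc i) i"
    using p[OF j i(1)] p[OF i(1,2)] i(1) j by (auto simp: swap_next_def split: if_splits)
  have "i - 1 \<le> lf' (Suc i)" using g.lf_ge[OF q(1)] by simp
  moreover have "lf' (Suc i) \<noteq> i" using g.prec_lf[OF i(2)] g.prec_asym[OF q(2)] i(1) by auto
  moreover have "lf' (Suc i) < Suc i" using g.diag[OF i(2)] by simp
  ultimately have "lf' (Suc i) = i - 1" by linarith
  then have "g.prec (tp i) (Suc i)" using k(4) by (intro g.H_prec[OF _ k(1) i(2)]) simp
  then show False using g.prec_asym[OF k(5)] by blast
qed

text \<open>Let \<open>c\<close> be the tile under \<open>i + 1\<close> behind the wall. In the
  second grid a chain in \<open>H\<close> leads from \<open>k = tp i\<close> to \<open>c\<close>,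
  leaves \<open>k\<close> at line \<open>i - 1\<close> and reaches \<open>c\<close> at line
  \<open>i + 1\<close>. Its first tile after \<open>k\<close> must be \<open>i\<close> or
  \<open>i + 1\<close>; but the second order puts \<open>c\<close> before \<open>i\<close>, and
  \<open>i + 1\<close> before \<open>k\<close>.\<close>

lemma swap_one_side_level:
  assumes v: "vert i" and lt: "tp (Suc i) < tp i" "bt (Suc i) < bt i"
    and g: "diagonal_grid n lf' rt' tp' bt'"
    and p: "\<And>a b. a \<in> {1..n} \<Longrightarrow> b \<in> {1..n} \<Longrightarrow>
       diagonal_grid.prec n lf' rt' tp' bt' (swap_next i a) (swap_next i b) \<longleftrightarrow> prec a b"
  shows False
proof -
  interpret g: diagonal_grid n lf' rt' tp' bt' by (rule g)
  define k where "k = tp i"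
  note k = swapped_top_corner[OF v lt(1) g p, folded k_def]
  have i: "i \<in> {1..n}" "Suc i \<in> {1..n}" "lf (Suc i) = i" "rt i = i" "0 < i" using v
    by (auto simp: vert_def)
  obtain c where c: "c \<in> {1..n}" "lf c = i" "tp c = bt (Suc i)" "Suc i < c"
    using next_right[OF i(2,3,5) lt(2)] by metis
  have "prec c (Suc i)" "prec k c" "prec i c"
    using V_prec[of "Suc i" c] H_prec[of k c] H_prec[of i c] c i k by auto
  then have q: "g.prec c i" "g.prec k c" "g.prec (Suc i) c"
    using p[OF c(1) i(2)] p[OF k(1) c(1)] p[OF i(1) c(1)] c(4) k(2) by (auto simp: swap_next_def)
  have l: "Suc i \<le> lf' c" by (rule g.lf_ge[OF q(3) c(4)])
  have "\<not> Suc i < lf' c"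
  proof
    assume a: "Suc i < lf' c"
    have j: "lf' c \<in> {1..n}" "lf' c < c" using a g.diag[OF c(1)] c(1) by auto
    have "prec (lf' c) c" using p[OF j(1) c(1)] g.prec_lf[OF c(1)] a c(4)
      by (simp add: swap_next_def)
    then show False using lf_ge[of "lf' c" c] j c a by simp
  qed
  then have lc: "lf' c = Suc i" using l by simp
  have kc: "(k, c) \<in> g.H\<^sup>+" by (rule g.prec_less_H[OF q(2)]) (use k(2) c(4) in simp)
  obtain a where a: "(k, a) \<in> g.H" "(a, c) \<in> g.H\<^sup>*" using tranclD[OF kc] by blast
  have la: "lf' a = i - 1" "a \<in> {1..n}" using a(1) k(4) unfolding g.H_def by auto
  have "a \<noteq> c" using la lc by auto
  then have ac: "(a, c) \<in> g.H\<^sup>+" using a(2) by (auto simp: rtrancl_eq_or_trancl)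
  obtain d where d: "(a, d) \<in> g.H\<^sup>*" "(d, c) \<in> g.H" using tranclD2[OF ac] by blast
  have "d \<le> rt' d" "rt' d = Suc i" using d(2) lc g.diag[of d] unfolding g.H_def by auto
  moreover have "a \<le> d" using d(1) g.H_trancl[of a d] by (auto simp: rtrancl_eq_or_trancl)
  moreover have "i - 1 < a" using g.diag[OF la(2)] la(1) by simp
  ultimately have "a = i \<or> a = Suc i" by linarith
  moreover have "g.prec a c" "g.prec k a" using ac a(1) by (auto simp: g.prec_def)
  ultimately show False using g.prec_asym[OF q(1)] g.prec_asym[OF k(5)] by blast
qed

end

lemma barcelona_flip_vertical:
  assumes r: "represents R n lf rt tp bt s" and r': "represents R' n lf' rt' tp' bt' s'"
    and d: "diagonal_rectangulation R" "diagonal_rectangulation R'"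
      and v: "diagonal_grid.vert n lf rt tp bt i"
    and p: "\<And>a b. a \<in> {1..n} \<Longrightarrow> b \<in> {1..n} \<Longrightarrow>
       diagonal_grid.prec n lf' rt' tp' bt' (swap_next i a) (swap_next i b) \<longleftrightarrow> diagonal_grid.prec n
         lf rt tp bt a b"
  shows "barcelona_flip R R'"
proof -
  have T: "tiling R" using d(1) by (simp add: diagonal_rectangulation_def rectangulation_tiling)
  interpret vertical_edge R n lf rt tp bt s i using r T v by unfold_locales
  note g' = representsD(1)[OF r']
  consider "tp (Suc i) = tp i" "bt (Suc i) = bt i" | "tp (Suc i) < tp i" "bt (Suc i) = bt i"
    | "tp (Suc i) = tp i" "bt (Suc i) < bt i" | "tp (Suc i) < tp i" "bt (Suc i) < bt i"
    using idx(13,14) by linarith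
  then show ?thesis
  proof cases
    case 1
    then show ?thesis by (rule barcelona_flip_simple[OF _ _ d r' p])
  next
    case 2
    then show ?thesis by (rule barcelona_flip_rotation[OF _ _ swap_top_adjacent[OF v 2(1) g' p] d r'
      p])
  next
    case 3
    have e: "n + 1 - (n - i) = Suc i" "n + 1 - (n - i + 1) = i" "n + 1 - Suc (n - i) = i"
      "n - i + 1 = Suc (n - i)" using idx by auto
    note rt = represents_turn[OF r] and rt' = represents_turn[OF r']
    interpret t: diagonal_grid n "turned n rt" "turned n lf" "turned n bt" "turned n tp"
      by (rule rotate)
    have vt: "t.vert (n - i)"
      unfolding t.vert_def e using idx by auto
    note dt = turn.diagonal_rectangulation_image[OF d(1)] turn.diagonal_rectangulation_image[OF
      d(2)]
    have Tt: "tiling (turn.im R)" using dt(1)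
      by (simp add: diagonal_rectangulation_def rectangulation_tiling)
    interpret w: vertical_edge "turn.im R" n "turned n rt" "turned n lf" "turned n bt" "turned n tp"
      "\<lambda>k. 1 - s (n - k)" "n - i"
      using rt Tt vt by unfold_locales
    note pt = turned_swap[OF diagonal_grid_axioms g' idx(1,2) p]
    have lt: "turned n bt (Suc (n - i)) < turned n bt (n - i)"
      "turned n tp (Suc (n - i)) = turned n tp (n - i)"
      unfolding e using 3 idx by auto
    have "barcelona_flip (turn.im R) (turn.im R')"
      by (rule w.barcelona_flip_rotation[OF lt t.swap_top_adjacent[OF vt lt(1) representsD(1)[OF
        rt'] pt] dt rt' pt])
    then show ?thesis using turn.barcelona_flip_image by fastforce
  next
    case 4
    then show ?thesis using swap_one_side_level[OF v _ _ g' p] by blast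
  qed
qed

lemma swap_related_flip:
  assumes s: "swap_related R R'" and d: "diagonal_rectangulation R" "diagonal_rectangulation R'"
  shows "barcelona_flip R R'"
proof -
  obtain n lf rt tp bt s lf' rt' tp' bt' s' i where r: "represents R n lf rt tp bt s"
    and r': "represents R' n lf' rt' tp' bt' s'"
     and i: "0 < i" "i < n" and p: "\<And>a b. a \<in> {1..n} \<Longrightarrow> b \<in> {1..n} \<Longrightarrow>
       diagonal_grid.prec n lf' rt' tp' bt' (swap_next i a) (swap_next i b) \<longleftrightarrow> diagonal_grid.prec n
         lf rt tp bt a b"
    using s unfolding swap_related_def by blast
  interpret diagonal_grid n lf rt tp bt by (rule representsD[OF r])
  note g' = representsD(1)[OF r']
  consider "vert i" | "horiz i" using vert_or_horiz[OF i] by blast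
  then show ?thesis
  proof cases
    case 1 then show ?thesis by (rule barcelona_flip_vertical[OF r r' d _ p])
  next
    case 2
    have v: "diagonal_grid.vert n tp bt lf rt i" using 2
      unfolding horiz_def diagonal_grid.vert_def[OF reflect] by auto
    have q: "diagonal_grid.prec n tp' bt' lf' rt' (swap_next i a) (swap_next i b) \<longleftrightarrow>
      diagonal_grid.prec n tp bt lf rt a b"
      if "a \<in> {1..n}" "b \<in> {1..n}" for a b
      unfolding reflect_prec diagonal_grid.reflect_prec[OF g'] by (rule p[OF that(2,1)])
    have "barcelona_flip (rho.im R) (rho.im R')"
      by (rule barcelona_flip_vertical[OF represents_rho[OF r] represents_rho[OF r']
        rho.diagonal_rectangulation_image[OF d(1)]
            rho.diagonal_rectangulation_image[OF d(2)] v q])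
    then show ?thesis using rho.barcelona_flip_image by fastforce
  qed
qed

section \<open>Transpositions of consecutive values in a list\<close>

lemma map_swap_next:
  assumes "distinct p" "j < length p" "k < length p" "p ! j = i" "p ! k = Suc i"
  shows "map (swap_next i) p = p[j := p ! k, k := p ! j]"
proof (rule nth_equalityI)
  fix m assume "m < length (map (swap_next i) p)"
  then have m: "m < length p" by simp
  have "p ! m = i \<longleftrightarrow> m = j" using nth_eq_iff_index_eq[OF assms(1) m assms(2)] assms(4) by simp
  moreover have "p ! m = Suc i \<longleftrightarrow> m = k" using nth_eq_iff_index_eq[OF assms(1) m assms(3)] assms(5)
    by simp
  moreover have "j \<noteq> k" using assms by auto
  ultimately show "map (swap_next i) p ! m = p[j := p ! k, k := p ! j] ! m"
    using m assms by (simp add: swap_next_def nth_list_update)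
qed simp

lemma consecutive_transposition_iff:
  assumes p: "distinct p" "set p = {1..n}"
  shows "differ_by_consecutive_transposition p q \<longleftrightarrow> (\<exists>i. 0 < i \<and> i < n \<and> q = map (swap_next i) p)"
proof
  assume "differ_by_consecutive_transposition p q"
  then obtain j k where jk: "j < length p" "k < length p" "\<bar>int (p ! j) - int (p ! k)\<bar> = 1"
    "q = p[j := p ! k, k := p ! j]"
    unfolding differ_by_consecutive_transposition_def by blast
  have ne: "j \<noteq> k" using jk(3) by auto
  have r: "p ! j \<in> {1..n}" "p ! k \<in> {1..n}" using p(2) jk(1,2) nth_mem by blast+
  consider "p ! k = Suc (p ! j)" | "p ! j = Suc (p ! k)" using jk(3) by linarith
  then show "\<exists>i. 0 < i \<and> i < n \<and> q = map (swap_next i) p"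
  proof cases
    case 1
    then show ?thesis using map_swap_next[OF p(1) jk(1,2) refl 1] jk(4) r
      by (intro exI[of _ "p ! j"]) auto
  next
    case 2
    then show ?thesis using map_swap_next[OF p(1) jk(2,1) refl 2] jk(4) r ne
      by (intro exI[of _ "p ! k"]) (auto simp: list_update_swap)
  qed
next
  assume "\<exists>i. 0 < i \<and> i < n \<and> q = map (swap_next i) p"
  then obtain i where i: "0 < i" "i < n" "q = map (swap_next i) p" by blast
  then have "i \<in> set p" "Suc i \<in> set p" using p by auto
  then obtain j k where jk: "j < length p" "k < length p" "p ! j = i" "p ! k = Suc i"
    by (metis in_set_conv_nth)
  show "differ_by_consecutive_transposition p q"
    unfolding differ_by_consecutive_transposition_def using map_swap_next[OF p(1) jk] i(3) jk
    by (intro exI[of _ j] exI[of _ k]) auto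
qed

lemma swap_next_involution [simp]: "swap_next i (swap_next i a) = a"
  by (simp add: swap_next_def)

text \<open>A total order on the labels and its sorted list determine each other. Exchanging two
  labels in the order therefore amounts to exchanging these two values in the list.\<close>

lemma swap_related_iff:
  assumes r: "represents R n lf rt tp bt s" and r': "represents R' n' lf' rt' tp' bt' s'"
  shows "swap_related R R' \<longleftrightarrow>
    differ_by_consecutive_transposition (baxter_permutation R) (baxter_permutation R')"
proof -
  note b = baxter_permutation_sorted[OF r] and b' = baxter_permutation_sorted[OF r']
  have img: "swap_next i ` {1..m} = {1..m}" if "0 < i" "i < m" for i m
  proof (intro set_eqI iffI)
    fix x assume "x \<in> {1..m}"
    then show "x \<in> swap_next i ` {1..m}"
      using swap_next_range[OF that] by (intro image_eqI[of _ _ "swap_next i x"]) simp_all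
  qed (use swap_next_range[OF that] in blast)
  have inj: "inj_on (swap_next i) A" for i A by (metis inj_onI swap_next_involution)
  show ?thesis
    unfolding consecutive_transposition_iff[OF b(1,2)]
  proof
    assume "swap_related R R'"
    then obtain m lf1 rt1 tp1 bt1 s1 lf2 rt2 tp2 bt2 s2 i where
      q: "represents R m lf1 rt1 tp1 bt1 s1" "represents R' m lf2 rt2 tp2 bt2 s2"
        and i: "0 < i" "i < m"
      and p: "\<And>a b. a \<in> {1..m} \<Longrightarrow> b \<in> {1..m} \<Longrightarrow>
       diagonal_grid.prec m lf2 rt2 tp2 bt2 (swap_next i a) (swap_next i b) \<longleftrightarrow> diagonal_grid.prec m
         lf1 rt1 tp1 bt1 a b"
      unfolding swap_related_def by blast
    note c = baxter_permutation_sorted[OF q(1)] and c' = baxter_permutation_sorted[OF q(2)]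
    interpret g': diagonal_grid m lf2 rt2 tp2 bt2 by (rule representsD[OF q(2)])
    have mn: "m = n" using c(2) b(2) by (metis card_atLeastAtMost diff_Suc_1)
    have "sorted_wrt g'.prec (map (swap_next i) (baxter_permutation R))"
      unfolding sorted_wrt_map by (rule sorted_wrt_mono_rel[OF _ c(3)]) (use p c(2) in blast)
    moreover have "set (map (swap_next i) (baxter_permutation R)) = {1..m}" using img[OF i] c(2)
      by simp
    moreover have "distinct (map (swap_next i) (baxter_permutation R))" using c(1) inj
      by (simp add: distinct_map)
    ultimately have "baxter_permutation R' = map (swap_next i) (baxter_permutation R)"
      by (intro sorted_wrt_unique[of g'.prec, OF c'(3) _ c'(1)]) (use c'(2) g'.prec_asym in auto)
    then show "\<exists>i. 0 < i \<and> i < n \<and> baxter_permutation R' = map (swap_next i) (baxter_permutation R)"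
      using i mn by blast
  next
    assume "\<exists>i. 0 < i \<and> i < n \<and> baxter_permutation R' = map (swap_next i) (baxter_permutation R)"
    then obtain i where i: "0 < i" "i < n"
      and e: "baxter_permutation R' = map (swap_next i) (baxter_permutation R)" by blast
    have "{1..n} = {1..n'}" using b'(2) unfolding e set_map b(2) img[OF i] .
    then have nn: "n' = n" by (metis card_atLeastAtMost diff_Suc_1)
    interpret g: diagonal_grid n lf rt tp bt by (rule representsD[OF r])
    interpret g': diagonal_grid n lf' rt' tp' bt' using representsD(1)[OF r'] nn by simp
    have s: "sorted_wrt (\<lambda>a b. g'.prec (swap_next i a) (swap_next i b)) (baxter_permutation R)"
      using b'(3) unfolding e sorted_wrt_map nn .
    have imp: "g'.prec (swap_next i x) (swap_next i y)" if xy: "g.prec x y" for x y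
    proof -
      have "x \<in> set (baxter_permutation R)" "y \<in> set (baxter_permutation R)"
        using g.prec_range[OF xy] b(2) by auto
      then obtain j k where jk: "j < length (baxter_permutation R)"
        "k < length (baxter_permutation R)"
         "baxter_permutation R ! j = x" "baxter_permutation R ! k = y" by (metis in_set_conv_nth)
      have "j \<noteq> k" using jk g.prec_range[OF xy] by auto
      moreover have "\<not> k < j"
      proof
        assume "k < j"
        then have "g.prec y x" using sorted_wrt_nth_less[OF b(3)] jk by blast
        then show False using g.prec_asym[OF xy] by blast
      qed
      ultimately show ?thesis using sorted_wrt_nth_less[OF s, of j k] jk by simp
    qed
    have "g'.prec (swap_next i a) (swap_next i b) \<longleftrightarrow> g.prec a b" if "a \<in> {1..n}" "b \<in> {1..n}" for a b
      using imp[of a b] imp[of b a] g.prec_total[OF that] g'.prec_asym g'.prec_irrefl by blast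
    then show "swap_related R R'" unfolding swap_related_def using r r' nn i by blast
  qed
qed

theorem theorem3:
  fixes R R' :: "point set set"
  assumes "diagonal_rectangulation R" and "diagonal_rectangulation R'"
  shows "barcelona_flip R R' \<longleftrightarrow>
    differ_by_consecutive_transposition (baxter_permutation R) (baxter_permutation R')"
proof -
  obtain n lf rt tp bt s where r: "represents R n lf rt tp bt s"
    using diagonal_rectangulation_represents[OF assms(1)] .
  obtain n' lf' rt' tp' bt' s' where r': "represents R' n' lf' rt' tp' bt' s'"
    using diagonal_rectangulation_represents[OF assms(2)] .
  show ?thesis
    using barcelona_flip_related swap_related_flip[OF _ assms] swap_related_iff[OF r r'] by blast
qed

end
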